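(* Let $M$ be a compact connected smooth manifold without boundary of dimension $n$, $H:T^*M\to\mathbb{R}$ a Tonelli Hamiltonian, $\phi\in\mathrm{SCL}(M)$, $x\in M$ and $T>0$. Let $\{\Delta_m\}_{m\in\mathbb{N}}$ be a sequence of partitions of $[0,\infty)$ with widths $|\Delta_m|\le\tau(\phi)$ and $\lim_{m\to\infty}|\Delta_m|=0$. For each $m$ let $\mathbf{x}_m:[0,T]\to M$ be the (unique, piecewise $C^1$) solution of $$\dot{\mathbf{x}}_m(t)=H_p(\mathbf{x}_m(t),\mathbf{p}_m(t)),\quad t\in[0,T],\qquad \mathbf{x}_m(0)=x,$$ where $\mathbf{p}_m(t):=DT^+_{\tau_{\Delta_m}(t)-t}\phi(\mathbf{x}_m(t))$. Suppose that $\mathbf{x}_m$ converges to $\mathbf{x}$ uniformly on $[0,T]$ as $m\to\infty$. Then: (1) There exist a family of Borel probability measures $\{\nu_t\}_{t\in[0,T]}$, $\nu_t$ on $T^*_{\mathbf{x}(t)}M\cong\mathbb{R}^n$, with $\mathrm{supp}\,\nu_t\subset D^+\phi(\mathbf{x}(t))$ for almost all $t\in[0,T]$, and a subsequence $\{m_k\}$ such that $$H_p(\mathbf{x}_{m_k},\mathbf{p}_{m_k})\ \stackrel{*}{\rightharpoonup}\ \overline{H}_p\quad\text{in }L^\infty([0,T])\quad\text{as }k\to\infty,$$ where $\overline{H}_p(t)=\int_{\mathbb{R}^n}H_p(\mathbf{x}(t),p)\,d\nu_t(p)$ for $t\in[0,T]$. (2) The curve $\mathbf{x}$ satisfies $\dot{\mathbf{x}}(t)=\overline{H}_p(t)$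 for a.e. $t\in[0,T]$. (3) The curve $\mathbf{x}$ satisfies the differential inclusion $\dot{\mathbf{x}}(t)\in\mathrm{co}\,H_p(\mathbf{x}(t),D^+\phi(\mathbf{x}(t)))$ for a.e. $t\in[0,T]$, $\mathbf{x}(0)=x$, and it is a generalized characteristic (i.e. a Lipschitz curve satisfying this inclusion).
   Context: Fix a Riemannian metric on $M$ with distance $d$. A Tonelli Hamiltonian is a $C^2$ function $H:T^*M\to\mathbb{R}$ with $H_{pp}>0$ and $p\mapsto H(x,p)$ uniformly superlinear; $L$ is the associated Tonelli Lagrangian (Fenchel transform). $\mathrm{SCL}(M)$ is the space of continuous functions on $M$ that are semiconcave with linear modulus (for some $C\ge0$, along every geodesic $\gamma$ joining $x$ to $y$, $\lambda\phi(x)+(1-\lambda)\phi(y)-\phi(z_\lambda)\le\frac C2\lambda(1-\lambda)d^2(x,y)$, where $z_\lambda$ is the point of the geodesic with weights $\lambda$ on $x$, $1-\lambda$ on $y$). $D^+\phi(x)\subset T^*_xM$ is the superdifferential of $\phi$ at $x$; $\mathrm{co}$ denotes convex hull; $H_p(x,D^+\phi(x))=\{H_p(x,p):p\in D^+\phi(x)\}$. $A_t(x,y)=\inf\int_0^tL(\xi,\dot\xi)\,ds$ over absolutely continuous $\xi:[0,t]\to M$ with $\xi(0)=x$, $\xi(t)=y$, and $T^+_t\phi(x)=\sup_{y\in M}\{\phi(y)-A_t(x,y)\}$. $\tau(\phi)>0$ is a fixed constant, depending only on $\phi$ and $H$, small enough that for every $t\in(0,\tau(\phi)]$ one has $T^+_t\phi\in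 C^{1,1}(M)$ and, for every $x\in M$, the function $y\mapsto\phi(y)-A_t(x,y)$ has a unique maximizer on $M$ (such a constant exists for every $\phi\in\mathrm{SCL}(M)$). A partition $\Delta$ of $[0,\infty)$ is given by an increasing sequence of points $0=\tau_0<\tau_1<\cdots\to\infty$, with width $|\Delta|=\max_i(\tau_i-\tau_{i-1})$, and $\tau_\Delta(t)=\inf\{\tau_i:\tau_i>t\}$. The vector field $(t,y)\mapsto H_p(y,DT^+_{\tau_\Delta(t)-t}\phi(y))$ is locally Lipschitz in $y$ on each interval $[\tau_{i-1},\tau_i)$ and uniformly bounded; the solution of the ODE is the continuous curve which is $C^1$ and satisfies the equation on each partition interval $[\tau_{i-1},\tau_i)$ (right derivative at left endpoints). Velocities and momenta are expressed in local coordinates; the weak-$*$ convergence in $L^\infty$ is that of the coordinate representations (i.e. on any subinterval on which $\mathbf{x}$ and $\mathbf{x}_{m_k}$, $k$ large, remain in a common chart). *)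

theory Defs
  imports "HOL-Probability.Probability"
begin

section \<open>Closed smooth manifolds\<close>

text \<open>
  The manifold is the whole type \<open>'m\<close>, modelled on the Euclidean space \<open>'e\<close>
  (so its dimension is \<open>DIM('e)\<close>). A chart is a pair of its domain and its coordinate map; the
  coordinate map is irrelevant outside the domain.
\<close>

type_synonym ('m, 'e) chart = "'m set \<times> ('m \<Rightarrow> 'e)"

definition chart_inv :: "('m, 'e) chart \<Rightarrow> 'e \<Rightarrow> 'm" where
  "chart_inv c = inv_into (fst c) (snd c)"

definition transition :: "('m, 'e) chart \<Rightarrow> ('m, 'e) chart \<Rightarrow> 'e \<Rightarrow> 'e" where
  "transition c d = snd d \<circ> chart_inv c"

definition is_chart :: "('m::topological_space, 'e::euclidean_space) chart \<Rightarrow> bool" where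
  "is_chart c \<longleftrightarrow> open (fst c) \<and> open (snd c ` fst c) \<and>
     homeomorphism (fst c) (snd c ` fst c) (snd c) (chart_inv c)"

text \<open>Functions of class \<open>C\<^sup>k\<close> on an open subset of a finite-dimensional space.\<close>

primrec Ck_on :: "nat \<Rightarrow> ('a::euclidean_space \<Rightarrow> 'b::real_normed_vector) \<Rightarrow> 'a set \<Rightarrow> bool" where
  "Ck_on 0 f S \<longleftrightarrow> continuous_on S f"
| "Ck_on (Suc k) f S \<longleftrightarrow> (\<forall>x\<in>S. f differentiable (at x)) \<and>
     (\<forall>v. Ck_on k (\<lambda>x. frechet_derivative f (at x) v) S)"

definition smooth_atlas :: "('m::topological_space, 'e::euclidean_space) chart set \<Rightarrow> bool" where
  "smooth_atlas A \<longleftrightarrow> (\<forall>c\<in>A. is_chart c) \<and> (\<Union>c\<in>A. fst c) = UNIV \<and>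
     (\<forall>c\<in>A. \<forall>d\<in>A. \<forall>k. Ck_on k (transition c d) (snd c ` (fst c \<inter> fst d)))"

text \<open>Second countability follows from compactness.\<close>

definition closed_connected_manifold :: "('m::t2_space, 'e::euclidean_space) chart set \<Rightarrow> bool" where
  "closed_connected_manifold A \<longleftrightarrow>
     smooth_atlas A \<and> compact (UNIV :: 'm set) \<and> connected (UNIV :: 'm set)"


section \<open>Tangent and cotangent vectors\<close>

text \<open>
  Every point \<open>x\<close> gets a preferred chart around it, and \<open>T\<^sub>xM\<close> and \<open>T\<^sup>*\<^sub>xM\<close> are both identified
  with \<open>'e\<close> by means of the coordinates of that chart; the duality pairing of
  \<open>T\<^sup>*\<^sub>xM\<close> with \<open>T\<^sub>xM\<close> then is the inner product of \<open>'e\<close>. Hence a function on \<open>TM\<close> or \<open>T\<^sup>*M\<close>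
  has type \<open>'m \<Rightarrow> 'e \<Rightarrow> _\<close>. The preferred chart need not depend continuously on \<open>x\<close>, so
  regularity in \<open>x\<close> must always be expressed in a fixed chart, using the changes of
  coordinates below.
\<close>

definition chart_at :: "('m, 'e) chart set \<Rightarrow> 'm \<Rightarrow> ('m, 'e) chart" where
  "chart_at A x = (SOME c. c \<in> A \<and> x \<in> fst c)"

text \<open>The representation in chart \<open>c\<close> of a tangent vector at \<open>x\<close>, and back.\<close>

definition tangent_in ::
    "('m, 'e::euclidean_space) chart set \<Rightarrow> ('m, 'e) chart \<Rightarrow> 'm \<Rightarrow> 'e \<Rightarrow> 'e" where
  "tangent_in A c x v =
     frechet_derivative (transition (chart_at A x) c) (at (snd (chart_at A x) x)) v"

definition tangent_from ::
    "('m, 'e::euclidean_space) chart set \<Rightarrow> ('m, 'e) chart \<Rightarrow> 'm \<Rightarrow> 'e \<Rightarrow> 'e" where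
  "tangent_from A c x v =
     frechet_derivative (transition c (chart_at A x)) (at (snd c x)) v"

text \<open>The cotangent vector at \<open>x\<close> with components \<open>q\<close> in chart \<open>c\<close>; it satisfies
  \<open>cotangent_from A c x q \<bullet> v = q \<bullet> tangent_in A c x v\<close>.\<close>

definition cotangent_from ::
    "('m, 'e::euclidean_space) chart set \<Rightarrow> ('m, 'e) chart \<Rightarrow> 'm \<Rightarrow> 'e \<Rightarrow> 'e" where
  "cotangent_from A c x q = adjoint (tangent_in A c x) q"

definition differential_at ::
    "('m, 'e::euclidean_space) chart set \<Rightarrow> ('m \<Rightarrow> real) \<Rightarrow> 'm \<Rightarrow> 'e" where
  "differential_at A f x =
     (THE p. GDERIV (f \<circ> chart_inv (chart_at A x)) (snd (chart_at A x) x) :> p)"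

definition C11 :: "('m, 'e::euclidean_space) chart set \<Rightarrow> ('m \<Rightarrow> real) \<Rightarrow> bool" where
  "C11 A f \<longleftrightarrow> (\<forall>c\<in>A. \<exists>G. \<forall>z\<in>snd c ` fst c.
     GDERIV (f \<circ> chart_inv c) z :> G z \<and>
     (\<exists>r>0. \<exists>C. C-lipschitz_on (ball z r \<inter> snd c ` fst c) G))"

definition superdifferential ::
    "('m::topological_space, 'e::euclidean_space) chart set \<Rightarrow> ('m \<Rightarrow> real) \<Rightarrow> 'm \<Rightarrow> 'e set" where
  "superdifferential A f x =
     (let F = f \<circ> chart_inv (chart_at A x); z = snd (chart_at A x) x in
      {p. Limsup (at z) (\<lambda>w. ereal ((F w - F z - p \<bullet> (w - z)) / norm (w - z))) \<le> 0})"


section \<open>Curves\<close>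

text \<open>In the definitions below derivatives are taken within the time interval \<open>I\<close>, hence
  they are one-sided at its end points.\<close>

definition velocity ::
    "('m, 'e::euclidean_space) chart set \<Rightarrow> real set \<Rightarrow> (real \<Rightarrow> 'm) \<Rightarrow> real \<Rightarrow> 'e" where
  "velocity A I \<gamma> t = vector_derivative (snd (chart_at A (\<gamma> t)) \<circ> \<gamma>) (at t within I)"

definition has_velocity ::
    "('m::topological_space, 'e::euclidean_space) chart set \<Rightarrow> real set \<Rightarrow> (real \<Rightarrow> 'm) \<Rightarrow>
     real \<Rightarrow> 'e \<Rightarrow> bool" where
  "has_velocity A I \<gamma> t v \<longleftrightarrow> continuous (at t within I) \<gamma> \<and>
     ((snd (chart_at A (\<gamma> t)) \<circ> \<gamma>) has_vector_derivative v) (at t within I)"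

definition C1_curve ::
    "('m::topological_space, 'e::euclidean_space) chart set \<Rightarrow> real set \<Rightarrow> (real \<Rightarrow> 'm) \<Rightarrow> bool" where
  "C1_curve A I \<gamma> \<longleftrightarrow> continuous_on I \<gamma> \<and>
     (\<forall>c\<in>A. \<exists>v. continuous_on {t\<in>I. \<gamma> t \<in> fst c} v \<and>
        (\<forall>t\<in>I. \<gamma> t \<in> fst c \<longrightarrow> ((snd c \<circ> \<gamma>) has_vector_derivative v t) (at t within I)))"


section \<open>Riemannian metrics\<close>

definition riemannian_metric ::
    "('m::topological_space, 'e::euclidean_space) chart set \<Rightarrow> ('m \<Rightarrow> 'e \<Rightarrow> 'e \<Rightarrow> real) \<Rightarrow> bool" where
  "riemannian_metric A g \<longleftrightarrow>
     (\<forall>x. bilinear (g x) \<and> (\<forall>u v. g x u v = g x v u) \<and> (\<forall>v. v \<noteq> 0 \<longrightarrow> g x v v > 0)) \<and>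
     (\<forall>c\<in>A. \<forall>u v. \<forall>k. Ck_on k
        (\<lambda>z. g (chart_inv c z) (tangent_from A c (chart_inv c z) u)
                               (tangent_from A c (chart_inv c z) v))
        (snd c ` fst c))"

definition curve_length ::
    "('m, 'e::euclidean_space) chart set \<Rightarrow> ('m \<Rightarrow> 'e \<Rightarrow> 'e \<Rightarrow> real) \<Rightarrow> (real \<Rightarrow> 'm) \<Rightarrow> real" where
  "curve_length A g \<gamma> =
     integral {0..1} (\<lambda>t. sqrt (g (\<gamma> t) (velocity A {0..1} \<gamma> t) (velocity A {0..1} \<gamma> t)))"

definition riem_dist ::
    "('m::topological_space, 'e::euclidean_space) chart set \<Rightarrow> ('m \<Rightarrow> 'e \<Rightarrow> 'e \<Rightarrow> real) \<Rightarrow>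
     'm \<Rightarrow> 'm \<Rightarrow> real" where
  "riem_dist A g x y = Inf {curve_length A g \<gamma> | \<gamma>. C1_curve A {0..1} \<gamma> \<and> \<gamma> 0 = x \<and> \<gamma> 1 = y}"

definition conorm :: "('m \<Rightarrow> 'e \<Rightarrow> 'e \<Rightarrow> real) \<Rightarrow> 'm \<Rightarrow> 'e::euclidean_space \<Rightarrow> real" where
  "conorm g x p = Sup {p \<bullet> v | v. g x v v \<le> 1}"

text \<open>Geodesics joining \<open>x\<close> to \<open>y\<close> are understood to be minimizing and parametrized on
  \<open>{0..1}\<close> with constant speed, which is then the distance of \<open>x\<close> and \<open>y\<close>. (If non-minimizing
  geodesics were allowed in the definition of semiconcavity, closed geodesics would force
  semiconcave functions to be constant on them.)\<close>

definition geodesic_joining ::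
    "('m::topological_space, 'e::euclidean_space) chart set \<Rightarrow> ('m \<Rightarrow> 'e \<Rightarrow> 'e \<Rightarrow> real) \<Rightarrow>
     'm \<Rightarrow> 'm \<Rightarrow> (real \<Rightarrow> 'm) \<Rightarrow> bool" where
  "geodesic_joining A g x y \<gamma> \<longleftrightarrow> C1_curve A {0..1} \<gamma> \<and> \<gamma> 0 = x \<and> \<gamma> 1 = y \<and>
     (\<forall>t\<in>{0..1}. sqrt (g (\<gamma> t) (velocity A {0..1} \<gamma> t) (velocity A {0..1} \<gamma> t)) = riem_dist A g x y)"

definition SCL ::
    "('m::topological_space, 'e::euclidean_space) chart set \<Rightarrow> ('m \<Rightarrow> 'e \<Rightarrow> 'e \<Rightarrow> real) \<Rightarrow>
     ('m \<Rightarrow> real) set" where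
  "SCL A g = {\<phi>. continuous_on UNIV \<phi> \<and>
     (\<exists>C\<ge>0. \<forall>x y \<gamma> l. geodesic_joining A g x y \<gamma> \<and> 0 \<le> l \<and> l \<le> 1 \<longrightarrow>
        l * \<phi> x + (1 - l) * \<phi> y - \<phi> (\<gamma> (1 - l)) \<le> C / 2 * l * (1 - l) * (riem_dist A g x y)\<^sup>2)}"

definition abs_continuous_curve ::
    "('m::topological_space, 'e::euclidean_space) chart set \<Rightarrow> ('m \<Rightarrow> 'e \<Rightarrow> 'e \<Rightarrow> real) \<Rightarrow>
     real \<Rightarrow> (real \<Rightarrow> 'm) \<Rightarrow> bool" where
  "abs_continuous_curve A g t \<xi> \<longleftrightarrow>
     (\<forall>\<epsilon>>0. \<exists>\<delta>>0. \<forall>(n::nat) a b.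
        (\<forall>i<n. 0 \<le> a i \<and> a i \<le> b i \<and> b i \<le> t) \<and>
        disjoint_family_on (\<lambda>i. {a i<..<b i}) {..<n} \<and> (\<Sum>i<n. b i - a i) < \<delta> \<longrightarrow>
        (\<Sum>i<n. riem_dist A g (\<xi> (a i)) (\<xi> (b i))) < \<epsilon>)"


section \<open>Tonelli Hamiltonians and the Lax-Oleinik operator\<close>

definition Hp :: "('m \<Rightarrow> 'e::euclidean_space \<Rightarrow> real) \<Rightarrow> 'm \<Rightarrow> 'e \<Rightarrow> 'e" where
  "Hp H x p = (THE v. GDERIV (H x) p :> v)"

definition tonelli_hamiltonian ::
    "('m::topological_space, 'e::euclidean_space) chart set \<Rightarrow> ('m \<Rightarrow> 'e \<Rightarrow> 'e \<Rightarrow> real) \<Rightarrow>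
     ('m \<Rightarrow> 'e \<Rightarrow> real) \<Rightarrow> bool" where
  "tonelli_hamiltonian A g H \<longleftrightarrow>
     (\<forall>c\<in>A. Ck_on 2 (\<lambda>(z, q). H (chart_inv c z) (cotangent_from A c (chart_inv c z) q))
              ((snd c ` fst c) \<times> UNIV)) \<and>
     (\<forall>x p w. w \<noteq> 0 \<longrightarrow> frechet_derivative (Hp H x) (at p) w \<bullet> w > 0) \<and>
     (\<forall>K\<ge>0. \<exists>C. \<forall>x p. H x p \<ge> K * conorm g x p - C)"

definition lagrangian :: "('m \<Rightarrow> 'e::euclidean_space \<Rightarrow> real) \<Rightarrow> 'm \<Rightarrow> 'e \<Rightarrow> real" where
  "lagrangian H x v = (SUP p. p \<bullet> v - H x p)"

text \<open>The Lagrangian is bounded below, so a curve along which it is not integrable has action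
  \<open>+\<infinity>\<close> and can be left out of the infimum.\<close>

definition action ::
    "('m::topological_space, 'e::euclidean_space) chart set \<Rightarrow> ('m \<Rightarrow> 'e \<Rightarrow> 'e \<Rightarrow> real) \<Rightarrow>
     ('m \<Rightarrow> 'e \<Rightarrow> real) \<Rightarrow> real \<Rightarrow> 'm \<Rightarrow> 'm \<Rightarrow> real" where
  "action A g H t x y =
     Inf {integral\<^sup>L (lebesgue_on {0..t}) (\<lambda>s. lagrangian H (\<xi> s) (velocity A {0..t} \<xi> s)) | \<xi>.
       abs_continuous_curve A g t \<xi> \<and> \<xi> 0 = x \<and> \<xi> t = y \<and>
       integrable (lebesgue_on {0..t}) (\<lambda>s. lagrangian H (\<xi> s) (velocity A {0..t} \<xi> s))}"

definition T_plus ::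
    "('m::topological_space, 'e::euclidean_space) chart set \<Rightarrow> ('m \<Rightarrow> 'e \<Rightarrow> 'e \<Rightarrow> real) \<Rightarrow>
     ('m \<Rightarrow> 'e \<Rightarrow> real) \<Rightarrow> real \<Rightarrow> ('m \<Rightarrow> real) \<Rightarrow> 'm \<Rightarrow> real" where
  "T_plus A g H t \<phi> x = (SUP y. \<phi> y - action A g H t x y)"

text \<open>The property required of the constant \<open>\<tau>(\<phi>)\<close>.\<close>

definition admissible_time ::
    "('m::topological_space, 'e::euclidean_space) chart set \<Rightarrow> ('m \<Rightarrow> 'e \<Rightarrow> 'e \<Rightarrow> real) \<Rightarrow>
     ('m \<Rightarrow> 'e \<Rightarrow> real) \<Rightarrow> ('m \<Rightarrow> real) \<Rightarrow> real \<Rightarrow> bool" where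
  "admissible_time A g H \<phi> \<tau> \<longleftrightarrow> \<tau> > 0 \<and>
     (\<forall>t. 0 < t \<and> t \<le> \<tau> \<longrightarrow> C11 A (T_plus A g H t \<phi>) \<and>
        (\<forall>x. \<exists>!y. \<forall>z. \<phi> z - action A g H t x z \<le> \<phi> y - action A g H t x y))"


section \<open>Partitions and the approximating equation\<close>

definition is_partition :: "(nat \<Rightarrow> real) \<Rightarrow> bool" where
  "is_partition \<Delta> \<longleftrightarrow> \<Delta> 0 = 0 \<and> strict_mono \<Delta> \<and> filterlim \<Delta> at_top sequentially"

definition width :: "(nat \<Rightarrow> real) \<Rightarrow> ereal" where
  "width \<Delta> = (SUP i. ereal (\<Delta> (Suc i) - \<Delta> i))"

definition next_time :: "(nat \<Rightarrow> real) \<Rightarrow> real \<Rightarrow> real" where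
  "next_time \<Delta> t = Inf {\<Delta> i | i. \<Delta> i > t}"

definition momentum ::
    "('m::topological_space, 'e::euclidean_space) chart set \<Rightarrow> ('m \<Rightarrow> 'e \<Rightarrow> 'e \<Rightarrow> real) \<Rightarrow>
     ('m \<Rightarrow> 'e \<Rightarrow> real) \<Rightarrow> ('m \<Rightarrow> real) \<Rightarrow> (nat \<Rightarrow> real) \<Rightarrow> (real \<Rightarrow> 'm) \<Rightarrow> real \<Rightarrow> 'e" where
  "momentum A g H \<phi> \<Delta> y t = differential_at A (T_plus A g H (next_time \<Delta> t - t) \<phi>) (y t)"

definition is_approx_solution ::
    "('m::topological_space, 'e::euclidean_space) chart set \<Rightarrow> ('m \<Rightarrow> 'e \<Rightarrow> 'e \<Rightarrow> real) \<Rightarrow>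
     ('m \<Rightarrow> 'e \<Rightarrow> real) \<Rightarrow> ('m \<Rightarrow> real) \<Rightarrow> (nat \<Rightarrow> real) \<Rightarrow> 'm \<Rightarrow> real \<Rightarrow> (real \<Rightarrow> 'm) \<Rightarrow> bool" where
  "is_approx_solution A g H \<phi> \<Delta> x0 T y \<longleftrightarrow> continuous_on {0..T} y \<and> y 0 = x0 \<and>
     (\<forall>i. let I = {\<Delta> i..<\<Delta> (Suc i)} \<inter> {0..T} in
        C1_curve A I y \<and>
        (\<forall>t\<in>I. has_velocity A I y t (Hp H (y t) (momentum A g H \<phi> \<Delta> y t))))"


section \<open>Weak-star convergence and generalized characteristics\<close>

definition Linf :: "'a measure \<Rightarrow> ('a \<Rightarrow> 'e::euclidean_space) set" where
  "Linf M = {f \<in> borel_measurable M. \<exists>C. AE t in M. norm (f t) \<le> C}"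

definition weak_star_Linf ::
    "'a measure \<Rightarrow> (nat \<Rightarrow> 'a \<Rightarrow> 'e::euclidean_space) \<Rightarrow> ('a \<Rightarrow> 'e) \<Rightarrow> bool" where
  "weak_star_Linf M f F \<longleftrightarrow> (\<forall>\<^sub>F k in sequentially. f k \<in> Linf M) \<and> F \<in> Linf M \<and>
     (\<forall>h. integrable M h \<longrightarrow>
        (\<lambda>k. integral\<^sup>L M (\<lambda>t. f k t \<bullet> h t)) \<longlonglongrightarrow> integral\<^sup>L M (\<lambda>t. F t \<bullet> h t))"

text \<open>Weak-star convergence of the vector fields \<open>w k\<close> along the curves \<open>y k\<close> to the vector
  field \<open>W\<close> along the curve \<open>Y\<close>: on each subinterval on which the curves remain in a common
  chart, it is weak-star convergence of the representations in that chart.\<close>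

definition weak_star_along ::
    "('m, 'e::euclidean_space) chart set \<Rightarrow> real \<Rightarrow> (nat \<Rightarrow> real \<Rightarrow> 'm) \<Rightarrow>
     (nat \<Rightarrow> real \<Rightarrow> 'e) \<Rightarrow> (real \<Rightarrow> 'm) \<Rightarrow> (real \<Rightarrow> 'e) \<Rightarrow> bool" where
  "weak_star_along A T y w Y W \<longleftrightarrow>
     (\<forall>c\<in>A. \<forall>a b. 0 \<le> a \<and> a < b \<and> b \<le> T \<and> Y ` {a..b} \<subseteq> fst c \<and>
        (\<forall>\<^sub>F k in sequentially. y k ` {a..b} \<subseteq> fst c) \<longrightarrow>
        weak_star_Linf (lebesgue_on {a..b})
          (\<lambda>k t. tangent_in A c (y k t) (w k t)) (\<lambda>t. tangent_in A c (Y t) (W t)))"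

definition measure_support :: "'a::topological_space measure \<Rightarrow> 'a set" where
  "measure_support \<mu> = {p. \<forall>U. open U \<and> p \<in> U \<longrightarrow> emeasure \<mu> U > 0}"

definition mean_Hp ::
    "('m \<Rightarrow> 'e::euclidean_space \<Rightarrow> real) \<Rightarrow> (real \<Rightarrow> 'm) \<Rightarrow> (real \<Rightarrow> 'e measure) \<Rightarrow> real \<Rightarrow> 'e" where
  "mean_Hp H y \<nu> t = integral\<^sup>L (\<nu> t) (Hp H (y t))"

definition satisfies_inclusion ::
    "('m::topological_space, 'e::euclidean_space) chart set \<Rightarrow> ('m \<Rightarrow> 'e \<Rightarrow> real) \<Rightarrow>
     ('m \<Rightarrow> real) \<Rightarrow> real \<Rightarrow> (real \<Rightarrow> 'm) \<Rightarrow> bool" where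
  "satisfies_inclusion A H \<phi> T y \<longleftrightarrow>
     (AE t in lebesgue_on {0..T}. \<exists>v. has_velocity A {0..T} y t v \<and>
        v \<in> convex hull (Hp H (y t) ` superdifferential A \<phi> (y t)))"

definition generalized_characteristic ::
    "('m::topological_space, 'e::euclidean_space) chart set \<Rightarrow> ('m \<Rightarrow> 'e \<Rightarrow> 'e \<Rightarrow> real) \<Rightarrow>
     ('m \<Rightarrow> 'e \<Rightarrow> real) \<Rightarrow> ('m \<Rightarrow> real) \<Rightarrow> real \<Rightarrow> (real \<Rightarrow> 'm) \<Rightarrow> bool" where
  "generalized_characteristic A g H \<phi> T y \<longleftrightarrow>
     (\<exists>C. \<forall>s\<in>{0..T}. \<forall>t\<in>{0..T}. riem_dist A g (y s) (y t) \<le> C * \<bar>s - t\<bar>) \<and>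
     satisfies_inclusion A H \<phi> T y"

end

theory Submission
 imports Defs
begin

text \<open>
  The inclusion holds because the velocities of the approximating curves are close to
  \<open>H\<^sub>p(x, D\<^sup>+\<phi>(x))\<close>: as \<open>t \<rightarrow> 0\<close> and \<open>y \<rightarrow> x\<close>, the limits of the gradients of \<open>T\<^sub>t\<^sup>+\<phi>\<close> at \<open>y\<close> are
  supergradients of \<open>\<phi>\<close> at \<open>x\<close>. Uniform convergence of the curves then places the difference quotients
  of the limit in arbitrarily small neighbourhoods of the convex hull of \<open>H\<^sub>p(x, D\<^sup>+\<phi>(x))\<close>, so that
  every \<open>\<nu>\<^sub>t\<close> can be taken to be a finite convex combination of Dirac measures, and the velocities
  converge weakly-* along the whole sequence.

  The convergence of gradients rests on the maximizer \<open>y\<close> of \<open>\<phi> - A\<^sub>t(x, \<cdot>)\<close>, which by uniqueness depends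
  continuously on \<open>x\<close> and is close to \<open>x\<close>, hence by Brouwer's theorem takes every value. So each
  \<open>y\<close> is optimal for some \<open>x\<close>, and translating a nearly optimal curve from \<open>x\<close> to \<open>y\<close> by \<open>v\<close> in a chart gives
  \<open>\<phi>(y + v) - \<phi>(y) \<le> T\<^sub>t\<^sup>+\<phi>(x + v) - T\<^sub>t\<^sup>+\<phi>(x) + C t |v|\<close>. For fixed \<open>t\<close> this makes \<open>\<phi>\<close> locally semiconcave
  with a uniform modulus in charts; for \<open>t \<rightarrow> 0\<close> it carries the gradients over to \<open>\<phi>\<close>.
\<close>

section \<open>Absolutely continuous functions of one variable\<close>

text \<open>The difficulty is to keep neighbourhoods uniform as t -> 0. Differentiability of
  \<open>u t\<close> at x controls only increments v whose size depends on t, so the translation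
  inequality alone says nothing in the limit. The semiconcavity modulus found at a fixed time
  repairs this: along a ray it lifts a bound for l v with tiny l to v itself, so the gradient of
  \<open>u t\<close> at x is, up to an error e, a supergradient of \<phi> at the optimal point y on
  a ball that does not depend on t. Minimizing curves are never produced. They are replaced by
  curves whose action is within any epsilon of the infimum; these are only absolutely continuous,
  and their velocities may be unbounded. Estimates along them are therefore comparisons of
  increments with an integrable rate, and large velocities are truncated pointwise. No limit of the
  momenta is taken. Weak-* convergence of the velocities comes from the convergence of uniformly
  Lipschitz curves, and the measures are read off afterwards from the velocity of the limit
  curve.\<close>

text \<open>For \<open>\<Phi> u v = \<bar>f v - f u\<bar>\<close> this is absolute continuity of \<open>f\<close>; taking \<open>\<Phi> u v = f v - f u\<close> gives a one-sided version.\<close>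

definition ac_family :: "(real => real => real) => real => real => bool" where
 "ac_family \<Phi> a b \<longleftrightarrow> (\<forall>\<epsilon>>0. \<exists>\<delta>>0. \<forall>D. D division_of \<Union>D \<and> \<Union>D \<subseteq> {a..b} \<and>
   (\<Sum>K\<in>D. measure lborel K) < \<delta> --> (\<Sum>K\<in>D. \<Phi> (Inf K) (Sup K)) < \<epsilon>)"

section \<open>Differentiability almost everywhere by Vitali coverings\<close>

definition small_intervals :: "(real => real => bool) => real => bool" where
 "small_intervals P s \<longleftrightarrow> (\<forall>d>0. \<exists>u v. u < v \<and> u \<le> s \<and> s \<le> v \<and> v - u < d \<and> P u v)"

lemma small_intervals_mono:
 assumes "small_intervals P s" "\<And>u v. u < v ==> P u v ==> Q u v"
 shows "small_intervals Q s" using assms unfolding small_intervals_def by blast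

lemma not_small_intervalsE:
 assumes "\<not> small_intervals P s"
 obtains d where "d > 0" "\<And>u v. [|u < v; u \<le> s; s \<le> v; v - u < d|] ==> \<not> P u v"
 using assms unfolding small_intervals_def by blast

text \<open>Short intervals around the points of \<open>E\<close> are balls about their midpoints,
  so Vitali's theorem gives a countable disjoint subfamily covering \<open>E\<close> up to a null
  set. Since \<open>U\<close> has finite measure, finitely many of its members already carry almost
  all of the measure. The discarded members and the null set together form \<open>T\<close>; the set
  \<open>E\<close> itself may be nonmeasurable, so the remainder is measured through
  \<open>T\<close>.\<close>

lemma vitali_finite:
 fixes E U :: "real set"
 assumes U: "open U" "U \<in> lmeasurable" "E \<subseteq> U"
  and P: "\<And>s. s \<in> E ==> small_intervals P s" and dl: "dl > 0"
 obtains D T where "D division_of \<Union>D" "pairwise disjnt D" "\<Union>D \<subseteq> U"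
  "\<forall>K\<in>D. \<exists>u v. u < v \<and> K = {u..v} \<and> P u v"
  "E - \<Union>D \<subseteq> T" "T \<in> lmeasurable" "measure lebesgue T < dl"
proof -
 let ?K = "{i::real\<times>real. 0 < snd i \<and> cball (fst i) (snd i) \<subseteq> U \<and> P (fst i - snd i) (fst i + snd i)}"
 obtain C where C: "countable C" "C \<subseteq> ?K"
   "pairwise (\<lambda>i j. disjnt (cball (fst i) (snd i)) (cball (fst j) (snd j))) C"
   "negligible(E - (\<Union>i \<in> C. cball (fst i) (snd i)))"
 proof (rule Vitali_covering_theorem_cballs[of ?K snd E fst])
  fix x d :: real assume x: "x \<in> E" and d: "0 < d"
  obtain e where e: "e > 0" "ball x e \<subseteq> U" using U x openE by blast
  obtain u v where uv: "u < v" "u \<le> x" "x \<le> v" "v - u < min d e" "P u v"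
   using P[OF x] d e unfolding small_intervals_def by (metis min_less_iff_conj)
  have "{u..v} \<subseteq> ball x e" using uv by (auto simp: dist_real_def)
  then have "{u..v} \<subseteq> U" using e by blast
  moreover have "cball ((u+v)/2) ((v-u)/2) = {u..v}" by (simp add: cball_eq_atLeastAtMost field_simps)
  moreover have "(u+v)/2 - (v-u)/2 = u" "(u+v)/2 + (v-u)/2 = v" by (auto simp: field_simps)
  ultimately show "\<exists>i. i \<in> ?K \<and> x \<in> cball (fst i) (snd i) \<and> snd i < d"
   using uv by (intro exI[of _ "((u+v)/2, (v-u)/2)"]) auto
 qed auto
 define \<D> where "\<D> = (\<lambda>i. cball (fst i) (snd i)) ` C"
 have cD: "countable \<D>" using C by (simp add: \<D>_def)
 have DU: "\<Union>\<D> \<subseteq> U" using C by (auto simp: \<D>_def)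
 have lm: "d \<in> lmeasurable" if "d \<in> \<D>" for d using that by (auto simp: \<D>_def)
 have lmU: "\<Union>\<D> \<in> lmeasurable"
  using U(2) DU cD lm by (metis fmeasurableD fmeasurable_Int_fmeasurable inf.absorb_iff2 sets.countable_Union subsetI)
 have bd: "measure lebesgue (\<Union>D') \<le> measure lebesgue U" if "D' \<subseteq> \<D>" "finite D'" for D'
 proof (rule measure_mono_fmeasurable)
  have "\<Union>D' \<in> lmeasurable" using that lm by (intro fmeasurable.finite_Union) auto
  then show "\<Union>D' \<in> sets lebesgue" by (rule fmeasurableD)
 qed (use that DU U in auto)
 obtain D where D: "D \<subseteq> \<D>" "finite D" "measure lebesgue (\<Union>\<D>) - dl/2 < measure lebesgue (\<Union>D)"
  using measure_countable_Union_approachable[OF cD _ lm bd, of "dl/2"] dl by auto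
 have neg: "negligible (E - \<Union>\<D>)" using C(4) by (simp add: \<D>_def)
 let ?T = "(\<Union>\<D> - \<Union>D) \<union> (E - \<Union>\<D>)"
 have lmD: "\<Union>D \<in> lmeasurable" using D lm by (auto intro!: fmeasurable.finite_Union)
 have "measure lebesgue (\<Union>\<D> - \<Union>D) = measure lebesgue (\<Union>\<D>) - measure lebesgue (\<Union>D)"
  using D by (intro measurable_measure_Diff lmU fmeasurableD lmD) auto
 then have "measure lebesgue (\<Union>\<D> - \<Union>D) < dl" using D dl by linarith
 moreover have "?T \<in> lmeasurable" by (intro fmeasurable.Un fmeasurable.Diff lmU lmD negligible_imp_measurable neg)
 moreover have "measure lebesgue ?T = measure lebesgue (\<Union>\<D> - \<Union>D)"
  by (rule measure_Un_null_set) (use lmU lmD neg in \<open>auto simp: negligible_iff_null_sets[symmetric] intro!: fmeasurableD\<close>)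
 moreover have "D division_of \<Union>D" unfolding division_of_def
 proof (intro conjI ballI impI)
  fix K assume K: "K \<in> D"
  then obtain i where i: "i \<in> C" "K = cball (fst i) (snd i)" using D(1) unfolding \<D>_def by blast
  then show "\<exists>a b. K = cbox a b" by (auto simp: cball_eq_atLeastAtMost)
  show "K \<noteq> {}" using i C(2) by auto
  show "K \<subseteq> \<Union>D" using K by auto
  fix K' assume K': "K' \<in> D" "K \<noteq> K'"
  then obtain j where j: "j \<in> C" "K' = cball (fst j) (snd j)" using D(1) unfolding \<D>_def by blast
  have "disjnt K K'" using C(3) i j K' unfolding pairwise_def by metis
  then show "interior K \<inter> interior K' = {}" using interior_subset[of K] interior_subset[of K'] by (auto simp: disjnt_def)
 qed (use D in auto)
 moreover have "\<forall>K\<in>D. \<exists>u v. u < v \<and> K = {u..v} \<and> P u v"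
 proof
  fix K assume "K \<in> D"
  obtain i where i: "i \<in> C" "K = cball (fst i) (snd i)" using D(1) \<open>K \<in> D\<close> unfolding \<D>_def by blast
  then show "\<exists>u v. u < v \<and> K = {u..v} \<and> P u v" using C(2)
   by (intro exI[of _ "fst i - snd i"] exI[of _ "fst i + snd i"]) (auto simp: cball_eq_atLeastAtMost)
 qed
 moreover have "pairwise disjnt D"
 proof (rule pairwiseI)
  fix K K' assume K: "K \<in> D" "K' \<in> D" "K \<noteq> K'"
  then obtain i j where "i \<in> C" "K = cball (fst i) (snd i)" "j \<in> C" "K' = cball (fst j) (snd j)"
   using D(1) unfolding \<D>_def by blast
  then show "disjnt K K'" using C(3) K unfolding pairwise_def by metis
 qed
 ultimately show thesis using that[of D ?T] subset_trans[OF Union_mono[OF D(1)] DU] by auto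
qed

text \<open>Lebesgue outer measure as a real number, meaningful for bounded sets. It is used because
  the exceptional sets are not known to be measurable.\<close>

definition outer :: "real set => real" where
 "outer E = Inf {measure lebesgue T |T. T \<in> lmeasurable \<and> E \<subseteq> T}"

lemma outer_le: "T \<in> lmeasurable ==> E \<subseteq> T ==> outer E \<le> measure lebesgue T"
 unfolding outer_def by (rule cInf_lower) (auto intro!: bdd_belowI[of _ 0])

lemma outer_approx:
 assumes "E \<subseteq> {a<..<b}" "e > 0"
 obtains U where "open U" "E \<subseteq> U" "U \<subseteq> {a<..<b}" "U \<in> lmeasurable" "measure lebesgue U < outer E + e"
proof -
 have "\<exists>x\<in>{measure lebesgue T |T. T \<in> lmeasurable \<and> E \<subseteq> T}. x < outer E + e/2"
  unfolding outer_def using assms by (intro cInf_lessD) (auto intro!: exI[of _ "{a<..<b}"])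
 then obtain T where T: "T \<in> lmeasurable" "E \<subseteq> T" "measure lebesgue T < outer E + e/2" by auto
 obtain U where U: "open U" "T \<subseteq> U" "(U - T) \<in> lmeasurable" "emeasure lebesgue (U - T) < ennreal (e/2)"
  using sets_lebesgue_outer_open[of T "e/2"] T assms by (auto dest: fmeasurableD)
 have lU: "U \<in> lmeasurable" using U T by (metis Diff_partition fmeasurable.Un)
 have "measure lebesgue (U - T) < e/2" using U(3,4) assms by (simp add: emeasure_eq_measure2 ennreal_less_iff)
 moreover have "measure lebesgue U = measure lebesgue T + measure lebesgue (U - T)"
  using measure_Un2[OF T(1) lU] U by (simp add: Un_absorb1)
 ultimately have m: "measure lebesgue U < outer E + e" using T by linarith
 have "measure lebesgue (U \<inter> {a<..<b}) \<le> measure lebesgue U"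
  by (rule measure_mono_fmeasurable) (use lU in \<open>auto dest: fmeasurableD\<close>)
 then show thesis using m U T assms lU
  by (intro that[of "U \<inter> {a<..<b}"]) (auto intro!: fmeasurable_Int_fmeasurable)
qed

lemma outer_zero:
 assumes "E \<subseteq> {a<..<b}" "outer E \<le> 0" shows "negligible E" unfolding negligible_outer
proof (intro allI impI)
 fix e :: real assume "e > 0"
 then obtain U where "open U" "E \<subseteq> U" "U \<in> lmeasurable" "measure lebesgue U < outer E + e"
  using outer_approx[OF assms(1)] by metis
 then show "\<exists>T. E \<subseteq> T \<and> T \<in> lmeasurable \<and> measure lebesgue T < e"
  using assms by (intro exI[of _ U]) auto
qed

lemma division_measure:
 fixes D :: "real set set"
 assumes "D division_of \<Union>D"
 shows "(\<Sum>K\<in>D. measure lborel K) = measure lebesgue (\<Union>D)" "\<Union>D \<in> lmeasurable"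
proof -
 show "\<Union>D \<in> lmeasurable" using division_ofD(1,4)[OF assms] by (intro fmeasurable.finite_Union) auto
 show "(\<Sum>K\<in>D. measure lborel K) = measure lebesgue (\<Union>D)"
  unfolding content_division[OF assms, symmetric]
  by (rule sum.cong) (auto dest!: division_ofD(4)[OF assms] simp: measure_completion)
qed

lemma division_additive:
 fixes f :: "real => real"
 assumes "D division_of {a..b}" "a \<le> b"
 shows "(\<Sum>K\<in>D. f (Sup K) - f (Inf K)) = f b - f a"
proof -
 have ne: "K \<noteq> {}" "\<exists>u v. K = {u..v}" if "K \<in> D" for K
  using assms that by (auto simp: division_of_def)
 have "(\<lambda>K. (Inf K, K)) ` D tagged_division_of {a..b}"
 proof (rule tagged_division_ofI)
  show "finite ((\<lambda>K. (Inf K, K)) ` D)" using assms by (auto simp: division_of_def)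
  show "\<Union> {K. \<exists>x. (x, K) \<in> (\<lambda>K. (Inf K, K)) ` D} = {a..b}"
   unfolding division_ofD(6)[OF assms(1), symmetric] by blast
  fix x K assume "(x, K) \<in> (\<lambda>K. (Inf K, K)) ` D"
  then have K: "K \<in> D" "x = Inf K" by auto
  obtain u v where uv: "K = {u..v}" "u \<le> v" using ne[OF K(1)] by auto
  show "x \<in> K" using uv K by auto
  show "\<exists>a b. K = cbox a b" using uv by auto
  show "K \<subseteq> {a..b}" using assms K division_ofD(2) by metis
 next
  fix x1 K1 x2 K2
  assume "(x1, K1) \<in> (\<lambda>K. (Inf K, K)) ` D" "(x2, K2) \<in> (\<lambda>K. (Inf K, K)) ` D" "(x1, K1) \<noteq> (x2, K2)"
  then show "interior K1 \<inter> interior K2 = {}" using division_ofD(5)[OF assms(1)] by auto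
 qed
 from additive_tagged_division_1[OF assms(2) this, of f] show ?thesis
  by (subst (asm) sum.reindex) (auto simp: inj_on_def)
qed

lemma ac_familyE:
 assumes "ac_family \<Phi> a b" "e > 0"
 obtains d where "d > 0" "\<And>D. D division_of \<Union>D ==> \<Union>D \<subseteq> {a..b} ==> measure lebesgue (\<Union>D) < d ==>
   (\<Sum>K\<in>D. \<Phi> (Inf K) (Sup K)) < e" using assms unfolding ac_family_def by (metis division_measure(1))

lemma outer_subadd:
 assumes "T \<in> lmeasurable" "S \<in> lmeasurable" "E \<subseteq> S \<union> T"
 shows "outer E \<le> measure lebesgue S + measure lebesgue T"
 using outer_le[OF fmeasurable.Un[OF assms(2,1)] assms(3)] measure_Un_le[of S lebesgue T] assms
 by (auto dest: fmeasurableD)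

text \<open>Cover the set by intervals on which \<open>f\<close> grows slowly, and inside each of these by intervals on which
  it grows fast: by absolute continuity, the small remainder cannot make up for the difference.\<close>

lemma ac_derivates_cross_negligible:
 fixes f :: "real => real"
 assumes ac: "ac_family (\<lambda>u v. \<bar>f v - f u\<bar>) a b" and E: "E \<subseteq> {a<..<b}"
  and less: "\<And>s. s \<in> E ==> small_intervals (\<lambda>u v. f v - f u < p * (v - u)) s"
  and more: "\<And>s. s \<in> E ==> small_intervals (\<lambda>u v. f v - f u > q * (v - u)) s"
  and pq: "p < q"
 shows "negligible E"
proof (rule ccontr)
 assume "\<not> negligible E"
 then have mu: "outer E > 0" using outer_zero[OF E] by force
 define \<mu> where "\<mu> = outer E"
 have \<mu>4: "(q - p) * \<mu> / 4 > 0" using mu pq by (simp add: \<mu>_def)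
 obtain d where d: "d > 0" "\<And>D. D division_of \<Union>D ==> \<Union>D \<subseteq> {a..b} ==> measure lebesgue (\<Union>D) < d ==>
   (\<Sum>K\<in>D. \<bar>f (Sup K) - f (Inf K)\<bar>) < (q - p) * \<mu> / 4"
  using ac_familyE[OF ac, of "(q - p) * \<mu> / 4"] \<mu>4 by blast
 \<comment> \<open>Up to errors \<open>e\<close>, the slow intervals have total length at most \<mu>
   and the fast ones at least \<mu>. The term \<open>d / 4\<close> keeps the remainder, of length
   below \<open>3 * e\<close>, within reach of absolute continuity; \<open>\<mu> / 8\<close> makes
   \<open>m2 < \<mu> / 2\<close> contradict \<open>\<mu> \<le> m2 + 2 * e\<close>; the last term
   bounds the loss \<open>\<bar>p\<bar> * (3 * e)\<close>.\<close>
 define e where "e = min (d / 4) (min (\<mu> / 8) ((q - p) * \<mu> / (12 * (\<bar>p\<bar> + 1))))"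
 have "e \<le> d / 4" "e \<le> \<mu> / 8" unfolding e_def by linarith+
 moreover have "0 < (q - p) * \<mu> / (12 * (\<bar>p\<bar> + 1))" using \<mu>4 by (intro divide_pos_pos) auto
 then have "e > 0" using mu d(1) by (simp add: e_def \<mu>_def)
 ultimately have e: "e > 0" "3 * e < d" "2 * e \<le> \<mu> / 4" using d(1) by auto
 have "e \<le> (q - p) * \<mu> / (12 * (\<bar>p\<bar> + 1))" by (simp add: e_def)
 then have "12 * (\<bar>p\<bar> + 1) * e \<le> (q - p) * \<mu>" by (simp add: pos_le_divide_eq add_pos_nonneg algebra_simps)
 moreover have "\<bar>p\<bar> * e \<le> (\<bar>p\<bar> + 1) * e" using e by (simp add: algebra_simps)
 ultimately have ep: "\<bar>p\<bar> * (3 * e) \<le> (q - p) * \<mu> / 4" by (simp add: algebra_simps)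
 obtain U where U: "open U" "E \<subseteq> U" "U \<subseteq> {a<..<b}" "U \<in> lmeasurable" "measure lebesgue U < \<mu> + e"
  using outer_approx[OF E e(1)] unfolding \<mu>_def by metis
 obtain D T where D: "D division_of \<Union>D" "\<Union>D \<subseteq> U"
  "\<forall>K\<in>D. \<exists>u v. u < v \<and> K = {u..v} \<and> f v - f u < p * (v - u)"
  "E - \<Union>D \<subseteq> T" "T \<in> lmeasurable" "measure lebesgue T < e" "pairwise disjnt D"
 proof -
  show thesis by (rule vitali_finite[OF U(1,4,2) less e(1)], assumption) (rule that; assumption)
 qed
 have finD: "finite D" using D by (auto simp: division_of_def)
 define e1 where "e1 = e / (real (card D) + 1)"
 have e1: "e1 > 0" using e by (simp add: e1_def)
 define Q where "Q J D' T' \<longleftrightarrow> D' division_of \<Union>D' \<and> \<Union>D' \<subseteq> interior J \<and>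
   (\<forall>K\<in>D'. \<exists>u v. u < v \<and> K = {u..v} \<and> f v - f u > q * (v - u)) \<and>
   (E \<inter> interior J) - \<Union>D' \<subseteq> T' \<and> T' \<in> lmeasurable \<and> measure lebesgue T' < e1" for J D' T'
 have "\<exists>D' T'. Q J D' T'" if J: "J \<in> D" for J
 proof -
  obtain u v where uv: "J = {u..v}" using bspec[OF D(3) J] by blast
  have lm: "interior J \<in> lmeasurable" by (simp add: uv interior_atLeastAtMost_real)
  have iv: "small_intervals (\<lambda>u v. q * (v - u) < f v - f u) s" if "s \<in> E \<inter> interior J" for s
   using more that by blast
  obtain D' T' where "D' division_of \<Union>D'" "pairwise disjnt D'" "\<Union>D' \<subseteq> interior J"
   "\<forall>K\<in>D'. \<exists>u v. u < v \<and> K = {u..v} \<and> f v - f u > q * (v - u)"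
   "E \<inter> interior J - \<Union>D' \<subseteq> T'" "T' \<in> lmeasurable" "measure lebesgue T' < e1"
   by (rule vitali_finite[OF open_interior lm Int_lower2[of E "interior J"] iv e1], assumption) (rule that; assumption)
  then show ?thesis unfolding Q_def by blast
 qed
 then obtain D' T' where Q: "\<And>J. J \<in> D ==> Q J (D' J) (T' J)" by metis
 have D': "\<And>J. J \<in> D ==> D' J division_of \<Union>(D' J)" "\<And>J. J \<in> D ==> \<Union>(D' J) \<subseteq> interior J"
   "\<And>J K. J \<in> D ==> K \<in> D' J ==> \<exists>u v. u < v \<and> K = {u..v} \<and> f v - f u > q * (v - u)"
   "\<And>J. J \<in> D ==> (E \<inter> interior J) - \<Union>(D' J) \<subseteq> T' J" "\<And>J. J \<in> D ==> T' J \<in> lmeasurable"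
   "\<And>J. J \<in> D ==> measure lebesgue (T' J) < e1" using Q unfolding Q_def by blast+
 have "\<exists>r. D' J \<subseteq> r \<and> r division_of J" if J: "J \<in> D" for J
 proof -
  obtain u v where uv: "J = {u..v}" "u < v" using bspec[OF D(3) J] by blast
  have Jd: "{J} division_of J" using division_of_self[of u v] uv by simp
  have "\<Union>(D' J) \<subseteq> J" using D'(2)[OF J] interior_subset[of J] by (rule subset_trans)
  then obtain r where "D' J \<subseteq> r" "r division_of J" by (rule partial_division_extend[OF D'(1)[OF J] Jd])
  then show ?thesis by blast
 qed
 then have "\<forall>J\<in>D. \<exists>r. D' J \<subseteq> r \<and> r division_of J" by blast
 from bchoice[OF this] obtain r where r: "\<And>J. J \<in> D ==> D' J \<subseteq> r J" "\<And>J. J \<in> D ==> r J division_of J" by blast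
 have fin: "finite (r J)" "finite (D' J)" if "J \<in> D" for J
  using r[OF that] by (auto simp: division_of_def intro: finite_subset)
 \<comment> \<open>The pieces of the slow intervals that the fast ones leave over. They are short in
   total, so \<open>f\<close> varies little on them, and the increments over \<open>D\<close> and
   over all the \<open>D' J\<close> nearly agree.\<close>
 define R where "R = (\<Union>J\<in>D. r J - D' J)"
 let ?\<Delta> = "\<lambda>K. f (Sup K) - f (Inf K)" and ?m = "\<lambda>K. measure lborel (K::real set)"
 have Rr: "K \<subseteq> J" "K \<noteq> {}" "\<exists>u v. K = {u..v}" if "K \<in> r J" "J \<in> D" for K J
  using r(2)[OF that(2)] that by (auto simp: division_of_def)
 have rdisj: "interior K \<inter> interior K' = {}" if "K \<in> r J" "K' \<in> r J'" "J \<in> D" "J' \<in> D" "K \<noteq> K'" for K K' J J'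
 proof (cases "J = J'")
  case True then show ?thesis using division_ofD(5)[OF r(2)] that by metis
 next
  case False
  then have "interior J \<inter> interior J' = {}" using division_ofD(5)[OF D(1)] that by blast
  then show ?thesis using interior_mono[OF Rr(1)] that by blast
 qed
 have Rdiv: "R division_of \<Union>R" unfolding division_of_def
 proof (intro conjI ballI impI)
  show "finite R" using finD fin by (auto simp: R_def)
  fix K assume "K \<in> R"
  then obtain J where J: "J \<in> D" "K \<in> r J" "K \<notin> D' J" by (auto simp: R_def)
  show "K \<subseteq> \<Union>R" using \<open>K \<in> R\<close> by auto
  show "K \<noteq> {}" "\<exists>a b. K = cbox a b" using Rr[OF J(2,1)] by auto
  fix K' assume "K' \<in> R" "K \<noteq> K'"
  then obtain J' where J': "J' \<in> D" "K' \<in> r J'" by (auto simp: R_def)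
  show "interior K \<inter> interior K' = {}" by (rule rdisj[OF J(2) J'(2) J(1) J'(1) \<open>K \<noteq> K'\<close>])
 qed auto
 have Rsub: "\<Union>R \<subseteq> {a..b}"
 proof -
  have "K \<subseteq> {a..b}" if KR: "K \<in> R" for K
  proof -
   obtain J where J: "J \<in> D" "K \<in> r J" using KR unfolding R_def by blast
   have "K \<subseteq> U" using Rr(1)[OF J(2,1)] D(2) J(1) by blast
   then have "K \<subseteq> {a<..<b}" using U(3) by (rule subset_trans)
   then show ?thesis using greaterThanLessThan_subseteq_atLeastAtMost_iff[of a b a b] by auto
  qed
  then show ?thesis by blast
 qed
 have sumR: "(\<Sum>K\<in>R. g K) = (\<Sum>J\<in>D. (\<Sum>K\<in>r J. g K) - (\<Sum>K\<in>D' J. g K))" for g :: "real set => real"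
 proof -
  have "(\<Sum>K\<in>R. g K) = (\<Sum>J\<in>D. \<Sum>K\<in>r J - D' J. g K)" unfolding R_def
  proof (rule sum.UNION_disjoint)
   show "\<forall>J\<in>D. \<forall>J'\<in>D. J \<noteq> J' --> (r J - D' J) \<inter> (r J' - D' J') = {}"
   proof (intro ballI impI)
    fix J J' assume JJ: "J \<in> D" "J' \<in> D" "J \<noteq> J'"
    have "False" if "K \<in> r J" "K \<in> r J'" for K
     using Rr[of K J] Rr[of K J'] that D(7) JJ unfolding pairwise_def disjnt_def by blast
    then show "(r J - D' J) \<inter> (r J' - D' J') = {}" by blast
   qed
  qed (use finD fin in auto)
  also have "\<dots> = (\<Sum>J\<in>D. (\<Sum>K\<in>r J. g K) - (\<Sum>K\<in>D' J. g K))"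
   by (intro sum.cong refl sum_diff) (use fin r in auto)
  finally show ?thesis .
 qed
 define m1 where "m1 = measure lebesgue (\<Union>D)"
 define m2 where "m2 = (\<Sum>J\<in>D. \<Sum>K\<in>D' J. ?m K)"
 have Dle: "\<exists>u v. J = {u..v} \<and> u \<le> v" if "J \<in> D" for J using bspec[OF D(3) that] by force
 have rm: "(\<Sum>K\<in>r J. ?m K) = ?m J" "(\<Sum>K\<in>r J. ?\<Delta> K) = ?\<Delta> J" if J: "J \<in> D" for J
 proof -
  obtain u v where uv: "J = {u..v}" "u \<le> v" using Dle[OF J] by blast
  show "(\<Sum>K\<in>r J. ?m K) = ?m J" using additive_content_division[of "r J" u v] r(2)[OF J] uv by simp
  show "(\<Sum>K\<in>r J. ?\<Delta> K) = ?\<Delta> J" using division_additive[of "r J" u v f] r(2)[OF J] uv by simp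
 qed
 have "m1 \<le> measure lebesgue U"
  unfolding m1_def by (rule measure_mono_fmeasurable) (use D U division_measure(2)[OF D(1)] in \<open>auto dest: fmeasurableD\<close>)
 then have m1: "m1 < \<mu> + e" using U by linarith
 have m1s: "m1 = (\<Sum>J\<in>D. ?m J)" using division_measure(1)[OF D(1)] by (simp add: m1_def)
 have mR: "measure lebesgue (\<Union>R) = m1 - m2"
  using division_measure(1)[OF Rdiv] sumR[of ?m] rm(1) by (simp add: m1s m2_def sum_subtractf)
 have lS: "\<Union>(D' J) \<in> lmeasurable" "measure lebesgue (\<Union>(D' J)) = (\<Sum>K\<in>D' J. ?m K)" if "J \<in> D" for J
  using division_measure[OF D'(1)[OF that]] by auto
 \<comment> \<open>The fast intervals were taken inside the interiors of the slow ones; the finitely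
   many end points have to be covered separately.\<close>
 define F where "F = (\<Union>J\<in>D. {Inf J, Sup J})"
 have F: "negligible F" using finD by (auto simp: F_def intro!: negligible_finite)
 have "\<mu> \<le> measure lebesgue (\<Union>J\<in>D. \<Union>(D' J)) + measure lebesgue ((T \<union> (\<Union>J\<in>D. T' J)) \<union> F)"
  unfolding \<mu>_def
 proof (rule outer_subadd)
  show "(\<Union>J\<in>D. \<Union>(D' J)) \<in> lmeasurable" using finD lS by (intro fmeasurable.finite_Union) auto
  show "T \<union> \<Union>(T' ` D) \<union> F \<in> lmeasurable"
   by (intro fmeasurable.Un fmeasurable.finite_Union D(5) negligible_imp_measurable[OF F]) (use finD D'(5) in auto)
  show "E \<subseteq> (\<Union>J\<in>D. \<Union>(D' J)) \<union> (T \<union> \<Union>(T' ` D) \<union> F)"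
  proof
   fix s assume s: "s \<in> E"
   show "s \<in> (\<Union>J\<in>D. \<Union>(D' J)) \<union> (T \<union> \<Union>(T' ` D) \<union> F)"
   proof (cases "s \<in> \<Union>D")
    case False then show ?thesis using D(4) s by blast
   next
    case True
    then obtain J where J: "J \<in> D" "s \<in> J" by auto
    obtain u v where uv: "J = {u..v}" "u \<le> v" using Dle[OF J(1)] by blast
    show ?thesis
    proof (cases "s \<in> interior J")
     case True
     then have "s \<in> \<Union>(D' J) \<union> T' J" using D'(4)[OF J(1)] s by blast
     then show ?thesis using J(1) by blast
    next
     case False
     then have "s = u \<or> s = v" using uv J by (auto simp: interior_atLeastAtMost_real)
     then have "s \<in> {Inf J, Sup J}" using uv by auto
     then have "s \<in> F" unfolding F_def using J(1) by blast
     then show ?thesis by auto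
    qed
   qed
  qed
 qed
 also have "measure lebesgue ((T \<union> (\<Union>J\<in>D. T' J)) \<union> F) = measure lebesgue (T \<union> (\<Union>J\<in>D. T' J))"
 proof (rule measure_Un_null_set)
  show "T \<union> (\<Union>J\<in>D. T' J) \<in> sets lebesgue"
   by (intro fmeasurableD fmeasurable.Un fmeasurable.finite_Union) (use finD D'(5) D(5) in auto)
  show "F \<in> null_sets lebesgue" using F by (simp add: negligible_iff_null_sets)
 qed
 also have "\<dots> \<le> measure lebesgue T + measure lebesgue (\<Union>J\<in>D. T' J)"
  by (rule measure_Un_le) (use finD D'(5) D(5) in \<open>auto intro!: fmeasurableD\<close>)
 also have "measure lebesgue (\<Union>J\<in>D. T' J) \<le> (\<Sum>J\<in>D. measure lebesgue (T' J))"
  by (rule measure_UNION_le) (use finD D'(5) in \<open>auto intro!: fmeasurableD\<close>)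
 also have "\<dots> \<le> (\<Sum>J\<in>D. e1)" by (rule sum_mono) (use D'(6) in \<open>auto intro: less_imp_le\<close>)
 also have "\<dots> \<le> e" using e(1) by (simp add: e1_def field_simps)
 also have "measure lebesgue (\<Union>J\<in>D. \<Union>(D' J)) \<le> (\<Sum>J\<in>D. measure lebesgue (\<Union>(D' J)))"
  by (rule measure_UNION_le) (use finD lS in \<open>auto intro!: fmeasurableD\<close>)
 also have "\<dots> = m2" by (simp add: m2_def lS(2))
 finally have \<mu>le: "\<mu> \<le> m2 + 2 * e" using D(6) by linarith
 have "\<bar>\<Sum>K\<in>R. ?\<Delta> K\<bar> \<le> (\<Sum>K\<in>R. \<bar>?\<Delta> K\<bar>)" by (rule sum_abs)
 also have "\<dots> < (q - p) * \<mu> / 4" by (rule d(2)[OF Rdiv Rsub]) (use mR m1 \<mu>le e in linarith)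
 finally have absR: "\<bar>\<Sum>K\<in>R. ?\<Delta> K\<bar> < (q - p) * \<mu> / 4" .
 have "(\<Sum>J\<in>D. ?\<Delta> J) = (\<Sum>J\<in>D. \<Sum>K\<in>D' J. ?\<Delta> K) + (\<Sum>K\<in>R. ?\<Delta> K)"
 proof -
  have "(\<Sum>J\<in>D. ?\<Delta> J) = (\<Sum>J\<in>D. \<Sum>K\<in>r J. ?\<Delta> K)"
   by (rule sum.cong[OF refl]) (rule rm(2)[symmetric])
  moreover have "(\<Sum>K\<in>R. ?\<Delta> K) = (\<Sum>J\<in>D. \<Sum>K\<in>r J. ?\<Delta> K) - (\<Sum>J\<in>D. \<Sum>K\<in>D' J. ?\<Delta> K)"
   by (rule trans[OF sumR[of ?\<Delta>] sum_subtractf[of "\<lambda>J. \<Sum>K\<in>r J. ?\<Delta> K" "\<lambda>J. \<Sum>K\<in>D' J. ?\<Delta> K" D]])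
  ultimately show ?thesis by linarith
 qed
 moreover have "(\<Sum>J\<in>D. ?\<Delta> J) \<le> (\<Sum>J\<in>D. p * ?m J)"
 proof (rule sum_mono)
  fix J assume "J \<in> D"
  from bspec[OF D(3) this] obtain u v where "u < v" "J = {u..v}" "f v - f u < p * (v - u)" by blast
  then show "?\<Delta> J \<le> p * ?m J" by simp
 qed
 then have "(\<Sum>J\<in>D. ?\<Delta> J) \<le> p * m1" by (simp add: m1s sum_distrib_left)
 moreover have "(\<Sum>J\<in>D. \<Sum>K\<in>D' J. q * ?m K) \<le> (\<Sum>J\<in>D. \<Sum>K\<in>D' J. ?\<Delta> K)"
 proof (intro sum_mono)
  fix J K assume "J \<in> D" "K \<in> D' J"
  from D'(3)[OF this] obtain u v where "u < v" "K = {u..v}" "f v - f u > q * (v - u)" by blast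
  then show "q * ?m K \<le> ?\<Delta> K" by simp
 qed
 then have "q * m2 \<le> (\<Sum>J\<in>D. \<Sum>K\<in>D' J. ?\<Delta> K)" by (simp add: m2_def sum_distrib_left)
 ultimately have "q * m2 - p * m1 < (q - p) * \<mu> / 4" using absR by linarith
 moreover have "(q - p) * m2 = q * m2 - p * m1 + p * (m1 - m2)" by (simp add: algebra_simps)
 ultimately have "(q - p) * m2 < (q - p) * \<mu> / 4 + p * (m1 - m2)" by linarith
 also have "p * (m1 - m2) \<le> \<bar>p\<bar> * \<bar>m1 - m2\<bar>" by (metis abs_ge_self abs_mult)
 also have "\<dots> \<le> \<bar>p\<bar> * (3 * e)"
  using m1 \<mu>le mR measure_nonneg[of lebesgue "\<Union>R"] by (intro mult_left_mono) auto
 also note ep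
 finally have "(q - p) * m2 < (q - p) * (\<mu> / 2)" by (simp add: algebra_simps)
 then have "m2 < \<mu> / 2" using pq by simp
 then show False using \<mu>le e(3) mu by (simp add: \<mu>_def)
qed

text \<open>Within a window shorter than \<open>dl\<close> the variation of \<open>f\<close> is
  below 1. If the part of \<open>E\<close> in the window had positive outer measure, disjoint
  intervals of slope above \<open>2 / outer\<close> would cover more than half of it and already
  force variation above 1. Negligibility is then a local property.\<close>

lemma ac_infinite_derivate_negligible:
 fixes f :: "real => real"
 assumes ac: "ac_family (\<lambda>u v. \<bar>f v - f u\<bar>) a b" and E: "E \<subseteq> {a<..<b}"
  and inf: "\<And>s N. s \<in> E ==> small_intervals (\<lambda>u v. f v - f u > N * (v - u)) s"
 shows "negligible E"
proof -
 obtain dl where dl: "dl > 0" "\<And>D. D division_of \<Union>D ==> \<Union>D \<subseteq> {a..b} ==> measure lebesgue (\<Union>D) < dl ==>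
   (\<Sum>K\<in>D. \<bar>f (Sup K) - f (Inf K)\<bar>) < 1" using ac_familyE[OF ac zero_less_one] by blast
 have neg: "negligible (E \<inter> {c<..<d})" if cd: "d - c < dl" "c < d" for c d
 proof (rule ccontr)
  let ?E = "E \<inter> {c<..<d}"
  assume "\<not> negligible ?E"
  then have mu: "outer ?E > 0" using outer_zero[of ?E a b] E by force
  have iv: "small_intervals (\<lambda>u v. f v - f u > (2 / outer ?E) * (v - u)) s" if "s \<in> ?E" for s
   using inf that by blast
  have lm: "{a<..<b} \<inter> {c<..<d} \<in> lmeasurable" by (intro fmeasurable_Int_fmeasurable) auto
  have sub: "?E \<subseteq> {a<..<b} \<inter> {c<..<d}" using E by blast
  have op: "open ({a<..<b} \<inter> {c<..<d})" by (intro open_Int) auto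
  have pos: "0 < outer ?E / 2" using mu by simp
  obtain D T where D: "D division_of \<Union>D" "pairwise disjnt D" "\<Union>D \<subseteq> {a<..<b} \<inter> {c<..<d}"
   "\<forall>K\<in>D. \<exists>u v. u < v \<and> K = {u..v} \<and> f v - f u > (2 / outer ?E) * (v - u)"
   "?E - \<Union>D \<subseteq> T" "T \<in> lmeasurable" "measure lebesgue T < outer ?E / 2"
   by (rule vitali_finite[OF op lm sub iv pos], assumption) (rule that; assumption)
  have "measure lebesgue (\<Union>D) \<le> measure lebesgue {c<..<d}"
   using D division_measure(2)[OF D(1)] by (intro measure_mono_fmeasurable) (auto dest: fmeasurableD)
  then have "measure lebesgue (\<Union>D) < dl" using cd by simp
  moreover have "\<Union>D \<subseteq> {a..b}" using D(3) by force
  ultimately have *: "(\<Sum>K\<in>D. \<bar>f (Sup K) - f (Inf K)\<bar>) < 1" using dl(2)[OF D(1)] by auto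
  have "(\<Sum>K\<in>D. (2 / outer ?E) * measure lborel K) \<le> (\<Sum>K\<in>D. \<bar>f (Sup K) - f (Inf K)\<bar>)"
  proof (rule sum_mono)
   fix K assume "K \<in> D"
   from bspec[OF D(4) this] obtain u v where "u < v" "K = {u..v}" "f v - f u > (2 / outer ?E) * (v - u)" by blast
   then show "(2 / outer ?E) * measure lborel K \<le> \<bar>f (Sup K) - f (Inf K)\<bar>" by simp
  qed
  then have "(2 / outer ?E) * measure lebesgue (\<Union>D) < 1"
   using * unfolding division_measure(1)[OF D(1), symmetric] sum_distrib_left by linarith
  then have "measure lebesgue (\<Union>D) < outer ?E / 2" using mu by (simp add: field_simps)
  moreover have "outer ?E \<le> measure lebesgue (\<Union>D) + measure lebesgue T"
   using D(5) by (intro outer_subadd D division_measure(2)) auto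
  ultimately show False using D(7) by linarith
 qed
 show ?thesis
 proof (rule iffD2[OF locally_negligible_alt], rule ballI)
  fix s assume "s \<in> E"
  let ?U = "E \<inter> {s - dl/3<..<s + dl/3}"
  have "openin (top_of_set E) ?U" by (rule openin_open_Int) simp
  moreover have "negligible ?U" using neg[of "s + dl/3" "s - dl/3"] dl(1) by (simp add: field_simps)
  ultimately show "\<exists>U. openin (top_of_set E) U \<and> s \<in> U \<and> negligible U"
   using \<open>s \<in> E\<close> dl(1) by (intro exI[of _ ?U]) auto
 qed
qed

text \<open>Differentiability expressed by intervals containing \<open>s\<close> instead of
  increments from \<open>s\<close>. Vitali intervals and the intervals of a tagged division contain
  the point without ending there, so this is the form in which derivatives arise and are
  used.\<close>

definition straddle_derivative :: "(real => real) => real => real => bool" where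
 "straddle_derivative f D s \<longleftrightarrow> (\<forall>e>0. \<exists>d>0. \<forall>u v. u \<le> s \<and> s \<le> v \<and> v - u < d -->
   \<bar>f v - f u - D * (v - u)\<bar> \<le> e * (v - u))"

lemma straddle_derivative_real:
 assumes "straddle_derivative f D s" shows "(f has_real_derivative D) (at s)"
proof -
 have "(f has_derivative (\<lambda>h. D * h)) (at s)" unfolding has_derivative_at_alt
 proof (intro conjI allI impI bounded_linear_mult_right)
  fix e :: real assume "e > 0"
  then obtain d where d: "d > 0" "\<And>u v. u \<le> s \<and> s \<le> v \<and> v - u < d ==> \<bar>f v - f u - D * (v - u)\<bar> \<le> e * (v - u)"
   using assms unfolding straddle_derivative_def by metis
  show "\<exists>d>0. \<forall>y. norm (y - s) < d --> norm (f y - f s - D * (y - s)) \<le> e * norm (y - s)"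
  proof (intro exI[of _ d] conjI allI impI d(1))
   fix y assume "norm (y - s) < d"
   then show "norm (f y - f s - D * (y - s)) \<le> e * norm (y - s)"
    using d(2)[of s y] d(2)[of y s] by (cases "s \<le> y") (auto simp: abs_if algebra_simps split: if_splits)
  qed
 qed
 then show ?thesis by (simp add: has_field_derivative_def)
qed

text \<open>Off a null set the upper and lower derivates are finite and equal: a gap between them
  contains two rationals, and each of the countably many rational crossings is negligible, as are
  the points with an infinite derivate. The lower derivate is treated by passing to
  \<open>- f\<close>.\<close>

theorem ac_differentiable_ae:
 fixes f :: "real => real"
 assumes ac: "ac_family (\<lambda>u v. \<bar>f v - f u\<bar>) a b"
 obtains N where "negligible N" "\<And>s. s \<in> {a<..<b} - N ==> \<exists>D. straddle_derivative f D s"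
proof -
 let ?more = "\<lambda>q. small_intervals (\<lambda>u v. f v - f u > q * (v - u))"
 let ?less = "\<lambda>p. small_intervals (\<lambda>u v. f v - f u < p * (v - u))"
 define X where "X p q = {s \<in> {a<..<b}. ?less p s \<and> ?more q s}" for p q
 define I1 where "I1 = {s \<in> {a<..<b}. \<forall>N. ?more N s}"
 define I2 where "I2 = {s \<in> {a<..<b}. \<forall>N. ?less N s}"
 define N where "N = (\<Union>(p,q)\<in>{(p,q). p \<in> \<rat> \<and> q \<in> \<rat> \<and> p < q}. X p q) \<union> I1 \<union> I2"
 have ac': "ac_family (\<lambda>u v. \<bar>(- f v) - (- f u)\<bar>) a b" using ac by (simp add: abs_minus_commute)
 have "negligible I1" by (rule ac_infinite_derivate_negligible[OF ac]) (auto simp: I1_def)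
 moreover have "negligible I2"
 proof (rule ac_infinite_derivate_negligible[OF ac'])
  fix s N assume "s \<in> I2"
  then have "?less (- N) s" unfolding I2_def by blast
  then show "small_intervals (\<lambda>u v. N * (v - u) < - f v - - f u) s"
   by (rule small_intervals_mono) (simp add: algebra_simps)
 qed (auto simp: I2_def)
 moreover have "negligible (\<Union>(p,q)\<in>{(p,q). p \<in> \<rat> \<and> q \<in> \<rat> \<and> p < q}. X p q)"
 proof (rule negligible_countable_Union)
  have "countable ((\<rat>::real set) \<times> (\<rat>::real set))" by (intro countable_SIGMA countable_rat)
  then have "countable {(p::real,q). p \<in> \<rat> \<and> q \<in> \<rat> \<and> p < q}" by (rule countable_subset[rotated]) auto
  then show "countable ((\<lambda>(p,q). X p q) ` {(p,q). p \<in> \<rat> \<and> q \<in> \<rat> \<and> p < q})" by (rule countable_image)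
  fix S assume "S \<in> (\<lambda>(p,q). X p q) ` {(p,q). p \<in> \<rat> \<and> q \<in> \<rat> \<and> p < q}"
  then obtain p q where "S = X p q" "p < q" by auto
  then show "negligible S" by (auto intro!: ac_derivates_cross_negligible[OF ac, where p=p and q=q] simp: X_def)
 qed
 ultimately have "negligible N" unfolding N_def by (intro negligible_Un)
 moreover have "\<exists>D. straddle_derivative f D s" if s: "s \<in> {a<..<b} - N" for s
 proof -
  have nX: "\<not> (?less p s \<and> ?more q s)" if pq: "p < q" for p q
  proof
   assume lm: "?less p s \<and> ?more q s"
   obtain p' where p': "p' \<in> \<rat>" "p < p'" "p' < q" using Rats_dense_in_real[OF pq] by auto
   obtain q' where q': "q' \<in> \<rat>" "p' < q'" "q' < q" using Rats_dense_in_real[OF p'(3)] by auto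
   have le: "c * (v - u) < c' * (v - u)" if "c < c'" "u < v" for c c' u v :: real using that by simp
   have "?less p' s"
    by (rule small_intervals_mono[OF conjunct1[OF lm]]) (use le p' in \<open>blast intro: less_trans\<close>)
   moreover have "?more q' s"
    by (rule small_intervals_mono[OF conjunct2[OF lm]]) (use le q' in \<open>blast intro: less_trans\<close>)
   ultimately have "s \<in> X p' q'" using s by (simp add: X_def)
   then show False using s p' q' by (auto simp: N_def)
  qed
  obtain q1 where q1: "\<not> ?more q1 s" using s by (auto simp: N_def I1_def)
  obtain p1 where p1: "\<not> ?less p1 s" using s by (auto simp: N_def I2_def)
  have nmore: "\<exists>d>0. \<forall>u v. u \<le> s \<and> s \<le> v \<and> v - u < d --> f v - f u \<le> q * (v - u)" if nq: "\<not> ?more q s" for q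
  proof -
   obtain d where d: "d > 0" "\<And>u v. [|u < v; u \<le> s; s \<le> v; v - u < d|] ==> f v - f u \<le> q * (v - u)"
    using nq by (rule not_small_intervalsE) (simp add: not_less)
   have "f v - f u \<le> q * (v - u)" if "u \<le> s" "s \<le> v" "v - u < d" for u v
    using d(2)[of u v] that by (cases "u = v") auto
   then show ?thesis using d(1) by blast
  qed
  have nless: "\<exists>d>0. \<forall>u v. u \<le> s \<and> s \<le> v \<and> v - u < d --> f v - f u \<ge> q * (v - u)" if nq: "\<not> ?less q s" for q
  proof -
   obtain d where d: "d > 0" "\<And>u v. [|u < v; u \<le> s; s \<le> v; v - u < d|] ==> f v - f u \<ge> q * (v - u)"
    using nq by (rule not_small_intervalsE) (simp add: not_less)
   have "f v - f u \<ge> q * (v - u)" if "u \<le> s" "s \<le> v" "v - u < d" for u v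
    using d(2)[of u v] that by (cases "u = v") auto
   then show ?thesis using d(1) by blast
  qed
  have less_ge: "?less p s" if q: "\<not> ?more q s" and "q < p" for p q unfolding small_intervals_def
  proof (intro allI impI)
   fix d :: real assume "d > 0"
   obtain d' where d': "d' > 0" "\<forall>u v. u \<le> s \<and> s \<le> v \<and> v - u < d' --> f v - f u \<le> q * (v - u)"
    using nmore[OF q] by auto
   let ?v = "s + min d d' / 2"
   have "f ?v - f s \<le> q * (?v - s)" by (rule d'(2)[rule_format]) (use d'(1) \<open>d > 0\<close> in auto)
   also have "\<dots> < p * (?v - s)" using \<open>q < p\<close> d' \<open>d > 0\<close> by (intro mult_strict_right_mono) auto
   finally show "\<exists>u v. u < v \<and> u \<le> s \<and> s \<le> v \<and> v - u < d \<and> f v - f u < p * (v - u)"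
    using d' \<open>d > 0\<close> by (intro exI[of _ s] exI[of _ ?v]) (auto simp: min_def)
  qed
  \<comment> \<open>The upper derivate at \<open>s\<close>. The supremum is finite because of
    \<open>p1\<close> and \<open>q1\<close>; slopes above it are not exceeded near \<open>s\<close>,
    and slopes below it are not undercut because there is no crossing at \<open>s\<close>.\<close>
  define D where "D = Sup {q. ?more q s}"
  have bdd: "q \<le> q1" if "?more q s" for q
  proof (rule ccontr)
   assume "\<not> q \<le> q1"
   then obtain p where "q1 < p" "p < q" using dense[of q1 q] by auto
   then show False using less_ge[OF q1, of p] nX[of p q] that by blast
  qed
  have ne: "?more (p1 - 1) s" using less_ge[of "p1 - 1" p1] p1 by auto
  have up: "\<not> ?more q s" if "q > D" for q
  proof
   have "bdd_above {q. ?more q s}" using bdd by (intro bdd_aboveI[of _ q1]) auto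
   moreover assume "?more q s"
   ultimately have "q \<le> D" unfolding D_def by (intro cSup_upper) auto
   then show False using that by simp
  qed
  have lo: "\<not> ?less p s" if p: "p < D" for p
  proof -
   obtain q where "?more q s" "p < q" using less_cSupD[of "{q. ?more q s}" p] ne p unfolding D_def by auto
   then show ?thesis using nX by blast
  qed
  have "straddle_derivative f D s" unfolding straddle_derivative_def
  proof (intro allI impI)
   fix e :: real assume "e > 0"
   obtain d1 where d1: "d1 > 0" "\<forall>u v. u \<le> s \<and> s \<le> v \<and> v - u < d1 --> f v - f u \<le> (D + e) * (v - u)"
    using nmore[OF up, of "D + e"] \<open>e > 0\<close> by auto
   obtain d2 where d2: "d2 > 0" "\<forall>u v. u \<le> s \<and> s \<le> v \<and> v - u < d2 --> f v - f u \<ge> (D - e) * (v - u)"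
    using nless[OF lo, of "D - e"] \<open>e > 0\<close> by auto
   show "\<exists>d>0. \<forall>u v. u \<le> s \<and> s \<le> v \<and> v - u < d --> \<bar>f v - f u - D * (v - u)\<bar> \<le> e * (v - u)"
   proof (intro exI[of _ "min d1 d2"] conjI allI impI)
    fix u v assume "u \<le> s \<and> s \<le> v \<and> v - u < min d1 d2"
    then have "f v - f u \<le> (D + e) * (v - u)" "f v - f u \<ge> (D - e) * (v - u)"
     using d1(2)[rule_format, of u v] d2(2)[rule_format, of u v] by auto
    then show "\<bar>f v - f u - D * (v - u)\<bar> \<le> e * (v - u)" by (simp add: abs_le_iff algebra_simps)
   qed (use d1 d2 in auto)
  qed
  then show ?thesis by blast
 qed
 ultimately show thesis by (rule that)
qed

text \<open>A fundamental theorem as an inequality, by telescoping over a fine tagged division.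
  Intervals with tags outside \<open>N\<close> contribute at most a Riemann sum of \<open>l\<close>;
  those with tags in \<open>N\<close> lie in an open set of small measure around \<open>N\<close>,
  where absolute continuity bounds their increments. Only upper bounds on increments enter, and for
  \<open>N = {}\<close> the local bound suffices.\<close>

lemma integral_comparison:
 fixes F l :: "real => real"
 assumes ab: "a \<le> b" and N: "negligible N" and ac: "N = {} \<or> ac_family (\<lambda>u v. F v - F u) a b"
  and good: "\<And>s ep. s \<in> {a..b} - N ==> ep > 0 ==> \<exists>dl>0. \<forall>u v. a \<le> u \<and> u \<le> s \<and> s \<le> v \<and> v \<le> b \<and> v - u < dl -->
    F v - F u \<le> (v - u) * (l s + ep)" and l: "l integrable_on {a..b}"
 shows "F b - F a \<le> integral {a..b} l"
proof (rule field_le_epsilon)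
 fix e0 :: real assume "e0 > 0"
 define e where "e = e0 / (b - a + 3)"
 have e: "e > 0" "e * (b - a + 3) = e0" using \<open>e0 > 0\<close> ab by (auto simp: e_def)
 \<comment> \<open>Setting the rate to zero on \<open>N\<close> leaves the integral unchanged and
   makes the Riemann sum ignore the tags in \<open>N\<close>.\<close>
 define l' where "l' = (\<lambda>s. if s \<in> N then 0 else l s)"
 have "(l' has_integral integral {a..b} l) {a..b}"
  by (rule has_integral_spike[OF N _ integrable_integral[OF l]]) (auto simp: l'_def)
 then obtain g where g: "gauge g" "\<And>p. p tagged_division_of {a..b} ==> g fine p ==>
   norm ((\<Sum>(x,K)\<in>p. measure lborel K *\<^sub>R l' x) - integral {a..b} l) < e"
  using e(1) unfolding has_integral_real by metis
 have "\<exists>V. open V \<and> N \<subseteq> V \<and> (\<forall>D. D \<noteq> {} --> N \<noteq> {} --> D division_of \<Union>D --> \<Union>D \<subseteq> {a..b} --> \<Union>D \<subseteq> V --> (\<Sum>K\<in>D. F (Sup K) - F (Inf K)) < e)"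
 proof (cases "N = {}")
  case False
  then obtain dl where dl: "dl > 0" "\<And>D. D division_of \<Union>D ==> \<Union>D \<subseteq> {a..b} ==> measure lebesgue (\<Union>D) < dl ==>
    (\<Sum>K\<in>D. F (Sup K) - F (Inf K)) < e" using ac_familyE[OF _ e(1)] ac by blast
  obtain V where V: "open V" "N \<subseteq> V" "V - N \<in> lmeasurable" "emeasure lebesgue (V - N) < ennreal dl"
   using sets_lebesgue_outer_open[of N dl] N dl(1) by (auto dest: negligible_imp_sets)
  have V': "V \<in> lmeasurable" using V N by (metis Diff_partition fmeasurable.Un negligible_imp_measurable)
  have "measure lebesgue V = measure lebesgue (V - N)"
   using measure_Diff_null_set[of V lebesgue N] N V' by (auto simp: negligible_iff_null_sets fmeasurableD)
  then have "measure lebesgue V < dl" using V(3,4) dl(1) by (simp add: emeasure_eq_measure2 ennreal_less_iff)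
  then have "measure lebesgue (\<Union>D) < dl" if "D division_of \<Union>D" "\<Union>D \<subseteq> V" for D
   using measure_mono_fmeasurable[OF that(2) fmeasurableD[OF division_measure(2)[OF that(1)]] V'] by linarith
  then show ?thesis using V dl(2) by (intro exI[of _ V]) blast
 qed auto
 then obtain V where V: "open V" "N \<subseteq> V" "\<And>D. D \<noteq> {} ==> N \<noteq> {} ==> D division_of \<Union>D ==> \<Union>D \<subseteq> {a..b} ==> \<Union>D \<subseteq> V ==> (\<Sum>K\<in>D. F (Sup K) - F (Inf K)) < e"
  by blast
 have "\<exists>dl>0. \<forall>u v. a \<le> u \<and> u \<le> s \<and> s \<le> v \<and> v \<le> b \<and> v - u < dl -->
    F v - F u \<le> (v - u) * (l s + e)" if "s \<in> {a..b} - N" for s using good that e(1) by blast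
 then obtain dl where dl: "\<And>s. s \<in> {a..b} - N ==> dl s > 0" "\<And>s u v. s \<in> {a..b} - N ==> a \<le> u ==> u \<le> s ==> s \<le> v ==> v \<le> b ==> v - u < dl s ==>
    F v - F u \<le> (v - u) * (l s + e)" by metis
 define g2 where "g2 s = (if s \<in> N then V else if s \<in> {a..b} then ball s (dl s / 2) else UNIV)" for s
 have "gauge g2" using V dl(1) by (auto simp: gauge_def g2_def)
 then have "gauge (\<lambda>s. g s \<inter> g2 s)" using g(1) by (simp add: gauge_def open_Int)
 then obtain p where p: "p tagged_division_of {a..b}" "(\<lambda>s. g s \<inter> g2 s) fine p"
  by (rule fine_division_exists_real)
 have gp: "g fine p" "g2 fine p" using p(2) by (auto simp: fine_def)
 let ?d = "\<lambda>K. F (Sup K) - F (Inf K)"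
 have finp: "finite p" using p(1) by (rule tagged_division_of_finite)
 have pK: "\<exists>u v. K = {u..v} \<and> u \<le> x \<and> x \<le> v \<and> a \<le> u \<and> v \<le> b \<and> x \<in> {a..b}" if xK: "(x,K) \<in> p" for x K
 proof -
  have "x \<in> K" "K \<subseteq> {a..b}" using tagged_division_ofD(2,3)[OF p(1) xK] by auto
  moreover obtain u v where "K = {u..v}" using tagged_division_ofD(4)[OF p(1) xK] by auto
  ultimately show ?thesis by auto
 qed
 define pb where "pb = {(x,K)\<in>p. x \<in> N}"
 define pg where "pg = {(x,K)\<in>p. x \<notin> N}"
 have split: "p = pg \<union> pb" "pg \<inter> pb = {}" "finite pg" "finite pb"
  using finp by (auto simp: pb_def pg_def intro: finite_subset)
 have "pb tagged_partial_division_of {a..b}"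
  using p(1) unfolding pb_def tagged_division_of_def by (auto intro: tagged_partial_division_subset)
 then have pb: "pb tagged_division_of \<Union>(snd ` pb)" by (rule tagged_partial_division_of_Union_self)
 have bad: "(\<Sum>(x,K)\<in>pb. ?d K) \<le> e"
 proof (cases "pb = {}")
  case True then show ?thesis using e by simp
 next
  case False
  \<comment> \<open>A degenerate interval may occur with several tags. The passage from tagged
    intervals to intervals needs a summand vanishing on such intervals, which the increment does but
    not as a syntactic function of \<open>K\<close>.\<close>
  let ?d' = "\<lambda>K. if interior K = {} then 0 else ?d K"
  have d': "?d K = ?d' K" if "(x,K) \<in> pb" for x K
  proof -
   have "(x,K) \<in> p" using that by (simp add: pb_def)
   from pK[OF this] obtain u v where "K = {u..v}" "u \<le> v" by force
   then show ?thesis by (cases "u = v") (auto simp: interior_atLeastAtMost_real)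
  qed
  have "(\<Sum>(x,K)\<in>pb. ?d K) = (\<Sum>(x,K)\<in>pb. ?d' K)"
   by (rule sum.cong[OF refl]) (auto split: prod.splits dest: d')
  also have "\<dots> = (\<Sum>K\<in>snd ` pb. ?d' K)"
   by (rule sum.over_tagged_division_lemma[OF pb]) (simp add: interior_cbox)
  also have "\<dots> = (\<Sum>K\<in>snd ` pb. ?d K)" by (rule sum.cong[OF refl]) (use d' in force)
  also have "\<dots> < e"
  proof (rule V(3))
   show "snd ` pb division_of \<Union>(snd ` pb)" by (rule division_of_tagged_division[OF pb])
   show "\<Union>(snd ` pb) \<subseteq> {a..b}" using tagged_division_ofD(3)[OF p(1)] by (fastforce simp: pb_def)
   show "N \<noteq> {}" using False by (auto simp: pb_def)
   show "\<Union>(snd ` pb) \<subseteq> V" using gp(2) by (fastforce simp: pb_def g2_def fine_def)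
  qed (use False in auto)
  finally show ?thesis by simp
 qed
 have good': "(\<Sum>(x,K)\<in>pg. ?d K) \<le> (\<Sum>(x,K)\<in>pg. measure lborel K * (l' x + e))"
 proof (rule sum_mono, clarify)
  fix x K assume xK: "(x,K) \<in> pg"
  then obtain u v where uv: "K = {u..v}" "u \<le> x" "x \<le> v" "a \<le> u" "v \<le> b" "x \<in> {a..b}" "x \<notin> N"
   using pK unfolding pg_def by blast
  have "K \<subseteq> ball x (dl x / 2)" using gp(2) xK uv by (fastforce simp: fine_def pg_def g2_def)
  moreover have "u \<in> K" "v \<in> K" using uv by auto
  ultimately have "u \<in> ball x (dl x / 2)" "v \<in> ball x (dl x / 2)" by auto
  then have "\<bar>x - u\<bar> < dl x / 2" "\<bar>x - v\<bar> < dl x / 2" by (auto simp: dist_real_def)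
  then have "v - u < dl x" by linarith
  then have "F v - F u \<le> (v - u) * (l x + e)" using dl(2) uv by auto
  then show "?d K \<le> measure lborel K * (l' x + e)" using uv by (simp add: l'_def)
 qed
 have "F b - F a = (\<Sum>(x,K)\<in>p. ?d K)" using additive_tagged_division_1[OF ab p(1), of F] by simp
 also have "\<dots> = (\<Sum>(x,K)\<in>pg. ?d K) + (\<Sum>(x,K)\<in>pb. ?d K)" using sum.union_disjoint[OF split(3,4,2), of "\<lambda>(x,K). ?d K"] split(1) by simp
 also have "\<dots> \<le> (\<Sum>(x,K)\<in>pg. measure lborel K * (l' x + e)) + e" using good' bad by linarith
 also have "(\<Sum>(x,K)\<in>pg. measure lborel K * (l' x + e)) = (\<Sum>(x,K)\<in>pg. measure lborel K *\<^sub>R l' x) + e * (\<Sum>(x,K)\<in>pg. measure lborel K)"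
  by (simp add: sum_distrib_left sum.distrib[symmetric] algebra_simps split_beta)
 also have "(\<Sum>(x,K)\<in>pg. measure lborel K) \<le> (\<Sum>(x,K)\<in>p. measure lborel K)"
  by (rule sum_mono2) (use finp in \<open>auto simp: pg_def\<close>)
 also have "\<dots> = b - a" using additive_content_tagged_division[of p a b] p(1) ab by simp
 also have "(\<Sum>(x,K)\<in>pg. measure lborel K *\<^sub>R l' x) = (\<Sum>(x,K)\<in>p. measure lborel K *\<^sub>R l' x)"
  by (rule sum.mono_neutral_left) (use finp in \<open>auto simp: pg_def l'_def\<close>)
 also have "\<dots> \<le> integral {a..b} l + e" using g(2)[OF p(1) gp(1)] by (simp add: abs_less_iff)
 finally show "F b - F a \<le> integral {a..b} l + e0" using e by (simp add: algebra_simps)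
qed

text \<open>A set of small total length consists of intervals that are individually short, so a
  comparison valid only on short intervals is enough. This transfers absolute continuity from the
  distance to coordinates, which make sense only while the curve stays in the chart.\<close>

lemma ac_family_mono:
 assumes ac: "ac_family \<Phi> a b" and C: "C \<ge> 0" and d0: "d0 > 0"
  and le: "\<And>u v. a \<le> u ==> u \<le> v ==> v \<le> b ==> v - u < d0 ==> \<Psi> u v \<le> C * \<Phi> u v + C * (v - u)"
 shows "ac_family \<Psi> a b" unfolding ac_family_def
proof (intro allI impI)
 fix ep :: real assume "ep > 0"
 define e where "e = ep / (2 * (C + 1))"
 have e: "e > 0" "C * e < ep / 2" using \<open>ep > 0\<close> C by (auto simp: e_def field_simps)
 obtain d where d: "d > 0" "\<And>D. D division_of \<Union>D ==> \<Union>D \<subseteq> {a..b} ==> measure lebesgue (\<Union>D) < d ==>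
   (\<Sum>K\<in>D. \<Phi> (Inf K) (Sup K)) < e" using ac_familyE[OF ac e(1)] by blast
 show "\<exists>d>0. \<forall>D. D division_of \<Union>D \<and> \<Union>D \<subseteq> {a..b} \<and> (\<Sum>K\<in>D. measure lborel K) < d -->
      (\<Sum>K\<in>D. \<Psi> (Inf K) (Sup K)) < ep"
 proof (intro exI[of _ "min d (min d0 e)"] conjI allI impI)
  fix D assume "D division_of \<Union>D \<and> \<Union>D \<subseteq> {a..b} \<and> (\<Sum>K\<in>D. measure lborel K) < min d (min d0 e)"
  then have D: "D division_of \<Union>D" "\<Union>D \<subseteq> {a..b}" and m: "(\<Sum>K\<in>D. measure lborel K) < min d (min d0 e)" by auto
  have fin: "finite D" using D(1) by (rule division_of_finite)
  have "(\<Sum>K\<in>D. \<Psi> (Inf K) (Sup K)) \<le> (\<Sum>K\<in>D. C * \<Phi> (Inf K) (Sup K) + C * measure lborel K)"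
  proof (rule sum_mono)
   fix K assume K: "K \<in> D"
   obtain u v where uv: "K = {u..v}" using division_ofD(4)[OF D(1) K] by auto
   have ne: "u \<le> v" using division_ofD(3)[OF D(1) K] uv by auto
   have "K \<subseteq> {a..b}" using K D(2) by auto
   then have ab: "a \<le> u" "v \<le> b" using uv ne by auto
   have "measure lborel K \<le> (\<Sum>K\<in>D. measure lborel K)"
    using member_le_sum[of K D "measure lborel"] K fin by auto
   then have "v - u < d0" using m uv ne by simp
   from le[OF ab(1) ne ab(2) this] show "\<Psi> (Inf K) (Sup K) \<le> C * \<Phi> (Inf K) (Sup K) + C * measure lborel K"
    using uv ne by simp
  qed
  also have "\<dots> = C * (\<Sum>K\<in>D. \<Phi> (Inf K) (Sup K)) + C * (\<Sum>K\<in>D. measure lborel K)"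
   by (simp add: sum.distrib sum_distrib_left)
  also have "\<dots> \<le> C * e + C * e"
   using d(2)[OF D] m division_measure(1)[OF D(1)] C by (intro add_mono mult_left_mono) auto
  also have "\<dots> < ep" using e by simp
  finally show "(\<Sum>K\<in>D. \<Psi> (Inf K) (Sup K)) < ep" .
 qed (use d d0 e in auto)
qed

lemma ac_family_lipschitz:
 assumes "\<And>u v. a \<le> u ==> u \<le> v ==> v \<le> b ==> \<Psi> u v \<le> B * (v - u)"
 shows "ac_family \<Psi> a b"
proof (rule ac_family_mono[of "\<lambda>_ _. 0" a b "\<bar>B\<bar>" 1])
 show "ac_family (\<lambda>_ _. 0) a b" by (auto simp: ac_family_def intro: exI[of _ 1])
 fix u v :: real assume *: "a \<le> u" "u \<le> v" "v \<le> b"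
 have "B * (v - u) \<le> \<bar>B\<bar> * (v - u)" using * by (intro mult_right_mono) auto
 then show "\<Psi> u v \<le> \<bar>B\<bar> * 0 + \<bar>B\<bar> * (v - u)" using assms[OF *] by linarith
qed auto

section \<open>Absolutely continuous and Lipschitz curves in Euclidean space\<close>

lemma ac_curve_differentiable_ae:
 fixes f :: "real => 'e::euclidean_space"
 assumes ac: "ac_family (\<lambda>u v. norm (f v - f u)) a b"
 obtains N where "negligible N" "\<And>s. s \<in> {a<..<b} - N ==> \<exists>D. (f has_vector_derivative D) (at s)"
proof -
 have comp: "ac_family (\<lambda>u v. \<bar>f v \<bullet> i - f u \<bullet> i\<bar>) a b" if "i \<in> Basis" for i
 proof (rule ac_family_mono[OF ac, of 1 1])
  fix u v :: real assume "u \<le> v"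
  have "\<bar>(f v - f u) \<bullet> i\<bar> \<le> norm (f v - f u)" by (rule Basis_le_norm[OF that])
  then show "\<bar>f v \<bullet> i - f u \<bullet> i\<bar> \<le> 1 * norm (f v - f u) + 1 * (v - u)"
   using \<open>u \<le> v\<close> by (simp add: inner_diff_left)
 qed auto
 have "\<forall>i\<in>Basis. \<exists>N. negligible N \<and> (\<forall>s\<in>{a<..<b} - N. \<exists>D. straddle_derivative (\<lambda>t. f t \<bullet> i) D s)"
 proof
  fix i :: 'e assume "i \<in> Basis"
  obtain N where "negligible N" "\<And>s. s \<in> {a<..<b} - N ==> \<exists>D. straddle_derivative (\<lambda>t. f t \<bullet> i) D s"
   using ac_differentiable_ae[OF comp[OF \<open>i \<in> Basis\<close>]] by blast
  then show "\<exists>N. negligible N \<and> (\<forall>s\<in>{a<..<b} - N. \<exists>D. straddle_derivative (\<lambda>t. f t \<bullet> i) D s)" by blast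
 qed
 from bchoice[OF this] obtain N where N: "\<And>i. i \<in> Basis ==> negligible (N i)"
  "\<And>i s. i \<in> Basis ==> s \<in> {a<..<b} - N i ==> \<exists>D. straddle_derivative (\<lambda>t. f t \<bullet> i) D s" by blast
 show thesis
 proof (rule that[of "\<Union>i\<in>Basis. N i"])
  show "negligible (\<Union>i\<in>Basis. N i)" using N(1) by (intro negligible_Union) auto
  fix s assume s: "s \<in> {a<..<b} - (\<Union>i\<in>Basis. N i)"
  then have "\<forall>i\<in>Basis. \<exists>D. straddle_derivative (\<lambda>t. f t \<bullet> i) D s" using N(2) by blast
  from bchoice[OF this] obtain D where D: "\<And>i. i \<in> Basis ==> straddle_derivative (\<lambda>t. f t \<bullet> i) (D i) s" by blast
  have "(f has_vector_derivative (\<Sum>i\<in>Basis. D i *\<^sub>R i)) (at s)" unfolding has_vector_derivative_def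
  proof (subst has_derivative_componentwise_within, intro ballI)
   fix i :: 'e assume i: "i \<in> Basis"
   have "((\<lambda>t. f t \<bullet> i) has_real_derivative D i) (at s)" by (rule straddle_derivative_real[OF D[OF i]])
   then show "((\<lambda>t. f t \<bullet> i) has_derivative (\<lambda>x. (x *\<^sub>R (\<Sum>i\<in>Basis. D i *\<^sub>R i)) \<bullet> i)) (at s)"
    using i by (simp add: has_field_derivative_def mult.commute[of _ "D i"])
  qed
  then show "\<exists>D. (f has_vector_derivative D) (at s)" by blast
 qed
qed

lemma vector_derivative_straddle:
 fixes f :: "real => 'e::real_normed_vector"
 assumes "(f has_vector_derivative D) (at s within I)" "e > 0"
 obtains d where "d > 0" "\<And>u v. u \<in> I ==> v \<in> I ==> u \<le> s ==> s \<le> v ==> v - u < d ==>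
   norm (f v - f u - (v - u) *\<^sub>R D) \<le> e * (v - u)"
proof -
 obtain d where d: "d > 0" "\<And>y. y \<in> I ==> norm (y - s) < d ==> norm (f y - f s - (y - s) *\<^sub>R D) \<le> e * norm (y - s)"
  using assms unfolding has_vector_derivative_def has_derivative_within_alt by blast
 show thesis
 proof (rule that[OF d(1)])
  fix u v assume uv: "u \<in> I" "v \<in> I" "u \<le> s" "s \<le> v" "v - u < d"
  have eq: "f v - f u - (v - u) *\<^sub>R D = (f v - f s - (v - s) *\<^sub>R D) - (f u - f s - (u - s) *\<^sub>R D)"
   by (simp add: algebra_simps)
  have "norm (f v - f s - (v - s) *\<^sub>R D) \<le> e * (v - s)" using d(2)[of v] uv by simp
  moreover have "norm (f u - f s - (u - s) *\<^sub>R D) \<le> e * (s - u)" using d(2)[of u] uv by simp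
  ultimately show "norm (f v - f u - (v - u) *\<^sub>R D) \<le> e * (v - u)"
   unfolding eq by (intro order_trans[OF norm_triangle_ineq4]) (simp add: algebra_simps)
 qed
qed

text \<open>Off a null set the derivative is a limit of continuous difference quotients, hence
  measurable, and the Lipschitz constant bounds it. The integral formula is
  \<open>integral_comparison\<close> applied to each component and to its negative.\<close>

lemma lipschitz_curve_integral:
 fixes F f :: "real => 'e::euclidean_space"
 assumes ab: "a \<le> b" and N: "negligible N"
  and lip: "\<And>s t. s \<in> {a..b} ==> t \<in> {a..b} ==> norm (F t - F s) \<le> B * \<bar>t - s\<bar>"
  and der: "\<And>t. t \<in> {a<..<b} - N ==> (F has_vector_derivative f t) (at t)"
 shows "f \<in> borel_measurable (lebesgue_on {a..b})"
  and "\<And>t. t \<in> {a<..<b} - N ==> norm (f t) \<le> B"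
  and "\<And>c d. a \<le> c ==> c \<le> d ==> d \<le> b ==> (f has_integral F d - F c) {c..d}"
proof -
 show bd: "norm (f t) \<le> B" if t: "t \<in> {a<..<b} - N" for t
 proof (rule field_le_epsilon)
  fix e :: real assume "e > 0"
  obtain dl where dl: "dl > 0" "\<And>u v. u \<in> UNIV ==> v \<in> UNIV ==> u \<le> t ==> t \<le> v ==> v - u < dl ==>
    norm (F v - F u - (v - u) *\<^sub>R f t) \<le> e * (v - u)"
   using vector_derivative_straddle[OF der[OF t] \<open>e > 0\<close>] by blast
  define v where "v = t + min (dl/2) (b - t)"
  have v: "t < v" "v - t < dl" "v \<in> {a..b}" using dl(1) t by (auto simp: v_def min_def)
  have "norm ((v - t) *\<^sub>R f t) \<le> norm (F v - F t) + norm (F v - F t - (v - t) *\<^sub>R f t)"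
   using norm_triangle_ineq4[of "F v - F t" "F v - F t - (v - t) *\<^sub>R f t"] by simp
  also have "\<dots> \<le> B * (v - t) + e * (v - t)" using lip[of t v] dl(2)[of t v] v t by (intro add_mono) auto
  finally have "norm ((v - t) *\<^sub>R f t) \<le> (v - t) * (B + e)" by (simp add: distrib_left mult.commute)
  moreover have "norm ((v - t) *\<^sub>R f t) = (v - t) * norm (f t)" using v by simp
  ultimately have "(v - t) * norm (f t) \<le> (v - t) * (B + e)" by linarith
  then show "norm (f t) \<le> B + e" using v by (simp add: mult_le_cancel_left)
 qed
 define S where "S = {a<..<b} - N"
 have Sm: "S \<in> sets lebesgue" using negligible_imp_sets[OF N] by (auto simp: S_def)
 \<comment> \<open>Constant extension beyond \<open>a\<close> and \<open>b\<close>, so that the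
   difference quotients are continuous functions on the whole line.\<close>
 define G where "G t = F (max a (min b t))" for t
 have contG: "continuous_on UNIV G"
 proof -
  have "continuous_on {a..b} F"
  proof (rule continuous_onI)
   fix x e :: real assume "x \<in> {a..b}" "e > 0"
   then show "\<exists>d>0. \<forall>x'\<in>{a..b}. dist x' x < d --> dist (F x') (F x) \<le> e"
   proof (intro exI[of _ "e / (\<bar>B\<bar> + 1)"] conjI ballI impI)
    fix x' assume x': "x' \<in> {a..b}" "dist x' x < e / (\<bar>B\<bar> + 1)"
    have "norm (F x' - F x) \<le> B * \<bar>x' - x\<bar>" using lip \<open>x \<in> {a..b}\<close> x' by blast
    also have "\<dots> \<le> (\<bar>B\<bar> + 1) * \<bar>x' - x\<bar>" by (intro mult_right_mono) auto
    also have "\<dots> \<le> e" using x'(2) by (simp add: dist_real_def field_simps)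
    finally show "dist (F x') (F x) \<le> e" by (simp add: dist_norm)
   qed simp
  qed
  then show ?thesis unfolding G_def
   by (rule continuous_on_compose2) (use ab in \<open>auto intro!: continuous_intros\<close>)
 qed
 define h where "h t = (if t \<in> S then f t else 0)" for t
 have "h \<in> borel_measurable lebesgue"
 proof (rule borel_measurable_LIMSEQ_metric)
  fix n :: nat
  have "continuous_on UNIV (\<lambda>t. real (Suc n) *\<^sub>R (G (t + 1 / real (Suc n)) - G t))"
   by (intro continuous_intros continuous_on_compose2[OF contG]) auto
  then have "(\<lambda>t. real (Suc n) *\<^sub>R (G (t + 1 / real (Suc n)) - G t)) \<in> borel_measurable lebesgue"
   by (intro measurable_completion) (simp add: borel_measurable_continuous_onI)
  then show "(\<lambda>t. if t \<in> S then real (Suc n) *\<^sub>R (G (t + 1 / real (Suc n)) - G t) else 0) \<in> borel_measurable lebesgue"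
   by (intro measurable_If_set) (use Sm in auto)
 next
  fix t :: real
  show "(\<lambda>n. if t \<in> S then real (Suc n) *\<^sub>R (G (t + 1 / real (Suc n)) - G t) else 0) \<longlonglongrightarrow> h t"
  proof (cases "t \<in> S")
   case True
   have "(\<lambda>n. real (Suc n) *\<^sub>R (G (t + 1 / real (Suc n)) - G t)) \<longlonglongrightarrow> f t"
    unfolding LIMSEQ_iff
   proof (intro allI impI)
    fix e :: real assume "e > 0"
    obtain dl where dl: "dl > 0" "\<And>u v. u \<in> UNIV ==> v \<in> UNIV ==> u \<le> t ==> t \<le> v ==> v - u < dl ==>
      norm (F v - F u - (v - u) *\<^sub>R f t) \<le> e / 2 * (v - u)"
     using vector_derivative_straddle[of F "f t" t UNIV "e/2"] der True \<open>e > 0\<close> unfolding S_def by auto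
    have tab: "a < t" "t < b" using True by (auto simp: S_def)
    obtain m where m: "1 / real (Suc m) < min dl (b - t)" using nat_approx_posE[of "min dl (b - t)"] dl(1) tab by auto
    show "\<exists>no. \<forall>n\<ge>no. norm (real (Suc n) *\<^sub>R (G (t + 1 / real (Suc n)) - G t) - f t) < e"
    proof (intro exI[of _ m] allI impI)
     fix n assume "m \<le> n"
     define r where "r = 1 / real (Suc n)"
     have r: "r > 0" "real (Suc n) = 1 / r" by (auto simp: r_def)
     have "r \<le> 1 / real (Suc m)" unfolding r_def using \<open>m \<le> n\<close> by (intro divide_left_mono) auto
     then have r2: "r < dl" "t + r < b" using m by auto
     have Geq: "G (t + r) = F (t + r)" "G t = F t" using r r2 tab by (auto simp: G_def)
     have "norm (F (t + r) - F t - r *\<^sub>R f t) \<le> e / 2 * r" using dl(2)[of t "t + r"] r r2 by simp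
     moreover have eq: "real (Suc n) *\<^sub>R (G (t + r) - G t) - f t = (1 / r) *\<^sub>R (F (t + r) - F t - r *\<^sub>R f t)"
      using r(1) unfolding Geq r(2) by (simp add: scaleR_diff_right)
     moreover have "norm ((1 / r) *\<^sub>R X) \<le> e / 2" if "norm X \<le> e / 2 * r" for X :: 'e
      using r(1) that by (simp add: field_simps)
     ultimately have "norm (real (Suc n) *\<^sub>R (G (t + r) - G t) - f t) \<le> e / 2" unfolding eq by blast
     then show "norm (real (Suc n) *\<^sub>R (G (t + 1 / real (Suc n)) - G t) - f t) < e"
      using \<open>e > 0\<close> unfolding r_def by linarith
    qed
   qed
   then show ?thesis using True by (simp add: h_def)
  qed (simp add: h_def)
 qed
 moreover have "AE t in lebesgue. h t = (if t \<in> {a..b} then f t else 0)"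
 proof -
  have "negligible (N \<union> {a, b})" using N by auto
  then have "AE t in lebesgue. t \<notin> N \<union> {a, b}" unfolding negligible_iff_null_sets by (rule AE_not_in)
  then show ?thesis by eventually_elim (auto simp: h_def S_def)
 qed
 ultimately have "(\<lambda>t. if t \<in> {a..b} then f t else 0) \<in> borel_measurable lebesgue" by (rule borel_measurable_AE)
 moreover have "(\<lambda>t. indicat_real {a..b} t *\<^sub>R f t) = (\<lambda>t. if t \<in> {a..b} then f t else 0)"
  by (auto simp: fun_eq_iff indicator_def)
 ultimately show fm: "f \<in> borel_measurable (lebesgue_on {a..b})"
  by (subst borel_measurable_restrict_space_iff) simp_all
 fix c d assume cd: "a \<le> c" "c \<le> d" "d \<le> b"
 have hm: "h \<in> borel_measurable (lebesgue_on {c..d})"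
  using \<open>h \<in> borel_measurable lebesgue\<close> by (rule measurable_restrict_space1)
 have hint: "h absolutely_integrable_on {c..d}"
 proof (rule measurable_bounded_by_integrable_imp_absolutely_integrable[OF hm, where g="\<lambda>_. \<bar>B\<bar>"])
  show "norm (h t) \<le> \<bar>B\<bar>" for t using bd[of t] by (auto simp: h_def S_def)
 qed auto
 then have hI: "h integrable_on {c..d}" by (simp add: absolutely_integrable_on_def)
 have cmp: "F d \<bullet> i - F c \<bullet> i \<le> integral {c..d} (\<lambda>t. h t \<bullet> i)" for i
 proof (rule integral_comparison[OF cd(2), where N="N \<union> {a,b}"])
  show "negligible (N \<union> {a,b})" using N by auto
  show "N \<union> {a, b} = {} \<or> ac_family (\<lambda>u v. F v \<bullet> i - F u \<bullet> i) c d"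
  proof (intro disjI2 ac_family_lipschitz[where B="B * norm i"])
   fix u v :: real assume uv: "c \<le> u" "u \<le> v" "v \<le> d"
   have "(F v - F u) \<bullet> i \<le> norm (F v - F u) * norm i" by (rule norm_cauchy_schwarz)
   also have "\<dots> \<le> (B * (v - u)) * norm i" using lip[of u v] uv cd by (intro mult_right_mono) auto
   finally show "F v \<bullet> i - F u \<bullet> i \<le> B * norm i * (v - u)" by (simp add: algebra_simps)
  qed
  show "(\<lambda>t. h t \<bullet> i) integrable_on {c..d}" using integrable_linear[OF hI bounded_linear_inner_left[of i]] by (simp add: o_def)
  fix s ep :: real assume s: "s \<in> {c..d} - (N \<union> {a,b})" and "ep > 0"
  have sS: "s \<in> S" using s cd by (auto simp: S_def)
  define e where "e = ep / (norm i + 1)"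
  have e: "e > 0" "e * norm i \<le> ep" using \<open>ep > 0\<close> by (auto simp: e_def field_simps add_pos_nonneg)
  obtain dl where dl: "dl > 0" "\<And>u v. u \<in> UNIV ==> v \<in> UNIV ==> u \<le> s ==> s \<le> v ==> v - u < dl ==>
    norm (F v - F u - (v - u) *\<^sub>R f s) \<le> e * (v - u)"
   using vector_derivative_straddle[of F "f s" s UNIV e] der sS e unfolding S_def by auto
  show "\<exists>dl>0. \<forall>u v. c \<le> u \<and> u \<le> s \<and> s \<le> v \<and> v \<le> d \<and> v - u < dl --> F v \<bullet> i - F u \<bullet> i \<le> (v - u) * (h s \<bullet> i + ep)"
  proof (intro exI[of _ dl] conjI allI impI dl(1))
   fix u v assume uv: "c \<le> u \<and> u \<le> s \<and> s \<le> v \<and> v \<le> d \<and> v - u < dl"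
   have "(F v - F u - (v - u) *\<^sub>R f s) \<bullet> i \<le> norm (F v - F u - (v - u) *\<^sub>R f s) * norm i"
    by (rule norm_cauchy_schwarz)
   also have "\<dots> \<le> (e * (v - u)) * norm i" using dl(2)[of u v] uv by (intro mult_right_mono) auto
   also have "\<dots> = (v - u) * (e * norm i)" by simp
   also have "\<dots> \<le> (v - u) * ep" using e uv by (intro mult_left_mono) auto
   finally show "F v \<bullet> i - F u \<bullet> i \<le> (v - u) * (h s \<bullet> i + ep)"
    using sS by (simp add: inner_diff_left h_def algebra_simps)
  qed
 qed
 have int_i: "integral {c..d} (\<lambda>t. h t \<bullet> i) = integral {c..d} h \<bullet> i" for i
  using integral_linear[OF hI bounded_linear_inner_left[of i]] by (simp add: o_def)
 have "integral {c..d} h = F d - F c"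
 proof (rule euclidean_eqI)
  fix i :: 'e assume "i \<in> Basis"
  \<comment> \<open>The one-sided comparison in the directions \<open>i\<close> and
    \<open>- i\<close> gives both inequalities.\<close>
  show "integral {c..d} h \<bullet> i = (F d - F c) \<bullet> i"
   using cmp[of i] cmp[of "- i"] unfolding int_i by (simp add: inner_diff_left)
 qed
 then have "(h has_integral F d - F c) {c..d}" using integrable_integral[OF hI] by simp
 then show "(f has_integral F d - F c) {c..d}"
  by (rule has_integral_spike[rotated 2, where S="N \<union> {a,b}"]) (use N cd in \<open>auto simp: h_def S_def\<close>)
qed

text \<open>Convergence on indicators extends linearly to simple functions. These are dense in the
  integrable functions, and the common bound \<open>B\<close> makes the functionals equicontinuous
  on them.\<close>

lemma weak_limit_core:
 fixes g :: "nat => real => 'e::euclidean_space" and h :: "real => 'e"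
 assumes fin: "finite_measure M" and gm: "\<And>k. g k \<in> borel_measurable M"
  and gb: "\<And>k. AE t in M. norm (g k t) \<le> B" and B: "B \<ge> 0"
  and g0: "\<And>A. A \<in> sets M ==> (\<lambda>k. \<integral>t. indicator A t *\<^sub>R g k t \<partial>M) \<longlonglongrightarrow> 0"
  and h: "integrable M h"
 shows "(\<lambda>k. \<integral>t. g k t \<bullet> h t \<partial>M) \<longlonglongrightarrow> 0"
proof -
 interpret finite_measure M by (rule fin)
 have gint: "integrable M (\<lambda>t. g k t \<bullet> f t)" if f: "integrable M f" for f and k
 proof (rule Bochner_Integration.integrable_bound)
  show "integrable M (\<lambda>t. B * norm (f t))" using f by auto
  show "(\<lambda>t. g k t \<bullet> f t) \<in> borel_measurable M" using gm f by (auto intro!: borel_measurable_inner)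
  show "AE t in M. norm (g k t \<bullet> f t) \<le> norm (B * norm (f t))" using gb[of k]
  proof eventually_elim
   case (elim t)
   have "\<bar>g k t \<bullet> f t\<bar> \<le> norm (g k t) * norm (f t)" by (rule Cauchy_Schwarz_ineq2)
   also have "\<dots> \<le> B * norm (f t)" using elim by (intro mult_right_mono) auto
   finally show ?case using B by simp
  qed
 qed
 have bound: "\<bar>\<integral>t. g k t \<bullet> f t \<partial>M\<bar> \<le> B * (\<integral>t. norm (f t) \<partial>M)" if f: "integrable M f" for f k
 proof -
  have "\<bar>\<integral>t. g k t \<bullet> f t \<partial>M\<bar> \<le> (\<integral>t. \<bar>g k t \<bullet> f t\<bar> \<partial>M)" by (rule integral_abs_bound)
  also have "\<dots> \<le> (\<integral>t. B * norm (f t) \<partial>M)"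
  proof (rule integral_mono_AE)
   show "integrable M (\<lambda>t. \<bar>g k t \<bullet> f t\<bar>)" using gint[OF f] by (rule integrable_abs)
   show "integrable M (\<lambda>t. B * norm (f t))" using f by auto
   show "AE t in M. \<bar>g k t \<bullet> f t\<bar> \<le> B * norm (f t)" using gb[of k]
   proof eventually_elim
    case (elim t)
    have "\<bar>g k t \<bullet> f t\<bar> \<le> norm (g k t) * norm (f t)" by (rule Cauchy_Schwarz_ineq2)
    also have "\<dots> \<le> B * norm (f t)" using elim by (intro mult_right_mono) auto
    finally show ?case .
   qed
  qed
  finally show ?thesis by simp
 qed
 show ?thesis using h
 proof (induction h rule: integrable_induct)
  case (base A c)
  have gi: "integrable M (\<lambda>t. indicator A t *\<^sub>R g k t)" for k
  proof (rule Bochner_Integration.integrable_bound)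
   show "integrable M (\<lambda>t. B)" by simp
   show "(\<lambda>t. indicator A t *\<^sub>R g k t) \<in> borel_measurable M" using gm base by measurable
   show "AE t in M. norm (indicator A t *\<^sub>R g k t) \<le> norm B"
    using gb[of k] by eventually_elim (use B in \<open>auto simp: indicator_def\<close>)
  qed
  have "(\<integral>t. g k t \<bullet> (indicator A t *\<^sub>R c) \<partial>M) = (\<integral>t. indicator A t *\<^sub>R g k t \<partial>M) \<bullet> c" for k
   using integral_inner_left[of c M "\<lambda>t. indicator A t *\<^sub>R g k t"] gi by simp
  moreover have "(\<lambda>k. (\<integral>t. indicator A t *\<^sub>R g k t \<partial>M) \<bullet> c) \<longlonglongrightarrow> 0 \<bullet> c"
   by (intro tendsto_inner g0[OF base(1)] tendsto_const)
  ultimately show ?case by simp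
 next
  case (add f1 f2)
  have "(\<integral>t. g k t \<bullet> (f1 t + f2 t) \<partial>M) = (\<integral>t. g k t \<bullet> f1 t \<partial>M) + (\<integral>t. g k t \<bullet> f2 t \<partial>M)" for k
   using gint add(1,2) by (simp add: inner_add_right)
  then show ?case using tendsto_add[OF add(3,4)] by simp
 next
  case (lim f s)
  show ?case
  proof (rule LIMSEQ_I)
   fix r :: real assume "r > 0"
   have "(\<lambda>i. \<integral>t. norm (f t - s i t) \<partial>M) \<longlonglongrightarrow> (\<integral>t. 0 \<partial>M)"
   proof (rule integral_dominated_convergence[where w="\<lambda>t. 3 * norm (f t)"])
    show "(\<lambda>t. norm (f t - s i t)) \<in> borel_measurable M" for i
     using borel_measurable_integrable[OF lim(1)[of i]] borel_measurable_integrable[OF lim(4)] by measurable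
    show "AE t in M. (\<lambda>i. norm (f t - s i t)) \<longlonglongrightarrow> 0"
    proof (rule AE_I2)
     fix t assume "t \<in> space M"
     from tendsto_norm_zero[OF LIM_zero[OF lim(2)[OF this]]]
     show "(\<lambda>i. norm (f t - s i t)) \<longlonglongrightarrow> 0" by (simp add: norm_minus_commute)
    qed
    show "AE t in M. norm (norm (f t - s i t)) \<le> 3 * norm (f t)" for i
    proof (rule AE_I2)
     fix t assume "t \<in> space M"
     then have "norm (s i t) \<le> 2 * norm (f t)" by (rule lim(3))
     then show "norm (norm (f t - s i t)) \<le> 3 * norm (f t)" using norm_triangle_ineq4[of "f t" "s i t"] by simp
    qed
   qed (use lim(4) in auto)
   then have "(\<lambda>i. \<integral>t. norm (f t - s i t) \<partial>M) \<longlonglongrightarrow> 0" by simp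
   from LIMSEQ_D[OF this, of "r / (2 * (B + 1))"] obtain i where i: "(\<integral>t. norm (f t - s i t) \<partial>M) < r / (2 * (B + 1))"
    using \<open>r > 0\<close> B by (force simp: abs_less_iff)
   have fs: "integrable M (\<lambda>t. f t - s i t)" using lim(1)[of i] lim(4) by auto
   have b: "B * (\<integral>t. norm (f t - s i t) \<partial>M) \<le> r / 2"
   proof -
    have "B * (\<integral>t. norm (f t - s i t) \<partial>M) \<le> (B + 1) * (\<integral>t. norm (f t - s i t) \<partial>M)"
     by (intro mult_right_mono integral_nonneg_AE) auto
    also have "\<dots> \<le> (B + 1) * (r / (2 * (B + 1)))" using i B by (intro mult_left_mono) auto
    also have "\<dots> = r / 2"
    proof -
     have "c * (r / (2 * c)) = r / 2" if "c > 0" for c :: real using that by simp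
     from this[of "B + 1"] show ?thesis using B by simp
    qed
    finally show ?thesis .
   qed
   from LIMSEQ_D[OF lim(5)[of i], of "r/2"] obtain n where n: "\<And>k. k \<ge> n ==> \<bar>\<integral>t. g k t \<bullet> s i t \<partial>M\<bar> < r / 2"
    using \<open>r > 0\<close> by auto
   show "\<exists>no. \<forall>k\<ge>no. norm ((\<integral>t. g k t \<bullet> f t \<partial>M) - 0) < r"
   proof (intro exI[of _ n] allI impI)
    fix k assume "n \<le> k"
    have "(\<integral>t. g k t \<bullet> f t \<partial>M) = (\<integral>t. g k t \<bullet> (f t - s i t) \<partial>M) + (\<integral>t. g k t \<bullet> s i t \<partial>M)"
     using gint[OF fs, of k] gint[OF lim(1)[of i], of k]
     by (subst Bochner_Integration.integral_add[symmetric]) (auto simp: inner_diff_right)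
    moreover have "\<bar>\<integral>t. g k t \<bullet> (f t - s i t) \<partial>M\<bar> \<le> r / 2" using bound[OF fs, of k] b by linarith
    ultimately have "\<bar>\<integral>t. g k t \<bullet> f t \<partial>M\<bar> < r" using n[OF \<open>n \<le> k\<close>] by linarith
    then show "norm ((\<integral>t. g k t \<bullet> f t \<partial>M) - 0) < r" by simp
   qed
  qed
 qed
qed

text \<open>Integrated over an initial interval, the derivatives give increments of the curves,
  which converge pointwise. The sets for which the integrals converge form a Dynkin system because
  of the common Lipschitz bound, so they include all Borel sets and, up to null sets, all Lebesgue
  sets; \<open>weak_limit_core\<close> concludes.\<close>

lemma weak_star_of_derivatives:
 fixes F :: "nat => real => 'e::euclidean_space" and f :: "nat => real => 'e"
 assumes ab: "a \<le> b" and N: "\<And>k. negligible (N k)" "negligible N0"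
  and lip: "\<And>k s t. s \<in> {a..b} ==> t \<in> {a..b} ==> norm (F k t - F k s) \<le> B * \<bar>t - s\<bar>"
  and der: "\<And>k t. t \<in> {a<..<b} - N k ==> (F k has_vector_derivative f k t) (at t)"
  and lip0: "\<And>s t. s \<in> {a..b} ==> t \<in> {a..b} ==> norm (F0 t - F0 s) \<le> B * \<bar>t - s\<bar>"
  and der0: "\<And>t. t \<in> {a<..<b} - N0 ==> (F0 has_vector_derivative f0 t) (at t)"
  and conv: "\<And>t. t \<in> {a..b} ==> (\<lambda>k. F k t) \<longlonglongrightarrow> F0 t"
  and h: "integrable (lebesgue_on {a..b}) h"
 shows "(\<lambda>k. \<integral>t. f k t \<bullet> h t \<partial>lebesgue_on {a..b}) \<longlonglongrightarrow> (\<integral>t. f0 t \<bullet> h t \<partial>lebesgue_on {a..b})"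
proof -
 define M where "M = lebesgue_on {a..b}"
 have sp: "space M = {a..b}" by (simp add: M_def)
 note I = lipschitz_curve_integral[OF ab N(1) lip der]
 note I0 = lipschitz_curve_integral[OF ab N(2) lip0 der0]
 have finM: "finite_measure M" unfolding M_def by (rule finite_measureI) (simp add: emeasure_restrict_space ab)
 interpret finite_measure M by (rule finM)
 have AEM: "AE t in M. norm (f' t) \<le> \<bar>B\<bar>" if "negligible N'" "\<And>t. t \<in> {a<..<b} - N' ==> norm (f' t) \<le> B" for f' :: "real => 'e" and N'
 proof -
  have "negligible (N' \<union> {a,b})" using that(1) by auto
  then have "AE t in lebesgue. t \<notin> N' \<union> {a,b}" unfolding negligible_iff_null_sets by (rule AE_not_in)
  then have "AE t in lebesgue. t \<in> {a..b} --> norm (f' t) \<le> \<bar>B\<bar>"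
  proof eventually_elim
   case (elim t)
   show ?case using that(2)[of t] elim by (auto simp: abs_if)
  qed
  then show ?thesis unfolding M_def by (simp add: AE_restrict_space_iff)
 qed
 have fb: "AE t in M. norm (f k t) \<le> \<bar>B\<bar>" for k by (rule AEM[OF N(1) I(2)])
 have f0b: "AE t in M. norm (f0 t) \<le> \<bar>B\<bar>" by (rule AEM[OF N(2) I0(2)])
 define g where "g k t = f k t - f0 t" for k t
 have fm: "f k \<in> borel_measurable M" "f0 \<in> borel_measurable M" for k using I(1) I0(1) by (auto simp: M_def)
 have gm: "g k \<in> borel_measurable M" for k unfolding g_def by (intro borel_measurable_diff fm)
 have gb: "AE t in M. norm (g k t) \<le> 2 * \<bar>B\<bar>" for k using fb[of k] f0b
 proof eventually_elim
  case (elim t) then show ?case using norm_triangle_ineq4[of "f k t" "f0 t"] by (simp add: g_def)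
 qed
 have gint: "integrable M (\<lambda>t. indicator A t *\<^sub>R g k t)" if "A \<in> sets M" for A k
 proof (rule Bochner_Integration.integrable_bound)
  show "integrable M (\<lambda>t. 2 * \<bar>B\<bar>)" by simp
  show "(\<lambda>t. indicator A t *\<^sub>R g k t) \<in> borel_measurable M" using gm that by measurable
  show "AE t in M. norm (indicator A t *\<^sub>R g k t) \<le> norm (2 * \<bar>B\<bar>)"
   using gb[of k] by eventually_elim (auto simp: indicator_def)
 qed
 have AbM: "A \<inter> {a..b} \<in> sets M" if "A \<in> sets borel" for A
 proof -
  have "A \<in> sets lebesgue" using that by (metis sets_completionI_sets sets_lborel)
  then show ?thesis unfolding M_def sets_restrict_space by (metis Int_commute image_eqI)
 qed
 have gintb: "integrable M (\<lambda>t. indicator A t *\<^sub>R g k t)" if A: "A \<in> sets borel" for A k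
 proof -
  have "A \<inter> {a..b} \<in> sets M" using A by (rule AbM)
  from gint[OF this, of k] show ?thesis
   by (rule Bochner_Integration.integrable_cong[THEN iffD1, rotated 2]) (use sp in \<open>auto simp: indicator_def\<close>)
 qed
 have nb: "norm (\<integral>t. indicator A t *\<^sub>R g k t \<partial>M) \<le> 2 * \<bar>B\<bar> * measure M (A \<inter> {a..b})" if A: "A \<in> sets borel" for A k
 proof -
  have AM: "A \<inter> {a..b} \<in> sets M" using A by (rule AbM)
  have "norm (\<integral>t. indicator A t *\<^sub>R g k t \<partial>M) \<le> (\<integral>t. norm (indicator A t *\<^sub>R g k t) \<partial>M)"
   by (rule integral_norm_bound)
  also have "\<dots> \<le> (\<integral>t. 2 * \<bar>B\<bar> * indicator (A \<inter> {a..b}) t \<partial>M)"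
  proof (rule integral_mono_AE)
   show "integrable M (\<lambda>t. norm (indicator A t *\<^sub>R g k t))" using gintb[OF A] by (rule integrable_norm)
   show "integrable M (\<lambda>t. 2 * \<bar>B\<bar> * indicator (A \<inter> {a..b}) t)"
    by (intro integrable_mult_right integrable_real_indicator AM) (simp add: less_top[symmetric])
   show "AE t in M. norm (indicator A t *\<^sub>R g k t) \<le> 2 * \<bar>B\<bar> * indicator (A \<inter> {a..b}) t"
    using gb[of k] AE_space by eventually_elim (use sp in \<open>auto simp: indicator_def\<close>)
  qed
  also have "\<dots> = 2 * \<bar>B\<bar> * measure M (A \<inter> {a..b})" using AM by simp
  finally show ?thesis .
 qed
 let ?I = "\<lambda>A k. \<integral>t. indicator A t *\<^sub>R g k t \<partial>M"
 let ?P = "\<lambda>A. (\<lambda>k. ?I A k) \<longlonglongrightarrow> 0"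
 have gi: "integrable M (g k)" for k using gintb[of UNIV k] by simp
 have iv: "?P {..c}" for c
 proof (cases "a \<le> c")
  case False
  have z: "(?I {..c} k) = 0" for k
  proof -
   have "(?I {..c} k) = (\<integral>t. 0 \<partial>M)"
    by (rule Bochner_Integration.integral_cong) (use False sp in \<open>auto simp: indicator_def\<close>)
   then show ?thesis by simp
  qed
  then show ?thesis unfolding z by simp
 next
  case True
  define d where "d = min c b"
  have d: "a \<le> d" "d \<le> b" using True ab by (auto simp: d_def)
  have "(?I {..c} k) = (F k d - F k a) - (F0 d - F0 a)" for k
  proof -
   have i1: "integrable M (\<lambda>t. indicator {..c} t *\<^sub>R g k t)" by (rule gintb) simp
   have "(?I {..c} k) = integral {a..b} (\<lambda>t. indicator {..c} t *\<^sub>R g k t)"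
    using i1 unfolding M_def by (intro lebesgue_integral_eq_integral) auto
   also have "\<dots> = integral {a..b} (\<lambda>t. if t \<in> {a..d} then g k t else 0)"
    by (rule integral_cong) (auto simp: indicator_def d_def)
   also have "\<dots> = integral ({a..d} \<inter> {a..b}) (g k)" by (rule integral_restrict_Int)
   also have "{a..d} \<inter> {a..b} = {a..d}" using d by auto
   also have "integral {a..d} (g k) = (F k d - F k a) - (F0 d - F0 a)"
    unfolding g_def by (intro integral_unique has_integral_diff I(3) I0(3)) (use d in auto)
   finally show ?thesis .
  qed
  moreover have "(\<lambda>k. (F k d - F k a) - (F0 d - F0 a)) \<longlonglongrightarrow> (F0 d - F0 a) - (F0 d - F0 a)"
   by (intro tendsto_intros conv) (use d ab in auto)
  ultimately show ?thesis by simp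
 qed
 have borelP: "?P A" if "A \<in> sets borel" for A
 proof -
  have A: "A \<in> sigma_sets UNIV (range (\<lambda>c::real. {..c}))"
   using that unfolding borel_eq_atMost by (simp add: sets_measure_of)
  have st: "Int_stable (range (\<lambda>c::real. {..c}))" by (auto simp: Int_stable_def)
  have sub: "range (\<lambda>c::real. {..c}) \<subseteq> Pow UNIV" by auto
  from st sub A show ?thesis
  proof (induction rule: sigma_sets_induct_disjoint)
   case (basic A) then show ?case using iv by auto
  next
   case empty show ?case by simp
  next
   case (compl A)
   have Am: "A \<in> sets borel" using compl(1) unfolding borel_eq_atMost by (simp add: sets_measure_of)
   have i1: "integrable M (\<lambda>t. indicator A t *\<^sub>R g k t)" for k by (rule gintb[OF Am])
   have "(?I (UNIV - A) k) = (?I {..b} k) - (?I A k)" for k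
   proof -
    have e: "(?I {..b} k) = (\<integral>t. g k t \<partial>M)"
     by (rule Bochner_Integration.integral_cong) (use sp in \<open>auto simp: indicator_def\<close>)
    have "(?I (UNIV - A) k) = (\<integral>t. g k t - indicator A t *\<^sub>R g k t \<partial>M)"
     by (rule Bochner_Integration.integral_cong) (auto simp: indicator_def)
    then show ?thesis unfolding e using gi[of k] i1[of k] by simp
   qed
   then show ?case using tendsto_diff[OF iv[of b] compl(2)] by simp
  next
   case (union A)
   have Am: "A i \<in> sets borel" for i using union(2) unfolding borel_eq_atMost by (auto simp: sets_measure_of)
   \<comment> \<open>Finitely many of the disjoint sets are handled by the induction hypothesis; the
     tail has small measure, and the bound \<open>2 * \<bar>B\<bar>\<close> makes its integral small
     for all \<open>k\<close> at once.\<close>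
   define U where "U n = (\<Union>i<n. A i)" for n
   have Ub: "U n \<in> sets borel" "(\<Union>i. A i) \<in> sets borel" for n using Am by (auto simp: U_def)
   have "(\<lambda>n. measure M (U n \<inter> {a..b})) \<longlonglongrightarrow> measure M (\<Union>n. U n \<inter> {a..b})"
   proof (rule finite_Lim_measure_incseq)
    show "range (\<lambda>n. U n \<inter> {a..b}) \<subseteq> sets M" using AbM[OF Ub(1)] by blast
    show "incseq (\<lambda>n. U n \<inter> {a..b})" by (force simp: incseq_def U_def)
   qed
   moreover have "(\<Union>n. U n \<inter> {a..b}) = (\<Union>i. A i) \<inter> {a..b}" by (auto simp: U_def)
   ultimately have lim: "(\<lambda>n. measure M (U n \<inter> {a..b})) \<longlonglongrightarrow> measure M ((\<Union>i. A i) \<inter> {a..b})" by simp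
   have split: "(?I (\<Union>i. A i) k) = (\<Sum>i<n. ?I (A i) k) + (?I ((\<Union>i. A i) - U n) k)" for k n
   proof -
    have ind: "(indicator (U n) t :: real) = (\<Sum>i<n. indicator (A i) t)" for t
     unfolding U_def by (rule indicator_UN_disjoint) (use union(1) in \<open>auto simp: disjoint_family_on_def\<close>)
    have "U n \<subseteq> (\<Union>i. A i)" by (auto simp: U_def)
    then have "indicator (\<Union>i. A i) t *\<^sub>R g k t = indicator (U n) t *\<^sub>R g k t + indicator ((\<Union>i. A i) - U n) t *\<^sub>R g k t" for t
     by (auto simp: indicator_def)
    then have "(?I (\<Union>i. A i) k) = (\<integral>t. (\<Sum>i<n. indicator (A i) t *\<^sub>R g k t) + indicator ((\<Union>i. A i) - U n) t *\<^sub>R g k t \<partial>M)"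
     unfolding ind by (simp add: scaleR_sum_left)
    also have "\<dots> = (\<integral>t. (\<Sum>i<n. indicator (A i) t *\<^sub>R g k t) \<partial>M) + (?I ((\<Union>i. A i) - U n) k)"
     by (intro Bochner_Integration.integral_add Bochner_Integration.integrable_sum gintb) (use Ub Am in auto)
    also have "(\<integral>t. (\<Sum>i<n. indicator (A i) t *\<^sub>R g k t) \<partial>M) = (\<Sum>i<n. ?I (A i) k)"
     by (intro Bochner_Integration.integral_sum gintb Am)
    finally show ?thesis .
   qed
   show ?case
   proof (rule LIMSEQ_I)
    fix r :: real assume "r > 0"
    define e where "e = r / (4 * \<bar>B\<bar> + 4)"
    have e: "e > 0" using \<open>r > 0\<close> by (simp add: e_def add_nonneg_pos)
    have eB: "2 * \<bar>B\<bar> * e < r / 2" using \<open>r > 0\<close> by (simp add: e_def field_simps add_nonneg_pos)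
    obtain n where n: "\<bar>measure M (U n \<inter> {a..b}) - measure M ((\<Union>i. A i) \<inter> {a..b})\<bar> < e"
     using LIMSEQ_D[OF lim e] by auto
    have "measure M (((\<Union>i. A i) - U n) \<inter> {a..b}) = measure M ((\<Union>i. A i) \<inter> {a..b}) - measure M (U n \<inter> {a..b})"
    proof -
     have eq: "((\<Union>i. A i) - U n) \<inter> {a..b} = ((\<Union>i. A i) \<inter> {a..b}) - (U n \<inter> {a..b})" by auto
     show ?thesis unfolding eq by (rule finite_measure_Diff[OF AbM[OF Ub(2)] AbM[OF Ub(1)]]) (auto simp: U_def)
    qed
    then have me: "measure M (((\<Union>i. A i) - U n) \<inter> {a..b}) \<le> e" using n by linarith
    have tail: "norm (?I ((\<Union>i. A i) - U n) k) < r / 2" for k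
    proof -
     have "norm (?I ((\<Union>i. A i) - U n) k) \<le> 2 * \<bar>B\<bar> * measure M (((\<Union>i. A i) - U n) \<inter> {a..b})"
      by (rule nb) (use Ub in auto)
     also have "\<dots> \<le> 2 * \<bar>B\<bar> * e" using me by (intro mult_left_mono) auto
     finally show ?thesis using eB by linarith
    qed
    have "(\<lambda>k. \<Sum>i<n. ?I (A i) k) \<longlonglongrightarrow> (\<Sum>i<n. 0)"
     by (rule tendsto_sum) (rule union(3))
    then have "(\<lambda>k. \<Sum>i<n. ?I (A i) k) \<longlonglongrightarrow> 0" by simp
    from LIMSEQ_D[OF this, of "r/2"] obtain k0 where k0: "\<And>k. k \<ge> k0 ==> norm (\<Sum>i<n. ?I (A i) k) < r / 2"
     using \<open>r > 0\<close> by auto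
    show "\<exists>no. \<forall>k\<ge>no. norm ((?I (\<Union>i. A i) k) - 0) < r"
    proof (intro exI[of _ k0] allI impI)
     fix k assume "k0 \<le> k"
     show "norm ((?I (\<Union>i. A i) k) - 0) < r"
      using norm_triangle_ineq[of "\<Sum>i<n. ?I (A i) k" "?I ((\<Union>i. A i) - U n) k"]
       k0[OF \<open>k0 \<le> k\<close>] tail[of k] unfolding split[of k n] by simp
    qed
   qed
  qed
 qed
 have "(\<lambda>k. \<integral>t. g k t \<bullet> h t \<partial>M) \<longlonglongrightarrow> 0"
 proof (rule weak_limit_core[OF finM gm gb])
  fix A assume A: "A \<in> sets M"
  then have "A \<in> sets lebesgue" by (auto simp: M_def sets_restrict_space)
  then obtain S N' N'' where S: "A = S \<union> N'" "N' \<subseteq> N''" "N'' \<in> null_sets lborel" "S \<in> sets lborel"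
   by (rule sets_completionE)
  have "negligible N'" using null_sets_completionI[OF S(3)] S(2) by (meson negligible_iff_null_sets negligible_subset)
  then have "AE t in lebesgue. t \<notin> N'" by (simp add: AE_not_in negligible_iff_null_sets)
  then have "AE t in M. t \<notin> N'" unfolding M_def by (subst AE_restrict_space_iff) (auto elim: eventually_mono)
  then have ae: "AE t in M. indicator A t *\<^sub>R g k t = indicator S t *\<^sub>R g k t" for k
   by eventually_elim (auto simp: S(1) indicator_def)
  have "(?I A k) = (?I S k)" for k using gint[OF A, of k] gintb[of S k] S(4) by (intro integral_cong_AE ae) auto
  then show "(\<lambda>k. ?I A k) \<longlonglongrightarrow> 0" using borelP[of S] S(4) by simp
 qed (use h in \<open>auto simp: M_def\<close>)
 moreover have "(\<integral>t. f k t \<bullet> h t \<partial>M) = (\<integral>t. g k t \<bullet> h t \<partial>M) + (\<integral>t. f0 t \<bullet> h t \<partial>M)" for k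
 proof -
  have hM: "integrable M h" using h by (simp add: M_def)
  have i: "integrable M (\<lambda>t. f' t \<bullet> h t)" if "f' \<in> borel_measurable M" "AE t in M. norm (f' t) \<le> C" for f' :: "real => 'e" and C
  proof (rule Bochner_Integration.integrable_bound)
   show "integrable M (\<lambda>t. C * norm (h t))" using hM by auto
   show "(\<lambda>t. f' t \<bullet> h t) \<in> borel_measurable M" using that(1) hM by (auto intro!: borel_measurable_inner)
   show "AE t in M. norm (f' t \<bullet> h t) \<le> norm (C * norm (h t))" using that(2)
   proof eventually_elim
    case (elim t)
    have "\<bar>f' t \<bullet> h t\<bar> \<le> norm (f' t) * norm (h t)" by (rule Cauchy_Schwarz_ineq2)
    also have "\<dots> \<le> C * norm (h t)" using elim by (intro mult_right_mono) auto
    finally show ?case by simp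
   qed
  qed
  show ?thesis using i[OF gm gb, of k] i[OF fm(2) f0b]
   by (subst Bochner_Integration.integral_add[symmetric]) (auto simp: g_def inner_diff_left)
 qed
 ultimately show ?thesis
  unfolding M_def[symmetric] using tendsto_add[of "\<lambda>k. \<integral>t. g k t \<bullet> h t \<partial>M" 0 sequentially "\<lambda>_. \<integral>t. f0 t \<bullet> h t \<partial>M"] by simp
qed

section \<open>Calculus in charts\<close>

lemma Ck2_derivative:
 fixes f :: "'a::euclidean_space => 'b::real_normed_vector"
 assumes "Ck_on 2 f S" and S: "open S"
 shows "\<And>x. x \<in> S ==> (f has_derivative frechet_derivative f (at x)) (at x)"
  and "continuous_on S (\<lambda>x. frechet_derivative f (at x) v)"
proof -
 have C: "\<forall>x\<in>S. f differentiable (at x)" "\<forall>v. \<forall>x\<in>S. (\<lambda>x. frechet_derivative f (at x) v) differentiable (at x)"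
  using assms(1) by (auto simp: numeral_2_eq_2)
 show "(f has_derivative frechet_derivative f (at x)) (at x)" if "x \<in> S" for x
  using C(1) that by (simp add: frechet_derivative_works)
 show "continuous_on S (\<lambda>x. frechet_derivative f (at x) v)"
  using C(2) by (intro continuous_at_imp_continuous_on) (auto intro: differentiable_imp_continuous_within)
qed

lemma lipschitz_on_compact_convex:
 fixes f :: "'a::euclidean_space => real"
 assumes der: "\<And>x. x \<in> K ==> (f has_derivative f' x) (at x)"
  and cont: "\<And>v. continuous_on K (\<lambda>x. f' x v)" and K: "compact K" "convex K"
 obtains B where "B \<ge> 0" "\<And>x y. x \<in> K ==> y \<in> K ==> \<bar>f x - f y\<bar> \<le> B * norm (x - y)"
proof -
 have "continuous_on K (\<lambda>x. \<Sum>i\<in>Basis. norm (f' x i))" by (intro continuous_intros cont)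
 then have "bounded ((\<lambda>x. \<Sum>i\<in>Basis. norm (f' x i)) ` K)"
  using K(1) compact_continuous_image compact_imp_bounded by blast
 then obtain B where B: "\<And>x. x \<in> K ==> \<bar>\<Sum>i\<in>Basis. norm (f' x i)\<bar> \<le> B"
  unfolding bounded_iff by auto
 show thesis
 proof (rule that[of "max B 0"])
  fix x y assume xy: "x \<in> K" "y \<in> K"
  have "norm (f x - f y) \<le> max B 0 * norm (x - y)"
  proof (rule differentiable_bound[OF K(2) _ _ xy])
   fix z assume z: "z \<in> K"
   show "(f has_derivative f' z) (at z within K)" using der[OF z] by (rule has_derivative_at_withinI)
   have "onorm (f' z) \<le> (\<Sum>i\<in>Basis. norm (f' z i))"
    using has_derivative_bounded_linear[OF der[OF z]] by (rule onorm_componentwise)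
   then show "onorm (f' z) \<le> max B 0" using B[OF z] by linarith
  qed
  then show "\<bar>f x - f y\<bar> \<le> max B 0 * norm (x - y)" by simp
 qed simp
qed

lemma GDERIV_unique: "GDERIV f x :> p ==> GDERIV f x :> q ==> p = q"
 for p :: "'a::euclidean_space" unfolding gderiv_def
 by (metis (no_types, lifting) has_derivative_unique inner_commute vector_eq_ldot)

lemma the_GDERIV: "GDERIV f x :> p ==> (THE q. GDERIV f x :> q) = p" for p :: "'a::euclidean_space"
 by (rule the_equality) (auto intro: GDERIV_unique)

lemma GDERIV_adjoint:
 fixes f :: "'a::euclidean_space => real" and h :: "'b::euclidean_space => 'a"
 assumes f: "GDERIV f (h x) :> p" and h: "(h has_derivative h') (at x)"
 shows "GDERIV (f \<circ> h) x :> adjoint h' p"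
proof -
 have l: "linear h'" using has_derivative_bounded_linear[OF h] bounded_linear.linear by blast
 have "((f \<circ> h) has_derivative (\<lambda>v. h' v \<bullet> p)) (at x)"
  using diff_chain_at[OF h f[unfolded gderiv_def]] by (simp add: o_def inner_commute)
 then show ?thesis unfolding gderiv_def by (simp add: adjoint_works[OF l, symmetric])
qed

section \<open>Charts, changes of coordinates and velocities\<close>

locale smooth_manifold =
 fixes A :: "('m::t2_space, 'e::euclidean_space) chart set"
 assumes manifold: "closed_connected_manifold A"
begin

abbreviation cdom :: "('m, 'e) chart => 'e set" where "cdom c \<equiv> snd c ` fst c"

lemma chart_open: assumes "c \<in> A" shows "open (fst c)" "open (cdom c)"
 using assms manifold by (auto simp: closed_connected_manifold_def smooth_atlas_def is_chart_def)

lemma chart_homeomorphism: assumes "c \<in> A" shows "homeomorphism (fst c) (cdom c) (snd c) (chart_inv c)"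
 using assms manifold by (auto simp: closed_connected_manifold_def smooth_atlas_def is_chart_def)

lemma chart_inv_chart [simp]: "c \<in> A ==> z \<in> fst c ==> chart_inv c (snd c z) = z"
 using chart_homeomorphism by (simp add: homeomorphism_def)

lemma chart_chart_inv [simp]:
 assumes "c \<in> A" "w \<in> cdom c" shows "snd c (chart_inv c w) = w" "chart_inv c w \<in> fst c"
 using chart_homeomorphism[OF assms(1)] assms(2) by (auto simp: homeomorphism_def)

lemma chart_continuous:
 assumes "c \<in> A" shows "continuous_on (fst c) (snd c)" "continuous_on (cdom c) (chart_inv c)"
 using chart_homeomorphism[OF assms] by (auto simp: homeomorphism_def)

lemma chart_at [simp]: "chart_at A x \<in> A" "x \<in> fst (chart_at A x)"
proof -
 have "x \<in> (\<Union>c\<in>A. fst c)" using manifold by (simp add: closed_connected_manifold_def smooth_atlas_def)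
 then have "\<exists>c. c \<in> A \<and> x \<in> fst c" by blast
 then have "chart_at A x \<in> A \<and> x \<in> fst (chart_at A x)" unfolding chart_at_def by (rule someI_ex)
 then show "chart_at A x \<in> A" "x \<in> fst (chart_at A x)" by auto
qed

lemma compact_M: "compact (UNIV :: 'm set)" and connected_M: "connected (UNIV :: 'm set)"
 using manifold by (auto simp: closed_connected_manifold_def)

definition dtrans :: "('m, 'e) chart => ('m, 'e) chart => 'm => 'e => 'e" where
 "dtrans c d z = frechet_derivative (transition c d) (at (snd c z))"

lemma open_chart_Int:
 assumes "c \<in> A" "d \<in> A" shows "open (snd c ` (fst c \<inter> fst d))"
proof -
 have "snd c ` (fst c \<inter> fst d) = {w \<in> cdom c. chart_inv c w \<in> fst d}" using assms by auto
 also have "\<dots> = cdom c \<inter> chart_inv c -` fst d" by auto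
 also have "open \<dots>" using chart_continuous(2)[OF assms(1)] chart_open[OF assms(1)] chart_open(1)[OF assms(2)]
  by (auto simp: continuous_on_open_vimage Int_commute)
 finally show ?thesis .
qed

lemma transition_derivative:
 assumes "c \<in> A" "d \<in> A" "z \<in> fst c" "z \<in> fst d"
 shows "(transition c d has_derivative dtrans c d z) (at (snd c z))"
proof -
 have "\<forall>c\<in>A. \<forall>d\<in>A. \<forall>k. Ck_on k (transition c d) (snd c ` (fst c \<inter> fst d))"
  using manifold by (simp add: closed_connected_manifold_def smooth_atlas_def)
 then have "Ck_on (Suc 0) (transition c d) (snd c ` (fst c \<inter> fst d))" using assms by blast
 then have "\<forall>x\<in>snd c ` (fst c \<inter> fst d). transition c d differentiable (at x)" by simp
 then have "transition c d differentiable (at (snd c z))" using assms by blast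
 then show ?thesis by (simp add: frechet_derivative_works dtrans_def)
qed

lemma dtrans_linear:
 assumes "c \<in> A" "d \<in> A" "z \<in> fst c" "z \<in> fst d" shows "bounded_linear (dtrans c d z)" "linear (dtrans c d z)"
 using has_derivative_bounded_linear[OF transition_derivative[OF assms]] bounded_linear.linear by auto

lemma transition_at [simp]: "c \<in> A ==> z \<in> fst c ==> transition c d (snd c z) = snd d z"
 by (simp add: transition_def)

lemma dtrans_comp:
 assumes "c \<in> A" "d \<in> A" "e \<in> A" "z \<in> fst c" "z \<in> fst d" "z \<in> fst e"
 shows "dtrans d e z (dtrans c d z v) = dtrans c e z v"
proof -
 have "((transition d e \<circ> transition c d) has_derivative (dtrans d e z \<circ> dtrans c d z)) (at (snd c z))"
  by (rule diff_chain_at) (use transition_derivative assms in auto)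
 moreover have "(transition c e has_derivative (dtrans d e z \<circ> dtrans c d z)) (at (snd c z))"
  if "((transition d e \<circ> transition c d) has_derivative (dtrans d e z \<circ> dtrans c d z)) (at (snd c z))"
  using that
 proof (rule has_derivative_transform_within_open[OF _ open_chart_Int[of c d]])
  fix w assume "w \<in> snd c ` (fst c \<inter> fst d)"
  then show "(transition d e \<circ> transition c d) w = transition c e w" using assms by (auto simp: transition_def)
 qed (use assms in auto)
 ultimately have "dtrans d e z \<circ> dtrans c d z = dtrans c e z"
  using transition_derivative[of c e z] assms has_derivative_unique by blast
 then show ?thesis by (simp add: fun_eq_iff)
qed

lemma dtrans_self [simp]:
 assumes "c \<in> A" "z \<in> fst c" shows "dtrans c c z v = v"
proof -
 have "((\<lambda>w. w) has_derivative (\<lambda>v. v)) (at (snd c z))" by simp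
 then have "(transition c c has_derivative (\<lambda>v. v)) (at (snd c z))"
  by (rule has_derivative_transform_within_open[OF _ chart_open(2)[OF assms(1)]])
    (use assms in \<open>auto simp: transition_def\<close>)
 then have "dtrans c c z = (\<lambda>v. v)" using transition_derivative[of c c z] assms has_derivative_unique by blast
 then show ?thesis by simp
qed

lemma tangent_in_dtrans: "tangent_in A c z = dtrans (chart_at A z) c z"
 and tangent_from_dtrans: "tangent_from A c z = dtrans c (chart_at A z) z"
 by (auto simp: tangent_in_def tangent_from_def dtrans_def fun_eq_iff)

lemma tangent_linear:
 assumes "c \<in> A" "z \<in> fst c"
 shows "linear (tangent_in A c z)" "linear (tangent_from A c z)"
  "bounded_linear (tangent_in A c z)" "bounded_linear (tangent_from A c z)"
 unfolding tangent_in_dtrans tangent_from_dtrans using dtrans_linear assms by auto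

lemma tangent_in_from [simp]:
 assumes "c \<in> A" "z \<in> fst c"
 shows "tangent_in A c z (tangent_from A c z v) = v" "tangent_from A c z (tangent_in A c z v) = v"
 unfolding tangent_in_dtrans tangent_from_dtrans using dtrans_comp assms by auto

lemma tangent_in_chart_at [simp]: "tangent_in A (chart_at A z) z v = v" by (simp add: tangent_in_dtrans)

lemma cotangent_from_inner:
 assumes "c \<in> A" "z \<in> fst c" shows "cotangent_from A c z q \<bullet> v = q \<bullet> tangent_in A c z v"
 using adjoint_works[OF tangent_linear(1)[OF assms], of v q] by (simp add: cotangent_from_def inner_commute)

lemma cotangent_from_chart_at [simp]: "cotangent_from A (chart_at A z) z q = q"
proof -
 have "cotangent_from A (chart_at A z) z q \<bullet> v = q \<bullet> v" for v by (simp add: cotangent_from_inner)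
 then show ?thesis by (metis vector_eq_rdot)
qed

lemma cotangent_from_surj:
 assumes "c \<in> A" "z \<in> fst c"
 shows "cotangent_from A c z (adjoint (tangent_from A c z) p) = p"
proof -
 have *: "adjoint (tangent_from A c z) p \<bullet> w = tangent_from A c z w \<bullet> p" for w
  using adjoint_works[OF tangent_linear(2)[OF assms], of w p] by (simp add: inner_commute)
 have "cotangent_from A c z (adjoint (tangent_from A c z) p) \<bullet> v = p \<bullet> v" for v
  unfolding cotangent_from_inner[OF assms] * using assms by (simp add: inner_commute)
 then show ?thesis by (metis vector_eq_rdot)
qed

lemma curve_near:
 fixes \<xi> :: "real => 'm"
 assumes "continuous (at s within I) \<xi>" "open U" "\<xi> s \<in> U"
 obtains d where "d > 0" "\<And>t. t \<in> I ==> \<bar>t - s\<bar> < d ==> \<xi> t \<in> (U :: 'm set)"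
proof -
 have "eventually (\<lambda>t. \<xi> t \<in> U) (at s within I)"
  using assms(1) unfolding continuous_within by (rule topological_tendstoD[OF _ assms(2,3)])
 then obtain d where d: "d > 0" "\<And>t. t \<in> I ==> t \<noteq> s ==> dist t s < d ==> \<xi> t \<in> U"
  unfolding eventually_at by auto
 show thesis by (rule that[OF d(1)]) (use d(2) assms(3) in \<open>auto simp: dist_real_def\<close>)
qed

lemma chart_change_derivative:
 fixes \<xi> :: "real => 'm"
 assumes c: "c \<in> A" "d \<in> A" "\<xi> s \<in> fst c" "\<xi> s \<in> fst d" and s: "s \<in> I"
  and cont: "continuous (at s within I) \<xi>"
  and der: "((snd c \<circ> \<xi>) has_vector_derivative v) (at s within I)"
 shows "((snd d \<circ> \<xi>) has_vector_derivative dtrans c d (\<xi> s) v) (at s within I)"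
proof -
 obtain dl where dl: "dl > 0" "\<And>t. t \<in> I ==> \<bar>t - s\<bar> < dl ==> \<xi> t \<in> fst c"
  using curve_near[OF cont chart_open(1)[OF c(1)] c(3)] by blast
 have "((transition c d \<circ> (snd c \<circ> \<xi>)) has_derivative (dtrans c d (\<xi> s) \<circ> (\<lambda>x. x *\<^sub>R v))) (at s within I)"
  by (rule diff_chain_within[OF der[unfolded has_vector_derivative_def]])
    (use has_derivative_at_withinI[OF transition_derivative] c in auto)
 then have "((transition c d \<circ> (snd c \<circ> \<xi>)) has_vector_derivative dtrans c d (\<xi> s) v) (at s within I)"
  unfolding has_vector_derivative_def using linear_cmul[OF dtrans_linear(2)[of c d "\<xi> s"]] c by (simp add: o_def)
 then show ?thesis unfolding has_vector_derivative_def by (rule has_derivative_transform_within[OF _ dl(1) s])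
    (use dl(2) c in \<open>auto simp: dist_real_def transition_def\<close>)
qed

text \<open>The chain rule applied to the change of charts and to its inverse, whose derivatives at
  the point are inverse to each other. It frees velocities from the preferred chart, which jumps
  along the curve.\<close>

lemma has_velocity_iff:
 fixes \<xi> :: "real => 'm"
 assumes c: "c \<in> A" "\<xi> s \<in> fst c" "s \<in> I"
 shows "has_velocity A I \<xi> s v \<longleftrightarrow> continuous (at s within I) \<xi> \<and>
  ((snd c \<circ> \<xi>) has_vector_derivative tangent_in A c (\<xi> s) v) (at s within I)"
proof (cases "continuous (at s within I) \<xi>")
 case True
 let ?d = "chart_at A (\<xi> s)"
 have 1: "((snd c \<circ> \<xi>) has_vector_derivative dtrans ?d c (\<xi> s) v) (at s within I)"
  if "((snd ?d \<circ> \<xi>) has_vector_derivative v) (at s within I)"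
  by (rule chart_change_derivative) (use that c True in auto)
 have 2: "((snd ?d \<circ> \<xi>) has_vector_derivative dtrans c ?d (\<xi> s) (dtrans ?d c (\<xi> s) v)) (at s within I)"
  if "((snd c \<circ> \<xi>) has_vector_derivative dtrans ?d c (\<xi> s) v) (at s within I)"
  by (rule chart_change_derivative) (use that c True in auto)
 have "dtrans c ?d (\<xi> s) (dtrans ?d c (\<xi> s) v) = v" using c by (simp add: dtrans_comp)
 then have 2: "((snd ?d \<circ> \<xi>) has_vector_derivative v) (at s within I)"
  if "((snd c \<circ> \<xi>) has_vector_derivative dtrans ?d c (\<xi> s) v) (at s within I)" using 2[OF that] by simp
 have "((snd ?d \<circ> \<xi>) has_vector_derivative v) (at s within I) \<longleftrightarrow>
   ((snd c \<circ> \<xi>) has_vector_derivative dtrans ?d c (\<xi> s) v) (at s within I)" by (rule iffI[OF 1 2])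
 then show ?thesis by (simp only: has_velocity_def tangent_in_dtrans)
qed (simp add: has_velocity_def)

lemma velocity_eq:
 assumes "has_velocity A I \<xi> s v" "at s within I \<noteq> bot"
 shows "velocity A I \<xi> s = v"
 using assms unfolding velocity_def has_velocity_def by (auto intro: vector_derivative_within)

text \<open>Near the point, the coordinate expression in the preferred chart is the one in
  \<open>c\<close> composed with the change of charts, so the gradient is transformed by the adjoint
  of the derivative. This lets \<open>differential_at\<close> be computed in any chart.\<close>

lemma gradient_chart_change:
 assumes c: "c \<in> A" "z \<in> fst c" and q: "GDERIV (f \<circ> chart_inv c) (snd c z) :> q"
 shows "GDERIV (f \<circ> chart_inv (chart_at A z)) (snd (chart_at A z) z) :> cotangent_from A c z q"
  "differential_at A f z = cotangent_from A c z q"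
proof -
 let ?d = "chart_at A z"
 have q': "GDERIV (f \<circ> chart_inv c) (transition ?d c (snd ?d z)) :> q" using q by simp
 have h: "(transition ?d c has_derivative dtrans ?d c z) (at (snd ?d z))"
  by (rule transition_derivative) (use c in auto)
 have D: "((f \<circ> chart_inv c \<circ> transition ?d c) has_derivative (\<lambda>h. h \<bullet> adjoint (dtrans ?d c z) q)) (at (snd ?d z))"
  using GDERIV_adjoint[of "f \<circ> chart_inv c" "transition ?d c", OF q' h] unfolding gderiv_def by (simp only: inner_commute)
 have op: "open (snd ?d ` (fst ?d \<inter> fst c))" by (rule open_chart_Int) (use c in auto)
 have mem: "snd ?d z \<in> snd ?d ` (fst ?d \<inter> fst c)" using c by auto
 have eq: "(f \<circ> chart_inv c \<circ> transition ?d c) w = (f \<circ> chart_inv ?d) w" if "w \<in> snd ?d ` (fst ?d \<inter> fst c)" for w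
  using c that by (auto simp: transition_def)
 have "((f \<circ> chart_inv ?d) has_derivative (\<lambda>h. h \<bullet> adjoint (dtrans ?d c z) q)) (at (snd ?d z))"
  by (rule has_derivative_transform_within_open[OF D op mem eq])
 then show *: "GDERIV (f \<circ> chart_inv ?d) (snd ?d z) :> cotangent_from A c z q"
  unfolding gderiv_def cotangent_from_def tangent_in_dtrans by (simp only: inner_commute)
 show "differential_at A f z = cotangent_from A c z q" unfolding differential_at_def by (rule the_GDERIV[OF *])
qed

end

lemma continuous_on_locally_within:
 fixes f :: "real => 'b::topological_space"
 assumes "\<And>t. t \<in> I ==> \<exists>d>0. continuous_on (I \<inter> ball t d) f"
 shows "continuous_on I f" unfolding continuous_on_eq_continuous_within
proof
 fix t assume t: "t \<in> I"
 obtain d where d: "d > 0" "continuous_on (I \<inter> ball t d) f" using assms[OF t] by blast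
 then have "continuous (at t within I \<inter> ball t d) f"
  using t unfolding continuous_on_eq_continuous_within by auto
 moreover have "at t within I = at t within I \<inter> ball t d"
  by (rule at_within_nhd[of t "ball t d"]) (use d(1) in auto)
 ultimately show "continuous (at t within I) f" by simp
qed

context smooth_manifold
begin

lemma dtrans_continuous:
 assumes "c \<in> A" "d \<in> A"
 shows "continuous_on (snd c ` (fst c \<inter> fst d)) (\<lambda>z. frechet_derivative (transition c d) (at z) u)"
proof -
 have "\<forall>c\<in>A. \<forall>d\<in>A. \<forall>k. Ck_on k (transition c d) (snd c ` (fst c \<inter> fst d))"
  using manifold by (simp add: closed_connected_manifold_def smooth_atlas_def)
 then have "Ck_on (Suc 0) (transition c d) (snd c ` (fst c \<inter> fst d))" using assms by blast
 then show ?thesis by simp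
qed

lemma chart_curve_continuous:
 assumes c: "c \<in> A" and ga: "continuous_on I ga" "\<And>t. t \<in> I ==> ga t \<in> cdom c"
 shows "continuous_on I (\<lambda>t. chart_inv c (ga t))"
 by (rule continuous_on_compose2[OF chart_continuous(2)[OF c] ga(1)]) (use ga in auto)

lemma chart_ball:
 fixes W :: "'m set"
 assumes "c \<in> A" "z \<in> fst c" "open W" "z \<in> W"
 obtains r where "r > 0" "cball (snd c z) r \<subseteq> cdom c" "chart_inv c ` cball (snd c z) r \<subseteq> W"
proof -
 have "open (cdom c \<inter> chart_inv c -` W)"
  using chart_continuous(2)[OF assms(1)] chart_open(2)[OF assms(1)] assms(3)
  by (auto simp: continuous_on_open_vimage Int_commute)
 moreover have "snd c z \<in> cdom c \<inter> chart_inv c -` W" using assms by auto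
 ultimately obtain r where "r > 0" "cball (snd c z) r \<subseteq> cdom c \<inter> chart_inv c -` W"
  using open_contains_cball by blast
 then show thesis by (intro that[of r]) auto
qed

lemma chart_image_open:
 assumes "c \<in> A" "open U" "U \<subseteq> cdom c" shows "open (chart_inv c ` U)"
proof -
 have "chart_inv c ` U = fst c \<inter> snd c -` U"
 proof (intro set_eqI iffI)
  fix z assume "z \<in> chart_inv c ` U"
  then obtain w where "w \<in> U" "z = chart_inv c w" by blast
  then show "z \<in> fst c \<inter> snd c -` U" using assms by auto
 next
  fix z assume "z \<in> fst c \<inter> snd c -` U"
  then show "z \<in> chart_inv c ` U" using assms(1) by (intro image_eqI[of _ _ "snd c z"]) auto
 qed
 also have "open \<dots>" using chart_continuous(1)[OF assms(1)] chart_open(1)[OF assms(1)] assms(2)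
  by (auto simp: continuous_on_open_vimage Int_commute)
 finally show ?thesis .
qed

lemma chart_image_compact:
 assumes "c \<in> A" "compact K" "K \<subseteq> cdom c" shows "compact (chart_inv c ` K)" "closed (chart_inv c ` K)"
proof -
 show "compact (chart_inv c ` K)"
  using assms chart_continuous(2)[OF assms(1)] by (intro compact_continuous_image) (auto intro: continuous_on_subset)
 then show "closed (chart_inv c ` K)" by (rule compact_imp_closed)
qed

lemma chart_segment_C1:
 assumes c: "c \<in> A" and seg: "\<And>t. t \<in> {a..b} ==> y + t *\<^sub>R w \<in> cdom c"
 shows "C1_curve A {a..b} (\<lambda>t. chart_inv c (y + t *\<^sub>R w))"
  "\<And>t. t \<in> {a..b} ==> has_velocity A {a..b} (\<lambda>t. chart_inv c (y + t *\<^sub>R w)) t (tangent_from A c (chart_inv c (y + t *\<^sub>R w)) w)"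
proof -
 let ?ga = "\<lambda>t. chart_inv c (y + t *\<^sub>R w)"
 have cont: "continuous_on {a..b} ?ga"
  by (rule chart_curve_continuous[OF c]) (use seg in \<open>auto intro!: continuous_intros\<close>)
 have dc: "((snd c \<circ> ?ga) has_vector_derivative w) (at t within {a..b})" if t: "t \<in> {a..b}" for t
 proof -
  have "((\<lambda>t. y + t *\<^sub>R w) has_vector_derivative w) (at t within {a..b})"
   by (auto intro!: derivative_eq_intros simp: has_vector_derivative_def)
  then show ?thesis unfolding has_vector_derivative_def
   by (rule has_derivative_transform_within[of _ _ _ _ 1]) (use t seg c in auto)
 qed
 have cw: "continuous (at t within {a..b}) ?ga" if "t \<in> {a..b}" for t
  using cont that by (simp add: continuous_on_eq_continuous_within)
 show "C1_curve A {a..b} ?ga" unfolding C1_curve_def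
 proof (intro conjI cont ballI)
  fix d assume d: "d \<in> A"
  let ?I = "{t\<in>{a..b}. ?ga t \<in> fst d}"
  show "\<exists>v. continuous_on ?I v \<and> (\<forall>t\<in>{a..b}. ?ga t \<in> fst d --> ((snd d \<circ> ?ga) has_vector_derivative v t) (at t within {a..b}))"
  proof (intro exI conjI ballI impI)
   show "continuous_on ?I (\<lambda>t. frechet_derivative (transition c d) (at (y + t *\<^sub>R w)) w)"
   proof (rule continuous_on_compose2[OF dtrans_continuous[OF c d]])
    show "(\<lambda>t. y + t *\<^sub>R w) ` ?I \<subseteq> snd c ` (fst c \<inter> fst d)"
    proof clarify
     fix t assume t: "t \<in> {a..b}" "?ga t \<in> fst d"
     then show "y + t *\<^sub>R w \<in> snd c ` (fst c \<inter> fst d)"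
      using c seg[OF t(1)] by (intro image_eqI[of _ _ "?ga t"]) auto
    qed
   qed (auto intro!: continuous_intros)
   fix t assume t: "t \<in> {a..b}" "?ga t \<in> fst d"
   have "((snd d \<circ> ?ga) has_vector_derivative dtrans c d (?ga t) w) (at t within {a..b})"
    by (rule chart_change_derivative[OF c d _ t(2) t(1) cw[OF t(1)] dc[OF t(1)]]) (use seg c t in auto)
   then show "((snd d \<circ> ?ga) has_vector_derivative frechet_derivative (transition c d) (at (y + t *\<^sub>R w)) w) (at t within {a..b})"
    using seg[OF t(1)] c by (simp add: dtrans_def)
  qed
 qed
 fix t assume t: "t \<in> {a..b}"
 show "has_velocity A {a..b} ?ga t (tangent_from A c (?ga t) w)"
  using has_velocity_iff[of c ?ga t "{a..b}"] c t seg[OF t] dc[OF t] cw[OF t] by simp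
qed

end

section \<open>The metric in charts and the length of curves\<close>

locale riemannian_manifold = smooth_manifold A for A :: "('m::t2_space, 'e::euclidean_space) chart set" +
 fixes g :: "'m => 'e => 'e => real"
 assumes metric: "riemannian_metric A g"
begin

definition speed :: "'m => 'e => real" where "speed z v = sqrt (g z v v)"

text \<open>The metric tensor in the coordinates of \<open>c\<close>; it is continuous there,
  whereas \<open>g\<close> in terms of the preferred charts need not be.\<close>

definition gc :: "('m, 'e) chart => 'e => 'e => 'e => real" where
 "gc c \<zeta> a b = g (chart_inv c \<zeta>) (tangent_from A c (chart_inv c \<zeta>) a) (tangent_from A c (chart_inv c \<zeta>) b)"

lemma g_props: "bilinear (g x)" "g x v v \<ge> 0" "v \<noteq> 0 ==> g x v v > 0"
proof -
 show b: "bilinear (g x)" "v \<noteq> 0 ==> g x v v > 0" using metric by (auto simp: riemannian_metric_def)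
 then show "g x v v \<ge> 0" by (cases "v = 0") (auto simp: bilinear_lzero)
qed

lemma speed_nonneg [simp]: "speed z v \<ge> 0" by (simp add: speed_def g_props)

lemma speed_scale: "speed z (a *\<^sub>R v) = \<bar>a\<bar> * speed z v"
proof -
 have "g z (a *\<^sub>R v) (a *\<^sub>R v) = a\<^sup>2 * g z v v"
  using g_props(1)[of z] by (simp add: bilinear_lmul bilinear_rmul power2_eq_square)
 then show ?thesis by (simp add: speed_def real_sqrt_mult)
qed

lemma gc_expand:
 assumes "c \<in> A" "zt \<in> cdom c"
 shows "gc c zt a b = (\<Sum>i\<in>Basis. \<Sum>j\<in>Basis. (a \<bullet> i) * (b \<bullet> j) * gc c zt i j)"
proof -
 let ?z = "chart_inv c zt"
 have l: "linear (tangent_from A c ?z)" by (rule tangent_linear) (use assms in auto)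
 have b: "bilinear (g ?z)" by (rule g_props)
 have l1: "linear (\<lambda>a. gc c zt a b)" for b
  using linear_compose[OF l, of "\<lambda>x. g ?z x (tangent_from A c ?z b)"] b by (simp add: bilinear_def gc_def o_def)
 have l2: "linear (\<lambda>b. gc c zt a b)" for a
  using linear_compose[OF l, of "g ?z (tangent_from A c ?z a)"] b by (simp add: bilinear_def gc_def o_def)
 have "gc c zt a b = (\<Sum>i\<in>Basis. (a \<bullet> i) * gc c zt i b)"
  using Linear_Algebra.linear_componentwise[OF l1, of a b 1] by simp
 also have "\<dots> = (\<Sum>i\<in>Basis. (a \<bullet> i) * (\<Sum>j\<in>Basis. (b \<bullet> j) * gc c zt i j))"
  using Linear_Algebra.linear_componentwise[OF l2, of _ b 1] by simp
 finally show ?thesis by (simp add: sum_distrib_left mult.assoc)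
qed

lemma gc_continuous:
 assumes c: "c \<in> A"
 shows "continuous_on (cdom c \<times> UNIV) (\<lambda>(zt, a). gc c zt a a)"
proof -
 have g0: "continuous_on (cdom c) (\<lambda>zt. gc c zt u v)" for u v
 proof -
  have "\<forall>c\<in>A. \<forall>u v. \<forall>k. Ck_on k (\<lambda>z. g (chart_inv c z) (tangent_from A c (chart_inv c z) u) (tangent_from A c (chart_inv c z) v)) (cdom c)"
   using metric by (simp add: riemannian_metric_def)
  then have "Ck_on 0 (\<lambda>z. g (chart_inv c z) (tangent_from A c (chart_inv c z) u) (tangent_from A c (chart_inv c z) v)) (cdom c)"
   using c by blast
  then show ?thesis by (simp add: gc_def)
 qed
 have "continuous_on (cdom c \<times> UNIV) (\<lambda>x. \<Sum>i\<in>Basis. \<Sum>j\<in>Basis. (snd x \<bullet> i) * (snd x \<bullet> j) * gc c (fst x) i j)"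
  by (intro continuous_intros continuous_on_compose2[OF g0 continuous_on_fst]) auto
 then show ?thesis by (rule continuous_on_eq) (use gc_expand[OF c] in auto)
qed

text \<open>The quadratic form is continuous and positive on the compact product of \<open>K\<close>
  with the unit sphere, hence lies between two positive constants there; homogeneity does the
  rest.\<close>

lemma gc_bounds:
 assumes c: "c \<in> A" and K: "compact K" "K \<subseteq> cdom c"
 obtains m M where "m > 0" "M > 0" "\<And>zt a. zt \<in> K ==> m * norm a \<le> sqrt (gc c zt a a)" "\<And>zt a. zt \<in> K ==> sqrt (gc c zt a a) \<le> M * norm a"
proof (cases "K = {}")
 case True then show thesis by (intro that[of 1 1]) auto
next
 case False
 let ?S = "K \<times> sphere (0::'e) 1"
 obtain u :: 'e where "u \<in> Basis" using nonempty_Basis by blast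
 then have "u \<in> sphere 0 1" by simp
 then have ne: "?S \<noteq> {}" using False by blast
 have cS: "compact ?S" using K by (intro compact_Times) auto
 have cont: "continuous_on ?S (\<lambda>(zt, a). gc c zt a a)"
  by (rule continuous_on_subset[OF gc_continuous[OF c]]) (use K in auto)
 obtain x0 where x0: "x0 \<in> ?S" "\<And>x. x \<in> ?S ==> (\<lambda>(zt, a). gc c zt a a) x0 \<le> (\<lambda>(zt, a). gc c zt a a) x"
  using continuous_attains_inf[OF cS ne cont] by blast
 obtain x1 where x1: "x1 \<in> ?S" "\<And>x. x \<in> ?S ==> (\<lambda>(zt, a). gc c zt a a) x \<le> (\<lambda>(zt, a). gc c zt a a) x1"
  using continuous_attains_sup[OF cS ne cont] by blast
 have pos: "gc c zt a a > 0" if "zt \<in> K" "a \<noteq> 0" for zt a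
 proof -
  have z: "chart_inv c zt \<in> fst c" using that K c by auto
  have "tangent_from A c (chart_inv c zt) a \<noteq> 0"
   using tangent_in_from(1)[OF c z, of a] linear_0[OF tangent_linear(1)[OF c z]] that(2) by metis
  then show ?thesis unfolding gc_def by (rule g_props)
 qed
 define m where "m = (\<lambda>(zt, a). gc c zt a a) x0"
 define M where "M = (\<lambda>(zt, a). gc c zt a a) x1"
 have pos': "(\<lambda>(zt, a). gc c zt a a) x > 0" if x: "x \<in> ?S" for x
 proof -
  have "fst x \<in> K" "snd x \<noteq> 0" using x by auto
  then show ?thesis using pos by (simp add: split_beta)
 qed
 have m: "m > 0" using pos'[OF x0(1)] by (simp only: m_def)
 have M: "M > 0" using pos'[OF x1(1)] by (simp only: M_def)
 have sc: "sqrt (gc c zt a a) = norm a * sqrt (gc c zt (sgn a) (sgn a))" if "zt \<in> K" for zt a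
 proof -
  let ?z = "chart_inv c zt"
  have z: "?z \<in> fst c" using that K c by auto
  have "norm a *\<^sub>R sgn a = a" by (cases "a = 0") (auto simp: sgn_div_norm)
  then have "tangent_from A c ?z a = norm a *\<^sub>R tangent_from A c ?z (sgn a)"
   using linear_cmul[OF tangent_linear(2)[OF c z], of "norm a" "sgn a"] by simp
  then have "speed ?z (tangent_from A c ?z a) = norm a * speed ?z (tangent_from A c ?z (sgn a))"
   by (simp add: speed_scale)
  then show ?thesis by (simp add: speed_def gc_def)
 qed
 show thesis
 proof (rule that[of "sqrt m" "sqrt M"])
  fix zt and a :: 'e assume zt: "zt \<in> K"
  have "a \<noteq> 0 ==> (zt, sgn a) \<in> ?S" using zt by (simp add: norm_sgn)
  from x0(2)[OF this] x1(2)[OF this] have *: "a \<noteq> 0 ==> m \<le> gc c zt (sgn a) (sgn a) \<and> gc c zt (sgn a) (sgn a) \<le> M"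
   by (auto simp: m_def M_def)
  show "sqrt m * norm a \<le> sqrt (gc c zt a a)" "sqrt (gc c zt a a) \<le> sqrt M * norm a"
   unfolding sc[OF zt, of a] using * by (cases "a = 0"; simp add: mult.commute)+
 qed (use m M in auto)
qed

lemma speed_chart:
 assumes "c \<in> A" "z \<in> fst c"
 shows "speed z v = sqrt (gc c (snd c z) (tangent_in A c z v) (tangent_in A c z v))"
 using assms by (simp add: speed_def gc_def)

lemma C1_velocity:
 assumes ga: "C1_curve A {0..1} ga" and c: "c \<in> A"
 obtains v where "continuous_on {t\<in>{0..1}. ga t \<in> fst c} v"
  "\<forall>t\<in>{0..1}. ga t \<in> fst c --> ((snd c \<circ> ga) has_vector_derivative v t) (at t within {0..1})"
  "\<forall>t\<in>{0..1}. ga t \<in> fst c --> tangent_in A c (ga t) (velocity A {0..1} ga t) = v t"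
proof -
 obtain v where v: "continuous_on {t\<in>{0..1}. ga t \<in> fst c} v"
  "\<forall>t\<in>{0..1}. ga t \<in> fst c --> ((snd c \<circ> ga) has_vector_derivative v t) (at t within {0..1})"
  using ga c unfolding C1_curve_def by blast
 have "tangent_in A c (ga t) (velocity A {0..1} ga t) = v t" if t: "t \<in> {0..1}" "ga t \<in> fst c" for t
 proof -
  have "continuous (at t within {0..1}) ga" using ga t by (simp add: C1_curve_def continuous_on_eq_continuous_within)
  then have "has_velocity A {0..1} ga t (tangent_from A c (ga t) (v t))"
   using has_velocity_iff[of c ga t "{0..1}"] c t v(2) by simp
  moreover have "at t within {0..1} \<noteq> bot" using t by (simp add: trivial_limit_within islimpt_Icc)
  ultimately have "velocity A {0..1} ga t = tangent_from A c (ga t) (v t)" by (rule velocity_eq)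
  then show ?thesis using c t by simp
 qed
 with v show thesis by (intro that[of v]) auto
qed

text \<open>The velocity in preferred charts may be discontinuous, but the speed does not depend on
  the chart. Near each time it can therefore be computed in one fixed chart, where everything is
  continuous.\<close>

lemma C1_speed_continuous:
 assumes ga: "C1_curve A {0..1} ga"
 shows "continuous_on {0..1} (\<lambda>t. speed (ga t) (velocity A {0..1} ga t))"
proof (rule continuous_on_locally_within)
 fix s :: real assume s: "s \<in> {0..1}"
 let ?c = "chart_at A (ga s)"
 have cont: "continuous_on {0..1} ga" using ga by (simp add: C1_curve_def)
 then have "continuous (at s within {0..1}) ga" using s by (simp add: continuous_on_eq_continuous_within)
 then obtain d where d: "d > 0" "\<And>t. t \<in> {0..1} ==> \<bar>t - s\<bar> < d ==> ga t \<in> fst ?c"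
  using curve_near[of s "{0..1}" ga "fst ?c"] chart_open(1)[of ?c] by auto
 obtain v where v: "continuous_on {t\<in>{0..1}. ga t \<in> fst ?c} v"
  "\<forall>t\<in>{0..1}. ga t \<in> fst ?c --> ((snd ?c \<circ> ga) has_vector_derivative v t) (at t within {0..1})"
  "\<forall>t\<in>{0..1}. ga t \<in> fst ?c --> tangent_in A ?c (ga t) (velocity A {0..1} ga t) = v t"
  by (rule C1_velocity[OF ga chart_at(1)[of "ga s"]])
 let ?I = "{0..1} \<inter> ball s d"
 have sub: "?I \<subseteq> {t\<in>{0..1}. ga t \<in> fst ?c}" using d(2) by (auto simp: dist_real_def abs_minus_commute)
 have "continuous_on ?I (\<lambda>t. sqrt (gc ?c (snd ?c (ga t)) (v t) (v t)))"
 proof (intro continuous_on_real_sqrt)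
  have "continuous_on ?I (\<lambda>t. (snd ?c (ga t), v t))"
  proof (intro continuous_on_Pair)
   show "continuous_on ?I v" using v(1) sub by (rule continuous_on_subset)
   have "continuous_on ?I ga" using cont by (rule continuous_on_subset) auto
   then show "continuous_on ?I (\<lambda>t. snd ?c (ga t))"
    by (rule continuous_on_compose2[OF chart_continuous(1)[of ?c], rotated]) (use sub in auto)
  qed
  then show "continuous_on ?I (\<lambda>t. gc ?c (snd ?c (ga t)) (v t) (v t))"
   using continuous_on_compose2[OF gc_continuous[of ?c], of ?I "\<lambda>t. (snd ?c (ga t), v t)"] sub by auto
 qed
 then have "continuous_on ?I (\<lambda>t. speed (ga t) (velocity A {0..1} ga t))"
  by (rule continuous_on_eq) (use sub v(3) speed_chart[of ?c] in auto)
 then show "\<exists>d>0. continuous_on ({0..1} \<inter> ball s d) (\<lambda>t. speed (ga t) (velocity A {0..1} ga t))"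
  using d(1) by blast
qed

lemma curve_length_speed: "curve_length A g c = integral {0..1} (\<lambda>t. speed (c t) (velocity A {0..1} c t))"
 by (simp add: curve_length_def speed_def)

lemma curve_length_nonneg: "C1_curve A {0..1} c ==> curve_length A g c \<ge> 0"
 unfolding curve_length_speed by (rule integral_nonneg) (auto intro: integrable_continuous_real C1_speed_continuous)

text \<open>The length of a curve dominates the increment of any function that is locally Lipschitz with
  respect to the length element; applied to a cut-off coordinate distance this shows that curves
  cannot leave a chart without having a certain length.\<close>

lemma length_dominates:
 fixes f :: "'m => real"
 assumes ga: "C1_curve A {0..1} ga"
  and f: "\<And>z. \<exists>W. open W \<and> z \<in> W \<and> ((\<forall>z'\<in>W. f z' = f z) \<or> (\<exists>c\<in>A. \<exists>m>0. z \<in> fst c \<and> W \<subseteq> fst c \<and>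
     (\<forall>a. m * norm a \<le> sqrt (gc c (snd c z) a a)) \<and>
     (\<forall>z'\<in>W. \<forall>z''\<in>W. \<bar>f z'' - f z'\<bar> \<le> m * norm (snd c z'' - snd c z'))))"
 shows "\<bar>f (ga 1) - f (ga 0)\<bar> \<le> curve_length A g ga"
proof -
 let ?l = "\<lambda>t. speed (ga t) (velocity A {0..1} ga t)"
 have li: "?l integrable_on {0..1}" by (rule integrable_continuous_real[OF C1_speed_continuous[OF ga]])
 have cont: "continuous_on {0..1} ga" using ga by (simp add: C1_curve_def)
 have str: "\<exists>d>0. \<forall>u v. 0 \<le> u \<and> u \<le> s \<and> s \<le> v \<and> v \<le> 1 \<and> v - u < d --> \<bar>f (ga v) - f (ga u)\<bar> \<le> (v - u) * (?l s + e)"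
  if s: "s \<in> {0..1}" and "e > 0" for s e
 proof -
  obtain W where W: "open W" "ga s \<in> W" and W2: "(\<forall>z'\<in>W. f z' = f (ga s)) \<or> (\<exists>c\<in>A. \<exists>m>0. ga s \<in> fst c \<and> W \<subseteq> fst c \<and>
     (\<forall>a. m * norm a \<le> sqrt (gc c (snd c (ga s)) a a)) \<and>
     (\<forall>z'\<in>W. \<forall>z''\<in>W. \<bar>f z'' - f z'\<bar> \<le> m * norm (snd c z'' - snd c z')))" using f[of "ga s"] by blast
  have "continuous (at s within {0..1}) ga" using cont s by (simp add: continuous_on_eq_continuous_within)
  then obtain d where d: "d > 0" "\<And>t. t \<in> {0..1} ==> \<bar>t - s\<bar> < d ==> ga t \<in> W"
   using curve_near[of s "{0..1}" ga W] W by auto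
  from W2 show ?thesis
  proof
   assume W2: "\<forall>z'\<in>W. f z' = f (ga s)"
   show ?thesis
   proof (intro exI[of _ d] conjI d(1) allI impI)
    fix u v assume uv: "0 \<le> u \<and> u \<le> s \<and> s \<le> v \<and> v \<le> 1 \<and> v - u < d"
    then have "ga u \<in> W" "ga v \<in> W" using s by (auto intro!: d(2))
    moreover have "0 \<le> (v - u) * (?l s + e)" using uv \<open>e > 0\<close> by (intro mult_nonneg_nonneg add_nonneg_nonneg) auto
    ultimately show "\<bar>f (ga v) - f (ga u)\<bar> \<le> (v - u) * (?l s + e)" using W2 by simp
   qed
  next
   assume "\<exists>c\<in>A. \<exists>m>0. ga s \<in> fst c \<and> W \<subseteq> fst c \<and> (\<forall>a. m * norm a \<le> sqrt (gc c (snd c (ga s)) a a)) \<and>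
     (\<forall>z'\<in>W. \<forall>z''\<in>W. \<bar>f z'' - f z'\<bar> \<le> m * norm (snd c z'' - snd c z'))"
   then obtain c m where c: "c \<in> A" "m > 0" "ga s \<in> fst c" "\<And>a. m * norm a \<le> sqrt (gc c (snd c (ga s)) a a)"
    "\<And>z' z''. z' \<in> W ==> z'' \<in> W ==> \<bar>f z'' - f z'\<bar> \<le> m * norm (snd c z'' - snd c z')" by blast
   obtain w where "continuous_on {t\<in>{0..1}. ga t \<in> fst c} w"
    and w: "\<forall>t\<in>{0..1}. ga t \<in> fst c --> ((snd c \<circ> ga) has_vector_derivative w t) (at t within {0..1})"
    "\<forall>t\<in>{0..1}. ga t \<in> fst c --> tangent_in A c (ga t) (velocity A {0..1} ga t) = w t"
    by (rule C1_velocity[OF ga c(1)])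
   have ls: "m * norm (w s) \<le> ?l s" using c(4)[of "w s"] w(2)[rule_format, OF s c(3)] speed_chart[OF c(1,3)] by simp
   have em: "e / m > 0" using \<open>e > 0\<close> c(2) by simp
   obtain d' where d': "d' > 0" "\<And>u v. u \<in> {0..1} ==> v \<in> {0..1} ==> u \<le> s ==> s \<le> v ==> v - u < d' ==>
     norm ((snd c \<circ> ga) v - (snd c \<circ> ga) u - (v - u) *\<^sub>R w s) \<le> e / m * (v - u)"
    using vector_derivative_straddle[OF w(1)[rule_format, OF s c(3)] em] by blast
   show ?thesis
   proof (intro exI[of _ "min d d'"] conjI allI impI)
    fix u v assume uv: "0 \<le> u \<and> u \<le> s \<and> s \<le> v \<and> v \<le> 1 \<and> v - u < min d d'"
    then have "ga u \<in> W" "ga v \<in> W" using s by (auto intro!: d(2))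
    then have "\<bar>f (ga v) - f (ga u)\<bar> \<le> m * norm (snd c (ga v) - snd c (ga u))" by (rule c(5))
    also have "norm (snd c (ga v) - snd c (ga u)) \<le> norm ((v - u) *\<^sub>R w s) + e / m * (v - u)"
     using d'(2)[of u v] uv norm_triangle_sub[of "snd c (ga v) - snd c (ga u)" "(v - u) *\<^sub>R w s"] s by simp
    also have "norm ((v - u) *\<^sub>R w s) = (v - u) * norm (w s)" using uv by simp
    finally have "\<bar>f (ga v) - f (ga u)\<bar> \<le> m * ((v - u) * norm (w s) + e / m * (v - u))" using c(2) by simp
    also have "\<dots> = (v - u) * (m * norm (w s) + e)" using c(2) by (simp add: field_simps)
    also have "\<dots> \<le> (v - u) * (?l s + e)" using ls uv by (intro mult_left_mono) auto
    finally show "\<bar>f (ga v) - f (ga u)\<bar> \<le> (v - u) * (?l s + e)" .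
   qed (use d d' in auto)
  qed
 qed
 have "f (ga 1) - f (ga 0) \<le> integral {0..1} ?l"
 proof (rule integral_comparison[where N="{}" and F="\<lambda>t. f (ga t)"])
  fix s e :: real assume "s \<in> {0..1} - {}" "e > 0"
  then obtain d where d: "d > 0" "\<And>u v. 0 \<le> u \<and> u \<le> s \<and> s \<le> v \<and> v \<le> 1 \<and> v - u < d ==> \<bar>f (ga v) - f (ga u)\<bar> \<le> (v - u) * (?l s + e)"
   using str[of s e] by auto
  show "\<exists>d>0. \<forall>u v. 0 \<le> u \<and> u \<le> s \<and> s \<le> v \<and> v \<le> 1 \<and> v - u < d --> f (ga v) - f (ga u) \<le> (v - u) * (?l s + e)"
   by (intro exI[of _ d] conjI d(1) allI impI) (drule d(2), linarith)
 qed (use li in auto)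
 moreover have "(- f (ga 1)) - (- f (ga 0)) \<le> integral {0..1} ?l"
 proof (rule integral_comparison[where N="{}" and F="\<lambda>t. - f (ga t)"])
  fix s e :: real assume "s \<in> {0..1} - {}" "e > 0"
  then obtain d where d: "d > 0" "\<And>u v. 0 \<le> u \<and> u \<le> s \<and> s \<le> v \<and> v \<le> 1 \<and> v - u < d ==> \<bar>f (ga v) - f (ga u)\<bar> \<le> (v - u) * (?l s + e)"
   using str[of s e] by auto
  show "\<exists>d>0. \<forall>u v. 0 \<le> u \<and> u \<le> s \<and> s \<le> v \<and> v \<le> 1 \<and> v - u < d --> - f (ga v) - - f (ga u) \<le> (v - u) * (?l s + e)"
   by (intro exI[of _ d] conjI d(1) allI impI) (drule d(2), linarith)
 qed (use li in auto)
 ultimately show ?thesis unfolding curve_length_speed by linarith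
qed

end

section \<open>The Riemannian distance\<close>

text \<open>A smooth increasing map of the unit interval onto itself with derivative
  \<open>6 * t * (1 - t)\<close>. As this vanishes at both ends, curves reparametrized by it can be
  joined without a corner.\<close>

definition smoothstep :: "real => real" where "smoothstep t = t\<^sup>2 * (3 - 2 * t)"

lemma smoothstep_unit: assumes "t \<in> {0..1}" shows "smoothstep t \<in> {0..1}"
proof -
 have "1 - smoothstep t = (1 - t)\<^sup>2 * (1 + 2 * t)" by (simp add: smoothstep_def power2_eq_square algebra_simps)
 moreover have "0 \<le> (1 - t)\<^sup>2 * (1 + 2 * t)" using assms by simp
 ultimately have "smoothstep t \<le> 1" by linarith
 moreover have "0 \<le> smoothstep t" using assms by (simp add: smoothstep_def)
 ultimately show ?thesis by simp
qed

lemma smoothstep_ends [simp]: "smoothstep 0 = 0" "smoothstep 1 = 1" by (auto simp: smoothstep_def)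

lemma smoothstep_derivative:
 "((\<lambda>t. smoothstep (2 * t + b)) has_vector_derivative (2 * (6 * (2 * t + b) * (1 - (2 * t + b))))) (at t within S)"
 unfolding smoothstep_def has_real_derivative_iff_has_vector_derivative[symmetric]
 by (auto intro!: derivative_eq_intros simp: power2_eq_square algebra_simps)

context smooth_manifold
begin

lemma velocityI:
 assumes "continuous_on {0..1} ga" "c \<in> A" "t \<in> {0..1}" "ga t \<in> fst c"
  "((snd c \<circ> ga) has_vector_derivative w) (at t within {0..1})"
 shows "velocity A {0..1} ga t = tangent_from A c (ga t) w"
proof (rule velocity_eq)
 have "continuous (at t within {0..1}) ga" using assms by (simp add: continuous_on_eq_continuous_within)
 then show "has_velocity A {0..1} ga t (tangent_from A c (ga t) w)"
  using has_velocity_iff[of c ga t "{0..1}"] assms by simp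
 show "at t within {0..1} \<noteq> bot" using assms by (simp add: trivial_limit_within islimpt_Icc)
qed

text \<open>Finitely many neighbourhoods cover the manifold and the smallest of their constants
  works everywhere. All uniform constants are obtained from this one rule; a constant that has to be
  large is encoded as \<open>1 / d\<close>.\<close>

lemma compact_uniform:
 assumes loc: "\<And>z::'m. \<exists>U d. open U \<and> z \<in> U \<and> d > 0 \<and> (\<forall>w\<in>U. Q w d)"
  and mono: "\<And>w d d'. Q w d ==> 0 < d' ==> d' \<le> d ==> Q w d'"
 obtains d :: real where "d > 0" "\<And>w. Q w d"
proof -
 have "\<forall>z. \<exists>p. open (fst p) \<and> z \<in> fst p \<and> snd p > 0 \<and> (\<forall>w\<in>fst p. Q w (snd p))"
 proof
  fix z
  obtain U d where "open U" "z \<in> U" "d > 0" "\<forall>w\<in>U. Q w d" using loc[of z] by blast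
  then show "\<exists>p. open (fst p) \<and> z \<in> fst p \<and> snd p > 0 \<and> (\<forall>w\<in>fst p. Q w (snd p))"
   by (intro exI[of _ "(U, d)"]) simp
 qed
 from choice[OF this] obtain p where p: "\<And>z. open (fst (p z))" "\<And>z. z \<in> fst (p z)" "\<And>z. snd (p z) > 0"
  "\<And>z w. w \<in> fst (p z) ==> Q w (snd (p z))" by blast
 have "(UNIV::'m set) \<subseteq> (\<Union>z\<in>UNIV. fst (p z))" using p(2) by blast
 then obtain Z where "Z \<subseteq> UNIV" and Z: "finite Z" "(UNIV::'m set) \<subseteq> (\<Union>z\<in>Z. fst (p z))"
  by (rule compactE_image[OF compact_M p(1)])
 define d where "d = Min (insert 1 ((\<lambda>z. snd (p z)) ` Z))"
 have "d > 0" using Z p by (auto simp: d_def)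
 moreover have "Q w d" for w
 proof -
  obtain z where z: "z \<in> Z" "w \<in> fst (p z)" using Z by blast
  then have "d \<le> snd (p z)" using Z by (auto simp: d_def)
  then show ?thesis using mono p(4)[OF z(2)] \<open>d > 0\<close> by blast
 qed
 ultimately show thesis by (rule that)
qed

end

context riemannian_manifold
begin

abbreviation dm :: "'m => 'm => real" where "dm \<equiv> riem_dist A g"

text \<open>The distance is an infimum over C1 curves, so the triangle inequality needs a C1
  concatenation. Each half is reparametrized by \<open>smoothstep\<close>, which stops the curve at
  the junction, so both one-sided velocities vanish there in every chart; the lengths are unchanged
  by substitution.\<close>

lemma C1_concat:
 assumes ga1: "C1_curve A {0..1} ga1" and ga2: "C1_curve A {0..1} ga2" and eq: "ga1 1 = ga2 0"
 obtains ga where "C1_curve A {0..1} ga" "ga 0 = ga1 0" "ga 1 = ga2 1"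
  "curve_length A g ga = curve_length A g ga1 + curve_length A g ga2"
proof -
 define f1 where "f1 t = smoothstep (2 * t + 0)" for t
 define f2 where "f2 t = smoothstep (2 * t + (-1))" for t
 define d1 where "d1 t = 2 * (6 * (2 * t + 0) * (1 - (2 * t + 0)))" for t :: real
 define d2 where "d2 t = 2 * (6 * (2 * t + (-1)) * (1 - (2 * t + (-1))))" for t :: real
 define ga where "ga t = (if t \<le> 1/2 then ga1 (f1 t) else ga2 (f2 t))" for t
 have ff: "f1 t \<in> {0..1}" if "t \<in> {0..1/2}" for t unfolding f1_def by (rule smoothstep_unit) (use that in auto)
 have ff2: "f2 t \<in> {0..1}" if "t \<in> {1/2..1}" for t unfolding f2_def by (rule smoothstep_unit) (use that in auto)
 have dd: "(f1 has_vector_derivative d1 t) (at t within S)" "(f2 has_vector_derivative d2 t) (at t within S)" for t S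
  unfolding f1_def f2_def d1_def d2_def by (rule smoothstep_derivative)+
 have ends: "f1 0 = 0" "f1 (1/2) = 1" "f2 (1/2) = 0" "f2 1 = 1" "d1 (1/2) = 0" "d2 (1/2) = 0"
  by (auto simp: f1_def f2_def d1_def d2_def)
 have dnn: "t \<in> {0..1/2} ==> d1 t \<ge> 0" "t \<in> {1/2..1} ==> d2 t \<ge> 0" for t by (auto simp: d1_def d2_def)
 have cf: "continuous_on S f1" "continuous_on S f2" "continuous_on S d1" "continuous_on S d2" for S
  unfolding f1_def f2_def d1_def d2_def smoothstep_def by (intro continuous_intros)+
 have c12: "continuous_on {0..1} ga1" "continuous_on {0..1} ga2" using ga1 ga2 by (auto simp: C1_curve_def)
 have cont: "continuous_on {0..1} ga" unfolding ga_def
 proof (rule continuous_on_cases_le)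
  show "continuous_on {t \<in> {0..1}. t \<le> 1/2} (\<lambda>t. ga1 (f1 t))"
   by (rule continuous_on_compose2[OF c12(1) cf(1)]) (use ff in auto)
  show "continuous_on {t \<in> {0..1}. 1/2 \<le> t} (\<lambda>t. ga2 (f2 t))"
   by (rule continuous_on_compose2[OF c12(2) cf(2)]) (use ff2 in auto)
  fix t :: real assume "t = 1/2"
  show "ga1 (f1 t) = ga2 (f2 t)" unfolding \<open>t = 1/2\<close> ends by (rule eq)
 qed (rule continuous_on_id)
 have gaS: "ga t = ga1 (f1 t)" if "t \<in> {0..1/2}" for t using that by (simp add: ga_def)
 have gaT: "ga t = ga2 (f2 t)" if "t \<in> {1/2..1}" for t
 proof (cases "t = 1/2")
  case True
  show ?thesis unfolding True ga_def ends using eq by simp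
 qed (use that in \<open>auto simp: ga_def\<close>)
 have main: "\<exists>v. continuous_on {t\<in>{0..1}. ga t \<in> fst c} v \<and>
    (\<forall>t\<in>{0..1}. ga t \<in> fst c --> ((snd c \<circ> ga) has_vector_derivative v t) (at t within {0..1})) \<and>
    (\<forall>t\<in>{0..1}. ga t \<in> fst c --> sqrt (gc c (snd c (ga t)) (v t) (v t)) =
      (if t \<le> 1/2 then d1 t * speed (ga1 (f1 t)) (velocity A {0..1} ga1 (f1 t))
      else d2 t * speed (ga2 (f2 t)) (velocity A {0..1} ga2 (f2 t))))" if c: "c \<in> A" for c
 proof -
  obtain v1 where v1: "continuous_on {t\<in>{0..1}. ga1 t \<in> fst c} v1"
   "\<forall>t\<in>{0..1}. ga1 t \<in> fst c --> ((snd c \<circ> ga1) has_vector_derivative v1 t) (at t within {0..1})"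
   "\<forall>t\<in>{0..1}. ga1 t \<in> fst c --> tangent_in A c (ga1 t) (velocity A {0..1} ga1 t) = v1 t"
   by (rule C1_velocity[OF ga1 c])
  obtain v2 where v2: "continuous_on {t\<in>{0..1}. ga2 t \<in> fst c} v2"
   "\<forall>t\<in>{0..1}. ga2 t \<in> fst c --> ((snd c \<circ> ga2) has_vector_derivative v2 t) (at t within {0..1})"
   "\<forall>t\<in>{0..1}. ga2 t \<in> fst c --> tangent_in A c (ga2 t) (velocity A {0..1} ga2 t) = v2 t"
   by (rule C1_velocity[OF ga2 c])
  define w1 where "w1 t = d1 t *\<^sub>R v1 (f1 t)" for t
  define w2 where "w2 t = d2 t *\<^sub>R v2 (f2 t)" for t
  define v where "v t = (if t \<le> 1/2 then w1 t else w2 t)" for t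
  have mid: "w1 (1/2) = w2 (1/2)" by (simp add: w1_def w2_def ends)
  have "continuous_on {t\<in>{0..1}. ga t \<in> fst c} v" unfolding v_def
  proof (rule continuous_on_cases_le)
   show "continuous_on {t \<in> {t\<in>{0..1}. ga t \<in> fst c}. t \<le> 1/2} w1" unfolding w1_def
    by (intro continuous_on_scaleR cf continuous_on_compose2[OF v1(1)]) (use ff gaS in auto)
   show "continuous_on {t \<in> {t\<in>{0..1}. ga t \<in> fst c}. 1/2 \<le> t} w2" unfolding w2_def
    by (intro continuous_on_scaleR cf continuous_on_compose2[OF v2(1)]) (use ff2 gaT in auto)
   fix t :: real assume "t = 1/2"
   show "w1 t = w2 t" unfolding \<open>t = 1/2\<close> by (rule mid)
  qed (rule continuous_on_id)
  moreover have "((snd c \<circ> ga) has_vector_derivative v t) (at t within {0..1})" if t: "t \<in> {0..1}" "ga t \<in> fst c" for t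
  proof -
   let ?S = "{0..1/2::real}" and ?T = "{1/2..1::real}"
   have ST: "?S \<inter> ?T = {1/2}" "closure ?S = ?S" "closure ?T = ?T" by auto
   have dS: "(((snd c \<circ> ga1) \<circ> f1) has_vector_derivative w1 t) (at t within ?S)" if "t \<in> ?S"
    unfolding w1_def
   proof (rule vector_diff_chain_within[OF dd(1)])
    have "((snd c \<circ> ga1) has_vector_derivative v1 (f1 t)) (at (f1 t) within {0..1})"
     using v1(2) ff[OF that] t(2) gaS[OF that] by simp
    then show "((snd c \<circ> ga1) has_vector_derivative v1 (f1 t)) (at (f1 t) within f1 ` ?S)"
     by (rule has_vector_derivative_within_subset) (use ff in auto)
   qed
   have dT: "(((snd c \<circ> ga2) \<circ> f2) has_vector_derivative w2 t) (at t within ?T)" if "t \<in> ?T"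
    unfolding w2_def
   proof (rule vector_diff_chain_within[OF dd(2)])
    have "((snd c \<circ> ga2) has_vector_derivative v2 (f2 t)) (at (f2 t) within {0..1})"
     using v2(2) ff2[OF that] t(2) gaT[OF that] by simp
    then show "((snd c \<circ> ga2) has_vector_derivative v2 (f2 t)) (at (f2 t) within f2 ` ?T)"
     by (rule has_vector_derivative_within_subset) (use ff2 in auto)
   qed
   have U: "{0..1::real} = ?S \<union> ?T" by auto
   have S': "?S \<union> closure ?S \<inter> closure ?T = ?S" "?T \<union> closure ?S \<inter> closure ?T = ?T" by auto
   have "((\<lambda>x. if x \<in> ?S then ((snd c \<circ> ga1) \<circ> f1) x else ((snd c \<circ> ga2) \<circ> f2) x) has_vector_derivative (if t \<in> ?S then w1 t else w2 t)) (at t within {0..1})"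
   proof (rule has_vector_derivative_If_within_closures[OF _ U])
    show "t \<in> ?S \<union> ?T" using t by auto
    assume *: "t \<in> closure ?S" "t \<in> closure ?T"
    then have t2: "t = 1/2" by auto
    show "((snd c \<circ> ga1) \<circ> f1) t = ((snd c \<circ> ga2) \<circ> f2) t" unfolding t2 o_def ends using eq by simp
    show "w1 t = w2 t" unfolding t2 by (rule mid)
   qed (unfold S', (erule dS | erule dT)+)
   then have "((snd c \<circ> ga) has_vector_derivative (if t \<in> ?S then w1 t else w2 t)) (at t within {0..1})"
    by (rule has_vector_derivative_transform[OF t(1), rotated]) (auto simp: ga_def)
   then show ?thesis using t(1) by (simp add: v_def)
  qed
  moreover have "sqrt (gc c (snd c (ga t)) (v t) (v t)) =
      (if t \<le> 1/2 then d1 t * speed (ga1 (f1 t)) (velocity A {0..1} ga1 (f1 t))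
      else d2 t * speed (ga2 (f2 t)) (velocity A {0..1} ga2 (f2 t)))" if t: "t \<in> {0..1}" "ga t \<in> fst c" for t
  proof -
   have sc: "sqrt (gc c (snd c z) (a *\<^sub>R u) (a *\<^sub>R u)) = a * speed z w"
    if "z \<in> fst c" "a \<ge> 0" "tangent_in A c z w = u" for z a u w
    using speed_chart[OF c that(1), of "a *\<^sub>R w"] speed_scale[of z a w] that(2,3)
     linear_cmul[OF tangent_linear(1)[OF c that(1)], of a w] by simp
   show ?thesis
   proof (cases "t \<le> 1/2")
    case True
    then have tS: "t \<in> {0..1/2}" using t by auto
    have "tangent_in A c (ga1 (f1 t)) (velocity A {0..1} ga1 (f1 t)) = v1 (f1 t)"
     using v1(3) ff[OF tS] t(2) gaS[OF tS] by simp
    moreover have "ga1 (f1 t) \<in> fst c" using t(2) gaS[OF tS] by simp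
    ultimately show ?thesis using True sc[OF _ dnn(1)[OF tS]] gaS[OF tS] by (simp add: v_def w1_def)
   next
    case False
    then have tT: "t \<in> {1/2..1}" using t by auto
    have "tangent_in A c (ga2 (f2 t)) (velocity A {0..1} ga2 (f2 t)) = v2 (f2 t)"
     using v2(3) ff2[OF tT] t(2) gaT[OF tT] by simp
    moreover have "ga2 (f2 t) \<in> fst c" using t(2) gaT[OF tT] by simp
    ultimately show ?thesis using False sc[OF _ dnn(2)[OF tT]] gaT[OF tT] by (simp add: v_def w2_def)
   qed
  qed
  ultimately show ?thesis by blast
 qed
 have C1: "C1_curve A {0..1} ga" unfolding C1_curve_def using cont main by blast
 let ?sp = "\<lambda>ga t. speed (ga t) (velocity A {0..1} ga t)"
 have sp: "?sp ga t = (if t \<le> 1/2 then d1 t * ?sp ga1 (f1 t) else d2 t * ?sp ga2 (f2 t))" if t: "t \<in> {0..1}" for t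
 proof -
  let ?c = "chart_at A (ga t)"
  obtain v where v: "((snd ?c \<circ> ga) has_vector_derivative v t) (at t within {0..1})"
   "sqrt (gc ?c (snd ?c (ga t)) (v t) (v t)) = (if t \<le> 1/2 then d1 t * ?sp ga1 (f1 t) else d2 t * ?sp ga2 (f2 t))"
   using main[OF chart_at(1), of "ga t"] t chart_at(2)[of "ga t"] by blast
  have "velocity A {0..1} ga t = tangent_from A ?c (ga t) (v t)" by (rule velocityI[OF cont _ t _ v(1)]) auto
  then show ?thesis unfolding v(2)[symmetric] by (simp only: speed_chart[OF chart_at] tangent_in_from(1)[OF chart_at])
 qed
 have I1: "((\<lambda>t. d1 t *\<^sub>R ?sp ga1 (f1 t)) has_integral integral {f1 0..f1 (1/2)} (?sp ga1)) {0..1/2}"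
  by (rule has_integral_substitution[where c=0 and d=1])
    (use ends ff dd C1_speed_continuous[OF ga1] in \<open>auto simp: has_real_derivative_iff_has_vector_derivative\<close>)
 have I2: "((\<lambda>t. d2 t *\<^sub>R ?sp ga2 (f2 t)) has_integral integral {f2 (1/2)..f2 1} (?sp ga2)) {1/2..1}"
  by (rule has_integral_substitution[where c=0 and d=1])
    (use ends ff2 dd C1_speed_continuous[OF ga2] in \<open>auto simp: has_real_derivative_iff_has_vector_derivative\<close>)
 have "(?sp ga has_integral integral {0..1} (?sp ga1)) {0..1/2}"
  using I1 unfolding ends by (rule has_integral_eq[rotated]) (use sp in auto)
 moreover have "(?sp ga has_integral integral {0..1} (?sp ga2)) {1/2..1}" using I2 unfolding ends
 proof (rule has_integral_spike[rotated 2, where S="{1/2}"])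
  show "?sp ga t = d2 t *\<^sub>R ?sp ga2 (f2 t)" if "t \<in> {1/2..1} - {1/2}" for t using sp[of t] that by auto
 qed simp
 ultimately have "(?sp ga has_integral (integral {0..1} (?sp ga1) + integral {0..1} (?sp ga2))) {0..1}"
  by (rule has_integral_combine[of 0 "1/2" 1, rotated 2]) auto
 then have "curve_length A g ga = curve_length A g ga1 + curve_length A g ga2"
  unfolding curve_length_speed by (rule integral_unique)
 moreover have "ga 0 = ga1 0" "ga 1 = ga2 1" by (auto simp: ga_def ends)
 ultimately show thesis using C1 that by blast
qed

lemma segment_curve:
 assumes c: "c \<in> A" and K: "convex K" "K \<subseteq> cdom c" and M: "\<And>zt a. zt \<in> K ==> sqrt (gc c zt a a) \<le> M * norm a"
  and y: "y \<in> K" "y' \<in> K"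
 obtains ga where "C1_curve A {0..1} ga" "ga 0 = chart_inv c y" "ga 1 = chart_inv c y'" "curve_length A g ga \<le> M * norm (y' - y)"
proof -
 let ?ga = "\<lambda>t. chart_inv c (y + t *\<^sub>R (y' - y))"
 have inK: "y + t *\<^sub>R (y' - y) \<in> K" if "t \<in> {0..1}" for t
  using convexD_alt[OF K(1) y, of t] that by (simp add: algebra_simps)
 then have seg: "\<And>t. t \<in> {0..1} ==> y + t *\<^sub>R (y' - y) \<in> cdom c" using K by blast
 have C: "C1_curve A {0..1} ?ga" by (rule chart_segment_C1(1)[OF c seg])
 have Cv: "has_velocity A {0..1} ?ga t (tangent_from A c (?ga t) (y' - y))" if "t \<in> {0..1}" for t
  by (rule chart_segment_C1(2)[OF c seg that])
 have "curve_length A g ?ga \<le> integral {0..1} (\<lambda>t::real. M * norm (y' - y))" unfolding curve_length_speed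
 proof (rule integral_le)
  show "(\<lambda>t. speed (?ga t) (velocity A {0..1} ?ga t)) integrable_on {0..1}"
   by (rule integrable_continuous_real[OF C1_speed_continuous[OF C]])
  fix t :: real assume t: "t \<in> {0..1}"
  have "at t within {0..1} \<noteq> bot" using t by (simp add: trivial_limit_within islimpt_Icc)
  then have v: "velocity A {0..1} ?ga t = tangent_from A c (?ga t) (y' - y)" by (rule velocity_eq[OF Cv[OF t]])
  have z: "?ga t \<in> fst c" "snd c (?ga t) = y + t *\<^sub>R (y' - y)" using seg[OF t] c by auto
  show "speed (?ga t) (velocity A {0..1} ?ga t) \<le> M * norm (y' - y)"
   unfolding v speed_chart[OF c z(1)] tangent_in_from(1)[OF c z(1)] z(2) by (rule M[OF inK[OF t]])
 qed auto
 then have "curve_length A g ?ga \<le> M * norm (y' - y)" by simp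
 then show thesis using C by (intro that[of ?ga]) auto
qed

section \<open>Properties of the distance and its comparison with coordinates\<close>

definition joined :: "'m => 'm => bool" where
 "joined x y \<longleftrightarrow> (\<exists>\<gamma>. C1_curve A {0..1} \<gamma> \<and> \<gamma> 0 = x \<and> \<gamma> 1 = y)"

lemma joined_trans: "joined x y ==> joined y z ==> joined x z"
 unfolding joined_def by (metis C1_concat)

text \<open>Coordinate segments join nearby points, and connectedness does the rest. It ensures that
  the infimum defining the distance is over a nonempty set, without which lower bounds on lengths
  would not pass to \<open>dm\<close>.\<close>

lemma all_joined: "joined x y"
proof -
 let ?R = "\<lambda>x y. joined x y \<and> joined y x"
 have "?R x y"
 proof (rule connected_equivalence_relation[where R="?R", OF connected_M UNIV_I UNIV_I])
  fix z :: 'm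
  let ?c = "chart_at A z"
  obtain r where r: "r > 0" "cball (snd ?c z) r \<subseteq> cdom ?c" using chart_ball[of ?c z UNIV] by auto
  obtain M where M: "\<And>zt a. zt \<in> cball (snd ?c z) r ==> sqrt (gc ?c zt a a) \<le> M * norm a"
   using gc_bounds[OF chart_at(1)[of z] compact_cball r(2)] by metis
  have J: "joined (chart_inv ?c et) (chart_inv ?c et')" if et: "et \<in> cball (snd ?c z) r" "et' \<in> cball (snd ?c z) r" for et et'
  proof -
   obtain ga where "C1_curve A {0..1} ga" "ga 0 = chart_inv ?c et" "ga 1 = chart_inv ?c et'"
    "curve_length A g ga \<le> M * norm (et' - et)"
    by (rule segment_curve[OF chart_at(1)[of z] convex_cball r(2) M et])
   then show ?thesis unfolding joined_def by blast
  qed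
  let ?U = "chart_inv ?c ` ball (snd ?c z) r"
  have "open ?U" by (rule chart_image_open) (use r(2) ball_subset_cball in auto)
  moreover have "z \<in> ?U" using r(1) by (intro image_eqI[of _ _ "snd ?c z"]) auto
  moreover have "\<forall>w\<in>?U. ?R z w"
  proof
   fix w assume "w \<in> ?U"
   then obtain et where "et \<in> ball (snd ?c z) r" "w = chart_inv ?c et" by blast
   then show "?R z w" using J[of "snd ?c z" et] J[of et "snd ?c z"] r(1) by auto
  qed
  ultimately show "\<exists>T. openin (top_of_set UNIV) T \<and> z \<in> T \<and> (\<forall>x\<in>T. ?R z x)" by auto
 qed (auto intro: joined_trans)
 then show ?thesis by blast
qed

lemma dm_le_length:
 assumes "C1_curve A {0..1} c" shows "dm (c 0) (c 1) \<le> curve_length A g c" unfolding riem_dist_def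
 by (rule cInf_lower) (use assms in \<open>auto intro!: bdd_belowI[of _ 0] curve_length_nonneg\<close>)

lemma dm_greatest:
 assumes "\<And>c. C1_curve A {0..1} c ==> c 0 = x ==> c 1 = y ==> a \<le> curve_length A g c" shows "a \<le> dm x y"
 unfolding riem_dist_def
 by (rule cInf_greatest) (use assms all_joined[of x y] in \<open>auto simp: joined_def\<close>)

lemma dm_nonneg [simp]: "dm x y \<ge> 0" by (rule dm_greatest) (rule curve_length_nonneg)

lemma dm_approx:
 assumes "e > 0"
 obtains c where "C1_curve A {0..1} c" "c 0 = x" "c 1 = y" "curve_length A g c < dm x y + e"
proof -
 have "\<not> (\<forall>c. C1_curve A {0..1} c --> c 0 = x --> c 1 = y --> dm x y + e \<le> curve_length A g c)"
  using dm_greatest[of x y "dm x y + e"] assms by auto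
 then show thesis using that by (auto simp: not_le)
qed

lemma dm_triangle: "dm x z \<le> dm x y + dm y z"
proof (rule field_le_epsilon)
 fix e :: real assume "e > 0"
 then have e: "e / 2 > 0" by simp
 obtain c1 where 1: "C1_curve A {0..1} c1" "c1 0 = x" "c1 1 = y" "curve_length A g c1 < dm x y + e/2"
  by (rule dm_approx[OF e])
 obtain c2 where 2: "C1_curve A {0..1} c2" "c2 0 = y" "c2 1 = z" "curve_length A g c2 < dm y z + e/2"
  by (rule dm_approx[OF e])
 have "c1 1 = c2 0" using 1 2 by simp
 then obtain c where "C1_curve A {0..1} c" "c 0 = c1 0" "c 1 = c2 1"
  "curve_length A g c = curve_length A g c1 + curve_length A g c2" by (rule C1_concat[OF 1(1) 2(1)])
 then show "dm x z \<le> dm x y + dm y z + e" using dm_le_length[of c] 1 2 by simp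
qed

text \<open>The upper bound is the length of a coordinate segment. For the lower bound, the
  coordinate distance from \<open>y\<close>, cut off at the boundary of a ball, grows no faster than
  length; so a curve leaving the ball is at least \<open>m * r / 2\<close> long, and a shorter one
  gives the coordinate estimate. The variable \<open>e\<close> stands for the distance in either
  order, symmetry of \<open>dm\<close> being nowhere established.\<close>

lemma chart_dm:
 assumes c: "c \<in> A" "z \<in> fst c"
 obtains r m M where "r > 0" "m > 0" "M > 0" "cball (snd c z) r \<subseteq> cdom c"
  "\<forall>zt\<in>cball (snd c z) r. \<forall>a. m * norm a \<le> sqrt (gc c zt a a) \<and> sqrt (gc c zt a a) \<le> M * norm a"
  "\<forall>y\<in>cball (snd c z) r. \<forall>y'\<in>cball (snd c z) r. dm (chart_inv c y) (chart_inv c y') \<le> M * norm (y' - y)"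
  "\<forall>y\<in>cball (snd c z) (r/2). \<forall>w e. e < m * r / 2 \<and> (e = dm (chart_inv c y) w \<or> e = dm w (chart_inv c y)) -->
    w \<in> fst c \<and> snd c w \<in> cball (snd c z) r \<and> m * norm (snd c w - y) \<le> e"
proof -
 obtain r where r: "r > 0" "cball (snd c z) r \<subseteq> cdom c" using chart_ball[of c z UNIV] c by auto
 let ?B = "cball (snd c z) r"
 obtain m M where mM: "m > 0" "M > 0" "\<And>zt a. zt \<in> ?B ==> m * norm a \<le> sqrt (gc c zt a a)"
  "\<And>zt a. zt \<in> ?B ==> sqrt (gc c zt a a) \<le> M * norm a"
  using gc_bounds[OF c(1) compact_cball r(2)] by metis
 have up: "dm (chart_inv c y) (chart_inv c y') \<le> M * norm (y' - y)" if y: "y \<in> ?B" "y' \<in> ?B" for y y'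
 proof -
  obtain ga where "C1_curve A {0..1} ga" "ga 0 = chart_inv c y" "ga 1 = chart_inv c y'"
    "curve_length A g ga \<le> M * norm (y' - y)" by (rule segment_curve[OF c(1) convex_cball r(2) mM(4) y])
  then show ?thesis using dm_le_length[of ga] by simp
 qed
 have low: "w \<in> fst c \<and> snd c w \<in> ?B \<and> m * norm (snd c w - y) \<le> e"
  if y: "y \<in> cball (snd c z) (r/2)" and e: "e < m * r / 2" "e = dm (chart_inv c y) w \<or> e = dm w (chart_inv c y)" for y w e
 proof -
  let ?b = "cball y (r/2)"
  have bB: "?b \<subseteq> ?B"
  proof
   fix x assume "x \<in> ?b"
   then show "x \<in> ?B" using y dist_triangle[of "snd c z" x y] by (simp add: dist_commute)
  qed
  define Z where "Z = chart_inv c ` ?b"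
  have Zc: "closed Z" unfolding Z_def by (rule chart_image_compact) (use c bB r in auto)
  define f where "f x = (if x \<in> Z then m * norm (snd c x - y) else m * (r/2))" for x
  have ZI: "x \<in> Z \<longleftrightarrow> norm (snd c x - y) \<le> r/2" if "x \<in> fst c" for x
  proof
   assume "x \<in> Z"
   then obtain \<xi> where \<xi>: "\<xi> \<in> ?b" "x = chart_inv c \<xi>" unfolding Z_def by blast
   then have "\<xi> \<in> cdom c" using bB r(2) by blast
   then have "snd c x = \<xi>" using \<xi>(2) c(1) by simp
   then show "norm (snd c x - y) \<le> r/2" using \<xi>(1) by (simp add: dist_norm norm_minus_commute)
  next
   assume "norm (snd c x - y) \<le> r/2"
   then show "x \<in> Z" unfolding Z_def using that c
    by (intro image_eqI[of _ _ "snd c x"]) (auto simp: dist_norm norm_minus_commute)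
  qed
  have fmin: "f x = m * min (norm (snd c x - y)) (r/2)" if "x \<in> fst c" for x
   using ZI[OF that] by (auto simp: f_def min_def)
  have Zf: "x \<in> fst c \<and> snd c x \<in> ?b" if "x \<in> Z" for x using that bB r c unfolding Z_def by auto
  have dom: "\<bar>f (ga 1) - f (ga 0)\<bar> \<le> curve_length A g ga" if ga: "C1_curve A {0..1} ga" for ga
  proof (rule length_dominates[OF ga])
   fix x
   show "\<exists>W. open W \<and> x \<in> W \<and> ((\<forall>z'\<in>W. f z' = f x) \<or> (\<exists>c\<in>A. \<exists>m>0. x \<in> fst c \<and> W \<subseteq> fst c \<and>
     (\<forall>a. m * norm a \<le> sqrt (gc c (snd c x) a a)) \<and>
     (\<forall>z'\<in>W. \<forall>z''\<in>W. \<bar>f z'' - f z'\<bar> \<le> m * norm (snd c z'' - snd c z'))))"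
   proof (cases "x \<in> Z")
    case False
    have "open (- Z)" using Zc by (rule open_Compl)
    moreover have "\<forall>z'\<in>- Z. f z' = f x" using False by (simp add: f_def)
    ultimately show ?thesis using False by blast
   next
    case True
    then have x: "x \<in> fst c" "snd c x \<in> ?B" using Zf[OF True] bB by blast+
    have L: "\<bar>f z'' - f z'\<bar> \<le> m * norm (snd c z'' - snd c z')" if "z' \<in> fst c" "z'' \<in> fst c" for z' z''
    proof -
     have "\<bar>min (norm (snd c z'' - y)) (r/2) - min (norm (snd c z' - y)) (r/2)\<bar> \<le> \<bar>norm (snd c z'' - y) - norm (snd c z' - y)\<bar>"
      by (auto simp: min_def)
     also have "\<dots> \<le> norm (snd c z'' - snd c z')"
      using norm_triangle_ineq3[of "snd c z'' - y" "snd c z' - y"] by simp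
     finally have "m * \<bar>min (norm (snd c z'' - y)) (r/2) - min (norm (snd c z' - y)) (r/2)\<bar> \<le> m * norm (snd c z'' - snd c z')"
      using mM(1) by simp
     then show ?thesis unfolding fmin[OF that(1)] fmin[OF that(2)] right_diff_distrib[symmetric]
      using mM(1) by (simp add: abs_mult)
    qed
    show ?thesis
     by (rule exI[of _ "fst c"], intro conjI disjI2 bexI[of _ c] exI[of _ m] chart_open(1)[OF c(1)] x(1) ballI allI L)
       (use mM x c in auto)
   qed
  qed
  have f0: "f (chart_inv c y) = 0"
  proof -
   have "y \<in> cdom c" using y r by (auto simp: subset_iff)
   then show ?thesis using fmin[of "chart_inv c y"] c r(1) by simp
  qed
  have fn: "f w \<ge> 0" using mM r by (auto simp: f_def)
  have "f w \<le> dm (chart_inv c y) w"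
  proof (rule dm_greatest)
   fix ga assume "C1_curve A {0..1} ga" "ga 0 = chart_inv c y" "ga 1 = w"
   then show "f w \<le> curve_length A g ga" using dom[of ga] f0 by simp
  qed
  moreover have "f w \<le> dm w (chart_inv c y)"
  proof (rule dm_greatest)
   fix ga assume "C1_curve A {0..1} ga" "ga 0 = w" "ga 1 = chart_inv c y"
   then show "f w \<le> curve_length A g ga" using dom[of ga] f0 by simp
  qed
  ultimately have fe: "f w \<le> e" using e(2) by auto
  then have "w \<in> Z" using e(1) by (auto simp: f_def split: if_splits)
  then show ?thesis using Zf[of w] bB fe by (auto simp: f_def)
 qed
 show thesis by (rule that[OF r(1) mM(1,2) r(2)]) (use mM up low in blast)+
qed

definition chart_box :: "('m, 'e) chart => 'm => real => real => real => bool" where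
 "chart_box c z r m M \<longleftrightarrow> r > 0 \<and>
   m > 0 \<and>
   M > 0 \<and>
   cball (snd c z) r \<subseteq> cdom c \<and>
   (\<forall>\<zeta>\<in>cball (snd c z) r. \<forall>a. m * norm a \<le> sqrt (gc c \<zeta> a a) \<and> sqrt (gc c \<zeta> a a) \<le> M * norm a) \<and>
   (\<forall>\<eta>\<in>cball (snd c z) r. \<forall>\<eta>'\<in>cball (snd c z) r. dm (chart_inv c \<eta>) (chart_inv c \<eta>') \<le> M * norm (\<eta>' - \<eta>)) \<and>
   (\<forall>\<eta>\<in>cball (snd c z) (r/2). \<forall>w e. e < m * r / 2 \<and> (e = dm (chart_inv c \<eta>) w \<or> e = dm w (chart_inv c \<eta>)) -->
    w \<in> fst c \<and> snd c w \<in> cball (snd c z) r \<and> m * norm (snd c w - \<eta>) \<le> e)"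

lemma chart_boxD:
 assumes "chart_box c z r m M"
 shows "r > 0" "m > 0" "M > 0" "cball (snd c z) r \<subseteq> cdom c"
  "\<forall>zt\<in>cball (snd c z) r. \<forall>a. m * norm a \<le> sqrt (gc c zt a a) \<and> sqrt (gc c zt a a) \<le> M * norm a"
  "\<forall>y\<in>cball (snd c z) r. \<forall>y'\<in>cball (snd c z) r. dm (chart_inv c y) (chart_inv c y') \<le> M * norm (y' - y)"
  "\<forall>y\<in>cball (snd c z) (r/2). \<forall>w e. e < m * r / 2 \<and> (e = dm (chart_inv c y) w \<or> e = dm w (chart_inv c y)) -->
    w \<in> fst c \<and> snd c w \<in> cball (snd c z) r \<and> m * norm (snd c w - y) \<le> e"
 using assms unfolding chart_box_def by blast+

lemma chart_box_exists:
 assumes c: "c \<in> A" "z \<in> fst c"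
 obtains r m M where "chart_box c z r m M"
proof -
 obtain r m M where "r > 0" "m > 0" "M > 0" "cball (snd c z) r \<subseteq> cdom c"
  "\<forall>zt\<in>cball (snd c z) r. \<forall>a. m * norm a \<le> sqrt (gc c zt a a) \<and> sqrt (gc c zt a a) \<le> M * norm a"
  "\<forall>y\<in>cball (snd c z) r. \<forall>y'\<in>cball (snd c z) r. dm (chart_inv c y) (chart_inv c y') \<le> M * norm (y' - y)"
  "\<forall>y\<in>cball (snd c z) (r/2). \<forall>w e. e < m * r / 2 \<and> (e = dm (chart_inv c y) w \<or> e = dm w (chart_inv c y)) -->
    w \<in> fst c \<and> snd c w \<in> cball (snd c z) r \<and> m * norm (snd c w - y) \<le> e"
  by (rule chart_dm[OF c])
 then have "chart_box c z r m M" unfolding chart_box_def by (intro conjI)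
 then show thesis by (rule that)
qed

lemma dm_self [simp]: "dm x x = 0"
proof -
 obtain r m M where "r > 0" and M: "\<forall>y\<in>cball (snd (chart_at A x) x) r. \<forall>y'\<in>cball (snd (chart_at A x) x) r.
   dm (chart_inv (chart_at A x) y) (chart_inv (chart_at A x) y') \<le> M * norm (y' - y)"
  by (rule chart_dm[OF chart_at[of x]])
 then have "dm x x \<le> 0" using M[rule_format, of "snd (chart_at A x) x" "snd (chart_at A x) x"] by simp
 then show ?thesis using dm_nonneg[of x x] by linarith
qed

text \<open>Small distance confines a point to a small coordinate ball by the lower bound of
  \<open>chart_boxD\<close>. Together with \<open>dm_continuous_nbhd\<close> this identifies the
  topology of the distance with that of the manifold.\<close>

lemma dm_small_in_open:
 assumes "open U" "z \<in> U"
 obtains ep where "ep > 0" "\<And>w. dm z w < ep \<or> dm w z < ep ==> w \<in> U"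
proof -
 let ?c = "chart_at A z"
 obtain r m M where "chart_box (chart_at A z) z r m M" by (rule chart_box_exists[OF chart_at[of z]])
 note r = chart_boxD[OF this]
 obtain r' where r': "r' > 0" "cball (snd ?c z) r' \<subseteq> cdom ?c" "chart_inv ?c ` cball (snd ?c z) r' \<subseteq> U"
  by (rule chart_ball[OF chart_at(1) chart_at(2) assms])
 show thesis
 proof (rule that[of "min (m * r / 2) (m * r')"])
  fix w assume "dm z w < min (m * r / 2) (m * r') \<or> dm w z < min (m * r / 2) (m * r')"
  then obtain e where e: "e < m * r / 2" "e < m * r'" "e = dm z w \<or> e = dm w z" by auto
  have "w \<in> fst ?c \<and> snd ?c w \<in> cball (snd ?c z) r \<and> m * norm (snd ?c w - snd ?c z) \<le> e"
   using r(7)[rule_format, of "snd ?c z" e w] e r(1) by simp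
  then have w: "w \<in> fst ?c" "m * norm (snd ?c w - snd ?c z) < m * r'" using e by auto
  then have "norm (snd ?c w - snd ?c z) < r'" using r(2) by simp
  then have "snd ?c w \<in> cball (snd ?c z) r'" by (simp add: dist_norm norm_minus_commute)
  then have "chart_inv ?c (snd ?c w) \<in> U" using r'(3) by blast
  then show "w \<in> U" using w(1) by simp
 qed (use r r' in auto)
qed

lemma dm_continuous_nbhd:
 assumes "e > 0"
 obtains U where "open U" "z \<in> U" "\<And>w w'. w \<in> U ==> w' \<in> U ==> dm w w' < e"
proof -
 let ?c = "chart_at A z"
 obtain r m M where r: "r > 0" "m > 0" "M > 0" "cball (snd ?c z) r \<subseteq> cdom ?c"
  "\<forall>zt\<in>cball (snd ?c z) r. \<forall>a. m * norm a \<le> sqrt (gc ?c zt a a) \<and> sqrt (gc ?c zt a a) \<le> M * norm a"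
  "\<forall>y\<in>cball (snd ?c z) r. \<forall>y'\<in>cball (snd ?c z) r. dm (chart_inv ?c y) (chart_inv ?c y') \<le> M * norm (y' - y)"
  by (rule chart_dm[OF chart_at[of z]])
 define rh where "rh = min r (e / (4 * M))"
 have rh: "rh > 0" "rh \<le> r" "rh \<le> e / (4 * M)" using r assms by (auto simp: rh_def)
 show thesis
 proof (rule that[of "chart_inv ?c ` ball (snd ?c z) rh"])
  show "open (chart_inv ?c ` ball (snd ?c z) rh)"
  proof (rule chart_image_open)
   have "ball (snd ?c z) rh \<subseteq> cball (snd ?c z) r" using rh by auto
   then show "ball (snd ?c z) rh \<subseteq> cdom ?c" using r(4) by blast
  qed auto
  show "z \<in> chart_inv ?c ` ball (snd ?c z) rh" using rh by (intro image_eqI[of _ _ "snd ?c z"]) auto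
  fix w w' assume "w \<in> chart_inv ?c ` ball (snd ?c z) rh" "w' \<in> chart_inv ?c ` ball (snd ?c z) rh"
  then obtain y y' where y: "y \<in> ball (snd ?c z) rh" "y' \<in> ball (snd ?c z) rh" "w = chart_inv ?c y" "w' = chart_inv ?c y'" by blast
  then have "dm w w' \<le> M * norm (y' - y)" using r(6) rh by auto
  also have "norm (y' - y) < 2 * rh"
   using y(1,2) dist_triangle_less_add[of y' "snd ?c z" rh y rh] by (simp add: dist_commute dist_norm)
  then have "M * norm (y' - y) < M * (2 * rh)" using r(3) by simp
  also have "\<dots> \<le> M * (2 * (e / (4 * M)))" using rh(3) r(3) by (intro mult_left_mono) auto
  also have "\<dots> < e" using r(3) assms by simp
  finally show "dm w w' < e" .
 qed
qed

end

section \<open>The Lagrangian in charts\<close>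

locale tonelli_manifold = riemannian_manifold A g
 for A :: "('m::t2_space, 'e::euclidean_space) chart set" and g :: "'m => 'e => 'e => real" +
 fixes H :: "'m => 'e => real"
 assumes tonelli: "tonelli_hamiltonian A g H"
begin

definition Hc :: "('m, 'e) chart => 'e \<times> 'e => real" where
 "Hc c = (\<lambda>(\<zeta>, q). H (chart_inv c \<zeta>) (cotangent_from A c (chart_inv c \<zeta>) q))"

definition dHc :: "('m, 'e) chart => 'e \<times> 'e => 'e \<times> 'e => real" where
 "dHc c x = frechet_derivative (Hc c) (at x)"

text \<open>The gradient of \<open>Hc c\<close> in the momentum variable, that is \<open>Hp\<close>
  in coordinates. It is assembled from the partial derivatives, because those are what
  \<open>Ck_on\<close> declares continuous.\<close>

definition hv :: "('m, 'e) chart => 'e => 'e => 'e" where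
 "hv c \<zeta> q = (\<Sum>i\<in>Basis. dHc c (\<zeta>, q) (0, i) *\<^sub>R i)"

definition Lc :: "('m, 'e) chart => 'e => 'e => real" where
 "Lc c \<zeta> w = lagrangian H (chart_inv c \<zeta>) (tangent_from A c (chart_inv c \<zeta>) w)"

lemma Hc_derivative:
 assumes "c \<in> A"
 shows "z \<in> cdom c ==> (Hc c has_derivative dHc c (z, q)) (at (z, q))"
  and "continuous_on (cdom c \<times> UNIV) (\<lambda>x. dHc c x v)"
proof -
 have "Ck_on 2 (Hc c) (cdom c \<times> UNIV)" using tonelli assms by (simp add: tonelli_hamiltonian_def Hc_def)
 moreover have "open (cdom c \<times> (UNIV::'e set))" using chart_open(2)[OF assms] by (intro open_Times) auto
 ultimately show "z \<in> cdom c ==> (Hc c has_derivative dHc c (z, q)) (at (z, q))"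
  "continuous_on (cdom c \<times> UNIV) (\<lambda>x. dHc c x v)"
  using Ck2_derivative[of "Hc c" "cdom c \<times> UNIV"] unfolding dHc_def by auto
qed

lemma hv_continuous:
 assumes "c \<in> A" shows "continuous_on (cdom c \<times> UNIV) (\<lambda>(z, q). hv c z q)"
proof -
 have "continuous_on (cdom c \<times> UNIV) (\<lambda>x. \<Sum>i\<in>Basis. dHc c x (0, i) *\<^sub>R i)"
  by (intro continuous_intros Hc_derivative(2)[OF assms])
 then show ?thesis by (rule continuous_on_eq) (auto simp: hv_def)
qed

lemma hv_gradient:
 assumes "c \<in> A" "z \<in> cdom c"
 shows "GDERIV (\<lambda>q. Hc c (z, q)) q :> hv c z q"
proof -
 have D: "(Hc c has_derivative dHc c (z, q)) (at (z, q))" by (rule Hc_derivative(1)[OF assms])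
 have P: "((\<lambda>q. (z, q)) has_derivative (\<lambda>v. (0, v))) (at q)" by (auto intro!: derivative_eq_intros)
 have "((\<lambda>q. Hc c (z, q)) has_derivative (\<lambda>v. dHc c (z, q) (0, v))) (at q)"
  using diff_chain_at[OF P D] by (simp add: o_def)
 moreover have "dHc c (z, q) (0, v) = v \<bullet> hv c z q" for v
 proof -
  have "linear (\<lambda>v. dHc c (z, q) (0, v))"
   using linear_compose[of "\<lambda>v. (0, v)" "dHc c (z, q)"] has_derivative_bounded_linear[OF D]
    has_derivative_bounded_linear[OF P] by (auto simp: o_def bounded_linear.linear)
  from Linear_Algebra.linear_componentwise[OF this, of v 1] show ?thesis
   by (simp add: hv_def inner_sum_right mult.commute)
 qed
 ultimately show ?thesis by (simp add: gderiv_def inner_commute)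
qed

lemma cotangent_from_inverse:
 assumes "c \<in> A" "z \<in> fst c"
 shows "adjoint (tangent_from A c z) (cotangent_from A c z q) = q"
proof -
 have "adjoint (tangent_from A c z) (cotangent_from A c z q) \<bullet> w = q \<bullet> w" for w
  using adjoint_works[OF tangent_linear(2)[OF assms], of w "cotangent_from A c z q"] assms
  by (simp add: cotangent_from_inner inner_commute)
 then show ?thesis by (metis vector_eq_rdot)
qed

lemma H_chart:
 assumes "c \<in> A" "z \<in> fst c"
 shows "H z p = Hc c (snd c z, adjoint (tangent_from A c z) p)" using assms by (simp add: Hc_def cotangent_from_surj)

text \<open>\<open>H z\<close> is the coordinate Hamiltonian composed with the linear map sending a
  covector to its coordinates in \<open>c\<close>. That map is the adjoint of
  \<open>tangent_from\<close>, so its own adjoint carries the gradient back as a tangent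
  vector.\<close>

lemma Hp_gradient:
 assumes c: "c \<in> A" "z \<in> fst c"
 shows "GDERIV (H z) (cotangent_from A c z q) :> tangent_from A c z (hv c (snd c z) q)"
  "Hp H z (cotangent_from A c z q) = tangent_from A c z (hv c (snd c z) q)"
proof -
 let ?B = "adjoint (tangent_from A c z)"
 have l: "linear (tangent_from A c z)" by (rule tangent_linear[OF c])
 have D: "(?B has_derivative ?B) (at (cotangent_from A c z q))"
  by (rule bounded_linear_imp_has_derivative) (simp add: linear_linear adjoint_linear[OF l])
 have "GDERIV (\<lambda>q. Hc c (snd c z, q)) (?B (cotangent_from A c z q)) :> hv c (snd c z) q"
  using hv_gradient[of c "snd c z" q] c by (simp add: cotangent_from_inverse)
 from GDERIV_adjoint[OF this D]
 have "GDERIV ((\<lambda>q. Hc c (snd c z, q)) \<circ> ?B) (cotangent_from A c z q) :> tangent_from A c z (hv c (snd c z) q)"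
  by (simp add: adjoint_adjoint[OF l])
 moreover have "(\<lambda>q. Hc c (snd c z, q)) \<circ> ?B = H z" using H_chart[OF c] by (auto simp: fun_eq_iff)
 ultimately show *: "GDERIV (H z) (cotangent_from A c z q) :> tangent_from A c z (hv c (snd c z) q)" by simp
 show "Hp H z (cotangent_from A c z q) = tangent_from A c z (hv c (snd c z) q)"
  unfolding Hp_def by (rule the_GDERIV[OF *])
qed

lemma conorm_ge:
 assumes c: "c \<in> A" "zt \<in> cdom c" and m: "m > 0" "M > 0"
  and b: "\<And>a. m * norm a \<le> sqrt (gc c zt a a)" "\<And>a. sqrt (gc c zt a a) \<le> M * norm a"
 shows "norm q / M \<le> conorm g (chart_inv c zt) (cotangent_from A c (chart_inv c zt) q)"
proof -
 let ?z = "chart_inv c zt"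
 let ?S = "{cotangent_from A c ?z q \<bullet> v | v. g ?z v v \<le> 1}"
 have z: "?z \<in> fst c" "snd c ?z = zt" using c by auto
 have "bdd_above ?S"
 proof (rule bdd_aboveI[of _ "norm q * (1 / m)"])
  fix x assume "x \<in> ?S"
  then obtain v where v: "x = cotangent_from A c ?z q \<bullet> v" "g ?z v v \<le> 1" by blast
  have "m * norm (tangent_in A c ?z v) \<le> speed ?z v" unfolding speed_chart[OF c(1) z(1)] z(2) by (rule b)
  also have "\<dots> \<le> 1" using v(2) by (simp add: speed_def)
  finally have "norm (tangent_in A c ?z v) \<le> 1 / m" using m by (simp add: field_simps)
  then have "norm q * norm (tangent_in A c ?z v) \<le> norm q * (1 / m)" by (intro mult_left_mono) auto
  moreover have "x \<le> norm q * norm (tangent_in A c ?z v)"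
   unfolding v(1) cotangent_from_inner[OF c(1) z(1)] by (rule norm_cauchy_schwarz)
  ultimately show "x \<le> norm q * (1 / m)" by linarith
 qed
 moreover have "norm q / M \<in> ?S"
 proof -
  \<comment> \<open>The direction of \<open>q\<close>, scaled to have Riemannian norm at most
    1.\<close>
  let ?w = "(1 / M) *\<^sub>R sgn q"
  have "norm ?w \<le> 1 / M" using m by (simp add: norm_sgn)
  then have "M * norm ?w \<le> 1" using m by (simp add: field_simps)
  then have "sqrt (gc c zt ?w ?w) \<le> 1" using b(2)[of ?w] by linarith
  then have "g ?z (tangent_from A c ?z ?w) (tangent_from A c ?z ?w) \<le> 1" by (simp add: gc_def)
  moreover have "cotangent_from A c ?z q \<bullet> tangent_from A c ?z ?w = norm q / M"
  proof -
   have "q \<bullet> sgn q = norm q" by (cases "q = 0") (auto simp: sgn_div_norm dot_square_norm power2_eq_square)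
   then show ?thesis unfolding cotangent_from_inner[OF c(1) z(1)] tangent_in_from(1)[OF c(1) z(1)] by simp
  qed
  ultimately show ?thesis by (intro CollectI exI[of _ "tangent_from A c ?z ?w"]) auto
 qed
 ultimately show ?thesis unfolding conorm_def by (rule cSup_upper[rotated])
qed

lemma Hc_superlinear:
 assumes c: "c \<in> A" and B: "compact B" "B \<subseteq> cdom c" and K: "K \<ge> 0"
 obtains C where "C \<ge> 0" "\<And>z q. z \<in> B ==> Hc c (z, q) \<ge> K * norm q - C"
proof -
 obtain m M where mM: "m > 0" "M > 0" "\<And>z a. z \<in> B ==> m * norm a \<le> sqrt (gc c z a a)"
  "\<And>z a. z \<in> B ==> sqrt (gc c z a a) \<le> M * norm a" using gc_bounds[OF c B] by metis
 obtain C where C: "\<And>x p. H x p \<ge> (K * M) * conorm g x p - C"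
  using tonelli mM(2) K unfolding tonelli_hamiltonian_def by (meson mult_nonneg_nonneg less_imp_le)
 show thesis
 proof (rule that[of "\<bar>C\<bar>"])
  fix z q :: 'e assume z: "z \<in> B"
  let ?p = "cotangent_from A c (chart_inv c z) q"
  have "norm q / M \<le> conorm g (chart_inv c z) ?p"
   by (rule conorm_ge[OF c _ mM(1,2) mM(3)[OF z] mM(4)[OF z]]) (use z B in auto)
  then have "(K * M) * (norm q / M) \<le> (K * M) * conorm g (chart_inv c z) ?p"
   using K mM(2) by (intro mult_left_mono) auto
  moreover have "(K * M) * (norm q / M) = K * norm q" using mM(2) by simp
  ultimately show "Hc c (z, q) \<ge> K * norm q - \<bar>C\<bar>" using C[of "chart_inv c z" ?p] by (simp add: Hc_def)
 qed simp
qed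

lemma Lc_eq:
 assumes "c \<in> A" "zt \<in> cdom c"
 shows "Lc c zt w = (SUP q. q \<bullet> w - Hc c (zt, q))"
proof -
 let ?z = "chart_inv c zt"
 have z: "?z \<in> fst c" "snd c ?z = zt" using assms by auto
 have "range (\<lambda>p. p \<bullet> tangent_from A c ?z w - H ?z p) = range (\<lambda>q. q \<bullet> w - Hc c (zt, q))"
 proof (intro set_eqI iffI)
  fix x assume "x \<in> range (\<lambda>p. p \<bullet> tangent_from A c ?z w - H ?z p)"
  then obtain p where p: "x = p \<bullet> tangent_from A c ?z w - H ?z p" by blast
  let ?q = "adjoint (tangent_from A c ?z) p"
  have "p \<bullet> tangent_from A c ?z w = ?q \<bullet> w"
   using adjoint_works[OF tangent_linear(2)[OF assms(1) z(1)], of w p] by (simp add: inner_commute)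
  then show "x \<in> range (\<lambda>q. q \<bullet> w - Hc c (zt, q))"
   unfolding p H_chart[OF assms(1) z(1)] z(2) by auto
 next
  fix x assume "x \<in> range (\<lambda>q. q \<bullet> w - Hc c (zt, q))"
  then obtain q where q: "x = q \<bullet> w - Hc c (zt, q)" by blast
  have "x = cotangent_from A c ?z q \<bullet> tangent_from A c ?z w - H ?z (cotangent_from A c ?z q)"
   unfolding q cotangent_from_inner[OF assms(1) z(1)] tangent_in_from(1)[OF assms(1) z(1)] by (simp add: Hc_def)
  then show "x \<in> range (\<lambda>p. p \<bullet> tangent_from A c ?z w - H ?z p)" by blast
 qed
 then show ?thesis unfolding Lc_def lagrangian_def by simp
qed

text \<open>Superlinearity is used at rate \<open>\<bar>W\<bar> + 1\<close>, one more than the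
  pairing can grow. The surplus \<open>norm q\<close> makes the supremum defining the Lagrangian
  finite and lets \<open>Lc_lipschitz\<close> discard large momenta.\<close>

lemma Lc_upper:
 assumes c: "c \<in> A" and B: "compact B" "B \<subseteq> cdom c"
 obtains C where "C \<ge> 0" "\<And>z q w. z \<in> B ==> norm w \<le> W ==> q \<bullet> w - Hc c (z, q) \<le> C - norm q"
proof -
 obtain C where C: "C \<ge> 0" "\<And>z q. z \<in> B ==> Hc c (z, q) \<ge> (\<bar>W\<bar> + 1) * norm q - C"
  using Hc_superlinear[OF c B, of "\<bar>W\<bar> + 1"] by auto
 show thesis
 proof (rule that[OF C(1)])
  fix z q w :: 'e assume z: "z \<in> B" and w: "norm w \<le> W"
  have "q \<bullet> w \<le> norm q * norm w" by (rule norm_cauchy_schwarz)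
  also have "\<dots> \<le> norm q * \<bar>W\<bar>" using w by (intro mult_left_mono) auto
  finally show "q \<bullet> w - Hc c (z, q) \<le> C - norm q" using C(2)[OF z, of q] by (simp add: algebra_simps)
 qed
qed

lemma fenchel:
 assumes c: "c \<in> A" "z \<in> cdom c"
 shows "q \<bullet> w - Hc c (z, q) \<le> Lc c z w"
proof -
 have "compact {z}" "{z} \<subseteq> cdom c" using c by auto
 then obtain C where C: "\<And>\<xi> q v. \<xi> \<in> {z} ==> norm v \<le> norm w ==> q \<bullet> v - Hc c (\<xi>, q) \<le> C - norm q"
  using Lc_upper[OF c(1), of "{z}" "norm w"] by metis
 have "bdd_above (range (\<lambda>q. q \<bullet> w - Hc c (z, q)))"
 proof (rule bdd_aboveI[of _ C])
  fix x assume "x \<in> range (\<lambda>q. q \<bullet> w - Hc c (z, q))"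
  then obtain q where "x = q \<bullet> w - Hc c (z, q)" by blast
  moreover have "q \<bullet> w - Hc c (z, q) \<le> C - norm q" by (rule C) auto
  ultimately show "x \<le> C" using norm_ge_zero[of q] by linarith
 qed
 then show ?thesis unfolding Lc_eq[OF c] by (rule cSUP_upper[rotated]) simp
qed

lemma Lc_le:
 assumes c: "c \<in> A" "z \<in> cdom c" and "\<And>q. q \<bullet> w - Hc c (z, q) \<le> C"
 shows "Lc c z w \<le> C" unfolding Lc_eq[OF c] by (rule cSUP_least) (use assms in auto)

lemma Hc_bounded:
 assumes c: "c \<in> A" and B: "compact B" "B \<subseteq> cdom c"
 obtains C where "C \<ge> 0" "\<And>z q. z \<in> B ==> norm q \<le> R ==> \<bar>Hc c (z, q)\<bar> \<le> C"
proof -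
 have "continuous_on (B \<times> cball 0 R) (Hc c)"
  by (intro continuous_at_imp_continuous_on ballI) (use Hc_derivative(1)[OF c] B in \<open>force intro: has_derivative_continuous\<close>)
 then have "bounded (Hc c ` (B \<times> cball 0 R))"
  using B by (intro compact_imp_bounded compact_continuous_image compact_Times) auto
 then obtain C where C: "\<And>x. x \<in> B \<times> cball 0 R ==> \<bar>Hc c x\<bar> \<le> C" unfolding bounded_iff by auto
 show thesis
 proof (rule that[of "max C 0"])
  fix z q :: 'e assume "z \<in> B" "norm q \<le> R"
  then have "(z, q) \<in> B \<times> cball 0 R" by simp
  from C[OF this] show "\<bar>Hc c (z, q)\<bar> \<le> max C 0" by linarith
 qed simp
qed

lemma Lc_bounded:
 assumes c: "c \<in> A" and B: "compact B" "B \<subseteq> cdom c"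
 obtains C where "C \<ge> 0" "\<And>z w. z \<in> B ==> norm w \<le> W ==> \<bar>Lc c z w\<bar> \<le> C"
proof -
 obtain C1 where C1: "C1 \<ge> 0" "\<And>z q w. z \<in> B ==> norm w \<le> W ==> q \<bullet> w - Hc c (z, q) \<le> C1 - norm q"
  using Lc_upper[OF c B, of W] by metis
 obtain C2 where C2: "C2 \<ge> 0" "\<And>z q. z \<in> B ==> norm q \<le> 0 ==> \<bar>Hc c (z, q)\<bar> \<le> C2"
  using Hc_bounded[OF c B, of 0] by metis
 show thesis
 proof (rule that[of "C1 + C2"])
  fix z w :: 'e assume z: "z \<in> B" and w: "norm w \<le> W"
  have z': "z \<in> cdom c" using z B by auto
  have "Lc c z w \<le> C1"
  proof (rule Lc_le[OF c z'])
   fix q show "q \<bullet> w - Hc c (z, q) \<le> C1" using C1(2)[OF z w, of q] norm_ge_zero[of q] by linarith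
  qed
  moreover have "- C2 \<le> Lc c z w" using fenchel[OF c z', of 0 w] C2(2)[OF z, of 0] by simp
  ultimately show "\<bar>Lc c z w\<bar> \<le> C1 + C2" using C1 C2 by linarith
 qed (use C1 C2 in auto)
qed

text \<open>For velocities bounded by \<open>W\<close>, momenta beyond radius \<open>R\<close> give
  less than the lower bound \<open>- C2\<close> of the Lagrangian. On the remaining compact set of
  momenta the Hamiltonian is Lipschitz in the position, and a supremum of functions with a common
  Lipschitz constant inherits it. No Legendre transform is inverted.\<close>

lemma Lc_lipschitz:
 assumes c: "c \<in> A" and B: "compact B" "convex B" "B \<subseteq> cdom c"
 obtains C where "C \<ge> 0" "\<And>z z' w. z \<in> B ==> z' \<in> B ==> norm w \<le> W ==> \<bar>Lc c z w - Lc c z' w\<bar> \<le> C * norm (z - z')"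
proof -
 obtain C1 where C1: "C1 \<ge> 0" "\<And>z q w. z \<in> B ==> norm w \<le> W ==> q \<bullet> w - Hc c (z, q) \<le> C1 - norm q"
  using Lc_upper[OF c B(1,3), of W] by metis
 obtain C2 where C2: "C2 \<ge> 0" "\<And>z w. z \<in> B ==> norm w \<le> W ==> \<bar>Lc c z w\<bar> \<le> C2"
  using Lc_bounded[OF c B(1,3), of W] by metis
 define R where "R = C1 + C2"
 let ?K = "B \<times> cball (0::'e) R"
 have Kd: "?K \<subseteq> cdom c \<times> UNIV" using B by auto
 obtain C where C: "C \<ge> 0" "\<And>x y. x \<in> ?K ==> y \<in> ?K ==> \<bar>Hc c x - Hc c y\<bar> \<le> C * norm (x - y)"
 proof (rule lipschitz_on_compact_convex[of ?K "Hc c" "dHc c"])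
  show "(Hc c has_derivative dHc c x) (at x)" if "x \<in> ?K" for x
   using Hc_derivative(1)[OF c, of "fst x" "snd x"] that B by auto
  show "continuous_on ?K (\<lambda>x. dHc c x v)" for v by (rule continuous_on_subset[OF Hc_derivative(2)[OF c] Kd])
  show "compact ?K" "convex ?K" using B by (auto intro: compact_Times convex_Times)
 qed blast
 have half: "Lc c z w \<le> Lc c z' w + C * norm (z - z')" if "z \<in> B" "z' \<in> B" "norm w \<le> W" for z z' w
 proof (rule Lc_le[OF c])
  show "z \<in> cdom c" using that B by auto
  have d': "z' \<in> cdom c" using that B by auto
  fix q
  show "q \<bullet> w - Hc c (z, q) \<le> Lc c z' w + C * norm (z - z')"
  proof (cases "norm q \<le> R")
   case True
   then have "\<bar>Hc c (z, q) - Hc c (z', q)\<bar> \<le> C * norm ((z, q) - (z', q))"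
    using that by (intro C(2)) auto
   then show ?thesis using fenchel[OF c d', of q w] by (simp add: norm_Pair)
  next
   case False
   then have "q \<bullet> w - Hc c (z, q) \<le> - C2" using C1(2)[OF that(1,3), of q] by (simp add: R_def)
   moreover have "- C2 \<le> Lc c z' w" using C2(2)[OF that(2,3)] by linarith
   moreover have "0 \<le> C * norm (z - z')" using C(1) by simp
   ultimately show ?thesis by linarith
  qed
 qed
 show thesis
 proof (rule that[OF C(1)])
  fix z z' w :: 'e assume "z \<in> B" "z' \<in> B" "norm w \<le> W"
  then show "\<bar>Lc c z w - Lc c z' w\<bar> \<le> C * norm (z - z')"
   using half[of z z' w] half[of z' z w] by (simp add: norm_minus_commute)
 qed
qed

lemma Lc_superlinear:
 assumes c: "c \<in> A" and B: "compact B" "B \<subseteq> cdom c" and K: "K \<ge> 0"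
 obtains C where "C \<ge> 0" "\<And>z w. z \<in> B ==> Lc c z w \<ge> K * norm w - C"
proof -
 obtain C where C: "C \<ge> 0" "\<And>z q. z \<in> B ==> norm q \<le> K ==> \<bar>Hc c (z, q)\<bar> \<le> C"
  using Hc_bounded[OF c B, of K] by metis
 show thesis
 proof (rule that[OF C(1)])
  fix z w :: 'e assume z: "z \<in> B"
  \<comment> \<open>The supremum is tested with the momentum of norm at most \<open>K\<close> that
    points in the direction of \<open>w\<close>.\<close>
  let ?q = "K *\<^sub>R sgn w"
  have "sgn w \<bullet> w = norm w" by (cases "w = 0") (auto simp: sgn_div_norm dot_square_norm power2_eq_square)
  then have "?q \<bullet> w = K * norm w" by simp
  moreover have "norm ?q \<le> K" using K by (auto simp: norm_sgn)
  then have "\<bar>Hc c (z, ?q)\<bar> \<le> C" by (rule C(2)[OF z])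
  moreover have "?q \<bullet> w - Hc c (z, ?q) \<le> Lc c z w" by (rule fenchel[OF c]) (use z B in auto)
  ultimately show "Lc c z w \<ge> K * norm w - C" by linarith
 qed
qed

lemma Lc_convex:
 assumes c: "c \<in> A" "z \<in> cdom c" and s: "0 \<le> s" "s \<le> 1"
 shows "Lc c z (s *\<^sub>R w) \<le> s * Lc c z w + (1 - s) * Lc c z 0"
proof (rule Lc_le[OF c])
 fix q
 have "s * (q \<bullet> w - Hc c (z, q)) \<le> s * Lc c z w" using s by (intro mult_left_mono fenchel[OF c]) auto
 moreover have "(1 - s) * (q \<bullet> 0 - Hc c (z, q)) \<le> (1 - s) * Lc c z 0" using s by (intro mult_left_mono fenchel[OF c]) auto
 ultimately show "q \<bullet> (s *\<^sub>R w) - Hc c (z, q) \<le> s * Lc c z w + (1 - s) * Lc c z 0" by (simp add: algebra_simps)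
qed

text \<open>Truncating a large velocity saves action at rate \<open>K\<close>; this replaces the a priori velocity bound
  for minimizers.\<close>

lemma Lc_truncate:
 assumes c: "c \<in> A" and B: "compact B" "B \<subseteq> cdom c" and K: "K \<ge> 0"
 obtains W where "W > 0" "\<And>z w. z \<in> B ==> \<exists>w'. norm w' \<le> W \<and> Lc c z w' + K * norm (w - w') \<le> Lc c z w"
proof -
 obtain C0 where C0: "C0 \<ge> 0" "\<And>z w. z \<in> B ==> norm w \<le> 0 ==> \<bar>Lc c z w\<bar> \<le> C0"
  using Lc_bounded[OF c B, of 0] by metis
 obtain C1 where C1: "C1 \<ge> 0" "\<And>z w. z \<in> B ==> Lc c z w \<ge> (K + 1) * norm w - C1"
  using Lc_superlinear[OF c B, of "K + 1"] K by auto
 \<comment> \<open>With this radius the Lagrangian rises by at least \<open>K * W\<close> from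
   velocity 0 to norm \<open>W\<close>. By convexity along the ray its slope beyond that sphere is
   at least \<open>K\<close>, so cutting \<open>w\<close> back to the sphere gains \<open>K\<close>
   per unit of norm.\<close>
 define W where "W = C0 + C1 + 1"
 have W: "W > 0" using C0 C1 by (simp add: W_def)
 show thesis
 proof (rule that[OF W])
  fix z w :: 'e assume z: "z \<in> B"
  show "\<exists>w'. norm w' \<le> W \<and> Lc c z w' + K * norm (w - w') \<le> Lc c z w"
  proof (cases "norm w \<le> W")
   case True then show ?thesis by (intro exI[of _ w]) simp
  next
   case False
   define s where "s = W / norm w"
   have nw: "norm w > 0" using False W by linarith
   have s: "0 < s" "s < 1" "s * norm w = W" using False W nw by (auto simp: s_def)
   let ?w = "s *\<^sub>R w"
   have nW: "norm ?w = W" using s by simp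
   have l0: "\<bar>Lc c z 0\<bar> \<le> C0" using C0(2)[OF z, of 0] by simp
   have "Lc c z ?w \<ge> (K + 1) * W - C1" using C1(2)[OF z, of ?w] unfolding nW .
   then have a: "Lc c z ?w - Lc c z 0 \<ge> K * W" using l0 by (simp add: W_def algebra_simps)
   have "Lc c z ?w \<le> s * Lc c z w + (1 - s) * Lc c z 0" by (rule Lc_convex[OF c]) (use s z B in auto)
   then have "(1 - s) * (Lc c z ?w - Lc c z 0) \<le> s * (Lc c z w - Lc c z ?w)" by (simp add: algebra_simps)
   moreover have "(1 - s) * (K * W) \<le> (1 - s) * (Lc c z ?w - Lc c z 0)" using a s by (intro mult_left_mono) auto
   ultimately have "(1 - s) * (K * W) \<le> s * (Lc c z w - Lc c z ?w)" by linarith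
   then have "s * ((1 - s) * K * norm w) \<le> s * (Lc c z w - Lc c z ?w)" using s(3) by (simp add: algebra_simps)
   then have "(1 - s) * K * norm w \<le> Lc c z w - Lc c z ?w" using s(1) by simp
   moreover have "norm (w - ?w) = (1 - s) * norm w"
   proof -
    have "w - ?w = (1 - s) *\<^sub>R w" by (simp add: algebra_simps)
    then show ?thesis using s by simp
   qed
   ultimately have "K * norm (w - ?w) \<le> Lc c z w - Lc c z ?w" by (simp add: mult.assoc mult.left_commute)
   then show ?thesis using nW by (intro exI[of _ ?w] conjI) linarith+
  qed
 qed
qed

lemma lagrangian_chart:
 assumes "c \<in> A" "z \<in> fst c" shows "lagrangian H z v = Lc c (snd c z) (tangent_in A c z v)"
 using assms by (simp add: Lc_def)

text \<open>Local superlinearity in coordinates, with speed and coordinate norm comparable, made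
  uniform by compactness. The subtracted constant appears as \<open>1 / d\<close> to fit
  \<open>compact_uniform\<close>; locally it is \<open>C + 1\<close>, which cannot vanish.\<close>

lemma lagrangian_superlinear:
 assumes K: "K \<ge> 0"
 obtains C where "C > 0" "\<And>z v. lagrangian H z v \<ge> K * speed z v - C"
proof -
 obtain d where d: "d > 0" "\<And>z. \<forall>v. lagrangian H z v \<ge> K * speed z v - 1 / d"
 proof (rule compact_uniform[of "\<lambda>z d. \<forall>v. lagrangian H z v \<ge> K * speed z v - 1 / d"])
  fix z
  let ?c = "chart_at A z"
  obtain r where r: "r > 0" "cball (snd ?c z) r \<subseteq> cdom ?c" "chart_inv ?c ` cball (snd ?c z) r \<subseteq> UNIV"
   by (rule chart_ball[OF chart_at(1) chart_at(2) open_UNIV UNIV_I])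
  obtain m M where mM: "m > 0" "M > 0" "\<And>zt a. zt \<in> cball (snd ?c z) r ==> m * norm a \<le> sqrt (gc ?c zt a a)"
   "\<And>zt a. zt \<in> cball (snd ?c z) r ==> sqrt (gc ?c zt a a) \<le> M * norm a"
   using gc_bounds[OF chart_at(1)[of z] compact_cball r(2)] by metis
  obtain C where C: "C \<ge> 0" "\<And>zt w. zt \<in> cball (snd ?c z) r ==> Lc ?c zt w \<ge> (K * M) * norm w - C"
   using Lc_superlinear[OF chart_at(1)[of z] compact_cball r(2), of "K * M"] K mM(2) by (metis mult_nonneg_nonneg less_imp_le)
  let ?U = "chart_inv ?c ` ball (snd ?c z) r"
  have "open ?U" by (rule chart_image_open) (use r(2) ball_subset_cball in auto)
  moreover have "z \<in> ?U" using r(1) by (intro image_eqI[of _ _ "snd ?c z"]) auto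
  moreover have "\<forall>w\<in>?U. \<forall>v. lagrangian H w v \<ge> K * speed w v - 1 / (1 / (C + 1))"
  proof (intro ballI allI)
   fix w v assume "w \<in> ?U"
   then obtain y where y: "y \<in> ball (snd ?c z) r" "w = chart_inv ?c y" by blast
   then have y': "y \<in> cball (snd ?c z) r" "y \<in> cdom ?c" using r(2) by auto
   then have w: "w \<in> fst ?c" "snd ?c w = y" using y(2) by auto
   let ?a = "tangent_in A ?c w v"
   have "K * speed w v \<le> K * (M * norm ?a)"
    unfolding speed_chart[OF chart_at(1) w(1)] w(2) using K mM(4)[OF y'(1)] by (intro mult_left_mono) auto
   then show "lagrangian H w v \<ge> K * speed w v - 1 / (1 / (C + 1))"
    using C(2)[OF y'(1), of ?a] unfolding lagrangian_chart[OF chart_at(1) w(1)] w(2) by (simp add: algebra_simps)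
  qed
  ultimately show "\<exists>U d. open U \<and> z \<in> U \<and> 0 < d \<and> (\<forall>w\<in>U. \<forall>v. lagrangian H w v \<ge> K * speed w v - 1 / d)"
   using C(1) by (intro exI[of _ ?U] exI[of _ "1 / (C + 1)"]) auto
 next
  fix w d d' assume *: "\<forall>v. K * speed w v - 1 / d \<le> lagrangian H w v" "0 < d'" "d' \<le> (d::real)"
  then have "1 / d \<le> 1 / d'" by (intro divide_left_mono) auto
  show "\<forall>v. K * speed w v - 1 / d' \<le> lagrangian H w v"
  proof
   fix v
   have "K * speed w v - 1 / d \<le> lagrangian H w v" using * by blast
   then show "K * speed w v - 1 / d' \<le> lagrangian H w v" using \<open>1 / d \<le> 1 / d'\<close> by linarith
  qed
 qed blast
 show thesis by (rule that[of "1 / d"]) (use d in auto)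
qed

end

section \<open>Absolutely continuous curves and their action\<close>

text \<open>A velocity depends on the interval within which it is taken only at the end points.
  Cutting and gluing curves therefore changes their Lagrangian only at finitely many times.\<close>

lemma vector_derivative_interior:
 fixes f :: "real => 'b::real_normed_vector"
 assumes "a < s" "s < b" shows "vector_derivative f (at s within {a..b}) = vector_derivative f (at s)"
 using at_within_Icc_at[OF assms] by simp

lemma vector_derivative_shift:
 fixes f :: "real => 'b::real_normed_vector"
 shows "vector_derivative (\<lambda>r. f (r + s)) (at r) = vector_derivative f (at (r + s))"
proof -
 have "((\<lambda>r. f (r + s)) has_vector_derivative v) (at r) \<longleftrightarrow> (f has_vector_derivative v) (at (r + s))" for v
 proof
  assume "(f has_vector_derivative v) (at (r + s))"
  moreover have "((\<lambda>r. r + s) has_vector_derivative 1) (at r)"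
   by (auto intro!: derivative_eq_intros simp: has_vector_derivative_def)
  ultimately show "((\<lambda>r. f (r + s)) has_vector_derivative v) (at r)"
   using vector_diff_chain_at[of "\<lambda>r. r + s" 1 r f v] by (simp add: o_def)
 next
  assume "((\<lambda>r. f (r + s)) has_vector_derivative v) (at r)"
  moreover have "((\<lambda>r. r - s) has_vector_derivative 1) (at (r + s))"
   by (auto intro!: derivative_eq_intros simp: has_vector_derivative_def)
  ultimately show "(f has_vector_derivative v) (at (r + s))"
   using vector_diff_chain_at[of "\<lambda>r. r - s" 1 "r + s" "\<lambda>r. f (r + s)" v] by (simp add: o_def)
 qed
 then show ?thesis by (simp add: vector_derivative_def)
qed

lemma vector_derivative_cong:
 fixes f :: "real => 'b::real_normed_vector"
 assumes "open S" "s \<in> S" "\<And>r. r \<in> S ==> f r = h r"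
 shows "vector_derivative f (at s) = vector_derivative h (at s)"
proof (rule vector_derivative_cong_eq)
 show "\<forall>\<^sub>F r in nhds s. r \<in> UNIV --> f r = h r"
  using assms unfolding eventually_nhds by blast
qed auto

text \<open>The action is a Lebesgue integral, while the arguments below use gauge integrals. For
  functions bounded below on a compact interval, as the Lagrangian along a curve is, gauge
  integrability implies Lebesgue integrability: after adding a constant the function is
  nonnegative.\<close>

lemma integrable_bounded_below:
 fixes f :: "real => real"
 assumes f: "f integrable_on {a..b}" and C: "\<And>s. s \<in> {a..b} ==> f s \<ge> - C"
 shows "integrable (lebesgue_on {a..b}) f"
proof -
 have "(\<lambda>s. f s + C) integrable_on {a..b}" using f by (intro integrable_add) auto
 then have "(\<lambda>s. f s + C) absolutely_integrable_on {a..b}"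
  by (rule nonnegative_absolutely_integrable_1) (use C in force)
 moreover have "(\<lambda>s::real. C) absolutely_integrable_on {a..b}" by (rule absolutely_integrable_on_const) simp
 ultimately have "(\<lambda>s. (f s + C) - C) absolutely_integrable_on {a..b}" by (rule set_integral_diff(1))
 then show ?thesis by (intro absolutely_integrable_imp_integrable) auto
qed

section \<open>Absolute continuity with respect to the distance\<close>

context riemannian_manifold
begin

abbreviation acc :: "real => (real => 'm) => bool" where "acc \<equiv> abs_continuous_curve A g"

definition subintervals :: "nat => (nat => real) => (nat => real) => real => bool" where
 "subintervals n a b t \<longleftrightarrow> (\<forall>i<n. 0 \<le> a i \<and> a i \<le> b i \<and> b i \<le> t) \<and> disjoint_family_on (\<lambda>i. {a i<..<b i}) {..<n}"

lemma acc_iff: "acc t \<xi> \<longleftrightarrow> (\<forall>e>0. \<exists>d>0. \<forall>n a b. subintervals n a b t \<and> (\<Sum>i<n. b i - a i) < d -->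
  (\<Sum>i<n. dm (\<xi> (a i)) (\<xi> (b i))) < e)"
 unfolding abs_continuous_curve_def subintervals_def conj_assoc by (rule refl)

lemma accE:
 assumes "acc t \<xi>" "e > 0"
 obtains d where "d > 0" "\<And>n a b. subintervals n a b t ==> (\<Sum>i<n. b i - a i) < d ==> (\<Sum>i<n. dm (\<xi> (a i)) (\<xi> (b i))) < e"
 using assms unfolding acc_iff by meson

lemma acc_window:
 assumes \<xi>: "acc t \<xi>" and p: "0 \<le> p" "p + s \<le> t"
 shows "acc s (\<lambda>r. \<xi> (r + p))" unfolding acc_iff
proof (intro allI impI)
 fix e :: real assume "e > 0"
 then obtain d where d: "d > 0" "\<And>n a b. subintervals n a b t ==> (\<Sum>i<n. b i - a i) < d ==> (\<Sum>i<n. dm (\<xi> (a i)) (\<xi> (b i))) < e"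
  using accE[OF \<xi>] by metis
 have "(\<Sum>i<n. dm (\<xi> (a i + p)) (\<xi> (b i + p))) < e" if *: "subintervals n a b s" "(\<Sum>i<n. b i - a i) < d" for n a b
 proof (rule d(2)[of n "\<lambda>i. a i + p" "\<lambda>i. b i + p"])
  have "\<forall>i<n. 0 \<le> a i + p \<and> a i + p \<le> b i + p \<and> b i + p \<le> t" using * p unfolding subintervals_def by force
  moreover have "{a i + p<..<b i + p} \<inter> {a j + p<..<b j + p} = {}" if ij: "i < n" "j < n" "i \<noteq> j" for i j
  proof (rule equals0I)
   fix x assume "x \<in> {a i + p<..<b i + p} \<inter> {a j + p<..<b j + p}"
   then have "x - p \<in> {a i<..<b i} \<inter> {a j<..<b j}" by auto
   then show False using *(1) ij unfolding subintervals_def disjoint_family_on_def by blast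
  qed
  ultimately show "subintervals n (\<lambda>i. a i + p) (\<lambda>i. b i + p) t" unfolding subintervals_def disjoint_family_on_def by simp
 qed (use * in auto)
 then show "\<exists>d>0. \<forall>n a b. subintervals n a b s \<and> (\<Sum>i<n. b i - a i) < d --> (\<Sum>i<n. dm (\<xi> (a i + p)) (\<xi> (b i + p))) < e"
  using d(1) by blast
qed

lemma acc_family:
 assumes "acc t \<xi>" shows "ac_family (\<lambda>u v. dm (\<xi> u) (\<xi> v)) 0 t" unfolding ac_family_def
proof (intro allI impI)
 fix e :: real assume "e > 0"
 then obtain d where d: "d > 0" "\<And>(n::nat) a b. (\<forall>i<n. 0 \<le> a i \<and> a i \<le> b i \<and> b i \<le> t) ==>
    disjoint_family_on (\<lambda>i. {a i<..<b i}) {..<n} ==> (\<Sum>i<n. b i - a i) < d ==>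
    (\<Sum>i<n. dm (\<xi> (a i)) (\<xi> (b i))) < e" using assms unfolding abs_continuous_curve_def by meson
 show "\<exists>d>0. \<forall>D. D division_of \<Union>D \<and> \<Union>D \<subseteq> {0..t} \<and> (\<Sum>K\<in>D. measure lborel K) < d -->
   (\<Sum>K\<in>D. dm (\<xi> (Inf K)) (\<xi> (Sup K))) < e"
 proof (intro exI[of _ d] conjI d(1) allI impI)
  fix D assume "D division_of \<Union>D \<and> \<Union>D \<subseteq> {0..t} \<and> (\<Sum>K\<in>D. measure lborel K) < d"
  then have D: "D division_of \<Union>D" "\<Union>D \<subseteq> {0..t}" "(\<Sum>K\<in>D. measure lborel K) < d" by auto
  have fin: "finite D" using D(1) by (rule division_of_finite)
  obtain h where h: "bij_betw h {0..<card D} D" using ex_bij_betw_nat_finite[OF fin] by blast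
  then have h': "bij_betw h {..<card D} D" by (simp add: atLeast0LessThan)
  have iv: "K = {Inf K..Sup K} \<and> Inf K \<le> Sup K \<and> 0 \<le> Inf K \<and> Sup K \<le> t" if K: "K \<in> D" for K
  proof -
   obtain u v where uv: "K = {u..v}" using division_ofD(4)[OF D(1) K] by auto
   have ne: "u \<le> v" using division_ofD(3)[OF D(1) K] uv by auto
   have "K \<subseteq> {0..t}" using K D(2) by auto
   then show ?thesis using uv ne by auto
  qed
  have hD: "h i \<in> D" if "i < card D" for i using h' that by (auto simp: bij_betw_def)
  have "(\<Sum>i<card D. dm (\<xi> (Inf (h i))) (\<xi> (Sup (h i)))) < e"
  proof (rule d(2))
   show "\<forall>i<card D. 0 \<le> Inf (h i) \<and> Inf (h i) \<le> Sup (h i) \<and> Sup (h i) \<le> t" using iv hD by blast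
   show "disjoint_family_on (\<lambda>i. {Inf (h i)<..<Sup (h i)}) {..<card D}" unfolding disjoint_family_on_def
   proof (intro ballI impI)
    fix i j assume ij: "i \<in> {..<card D}" "j \<in> {..<card D}" "i \<noteq> j"
    then have "h i \<noteq> h j" using h' by (auto simp: bij_betw_def inj_on_def)
    then have "interior (h i) \<inter> interior (h j) = {}" using division_ofD(5)[OF D(1)] hD ij by auto
    moreover have "{Inf K<..<Sup K} = interior K" if "K \<in> D" for K
     using iv[OF that] by (metis interior_atLeastAtMost_real)
    ultimately show "{Inf (h i)<..<Sup (h i)} \<inter> {Inf (h j)<..<Sup (h j)} = {}" using hD ij by auto
   qed
   have "(\<Sum>i<card D. Sup (h i) - Inf (h i)) = (\<Sum>K\<in>D. Sup K - Inf K)"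
    by (rule sum.reindex_bij_betw[OF h'])
   also have "\<dots> = (\<Sum>K\<in>D. measure lborel K)"
   proof (rule sum.cong[OF refl])
    fix K assume "K \<in> D"
    from iv[OF this] obtain u v where "K = {u..v}" "u \<le> v" by blast
    then show "Sup K - Inf K = measure lborel K" by simp
   qed
   finally show "(\<Sum>i<card D. Sup (h i) - Inf (h i)) < d" using D(3) by simp
  qed
  then show "(\<Sum>K\<in>D. dm (\<xi> (Inf K)) (\<xi> (Sup K))) < e"
   using sum.reindex_bij_betw[OF h', of "\<lambda>K. dm (\<xi> (Inf K)) (\<xi> (Sup K))"] by simp
 qed
qed

lemma ac_family_subinterval:
 assumes "ac_family \<Phi> a b" "a \<le> a'" "b' \<le> b" shows "ac_family \<Phi> a' b'" unfolding ac_family_def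
proof (intro allI impI)
 fix e :: real assume "e > 0"
 then obtain d where d: "d > 0" "\<And>D. D division_of \<Union>D ==> \<Union>D \<subseteq> {a..b} ==> (\<Sum>K\<in>D. measure lborel K) < d ==> (\<Sum>K\<in>D. \<Phi> (Inf K) (Sup K)) < e"
  using assms(1) unfolding ac_family_def by meson
 have "{a'..b'} \<subseteq> {a..b}" using assms by auto
 then show "\<exists>d>0. \<forall>D. D division_of \<Union>D \<and> \<Union>D \<subseteq> {a'..b'} \<and> (\<Sum>K\<in>D. measure lborel K) < d --> (\<Sum>K\<in>D. \<Phi> (Inf K) (Sup K)) < e"
  by (intro exI[of _ d] conjI d(1) allI impI d(2)) (auto elim: subset_trans)
qed

lemma acc_uniform:
 assumes "acc t \<xi>" "e > 0"
 obtains d where "d > 0" "\<And>u v. 0 \<le> u ==> u \<le> v ==> v \<le> t ==> v - u < d ==> dm (\<xi> u) (\<xi> v) < e"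
proof -
 obtain d where d: "d > 0" "\<And>(n::nat) a b. (\<forall>i<n. 0 \<le> a i \<and> a i \<le> b i \<and> b i \<le> t) ==>
    disjoint_family_on (\<lambda>i. {a i<..<b i}) {..<n} ==> (\<Sum>i<n. b i - a i) < d ==>
    (\<Sum>i<n. dm (\<xi> (a i)) (\<xi> (b i))) < e" using assms unfolding abs_continuous_curve_def by meson
 show thesis
 proof (rule that[OF d(1)])
  fix u v assume "0 \<le> u" "u \<le> v" "v \<le> t" "v - u < d"
  then show "dm (\<xi> u) (\<xi> v) < e"
   using d(2)[of 1 "\<lambda>_. u" "\<lambda>_. v"] by (simp add: disjoint_family_on_def)
 qed
qed

lemma acc_near:
 assumes \<xi>: "acc t \<xi>" "s \<in> {0..t}" and U: "open U" "\<xi> s \<in> U"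
 obtains d where "d > 0" "\<And>r. r \<in> {0..t} ==> \<bar>r - s\<bar> < d ==> \<xi> r \<in> U"
proof -
 obtain e where e: "e > 0" "\<And>w. dm (\<xi> s) w < e \<or> dm w (\<xi> s) < e ==> w \<in> U"
  using dm_small_in_open[OF U] by metis
 obtain d where d: "d > 0" "\<And>u v. 0 \<le> u ==> u \<le> v ==> v \<le> t ==> v - u < d ==> dm (\<xi> u) (\<xi> v) < e"
  using acc_uniform[OF \<xi>(1) e(1)] by metis
 show thesis
 proof (rule that[OF d(1)])
  fix r assume r: "r \<in> {0..t}" "\<bar>r - s\<bar> < d"
  show "\<xi> r \<in> U"
  proof (cases "r \<le> s")
   case True then show ?thesis using d(2)[of r s] e(2)[of "\<xi> r"] r \<xi>(2) by auto
  next
   case False then show ?thesis using d(2)[of s r] e(2)[of "\<xi> r"] r \<xi>(2) by auto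
  qed
 qed
qed

lemma acc_continuous: assumes "acc t \<xi>" shows "continuous_on {0..t} \<xi>" unfolding continuous_on_topological
proof (intro ballI allI impI)
 fix s B assume "s \<in> {0..t}" "open B" "\<xi> s \<in> B"
 then obtain d where "d > 0" "\<And>r. r \<in> {0..t} ==> \<bar>r - s\<bar> < d ==> \<xi> r \<in> B"
  using acc_near[OF assms] by metis
 then show "\<exists>A. open A \<and> s \<in> A \<and> (\<forall>y\<in>{0..t}. y \<in> A --> \<xi> y \<in> B)"
  by (intro exI[of _ "ball s d"]) (auto simp: dist_real_def abs_minus_commute)
qed

text \<open>By uniform continuity the curve moves less than \<open>m * r / 2\<close> in a short
  time, too little to leave the chart from the half-size ball; there the lower bound of
  \<open>chart_boxD\<close> compares coordinates with the distance.\<close>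

lemma acc_chart_bound:
 assumes \<xi>: "acc t \<xi>" and c: "c \<in> A" "z \<in> fst c"
 obtains r C dl where "r > 0" "cball (snd c z) r \<subseteq> cdom c" "C > 0" "dl > 0"
  "\<forall>u v. 0 \<le> u \<and> u \<le> v \<and> v \<le> t \<and> v - u < dl \<and> \<xi> u \<in> fst c \<and> snd c (\<xi> u) \<in> cball (snd c z) r -->
    norm (snd c (\<xi> v) - snd c (\<xi> u)) \<le> C * dm (\<xi> u) (\<xi> v)"
proof -
 obtain r m M where "chart_box c z r m M" by (rule chart_box_exists[OF c])
 note r = chart_boxD[OF this]
 have "m * r / 2 > 0" using r by simp
 then obtain dl where dl: "dl > 0" "\<And>u v. 0 \<le> u ==> u \<le> v ==> v \<le> t ==> v - u < dl ==> dm (\<xi> u) (\<xi> v) < m * r / 2"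
  using acc_uniform[OF \<xi>] by metis
 show thesis
 proof (rule that[of "r/2" "1/m" dl])
  show "cball (snd c z) (r/2) \<subseteq> cdom c" by (rule order_trans[OF subset_cball r(4)]) (use r(1) in auto)
  show "\<forall>u v. 0 \<le> u \<and> u \<le> v \<and> v \<le> t \<and> v - u < dl \<and> \<xi> u \<in> fst c \<and> snd c (\<xi> u) \<in> cball (snd c z) (r/2) -->
    norm (snd c (\<xi> v) - snd c (\<xi> u)) \<le> 1 / m * dm (\<xi> u) (\<xi> v)"
  proof (intro allI impI)
   fix u v assume uv: "0 \<le> u \<and> u \<le> v \<and> v \<le> t \<and> v - u < dl \<and> \<xi> u \<in> fst c \<and> snd c (\<xi> u) \<in> cball (snd c z) (r/2)"
   have d: "dm (\<xi> u) (\<xi> v) < m * r / 2" using dl(2)[of u v] uv by simp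
   have u: "\<xi> u \<in> fst c" "snd c (\<xi> u) \<in> cball (snd c z) (r/2)" using uv by auto
   have "m * norm (snd c (\<xi> v) - snd c (\<xi> u)) \<le> dm (\<xi> u) (\<xi> v)"
    using r(7)[rule_format, OF u(2), of "dm (\<xi> u) (\<xi> v)" "\<xi> v"] d u(1) c(1) by simp
   then show "norm (snd c (\<xi> v) - snd c (\<xi> u)) \<le> 1 / m * dm (\<xi> u) (\<xi> v)" using r(2) by (simp add: field_simps)
  qed
 qed (use r dl in auto)
qed

text \<open>Around each time the curve stays in one chart and is absolutely continuous in its
  coordinates, so it is differentiable there off a null set. Negligibility is local, and
  differentiability passes from that chart to every other one.\<close>

lemma acc_differentiable_ae:
 assumes \<xi>: "acc t \<xi>"
 obtains N where "negligible N" "\<forall>s\<in>{0<..<t} - N. \<forall>c\<in>A. \<xi> s \<in> fst c -->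
   ((snd c \<circ> \<xi>) has_vector_derivative tangent_in A c (\<xi> s) (velocity A {0..t} \<xi> s)) (at s)"
proof -
 define N where "N = {s \<in> {0<..<t}. \<not> (\<exists>v. ((snd (chart_at A (\<xi> s)) \<circ> \<xi>) has_vector_derivative v) (at s))}"
 note cont = acc_continuous[OF \<xi>]
 have contat: "continuous (at s) \<xi>" if "s \<in> {0<..<t}" for s
  using continuous_on_interior[OF cont, of s] that by (simp add: interior_atLeastAtMost_real)
 have "negligible N"
 proof (rule iffD2[OF locally_negligible_alt], rule ballI)
  fix s assume sN: "s \<in> N"
  then have s: "0 < s" "s < t" by (auto simp: N_def)
  let ?c = "chart_at A (\<xi> s)"
  obtain r C d where r: "r > 0" "cball (snd ?c (\<xi> s)) r \<subseteq> cdom ?c" and C: "C > 0" and d: "d > 0"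
   and b: "\<forall>u v. 0 \<le> u \<and> u \<le> v \<and> v \<le> t \<and> v - u < d \<and> \<xi> u \<in> fst ?c \<and> snd ?c (\<xi> u) \<in> cball (snd ?c (\<xi> s)) r -->
    norm (snd ?c (\<xi> v) - snd ?c (\<xi> u)) \<le> C * dm (\<xi> u) (\<xi> v)"
   by (rule acc_chart_bound[OF \<xi> chart_at])
  let ?U = "chart_inv ?c ` ball (snd ?c (\<xi> s)) r"
  have "open ?U" by (rule chart_image_open) (use r(2) ball_subset_cball in auto)
  moreover have "\<xi> s \<in> ?U" using r(1) by (intro image_eqI[of _ _ "snd ?c (\<xi> s)"]) auto
  moreover have "s \<in> {0..t}" using s by simp
  ultimately obtain d1 where d1: "d1 > 0" "\<And>u. u \<in> {0..t} ==> \<bar>u - s\<bar> < d1 ==> \<xi> u \<in> ?U"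
   using acc_near[OF \<xi>, of s ?U] by metis
  define rh where "rh = min (d1 / 2) (min s (t - s))"
  have rh: "rh > 0" "rh < d1" "rh \<le> s" "s + rh \<le> t" using s d1(1) by (auto simp: rh_def)
  have inU: "\<xi> u \<in> fst ?c \<and> snd ?c (\<xi> u) \<in> cball (snd ?c (\<xi> s)) r" if u: "s - rh \<le> u" "u \<le> s + rh" for u
  proof -
   have "\<xi> u \<in> ?U" using u rh by (intro d1(2)) auto
   then obtain y where y: "y \<in> ball (snd ?c (\<xi> s)) r" "\<xi> u = chart_inv ?c y" by blast
   then have "y \<in> cdom ?c" "y \<in> cball (snd ?c (\<xi> s)) r" using r(2) by auto
   then show ?thesis using y(2) by simp
  qed
  have "ac_family (\<lambda>u v. norm ((snd ?c \<circ> \<xi>) v - (snd ?c \<circ> \<xi>) u)) (s - rh) (s + rh)"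
  proof (rule ac_family_mono)
   show "ac_family (\<lambda>u v. dm (\<xi> u) (\<xi> v)) (s - rh) (s + rh)"
    by (rule ac_family_subinterval[OF acc_family[OF \<xi>]]) (use rh in auto)
   show "C \<ge> 0" "d > 0" using C d by auto
   fix u v assume uv: "s - rh \<le> u" "u \<le> v" "v \<le> s + rh" "v - u < d"
   have "norm (snd ?c (\<xi> v) - snd ?c (\<xi> u)) \<le> C * dm (\<xi> u) (\<xi> v)"
    using b[rule_format, of u v] uv inU[of u] rh by simp
   moreover have "0 \<le> C * (v - u)" using C uv by simp
   ultimately show "norm ((snd ?c \<circ> \<xi>) v - (snd ?c \<circ> \<xi>) u) \<le> C * dm (\<xi> u) (\<xi> v) + C * (v - u)" by simp
  qed
  then obtain N' where N': "negligible N'" "\<And>s'. s' \<in> {s - rh<..<s + rh} - N' ==> \<exists>D. ((snd ?c \<circ> \<xi>) has_vector_derivative D) (at s')"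
   using ac_curve_differentiable_ae by blast
  have "N \<inter> {s - rh<..<s + rh} \<subseteq> N'"
  proof
   fix s' assume s': "s' \<in> N \<inter> {s - rh<..<s + rh}"
   show "s' \<in> N'"
   proof (rule ccontr)
    assume "s' \<notin> N'"
    then obtain D where D: "((snd ?c \<circ> \<xi>) has_vector_derivative D) (at s')" using N'(2)[of s'] s' by blast
    have "s' \<in> {0<..<t}" using s' by (simp add: N_def)
    then have ca: "continuous (at s') \<xi>" by (rule contat)
    have ic: "\<xi> s' \<in> fst ?c" using inU[of s'] s' by auto
    have "((snd (chart_at A (\<xi> s')) \<circ> \<xi>) has_vector_derivative dtrans ?c (chart_at A (\<xi> s')) (\<xi> s') D) (at s')"
     by (rule chart_change_derivative[OF chart_at(1) chart_at(1) ic chart_at(2) UNIV_I ca D])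
    then show False using s' by (auto simp: N_def)
   qed
  qed
  then have "negligible (N \<inter> {s - rh<..<s + rh})" using N'(1) negligible_subset by blast
  moreover have "openin (top_of_set N) (N \<inter> {s - rh<..<s + rh})" by (rule openin_open_Int) simp
  ultimately show "\<exists>U. openin (top_of_set N) U \<and> s \<in> U \<and> negligible U"
   using sN rh(1) by (intro exI[of _ "N \<inter> {s - rh<..<s + rh}"]) auto
 qed
 moreover have "((snd c \<circ> \<xi>) has_vector_derivative tangent_in A c (\<xi> s) (velocity A {0..t} \<xi> s)) (at s)"
  if s: "s \<in> {0<..<t} - N" and c: "c \<in> A" "\<xi> s \<in> fst c" for s c
 proof -
  obtain v where v: "((snd (chart_at A (\<xi> s)) \<circ> \<xi>) has_vector_derivative v) (at s)" using s by (auto simp: N_def)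
  have "velocity A {0..t} \<xi> s = v"
   using s vector_derivative_at[OF v] unfolding velocity_def by (simp add: vector_derivative_interior)
  moreover have "((snd c \<circ> \<xi>) has_vector_derivative dtrans (chart_at A (\<xi> s)) c (\<xi> s) v) (at s)"
   by (rule chart_change_derivative[OF chart_at(1) c(1) chart_at(2) c(2) UNIV_I contat v]) (use s in auto)
  ultimately show ?thesis by (simp add: tangent_in_dtrans)
 qed
 ultimately show thesis by (intro that[of N]) auto
qed

text \<open>In a small chart, distance and coordinate norm are comparable with constants
  \<open>M\<close> and \<open>m\<close>, and \<Lambda> bounds \<open>M / m\<close> over a finite
  cover. A sharp infinitesimal comparison with factor 1 is unnecessary, since the superlinear rate
  in \<open>adm_lower\<close> can be raised to absorb \<Lambda>.\<close>

lemma dm_speed_bound: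
 obtains \<Lambda> where "\<Lambda> > 0" "\<And>z. \<exists>c\<in>A. \<exists>m>0. \<exists>U. z \<in> fst c \<and> open U \<and> z \<in> U \<and> U \<subseteq> fst c \<and> (\<forall>a. m * norm a \<le> sqrt (gc c (snd c z) a a)) \<and>
   (\<forall>x\<in>U. \<forall>y\<in>U. dm x y \<le> \<Lambda> * m * norm (snd c y - snd c x))"
proof -
 let ?Q = "\<lambda>z dl. \<exists>c\<in>A. \<exists>m>0. \<exists>U. z \<in> fst c \<and> open U \<and> z \<in> U \<and> U \<subseteq> fst c \<and> (\<forall>a. m * norm a \<le> sqrt (gc c (snd c z) a a)) \<and>
   (\<forall>x\<in>U. \<forall>y\<in>U. dm x y \<le> (1 / dl) * m * norm (snd c y - snd c x))"
 obtain dl :: real where dl: "dl > 0" "\<And>z. ?Q z dl"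
 proof (rule compact_uniform[of ?Q])
  fix z
  let ?c = "chart_at A z"
  obtain r m M where r: "r > 0" "m > 0" "M > 0" "cball (snd ?c z) r \<subseteq> cdom ?c"
   "\<forall>zt\<in>cball (snd ?c z) r. \<forall>a. m * norm a \<le> sqrt (gc ?c zt a a) \<and> sqrt (gc ?c zt a a) \<le> M * norm a"
   "\<forall>et\<in>cball (snd ?c z) r. \<forall>et'\<in>cball (snd ?c z) r. dm (chart_inv ?c et) (chart_inv ?c et') \<le> M * norm (et' - et)"
   by (rule chart_dm[OF chart_at[of z]])
  let ?U = "chart_inv ?c ` ball (snd ?c z) r"
  have op: "open ?U" by (rule chart_image_open) (use r(4) ball_subset_cball in auto)
  have zU: "z \<in> ?U" using r(1) by (intro image_eqI[of _ _ "snd ?c z"]) auto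
  have inU: "w \<in> fst ?c \<and> snd ?c w \<in> cball (snd ?c z) r" if w: "w \<in> ?U" for w
  proof -
   obtain et where et: "et \<in> ball (snd ?c z) r" "w = chart_inv ?c et" using w by blast
   then have "et \<in> cdom ?c" "et \<in> cball (snd ?c z) r" using r(4) by auto
   then show ?thesis using et(2) by simp
  qed
  have "?Q w (m / M)" if w: "w \<in> ?U" for w
  proof (rule bexI[of _ ?c], rule exI[of _ m], intro conjI exI[of _ ?U] ballI allI)
   show "m > 0" "open ?U" "w \<in> ?U" "w \<in> fst ?c" using r op w inU by auto
   show "?U \<subseteq> fst ?c" using inU by blast
   show "m * norm a \<le> sqrt (gc ?c (snd ?c w) a a)" for a using r(5) inU[OF w] by blast
   fix x y assume x: "x \<in> ?U" and y: "y \<in> ?U"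
   have "dm (chart_inv ?c (snd ?c x)) (chart_inv ?c (snd ?c y)) \<le> M * norm (snd ?c y - snd ?c x)"
    using r(6) inU[OF x] inU[OF y] by blast
   then show "dm x y \<le> 1 / (m / M) * m * norm (snd ?c y - snd ?c x)" using inU[OF x] inU[OF y] r(2) by simp
  qed simp
  then show "\<exists>U dl. open U \<and> z \<in> U \<and> 0 < dl \<and> (\<forall>w\<in>U. ?Q w dl)"
   using op zU r by (intro exI[of _ ?U] exI[of _ "m / M"]) simp
 next
  fix w and dl dl' :: real assume Q: "?Q w dl" and dl: "0 < dl'" "dl' \<le> dl"
  then obtain c m U where c: "c \<in> A" "m > 0" "w \<in> fst c" "open U" "w \<in> U" "U \<subseteq> fst c" "\<forall>a. m * norm a \<le> sqrt (gc c (snd c w) a a)"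
   and d: "\<forall>x\<in>U. \<forall>y\<in>U. dm x y \<le> (1 / dl) * m * norm (snd c y - snd c x)" by blast
  have "1 / dl \<le> 1 / dl'" using dl by (intro divide_left_mono) auto
  then have "(1 / dl) * (m * norm (snd c y - snd c x)) \<le> (1 / dl') * (m * norm (snd c y - snd c x))" for x y
   using c(2) by (intro mult_right_mono) auto
  then have "\<forall>x\<in>U. \<forall>y\<in>U. dm x y \<le> (1 / dl') * m * norm (snd c y - snd c x)"
   using d order_trans unfolding mult.assoc by (intro ballI) (rule order_trans, blast, blast)
  then show "?Q w dl'" using c by (intro bexI[of _ c] exI[of _ m] exI[of _ U] conjI)
 qed blast
 show thesis by (rule that[of "1 / dl"]) (use dl in auto)
qed

end

section \<open>Actions of curves: cutting, gluing, straight lines and lower bounds\<close>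

context tonelli_manifold
begin

abbreviation lag :: "(real => 'm) => real set => real => real" where
 "lag \<xi> I s \<equiv> lagrangian H (\<xi> s) (velocity A I \<xi> s)"

text \<open>\<open>J\<close> is the action of some curve from \<open>x\<close> to \<open>y\<close>
  in time \<open>t\<close>. Working with the set of such values instead of its infimum allows
  arguments with nearly optimal curves, and the gauge integral makes cutting and gluing
  easy.\<close>

definition adm :: "real => 'm => 'm => real => bool" where
 "adm t x y J \<longleftrightarrow> (\<exists>\<xi>. acc t \<xi> \<and> \<xi> 0 = x \<and> \<xi> t = y \<and> (lag \<xi> {0..t} has_integral J) {0..t})"

text \<open>The gauge and Lebesgue integrals of the Lagrangian agree because it is bounded below, so
  both descriptions give the same set of values.\<close>

lemma action_adm: "action A g H t x y = Inf {J. adm t x y J}"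
proof -
 obtain C where C: "\<And>z v. lagrangian H z v \<ge> 0 * speed z v - C" using lagrangian_superlinear[OF order_refl] by metis
 have "(\<exists>\<xi>. J = integral\<^sup>L (lebesgue_on {0..t}) (lag \<xi> {0..t}) \<and> acc t \<xi> \<and> \<xi> 0 = x \<and> \<xi> t = y \<and>
    integrable (lebesgue_on {0..t}) (lag \<xi> {0..t})) \<longleftrightarrow> adm t x y J" for J
 proof
  assume "\<exists>\<xi>. J = integral\<^sup>L (lebesgue_on {0..t}) (lag \<xi> {0..t}) \<and> acc t \<xi> \<and> \<xi> 0 = x \<and> \<xi> t = y \<and>
    integrable (lebesgue_on {0..t}) (lag \<xi> {0..t})"
  then obtain \<xi> where \<xi>: "J = integral\<^sup>L (lebesgue_on {0..t}) (lag \<xi> {0..t})" "acc t \<xi>" "\<xi> 0 = x" "\<xi> t = y"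
   "integrable (lebesgue_on {0..t}) (lag \<xi> {0..t})" by blast
  have "(lag \<xi> {0..t} has_integral J) {0..t}"
   unfolding \<xi>(1) by (rule has_integral_integral_lebesgue_on[OF \<xi>(5)]) simp
  then show "adm t x y J" unfolding adm_def using \<xi> by blast
 next
  assume "adm t x y J"
  then obtain \<xi> where \<xi>: "acc t \<xi>" "\<xi> 0 = x" "\<xi> t = y" "(lag \<xi> {0..t} has_integral J) {0..t}"
   unfolding adm_def by blast
  have i: "integrable (lebesgue_on {0..t}) (lag \<xi> {0..t})"
   by (rule integrable_bounded_below[of _ _ _ C]) (use \<xi>(4) C in auto)
  have "J = integral\<^sup>L (lebesgue_on {0..t}) (lag \<xi> {0..t})"
   using has_integral_unique[OF \<xi>(4) has_integral_integral_lebesgue_on[OF i]] by simp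
  then show "\<exists>\<xi>. J = integral\<^sup>L (lebesgue_on {0..t}) (lag \<xi> {0..t}) \<and> acc t \<xi> \<and> \<xi> 0 = x \<and> \<xi> t = y \<and>
    integrable (lebesgue_on {0..t}) (lag \<xi> {0..t})" using \<xi> i by blast
 qed
 then show ?thesis unfolding action_def by simp
qed

lemma adm_split:
 assumes \<xi>: "acc (s + t) \<xi>" and st: "s > 0" "t > 0" and J: "(lag \<xi> {0..s+t} has_integral J) {0..s+t}"
 obtains J1 J2 where "adm s (\<xi> 0) (\<xi> s) J1" "adm t (\<xi> s) (\<xi> (s + t)) J2" "J1 + J2 = J"
  "acc s \<xi>" "(lag \<xi> {0..s} has_integral J1) {0..s}"
proof -
 define \<xi>2 where "\<xi>2 r = \<xi> (r + s)" for r
 have a1: "acc s \<xi>" using acc_window[OF \<xi>, of 0 s] st by simp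
 have a2: "acc t \<xi>2" using acc_window[OF \<xi>, of s t] st by (simp add: \<xi>2_def[abs_def])
 have J1: "lag \<xi> {0..s+t} integrable_on {0..s}" and J2: "lag \<xi> {0..s+t} integrable_on {s..s+t}"
  using J st by (auto intro: integrable_on_subinterval[where S="{0..s+t}"] simp: has_integral_integrable)
 define j1 where "j1 = integral {0..s} (lag \<xi> {0..s+t})"
 define j2 where "j2 = integral {s..s+t} (lag \<xi> {0..s+t})"
 have "lag \<xi> {0..s+t} integrable_on {0..s+t}" using J by (rule has_integral_integrable)
 then have "j1 + j2 = integral {0..s+t} (lag \<xi> {0..s+t})"
  unfolding j1_def j2_def using st by (intro Henstock_Kurzweil_Integration.integral_combine) auto
 then have "j1 + j2 = J" using integral_unique[OF J] by simp
 moreover have I1: "(lag \<xi> {0..s} has_integral j1) {0..s}"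
 proof (rule has_integral_spike[where S="{0, s}" and f="lag \<xi> {0..s+t}"])
  show "(lag \<xi> {0..s+t} has_integral j1) {0..s}" unfolding j1_def by (rule integrable_integral[OF J1])
  fix r assume "r \<in> {0..s} - {0, s}"
  then have "velocity A {0..s} \<xi> r = velocity A {0..s+t} \<xi> r"
   unfolding velocity_def using st by (simp add: vector_derivative_interior)
  then show "lag \<xi> {0..s} r = lag \<xi> {0..s+t} r" by simp
 qed simp
 moreover have "(lag \<xi>2 {0..t} has_integral j2) {0..t}"
 proof (rule has_integral_spike[where S="{0, t}" and f="\<lambda>r. lag \<xi> {0..s+t} (r + s)"])
  have "((\<lambda>r. lag \<xi> {0..s+t} (r + s)) has_integral j2) {s - s..s + t - s}"
   by (rule has_integral_shift_real_ivl) (simp add: j2_def integrable_integral[OF J2])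
  then show "((\<lambda>r. lag \<xi> {0..s+t} (r + s)) has_integral j2) {0..t}" by simp
  fix r assume r: "r \<in> {0..t} - {0, t}"
  then have r': "0 < r" "r < t" "0 < r + s" "r + s < s + t" using st by auto
  have e: "snd (chart_at A (\<xi>2 r)) \<circ> \<xi>2 = (\<lambda>u. (snd (chart_at A (\<xi> (r + s))) \<circ> \<xi>) (u + s))" by (auto simp: \<xi>2_def)
  have "velocity A {0..t} \<xi>2 r = vector_derivative (snd (chart_at A (\<xi> (r + s))) \<circ> \<xi>) (at (r + s))"
   unfolding velocity_def vector_derivative_interior[OF r'(1,2)] e by (rule vector_derivative_shift)
  also have "\<dots> = velocity A {0..s+t} \<xi> (r + s)"
   unfolding velocity_def vector_derivative_interior[OF r'(3,4)] ..
  finally show "lag \<xi>2 {0..t} r = lag \<xi> {0..s+t} (r + s)" by (simp add: \<xi>2_def)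
 qed simp
 ultimately have *: "j1 + j2 = J" "(lag \<xi> {0..s} has_integral j1) {0..s}" "(lag \<xi>2 {0..t} has_integral j2) {0..t}"
  by blast+
 have "adm s (\<xi> 0) (\<xi> s) j1" unfolding adm_def by (intro exI[of _ \<xi>] conjI a1 refl *)
 moreover have "adm t (\<xi> s) (\<xi> (s + t)) j2"
  unfolding adm_def by (intro exI[of _ \<xi>2] conjI a2 *) (simp_all add: \<xi>2_def add.commute)
 ultimately show thesis by (rule that) (fact * a1)+
qed

end

context riemannian_manifold
begin

lemma acc_concat:
 assumes s: "s \<ge> 0" and \<xi>1: "acc s \<xi>1" and \<xi>2: "acc t \<xi>2" and t: "t \<ge> 0"
  and e1: "\<And>r. r \<le> s ==> \<xi> r = \<xi>1 r" and e2: "\<And>r. s \<le> r ==> \<xi> r = \<xi>2 (r - s)"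
 shows "acc (s + t) \<xi>" unfolding acc_iff
proof (intro allI impI)
 fix e :: real assume "e > 0"
 then have e: "e / 2 > 0" by simp
 obtain dl1 where dl1: "dl1 > 0" "\<And>n a b. subintervals n a b s ==> (\<Sum>i<n. b i - a i) < dl1 ==> (\<Sum>i<n. dm (\<xi>1 (a i)) (\<xi>1 (b i))) < e / 2"
  using accE[OF \<xi>1 e] by metis
 obtain dl2 where dl2: "dl2 > 0" "\<And>n a b. subintervals n a b t ==> (\<Sum>i<n. b i - a i) < dl2 ==> (\<Sum>i<n. dm (\<xi>2 (a i)) (\<xi>2 (b i))) < e / 2"
  using accE[OF \<xi>2 e] by metis
 show "\<exists>dl>0. \<forall>n a b. subintervals n a b (s + t) \<and> (\<Sum>i<n. b i - a i) < dl --> (\<Sum>i<n. dm (\<xi> (a i)) (\<xi> (b i))) < e"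
 proof (intro exI[of _ "min dl1 dl2"] conjI allI impI)
  fix n and a b :: "nat => real"
  assume **: "subintervals n a b (s + t) \<and> (\<Sum>i<n. b i - a i) < min dl1 dl2"
  note * = **[unfolded subintervals_def]
  have dis: "{a i<..<b i} \<inter> {a j<..<b j} = {}" if "i < n" "j < n" "i \<noteq> j" for i j
   using * that unfolding disjoint_family_on_def by blast
  \<comment> \<open>Clipping at \<open>s\<close> yields one admissible family for each curve,
    neither longer than the original. An interval that contains \<open>s\<close> in its interior is
    split there by the triangle inequality.\<close>
  define a1 where "a1 i = min (a i) s" for i
  define b1 where "b1 i = min (b i) s" for i
  define a2 where "a2 i = max (a i) s - s" for i
  define b2 where "b2 i = max (b i) s - s" for i
  have ab: "0 \<le> a i" "a i \<le> b i" "b i \<le> s + t" if "i < n" for i using * that by auto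
  have d1: "disjoint_family_on (\<lambda>i. {a1 i<..<b1 i}) {..<n}" unfolding disjoint_family_on_def
  proof (intro ballI impI)
   fix i j assume "i \<in> {..<n}" "j \<in> {..<n}" "i \<noteq> j"
   then have d: "{a i<..<b i} \<inter> {a j<..<b j} = {}" by (intro dis) auto
   have "{a1 k<..<b1 k} \<subseteq> {a k<..<b k}" for k by (auto simp: a1_def b1_def min_def split: if_splits)
   then show "{a1 i<..<b1 i} \<inter> {a1 j<..<b1 j} = {}" using d by blast
  qed
  have d2: "disjoint_family_on (\<lambda>i. {a2 i<..<b2 i}) {..<n}" unfolding disjoint_family_on_def
  proof (intro ballI impI)
   fix i j assume "i \<in> {..<n}" "j \<in> {..<n}" "i \<noteq> j"
   then have d: "{a i<..<b i} \<inter> {a j<..<b j} = {}" by (intro dis) auto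
   have sub: "x + s \<in> {a k<..<b k}" if "x \<in> {a2 k<..<b2 k}" for k x
    using that by (auto simp: a2_def b2_def max_def split: if_splits)
   show "{a2 i<..<b2 i} \<inter> {a2 j<..<b2 j} = {}"
   proof (rule equals0I)
    fix x assume "x \<in> {a2 i<..<b2 i} \<inter> {a2 j<..<b2 j}"
    then have "x + s \<in> {a i<..<b i} \<inter> {a j<..<b j}" using sub by blast
    then show False using d by blast
   qed
  qed
  have l1: "(\<Sum>i<n. b1 i - a1 i) \<le> (\<Sum>i<n. b i - a i)"
  proof (rule sum_mono)
   fix i assume "i \<in> {..<n}"
   then have "a i \<le> b i" using ab(2) by simp
   then show "b1 i - a1 i \<le> b i - a i" by (auto simp: a1_def b1_def min_def)
  qed
  have l2: "(\<Sum>i<n. b2 i - a2 i) \<le> (\<Sum>i<n. b i - a i)"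
  proof (rule sum_mono)
   fix i assume "i \<in> {..<n}"
   then have "a i \<le> b i" using ab(2) by simp
   then show "b2 i - a2 i \<le> b i - a i" by (auto simp: a2_def b2_def max_def)
  qed
  have "(\<Sum>i<n. dm (\<xi> (a i)) (\<xi> (b i))) \<le> (\<Sum>i<n. dm (\<xi>1 (a1 i)) (\<xi>1 (b1 i)) + dm (\<xi>2 (a2 i)) (\<xi>2 (b2 i)))"
  proof (rule sum_mono)
   fix i assume "i \<in> {..<n}"
   then have i: "i < n" by simp
   consider "b i \<le> s" | "s \<le> a i" | "a i < s" "s < b i" by linarith
   then show "dm (\<xi> (a i)) (\<xi> (b i)) \<le> dm (\<xi>1 (a1 i)) (\<xi>1 (b1 i)) + dm (\<xi>2 (a2 i)) (\<xi>2 (b2 i))"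
   proof cases
    case 1
    then have "\<xi> (a i) = \<xi>1 (a1 i)" "\<xi> (b i) = \<xi>1 (b1 i)" using ab(2)[OF i] by (auto simp: e1 a1_def b1_def min_def)
    then show ?thesis by simp
   next
    case 2
    then have "s \<le> b i" using ab(2)[OF i] by simp
    then have "\<xi> (a i) = \<xi>2 (a2 i)" "\<xi> (b i) = \<xi>2 (b2 i)" using 2 by (simp_all add: e2 a2_def b2_def max_absorb1)
    then show ?thesis by simp
   next
    case 3
    then have "\<xi> (a i) = \<xi>1 (a1 i)" "\<xi> (b i) = \<xi>2 (b2 i)" "\<xi>1 (b1 i) = \<xi> s" "\<xi>2 (a2 i) = \<xi> s"
     using e1[of "a i"] e1[of s] e2[of s] e2[of "b i"] by (auto simp: a1_def b2_def b1_def a2_def min_def max_def)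
    then show ?thesis using dm_triangle by simp
   qed
  qed
  also have "\<dots> = (\<Sum>i<n. dm (\<xi>1 (a1 i)) (\<xi>1 (b1 i))) + (\<Sum>i<n. dm (\<xi>2 (a2 i)) (\<xi>2 (b2 i)))"
   by (rule sum.distrib)
  also have "\<dots> < e / 2 + e / 2"
  proof (rule add_strict_mono)
   have "\<forall>i<n. 0 \<le> a1 i \<and> a1 i \<le> b1 i \<and> b1 i \<le> s"
   proof (intro allI impI)
    fix i assume i: "i < n"
    show "0 \<le> a1 i \<and> a1 i \<le> b1 i \<and> b1 i \<le> s" using ab[OF i] s by (auto simp: a1_def b1_def min_def)
   qed
   then show "(\<Sum>i<n. dm (\<xi>1 (a1 i)) (\<xi>1 (b1 i))) < e / 2" using d1 l1 * by (intro dl1(2)) (auto simp: subintervals_def)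
   have "\<forall>i<n. 0 \<le> a2 i \<and> a2 i \<le> b2 i \<and> b2 i \<le> t"
   proof (intro allI impI)
    fix i assume i: "i < n"
    show "0 \<le> a2 i \<and> a2 i \<le> b2 i \<and> b2 i \<le> t" using ab[OF i] s t by (auto simp: a2_def b2_def max_def)
   qed
   then show "(\<Sum>i<n. dm (\<xi>2 (a2 i)) (\<xi>2 (b2 i))) < e / 2" using d2 l2 * by (intro dl2(2)) (auto simp: subintervals_def)
  qed
  finally show "(\<Sum>i<n. dm (\<xi> (a i)) (\<xi> (b i))) < e" by simp
 qed (use dl1 dl2 in auto)
qed

end

context tonelli_manifold
begin

lemma adm_concat:
 assumes "adm s x y J1" "adm t y z J2" "s \<ge> 0" "t \<ge> 0"
 shows "adm (s + t) x z (J1 + J2)"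
proof -
 obtain \<xi>1 where \<xi>1: "acc s \<xi>1" "\<xi>1 0 = x" "\<xi>1 s = y" "(lag \<xi>1 {0..s} has_integral J1) {0..s}"
  using assms(1) unfolding adm_def by blast
 obtain \<xi>2 where \<xi>2: "acc t \<xi>2" "\<xi>2 0 = y" "\<xi>2 t = z" "(lag \<xi>2 {0..t} has_integral J2) {0..t}"
  using assms(2) unfolding adm_def by blast
 define \<xi> where "\<xi> r = (if r \<le> s then \<xi>1 r else \<xi>2 (r - s))" for r
 have e1: "\<xi> r = \<xi>1 r" if "r \<le> s" for r using that by (simp add: \<xi>_def)
 have e2: "\<xi> r = \<xi>2 (r - s)" if "s \<le> r" for r using that \<xi>1(3) \<xi>2(2) by (auto simp: \<xi>_def)
 have ac: "acc (s + t) \<xi>" by (rule acc_concat[OF assms(3) \<xi>1(1) \<xi>2(1) assms(4) e1 e2])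
 have I1: "(lag \<xi> {0..s+t} has_integral J1) {0..s}"
 proof (rule has_integral_spike[OF _ _ \<xi>1(4), of "{0, s}"])
  fix r assume "r \<in> {0..s} - {0, s}"
  then have r: "0 < r" "r < s" "r < s + t" using assms by auto
  have "vector_derivative (snd (chart_at A (\<xi>1 r)) \<circ> \<xi>) (at r) = vector_derivative (snd (chart_at A (\<xi>1 r)) \<circ> \<xi>1) (at r)"
   by (rule vector_derivative_cong[of "{0<..<s}"]) (use r e1 in auto)
  then show "lag \<xi> {0..s+t} r = lag \<xi>1 {0..s} r"
   using r e1 unfolding velocity_def by (simp add: vector_derivative_interior)
 qed simp
 have I2: "(lag \<xi> {0..s+t} has_integral J2) {s..s+t}"
 proof (rule has_integral_spike[of "{s, s + t}" _ _ "\<lambda>r. lag \<xi>2 {0..t} (r + (- s))"])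
  have "((\<lambda>r. lag \<xi>2 {0..t} (r + (- s))) has_integral J2) {0 - (- s)..t - (- s)}"
   by (rule has_integral_shift_real_ivl) (rule \<xi>2(4))
  then show "((\<lambda>r. lag \<xi>2 {0..t} (r + (- s))) has_integral J2) {s..s+t}" by (simp add: add.commute)
  fix r assume "r \<in> {s..s+t} - {s, s + t}"
  then have r: "0 < r" "s < r" "r < s + t" "0 < r + (-s)" "r + (-s) < t" using assms by auto
  have "vector_derivative (snd (chart_at A (\<xi> r)) \<circ> \<xi>) (at r) =
    vector_derivative (\<lambda>u. (snd (chart_at A (\<xi> r)) \<circ> \<xi>2) (u + (- s))) (at r)"
   by (rule vector_derivative_cong[of "{s<..<s+t}"]) (use r e2 in auto)
  also have "\<dots> = vector_derivative (snd (chart_at A (\<xi> r)) \<circ> \<xi>2) (at (r + (- s)))" by (rule vector_derivative_shift)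
  finally have "velocity A {0..s+t} \<xi> r = velocity A {0..t} \<xi>2 (r + (- s))"
   unfolding velocity_def vector_derivative_interior[OF r(1,3)] vector_derivative_interior[OF r(4,5)]
   using r e2[of r] by simp
  then show "lag \<xi> {0..s+t} r = lag \<xi>2 {0..t} (r + (- s))" using r e2[of r] by simp
 qed simp
 have "(lag \<xi> {0..s+t} has_integral J1 + J2) {0..s+t}"
  by (rule has_integral_combine[OF _ _ I1 I2]) (use assms in auto)
 then show ?thesis
  unfolding adm_def using ac e1[of 0] e2[of "s + t"] \<xi>1(2) \<xi>2(3) assms(3,4) by (intro exI[of _ \<xi>]) auto
qed

lemma adm_cut:
 assumes "adm (s + t) x z J" "s > 0" "t > 0"
 obtains y J1 J2 where "adm s x y J1" "adm t y z J2" "J1 + J2 = J"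
proof -
 obtain \<xi> where \<xi>: "acc (s + t) \<xi>" "\<xi> 0 = x" "\<xi> (s + t) = z" "(lag \<xi> {0..s+t} has_integral J) {0..s+t}"
  using assms(1) unfolding adm_def by blast
 obtain J1 J2 where "adm s (\<xi> 0) (\<xi> s) J1" "adm t (\<xi> s) (\<xi> (s + t)) J2" "J1 + J2 = J"
  by (rule adm_split[OF \<xi>(1) assms(2,3) \<xi>(4)])
 then show thesis using that \<xi> by auto
qed

lemma adm_zero [simp]: "adm 0 x x 0"
proof -
 have "acc 0 (\<lambda>r. x)" unfolding abs_continuous_curve_def by (auto intro: exI[of _ 1])
 moreover have "(lag (\<lambda>r. x) {0..0} has_integral 0) {0..0::real}" by (simp add: has_integral_refl)
 ultimately show ?thesis unfolding adm_def by (intro exI[of _ "\<lambda>r. x"] conjI refl) simp_all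
qed

text \<open>Traversing the coordinate segment with constant velocity \<open>w\<close> gives a
  Lipschitz curve whose Lagrangian is \<open>Lc c\<close> along it. The bound \<open>C\<close> is
  required on this segment only, so that a nearly exact value of the Lagrangian can be
  inserted.\<close>

lemma adm_line:
 assumes c: "c \<in> A" and B: "compact B" "convex B" "B \<subseteq> cdom c"
  and y: "y \<in> B" "y + h *\<^sub>R w \<in> B" and h: "h > 0" and C: "\<And>z. z \<in> closed_segment y (y + h *\<^sub>R w) ==> Lc c z w \<le> C"
 obtains J where "adm h (chart_inv c y) (chart_inv c (y + h *\<^sub>R w)) J" "J \<le> C * h"
proof -
 define \<xi> where "\<xi> r = chart_inv c (y + r *\<^sub>R w)" for r
 have seg: "y + r *\<^sub>R w \<in> closed_segment y (y + h *\<^sub>R w)" if "r \<in> {0..h}" for r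
  unfolding closed_segment_def using that h
  by (intro CollectI exI[of _ "r / h"]) (auto simp: scaleR_left_diff_distrib scaleR_add_right)
 have inB: "y + r *\<^sub>R w \<in> B" if "r \<in> {0..h}" for r
  using seg[OF that] closed_segment_subset[OF y B(2)] by blast
 then have dom: "y + r *\<^sub>R w \<in> cdom c" if "r \<in> {0..h}" for r using that B(3) by blast
 obtain m M where M: "M > 0" "\<And>z a. z \<in> B ==> sqrt (gc c z a a) \<le> M * norm a"
  using gc_bounds[OF c B(1,3)] by metis
 have lip: "dm (\<xi> a) (\<xi> b) \<le> M * norm w * (b - a)" if ab: "0 \<le> a" "a \<le> b" "b \<le> h" for a b
 proof -
  have p: "y + a *\<^sub>R w \<in> B" "y + b *\<^sub>R w \<in> B" using ab by (auto intro!: inB)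
  obtain ga where ga: "C1_curve A {0..1} ga" "ga 0 = chart_inv c (y + a *\<^sub>R w)" "ga 1 = chart_inv c (y + b *\<^sub>R w)"
   "curve_length A g ga \<le> M * norm ((y + b *\<^sub>R w) - (y + a *\<^sub>R w))"
   by (rule segment_curve[OF c B(2,3) M(2) p])
  have "(y + b *\<^sub>R w) - (y + a *\<^sub>R w) = (b - a) *\<^sub>R w" by (simp add: algebra_simps)
  then show ?thesis using dm_le_length[OF ga(1)] ga ab(2) by (simp add: \<xi>_def mult_ac)
 qed
 have ac: "acc h \<xi>" unfolding abs_continuous_curve_def
 proof (intro allI impI)
  fix e :: real assume e: "e > 0"
  define P where "P = M * norm w + 1"
  have P: "P > 0" using M(1) by (simp add: P_def add_nonneg_pos)
  show "\<exists>d>0. \<forall>(n::nat) a b. (\<forall>i<n. 0 \<le> a i \<and> a i \<le> b i \<and> b i \<le> h) \<and>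
   disjoint_family_on (\<lambda>i. {a i<..<b i}) {..<n} \<and> (\<Sum>i<n. b i - a i) < d -->
   (\<Sum>i<n. dm (\<xi> (a i)) (\<xi> (b i))) < e"
  proof (intro exI[of _ "e / P"] conjI allI impI)
   fix n and a b :: "nat => real"
   assume *: "(\<forall>i<n. 0 \<le> a i \<and> a i \<le> b i \<and> b i \<le> h) \<and> disjoint_family_on (\<lambda>i. {a i<..<b i}) {..<n} \<and> (\<Sum>i<n. b i - a i) < e / P"
   have "(\<Sum>i<n. dm (\<xi> (a i)) (\<xi> (b i))) \<le> (\<Sum>i<n. P * (b i - a i))"
   proof (rule sum_mono)
    fix i assume "i \<in> {..<n}"
    then have i: "0 \<le> a i" "a i \<le> b i" "b i \<le> h" using * by auto
    have "dm (\<xi> (a i)) (\<xi> (b i)) \<le> M * norm w * (b i - a i)" by (rule lip[OF i])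
    also have "\<dots> \<le> P * (b i - a i)" using i by (intro mult_right_mono) (auto simp: P_def)
    finally show "dm (\<xi> (a i)) (\<xi> (b i)) \<le> P * (b i - a i)" .
   qed
   also have "\<dots> = P * (\<Sum>i<n. b i - a i)" by (simp add: sum_distrib_left)
   also have "\<dots> < e" using * P by (simp add: pos_less_divide_eq mult.commute)
   finally show "(\<Sum>i<n. dm (\<xi> (a i)) (\<xi> (b i))) < e" .
  qed (use e P in auto)
 qed
 have cont: "continuous_on {0..h} \<xi>" by (rule acc_continuous[OF ac])
 have lg: "lag \<xi> {0..h} r = Lc c (y + r *\<^sub>R w) w" if r: "r \<in> {0..h} - {0, h}" for r
 proof -
  have r': "r \<in> {0..h}" using r by simp
  have in_c: "\<xi> r \<in> fst c" "snd c (\<xi> r) = y + r *\<^sub>R w" using chart_chart_inv[OF c dom[OF r']] by (auto simp: \<xi>_def)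
  have "((\<lambda>r. y + r *\<^sub>R w) has_vector_derivative w) (at r within {0..h})"
   by (auto intro!: derivative_eq_intros)
  then have "((snd c \<circ> \<xi>) has_vector_derivative w) (at r within {0..h})"
   by (rule has_vector_derivative_transform[OF r', rotated]) (use chart_chart_inv[OF c dom] in \<open>auto simp: \<xi>_def\<close>)
  moreover have "continuous (at r within {0..h}) \<xi>" using cont r' continuous_on_eq_continuous_within by blast
  ultimately have "has_velocity A {0..h} \<xi> r (tangent_from A c (\<xi> r) w)"
   using has_velocity_iff[where \<xi>=\<xi>, OF c in_c(1) r'] c in_c by simp
  moreover have "at r within {0..h} \<noteq> bot" using r at_within_Icc_at[of 0 r h] by simp
  ultimately have "velocity A {0..h} \<xi> r = tangent_from A c (\<xi> r) w" by (rule velocity_eq)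
  then show ?thesis using c in_c by (simp add: lagrangian_chart)
 qed
 obtain K where K: "K \<ge> 0" "\<And>z z' w'. z \<in> B ==> z' \<in> B ==> norm w' \<le> norm w ==> \<bar>Lc c z w' - Lc c z' w'\<bar> \<le> K * norm (z - z')"
  using Lc_lipschitz[OF c B, of "norm w"] by metis
 have "K-lipschitz_on B (\<lambda>z. Lc c z w)" using K by (intro lipschitz_onI) (auto simp: dist_norm dist_real_def)
 then have "continuous_on B (\<lambda>z. Lc c z w)" by (rule lipschitz_on_continuous_on)
 then have "continuous_on {0..h} (\<lambda>r. Lc c (y + r *\<^sub>R w) w)"
  by (rule continuous_on_compose2) (use inB in \<open>auto intro!: continuous_intros\<close>)
 then have I: "((\<lambda>r. Lc c (y + r *\<^sub>R w) w) has_integral integral {0..h} (\<lambda>r. Lc c (y + r *\<^sub>R w) w)) {0..h}"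
  by (intro integrable_integral integrable_continuous_interval)
 have "(lag \<xi> {0..h} has_integral integral {0..h} (\<lambda>r. Lc c (y + r *\<^sub>R w) w)) {0..h}"
  by (rule has_integral_spike[where S="{0, h}", OF _ lg I]) simp_all
 then have "adm h (chart_inv c y) (chart_inv c (y + h *\<^sub>R w)) (integral {0..h} (\<lambda>r. Lc c (y + r *\<^sub>R w) w))"
  unfolding adm_def using ac by (intro exI[of _ \<xi>]) (auto simp: \<xi>_def)
 moreover have "integral {0..h} (\<lambda>r. Lc c (y + r *\<^sub>R w) w) \<le> C * (h - 0)"
 proof (rule has_integral_le[OF I])
  show "((\<lambda>r. C) has_integral C * (h - 0)) {0..h}" using has_integral_const_real[of C 0 h] h by (simp add: mult.commute)
 qed (use seg C in auto)
 ultimately show thesis using that by simp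
qed

lemma chart_line:
 assumes c: "c \<in> A" and B: "compact B" "convex B" "B \<subseteq> cdom c" and W: "W \<ge> 0"
 obtains C where "C \<ge> 0" "\<forall>y\<in>B. \<forall>y'\<in>B. \<forall>h>0. norm (y' - y) \<le> W * h --> (\<exists>J. adm h (chart_inv c y) (chart_inv c y') J \<and> J \<le> C * h)"
proof -
 obtain C where C: "C \<ge> 0" "\<And>zt w. zt \<in> B ==> norm w \<le> W ==> \<bar>Lc c zt w\<bar> \<le> C"
  using Lc_bounded[OF c B(1,3), of W] by metis
 have "\<exists>J. adm h (chart_inv c y) (chart_inv c y') J \<and> J \<le> C * h"
  if *: "y \<in> B" "y' \<in> B" "h > 0" "norm (y' - y) \<le> W * h" for y y' h
 proof -
  define w where "w = (1 / h) *\<^sub>R (y' - y)"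
  have y': "y' = y + h *\<^sub>R w" using *(3) by (simp add: w_def)
  have nw: "norm w \<le> W" using * by (simp add: w_def divide_simps mult.commute)
  have "Lc c zt w \<le> C" if z: "zt \<in> closed_segment y (y + h *\<^sub>R w)" for zt
   using z closed_segment_subset[OF *(1,2) B(2)] C(2)[OF _ nw, of zt] y' by fastforce
  then obtain J where "adm h (chart_inv c y) (chart_inv c (y + h *\<^sub>R w)) J" "J \<le> C * h"
   using adm_line[OF c B *(1) _ *(3), of w C] *(2) y' by auto
  then show ?thesis using y' by auto
 qed
 then show thesis using that C(1) by blast
qed

text \<open>For small \<open>h\<close> two points at distance at most \<open>W * h\<close> lie in a
  common chart, and the coordinate segment between them has velocity at most \<open>W / m\<close>,
  where the Lagrangian is bounded. Compactness makes the cost per unit of time uniform.\<close>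

lemma short_lines:
 assumes W: "W \<ge> 0"
 obtains C d where "C > 0" "d > 0" "\<forall>x y h. 0 < h \<and> h < d \<and> (dm x y \<le> W * h \<or> dm y x \<le> W * h) --> (\<exists>J. adm h x y J \<and> J \<le> C * h)"
proof -
 let ?Q = "\<lambda>x d. \<forall>y h. 0 < h \<and> h < d \<and> (dm x y \<le> W * h \<or> dm y x \<le> W * h) --> (\<exists>J. adm h x y J \<and> J \<le> (1 / d) * h)"
 obtain d :: real where d: "d > 0" "\<And>x. ?Q x d"
 proof (rule compact_uniform[of ?Q])
  fix z
  let ?c = "chart_at A z"
  obtain r m M where "chart_box (chart_at A z) z r m M" by (rule chart_box_exists[OF chart_at[of z]])
  note r = chart_boxD[OF this]
  have W': "W / m \<ge> 0" using W r by simp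
  obtain C where C: "C \<ge> 0" "\<forall>et\<in>cball (snd ?c z) r. \<forall>et'\<in>cball (snd ?c z) r. \<forall>h>0. norm (et' - et) \<le> W / m * h -->
    (\<exists>J. adm h (chart_inv ?c et) (chart_inv ?c et') J \<and> J \<le> C * h)"
   by (rule chart_line[OF chart_at(1)[of z] compact_cball convex_cball r(4) W'])
  \<comment> \<open>The first term lets \<open>1 / d\<close> serve as the cost constant demanded by
    \<open>compact_uniform\<close>; the second keeps \<open>W * h\<close> below
    \<open>m * r / 2\<close>, so that the other end point is in the chart.\<close>
  define d where "d = min (1 / (C + 1)) (m * r / (2 * (W + 1)))"
  have d: "d > 0" "d \<le> 1 / (C + 1)" "d \<le> m * r / (2 * (W + 1))" using C(1) r(1,2) W by (auto simp: d_def)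
  have Cd: "C \<le> 1 / d"
  proof -
   have "1 / (1 / (C + 1)) \<le> 1 / d" using d by (intro divide_left_mono) (use C(1) in auto)
   then show ?thesis by simp
  qed
  let ?U = "chart_inv ?c ` ball (snd ?c z) (r / 2)"
  have op: "open ?U"
  proof (rule chart_image_open)
   show "ball (snd ?c z) (r / 2) \<subseteq> cdom ?c" using r(1,4) by (auto simp: subset_eq)
  qed auto
  have zU: "z \<in> ?U" using r(1) by (intro image_eqI[of _ _ "snd ?c z"]) auto
  have "?Q w d" if "w \<in> ?U" for w
  proof (intro allI impI)
   fix y h assume *: "0 < h \<and> h < d \<and> (dm w y \<le> W * h \<or> dm y w \<le> W * h)"
   obtain et where et: "et \<in> ball (snd ?c z) (r / 2)" "w = chart_inv ?c et" using \<open>w \<in> ?U\<close> by blast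
   obtain e where e: "e \<le> W * h" "e = dm w y \<or> e = dm y w" using * by blast
   have "W * h \<le> W * d" using * W by (intro mult_left_mono) auto
   also have "\<dots> < (W + 1) * d" using d(1) by (simp add: algebra_simps)
   also have "\<dots> \<le> m * r / 2" using d(3) W by (simp add: field_simps)
   finally have "e < m * r / 2" using e(1) by simp
   then have "y \<in> fst ?c \<and> snd ?c y \<in> cball (snd ?c z) r \<and> m * norm (snd ?c y - et) \<le> e"
    using r(7)[rule_format, of et e y] et e(2) ball_subset_cball by blast
   then have y: "y \<in> fst ?c" "snd ?c y \<in> cball (snd ?c z) r" "m * norm (snd ?c y - et) \<le> e" by blast+
   have "norm (snd ?c y - et) \<le> W / m * h" using y(3) e(1) r(2) by (simp add: field_simps)
   moreover have "et \<in> cball (snd ?c z) r" using et(1) r(1) by auto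
   ultimately obtain J where J: "adm h (chart_inv ?c et) (chart_inv ?c (snd ?c y)) J" "J \<le> C * h"
    using C(2) y(2) * by blast
   have "C * h \<le> (1 / d) * h" using Cd * by (intro mult_right_mono) auto
   then show "\<exists>J. adm h w y J \<and> J \<le> (1 / d) * h" using J y(1) et(2) by (intro exI[of _ J]) auto
  qed
  then show "\<exists>U d. open U \<and> z \<in> U \<and> 0 < d \<and> (\<forall>w\<in>U. ?Q w d)" using op zU d(1) by blast
 next
  fix w and d d' :: real assume Q: "?Q w d" and d: "0 < d'" "d' \<le> d"
  have le: "1 / d \<le> 1 / d'" using d by (intro divide_left_mono) auto
  show "?Q w d'"
  proof (intro allI impI)
   fix y h assume *: "0 < h \<and> h < d' \<and> (dm w y \<le> W * h \<or> dm y w \<le> W * h)"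
   then obtain J where "adm h w y J" "J \<le> (1 / d) * h" using Q d(2) by (meson order_less_le_trans)
   moreover have "(1 / d) * h \<le> (1 / d') * h" using le * by (intro mult_right_mono) auto
   ultimately show "\<exists>J. adm h w y J \<and> J \<le> (1 / d') * h" by (intro exI[of _ J]) auto
  qed
 qed blast
 show thesis by (rule that[of "1 / d" d]) (use d in auto)
qed

text \<open>Nearby points are joined by coordinate segments in any time, and time can be shared
  between two curves, so connectedness applies. Hence the infimum defining the action is over a
  nonempty set.\<close>

lemma adm_exists:
 assumes "t > 0" obtains J where "adm t x y J"
proof -
 let ?S = "\<lambda>x y. \<forall>t>0. \<exists>J. adm t x y J"
 let ?R = "\<lambda>x y. ?S x y \<and> ?S y x"
 have tr: "?S x z" if xy: "?S x y" and yz: "?S y z" for x y z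
 proof (intro allI impI)
  fix t :: real assume t: "t > 0"
  obtain J1 J2 where "adm (t/2) x y J1" "adm (t/2) y z J2" using xy yz t half_gt_zero by blast
  then have "adm (t/2 + t/2) x z (J1 + J2)" using t by (intro adm_concat) auto
  then show "\<exists>J. adm t x z J" by auto
 qed
 have "?R x y"
 proof (rule connected_equivalence_relation[where R="?R", OF connected_M UNIV_I UNIV_I])
  fix z :: 'm
  let ?c = "chart_at A z"
  obtain r where r: "r > 0" "cball (snd ?c z) r \<subseteq> cdom ?c" using chart_ball[of ?c z UNIV] by auto
  have J: "?S (chart_inv ?c et) (chart_inv ?c et')" if et: "et \<in> cball (snd ?c z) r" "et' \<in> cball (snd ?c z) r" for et et'
  proof (intro allI impI)
   fix t :: real assume t: "t > 0"
   have W: "norm (et' - et) / t \<ge> 0" using t by simp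
   obtain C where "\<forall>zt\<in>cball (snd ?c z) r. \<forall>zt'\<in>cball (snd ?c z) r. \<forall>h>0. norm (zt' - zt) \<le> norm (et' - et) / t * h -->
    (\<exists>J. adm h (chart_inv ?c zt) (chart_inv ?c zt') J \<and> J \<le> C * h)"
    by (rule chart_line[OF chart_at(1)[of z] compact_cball convex_cball r(2) W])
   moreover have "norm (et' - et) \<le> norm (et' - et) / t * t" using t by simp
   ultimately show "\<exists>J. adm t (chart_inv ?c et) (chart_inv ?c et') J" using et t by blast
  qed
  let ?U = "chart_inv ?c ` ball (snd ?c z) r"
  have "open ?U" by (rule chart_image_open) (use r(2) ball_subset_cball in auto)
  moreover have "z \<in> ?U" using r(1) by (intro image_eqI[of _ _ "snd ?c z"]) auto
  moreover have "\<forall>w\<in>?U. ?R z w"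
  proof
   fix w assume "w \<in> ?U"
   then obtain et where et: "et \<in> ball (snd ?c z) r" "w = chart_inv ?c et" by blast
   have z: "snd ?c z \<in> cball (snd ?c z) r" "et \<in> cball (snd ?c z) r" using et r(1) by auto
   have "chart_inv ?c (snd ?c z) = z" by simp
   then show "?R z w" using J[OF z] J[OF z(2,1)] et(2) by simp
  qed
  ultimately show "\<exists>T. openin (top_of_set UNIV) T \<and> z \<in> T \<and> (\<forall>w\<in>T. ?R z w)" by auto
 next
  fix x y z assume "?R x y" "?R y z"
  then show "?R x z" using tr[of x y z] tr[of z y x] by blast
 qed blast
 then show thesis using that assms by blast
qed

text \<open>Along the curve the distance from \<open>x\<close> grows at a rate of at most \<Lambda>
  times the speed, and superlinearity bounds \<open>K * \<Lambda>\<close> times the speed by the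
  Lagrangian plus a constant. Since \<open>K\<close> is arbitrary, curves of bounded action in short
  time have small displacement.\<close>

lemma adm_lower:
 assumes K: "K > 0"
 obtains C where "C > 0" "\<And>t x y J. t \<ge> 0 ==> adm t x y J ==> K * dm x y \<le> J + C * t"
proof -
 obtain \<Lambda> where \<Lambda>: "\<Lambda> > 0" "\<And>z. \<exists>c\<in>A. \<exists>m>0. \<exists>U. z \<in> fst c \<and> open U \<and> z \<in> U \<and> U \<subseteq> fst c \<and> (\<forall>a. m * norm a \<le> sqrt (gc c (snd c z) a a)) \<and>
   (\<forall>x\<in>U. \<forall>y\<in>U. dm x y \<le> \<Lambda> * m * norm (snd c y - snd c x))"
  by (rule dm_speed_bound) blast
 have "K * \<Lambda> \<ge> 0" using K \<Lambda>(1) by simp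
 then obtain C where C: "C > 0" "\<And>z v. lagrangian H z v \<ge> K * \<Lambda> * speed z v - C"
  using lagrangian_superlinear by metis
 have "K * dm x y \<le> J + C * t" if t: "t \<ge> 0" and J: "adm t x y J" for t x y J
 proof -
  obtain \<xi> where \<xi>: "acc t \<xi>" "\<xi> 0 = x" "\<xi> t = y" "(lag \<xi> {0..t} has_integral J) {0..t}"
   using J unfolding adm_def by blast
  obtain N where N: "negligible N" "\<forall>s\<in>{0<..<t} - N. \<forall>c\<in>A. \<xi> s \<in> fst c -->
   ((snd c \<circ> \<xi>) has_vector_derivative tangent_in A c (\<xi> s) (velocity A {0..t} \<xi> s)) (at s)"
   by (rule acc_differentiable_ae[OF \<xi>(1)])
  have I: "((\<lambda>s. (lag \<xi> {0..t} s + C) / K) has_integral (J + C * t) / K) {0..t}"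
  proof -
   have "((\<lambda>s. C) has_integral C * t) {0..t}" using has_integral_const_real[of C 0 t] t by (simp add: mult.commute)
   from has_integral_divide[OF has_integral_add[OF \<xi>(4) this]] show ?thesis .
  qed
  have "dm x (\<xi> t) - dm x (\<xi> 0) \<le> integral {0..t} (\<lambda>s. (lag \<xi> {0..t} s + C) / K)"
  proof (rule integral_comparison)
   show "negligible (N \<union> {0, t})" using N(1) by (simp add: negligible_insert)
   have "ac_family (\<lambda>u v. dm x (\<xi> v) - dm x (\<xi> u)) 0 t"
   proof (rule ac_family_mono[OF acc_family[OF \<xi>(1)], of 1 1])
    fix u v :: real assume "u \<le> v"
    then show "dm x (\<xi> v) - dm x (\<xi> u) \<le> 1 * dm (\<xi> u) (\<xi> v) + 1 * (v - u)"
     using dm_triangle[of x "\<xi> v" "\<xi> u"] by simp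
   qed auto
   then show "N \<union> {0, t} = {} \<or> ac_family (\<lambda>u v. dm x (\<xi> v) - dm x (\<xi> u)) 0 t" ..
   fix s e :: real assume s: "s \<in> {0..t} - (N \<union> {0, t})" and e: "e > 0"
   obtain c m U where c: "c \<in> A" "m > 0" "\<xi> s \<in> fst c" "open U" "\<xi> s \<in> U" "U \<subseteq> fst c"
    "\<And>a. m * norm a \<le> sqrt (gc c (snd c (\<xi> s)) a a)"
    "\<And>x y. x \<in> U ==> y \<in> U ==> dm x y \<le> \<Lambda> * m * norm (snd c y - snd c x)"
    using \<Lambda>(2)[of "\<xi> s"] by blast
   define D where "D = tangent_in A c (\<xi> s) (velocity A {0..t} \<xi> s)"
   have D: "((snd c \<circ> \<xi>) has_vector_derivative D) (at s within UNIV)" using N(2) s c unfolding D_def by auto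
   have e': "e / (\<Lambda> * m) > 0" using e \<Lambda>(1) c(2) by simp
   obtain d1 where d1: "d1 > 0" "\<And>u v. u \<in> UNIV ==> v \<in> UNIV ==> u \<le> s ==> s \<le> v ==> v - u < d1 ==>
    norm ((snd c \<circ> \<xi>) v - (snd c \<circ> \<xi>) u - (v - u) *\<^sub>R D) \<le> e / (\<Lambda> * m) * (v - u)"
    using vector_derivative_straddle[OF D e'] by metis
   have "s \<in> {0..t}" using s by simp
   then obtain d2 where d2: "d2 > 0" "\<And>r. r \<in> {0..t} ==> \<bar>r - s\<bar> < d2 ==> \<xi> r \<in> U"
    using acc_near[OF \<xi>(1) _ c(4,5)] by metis
   show "\<exists>d>0. \<forall>u v. 0 \<le> u \<and> u \<le> s \<and> s \<le> v \<and> v \<le> t \<and> v - u < d -->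
    dm x (\<xi> v) - dm x (\<xi> u) \<le> (v - u) * ((lag \<xi> {0..t} s + C) / K + e)"
   proof (intro exI[of _ "min d1 d2"] conjI allI impI)
    fix u v assume *: "0 \<le> u \<and> u \<le> s \<and> s \<le> v \<and> v \<le> t \<and> v - u < min d1 d2"
    have U: "\<xi> u \<in> U" "\<xi> v \<in> U" using * by (auto intro!: d2(2))
    have "norm (snd c (\<xi> v) - snd c (\<xi> u)) \<le> norm (snd c (\<xi> v) - snd c (\<xi> u) - (v - u) *\<^sub>R D) + norm ((v - u) *\<^sub>R D)"
     using norm_triangle_ineq[of "snd c (\<xi> v) - snd c (\<xi> u) - (v - u) *\<^sub>R D" "(v - u) *\<^sub>R D"] by simp
    also have "\<dots> \<le> e / (\<Lambda> * m) * (v - u) + (v - u) * norm D"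
     using d1(2)[of u v] * by (intro add_mono) auto
    finally have n: "norm (snd c (\<xi> v) - snd c (\<xi> u)) \<le> e / (\<Lambda> * m) * (v - u) + (v - u) * norm D" .
    have "dm x (\<xi> v) - dm x (\<xi> u) \<le> dm (\<xi> u) (\<xi> v)" using dm_triangle[of x "\<xi> v" "\<xi> u"] by simp
    also have "\<dots> \<le> \<Lambda> * m * norm (snd c (\<xi> v) - snd c (\<xi> u))" by (rule c(8)[OF U])
    also have "\<dots> \<le> \<Lambda> * m * (e / (\<Lambda> * m) * (v - u) + (v - u) * norm D)"
     using n \<Lambda>(1) c(2) by (intro mult_left_mono) auto
    also have "\<dots> = (v - u) * (\<Lambda> * (m * norm D) + e)" using \<Lambda>(1) c(2) by (simp add: field_simps)
    also have "\<dots> \<le> (v - u) * ((lag \<xi> {0..t} s + C) / K + e)"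
    proof (intro mult_left_mono add_right_mono)
     have "m * norm D \<le> speed (\<xi> s) (velocity A {0..t} \<xi> s)"
      using speed_chart[OF c(1,3)] c(7) unfolding D_def by simp
     then have "K * \<Lambda> * (m * norm D) \<le> K * \<Lambda> * speed (\<xi> s) (velocity A {0..t} \<xi> s)"
      using K \<Lambda>(1) by (intro mult_left_mono) auto
     also have "\<dots> \<le> lag \<xi> {0..t} s + C" using C(2)[of "\<xi> s" "velocity A {0..t} \<xi> s"] by simp
     finally show "\<Lambda> * (m * norm D) \<le> (lag \<xi> {0..t} s + C) / K" using K by (simp add: field_simps)
    qed (use * in auto)
    finally show "dm x (\<xi> v) - dm x (\<xi> u) \<le> (v - u) * ((lag \<xi> {0..t} s + C) / K + e)" .
   qed (use d1 d2 in auto)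
  qed (use t I in auto)
  also have "\<dots> = (J + C * t) / K" by (rule integral_unique[OF I])
  finally show ?thesis using K \<xi>(2,3) by (simp add: field_simps)
 qed
 then show thesis using that C(1) by blast
qed

text \<open>Of \<open>Suc n\<close> pieces of equal duration one has at most the average action: if
  the first piece exceeds the average, the remaining ones fall below it on average and the induction
  applies to them.\<close>

lemma adm_pigeonhole:
 assumes "adm (real (Suc n) * \<sigma>) x z J" "\<sigma> > 0"
 shows "\<exists>i k p q J1 J' J2. i + k = n \<and> adm (real i * \<sigma>) x p J1 \<and> adm \<sigma> p q J' \<and> adm (real k * \<sigma>) q z J2 \<and>
  J1 + J' + J2 = J \<and> J' \<le> J / real (Suc n)" using assms(1)
proof (induction n arbitrary: x J)
 case 0
 then show ?case by (intro exI[of _ 0] exI[of _ x] exI[of _ z] exI[of _ J]) simp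
next
 case (Suc n)
 have e: "real (Suc (Suc n)) * \<sigma> = \<sigma> + real (Suc n) * \<sigma>" by (simp add: algebra_simps)
 obtain y Ja Jb where y: "adm \<sigma> x y Ja" "adm (real (Suc n) * \<sigma>) y z Jb" "Ja + Jb = J"
  using adm_cut[of \<sigma> "real (Suc n) * \<sigma>" x z J] Suc.prems assms(2) unfolding e by auto
 show ?case
 proof (cases "Ja \<le> J / real (Suc (Suc n))")
  case True
  then show ?thesis using y
   by (intro exI[of _ 0] exI[of _ "Suc n"] exI[of _ x] exI[of _ y] exI[of _ Ja] exI[of _ Jb]) simp
 next
  case False
  obtain i k p q J1 J' J2 where *: "i + k = n" "adm (real i * \<sigma>) y p J1" "adm \<sigma> p q J'" "adm (real k * \<sigma>) q z J2"
   "J1 + J' + J2 = Jb" "J' \<le> Jb / real (Suc n)" using Suc.IH[OF y(2)] by blast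
  have "Jb \<le> J - J / real (Suc (Suc n))" using False y(3) by simp
  also have "\<dots> = real (Suc n) * (J / real (Suc (Suc n)))" by (simp add: field_simps)
  finally have "Jb / real (Suc n) \<le> J / real (Suc (Suc n))" by (simp add: field_simps)
  then have "J' \<le> J / real (Suc (Suc n))" using *(6) by simp
  moreover have "adm (\<sigma> + real i * \<sigma>) x p (Ja + J1)" by (rule adm_concat[OF y(1) *(2)]) (use assms(2) in auto)
  then have "adm (real (Suc i) * \<sigma>) x p (Ja + J1)" by (simp add: algebra_simps)
  ultimately show ?thesis using * y(3)
   by (intro exI[of _ "Suc i"] exI[of _ k] exI[of _ p] exI[of _ q] exI[of _ "Ja + J1"] exI[of _ J'] exI[of _ J2]) auto
 qed
qed

text \<open>Among many pieces of equal duration \<open>4 h\<close> one has small action, hence small displacement;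
  traversing it in time \<open>2 h\<close> leaves time \<open>h\<close> at both ends to move the end points.\<close>

lemma action_perturbation:
 assumes s: "s > 0"
 obtains C N0 where "C > 0" "\<forall>n\<ge>N0. \<forall>x z x' z' J. adm s x z J \<and> J \<le> B \<and>
   (let h = s / (4 * real (Suc n)) in (dm x x' \<le> h \<or> dm x' x \<le> h) \<and> (dm z z' \<le> h \<or> dm z' z \<le> h)) -->
   (\<exists>J'. adm s x' z' J' \<and> J' \<le> J + C * (s / (4 * real (Suc n))))"
proof -
 obtain K where K: "K > 0" "\<And>t x y J. t \<ge> 0 ==> adm t x y J ==> 1 * dm x y \<le> J + K * t"
  by (rule adm_lower[of 1]) simp_all
 \<comment> \<open>The cheap piece moves by at most
   \<open>(\<bar>B\<bar> / s + K) * (4 * h)\<close>. The factor 2 arises because this distance is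
   now covered in time \<open>2 * h\<close>.\<close>
 define W where "W = 2 * (\<bar>B\<bar> / s + K)"
 have W: "W \<ge> 0" using K(1) s by (simp add: W_def)
 obtain C1 dl1 where L1: "C1 > 0" "dl1 > 0" "\<forall>x y h. 0 < h \<and> h < dl1 \<and> (dm x y \<le> 1 * h \<or> dm y x \<le> 1 * h) --> (\<exists>J. adm h x y J \<and> J \<le> C1 * h)"
  by (rule short_lines[of 1]) simp_all
 obtain C2 dl2 where L2: "C2 > 0" "dl2 > 0" "\<forall>x y h. 0 < h \<and> h < dl2 \<and> (dm x y \<le> W * h \<or> dm y x \<le> W * h) --> (\<exists>J. adm h x y J \<and> J \<le> C2 * h)"
  by (rule short_lines[OF W]) blast
 obtain N0 :: nat where N0: "s / min dl1 dl2 < real N0" using reals_Archimedean2 by blast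
 \<comment> \<open>Two end segments of duration \<open>h\<close>, the middle segment of duration
   \<open>2 * h\<close>, and the action of the removed piece, which may be as low as
   \<open>- 4 * K * h\<close>.\<close>
 define C where "C = 2 * C1 + 2 * C2 + 4 * K"
 have "\<exists>J'. adm s x' z' J' \<and> J' \<le> J + C * h"
  if n: "n \<ge> N0" and J: "adm s x z J" "J \<le> B" and h: "h = s / (4 * real (Suc n))"
   and d: "dm x x' \<le> h \<or> dm x' x \<le> h" "dm z z' \<le> h \<or> dm z' z \<le> h" for n x z x' z' J h
 proof -
  have h0: "h > 0" using s h by simp
  have hs: "real (Suc n) * (4 * h) = s" unfolding h by (simp del: of_nat_Suc)
  have "s < real N0 * min dl1 dl2" using N0 L1(2) L2(2) by (simp add: field_simps)
  also have "\<dots> \<le> real (Suc n) * min dl1 dl2" using n L1(2) L2(2) by (intro mult_right_mono) auto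
  finally have "real (Suc n) * (4 * h) < real (Suc n) * min dl1 dl2" using hs by simp
  then have hdl: "4 * h < min dl1 dl2" by (simp only: mult_less_cancel_left_pos of_nat_0_less_iff zero_less_Suc)
  have J': "adm (real (Suc n) * (4 * h)) x z J" using J(1) hs by simp
  obtain i k p q J1 J' J2 where *: "i + k = n" "adm (real i * (4 * h)) x p J1" "adm (4 * h) p q J'" "adm (real k * (4 * h)) q z J2"
   "J1 + J' + J2 = J" "J' \<le> J / real (Suc n)" using adm_pigeonhole[OF J'] h0 by auto
  have dpq: "dm p q \<le> J' + K * (4 * h)" using K(2)[OF _ *(3)] h0 by simp
  also have "J' \<le> \<bar>B\<bar> / real (Suc n)" using *(6) J(2) by (smt (verit) divide_right_mono of_nat_0_le_iff)
  also have "\<bar>B\<bar> / real (Suc n) = \<bar>B\<bar> / s * (4 * h)" using s by (simp add: h del: of_nat_Suc)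
  finally have "dm p q \<le> W * (2 * h)" by (simp add: W_def algebra_simps)
  then obtain Jm where Jm: "adm (2 * h) p q Jm" "Jm \<le> C2 * (2 * h)" using L2(3)[rule_format, of "2 * h" p q] h0 hdl by auto
  obtain Ja where Ja: "adm h x' x Ja" "Ja \<le> C1 * h" using L1(3)[rule_format, of h x' x] h0 hdl d(1) by auto
  obtain Jb where Jb: "adm h z z' Jb" "Jb \<le> C1 * h" using L1(3)[rule_format, of h z z'] h0 hdl d(2) by auto
  have low: "J' \<ge> - K * (4 * h)" using dpq dm_nonneg[of p q] by linarith
  have i0: "real i * (4 * h) \<ge> 0" "real k * (4 * h) \<ge> 0" using h0 by auto
  have "adm (h + real i * (4 * h) + 2 * h + real k * (4 * h) + h) x' z' (Ja + J1 + Jm + J2 + Jb)"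
   by (intro adm_concat[OF adm_concat[OF adm_concat[OF adm_concat[OF Ja(1) *(2)] Jm(1)] *(4)] Jb(1)]) (use h0 i0 in auto)
  moreover have "h + real i * (4 * h) + 2 * h + real k * (4 * h) + h = real (Suc n) * (4 * h)"
   using *(1) by (auto simp: algebra_simps)
  moreover have "Ja + J1 + Jm + J2 + Jb \<le> J + C * h"
   using Ja(2) Jb(2) Jm(2) low *(5) by (simp add: C_def algebra_simps)
  ultimately show ?thesis using hs by auto
 qed
 then have "\<forall>n\<ge>N0. \<forall>x z x' z' J. adm s x z J \<and> J \<le> B \<and>
   (let h = s / (4 * real (Suc n)) in (dm x x' \<le> h \<or> dm x' x \<le> h) \<and> (dm z z' \<le> h \<or> dm z' z \<le> h)) -->
   (\<exists>J'. adm s x' z' J' \<and> J' \<le> J + C * (s / (4 * real (Suc n))))" unfolding Let_def by blast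
 moreover have "C > 0" using L1 L2 K(1) by (simp add: C_def)
 ultimately show thesis using that by blast
qed

end

section \<open>The Lax-Oleinik evolution for small times\<close>

locale lax_oleinik = tonelli_manifold A g H
 for A :: "('m::t2_space, 'e::euclidean_space) chart set" and g :: "'m => 'e => 'e => real"
  and H :: "'m => 'e => real" +
 fixes \<phi> :: "'m => real" and \<tau> :: real
 assumes phi_continuous: "continuous_on UNIV \<phi>" and tau: "admissible_time A g H \<phi> \<tau>"
begin

text \<open>At \<open>t = 0\<close> the defining formula of \<open>T_plus\<close> would involve infima of empty sets.\<close>

definition u :: "real => 'm => real" where
 "u t x = (if t = 0 then \<phi> x else T_plus A g H t \<phi> x)"

text \<open>\<open>y\<close> maximizes \<phi> minus the action from \<open>x\<close>, as
  \<open>opt_unique\<close> verifies for times up to \<tau>. The formulation asks for a nearly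
  optimal curve ending at \<open>y\<close> for each epsilon, because no curve is shown to attain the
  action.\<close>

definition opt :: "real => 'm => 'm => bool" where
 "opt t x y \<longleftrightarrow> (\<forall>\<epsilon>>0. \<exists>J. adm t x y J \<and> u t x - \<epsilon> < \<phi> y - J)"

lemma u_zero [simp]: "u 0 = \<phi>" by (simp add: u_def fun_eq_iff)

lemma tau_pos: "\<tau> > 0" using tau by (simp add: admissible_time_def)

lemma phi_bound: obtains F where "F > 0" "\<And>x. \<bar>\<phi> x\<bar> \<le> F"
proof -
 have "compact (range \<phi>)" using phi_continuous compact_M compact_continuous_image by blast
 then obtain F where "\<forall>v\<in>range \<phi>. \<bar>v\<bar> \<le> F" using compact_imp_bounded bounded_real by metis
 then have "\<bar>\<phi> x\<bar> \<le> \<bar>F\<bar> + 1" for x by (smt (verit) rangeI)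
 then show thesis using that[of "\<bar>F\<bar> + 1"] by simp
qed

lemma adm_bounded_below: obtains C where "C > 0" "\<And>t x y J. t \<ge> 0 ==> adm t x y J ==> - C * t \<le> J"
proof -
 obtain C where C: "C > 0" "\<And>t x y J. t \<ge> 0 ==> adm t x y J ==> 1 * dm x y \<le> J + C * t"
  using adm_lower[of 1] by (metis zero_less_one)
 have "- C * t \<le> J" if t: "t \<ge> 0" "adm t x y J" for t x y J using C(2)[OF t] dm_nonneg[of x y] by linarith
 then show thesis using that C(1) by blast
qed

lemma action_facts:
 assumes t: "t > 0"
 shows "adm t x y J ==> action A g H t x y \<le> J"
  and "e > 0 ==> \<exists>J. adm t x y J \<and> J < action A g H t x y + e"
proof -
 obtain C where C: "\<And>t x y J. t \<ge> 0 ==> adm t x y J ==> - C * t \<le> J" using adm_bounded_below by metis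
 have bdd: "bdd_below {J. adm t x y J}" using C[of t x y] t by (intro bdd_belowI[of _ "- C * t"]) auto
 obtain J0 where "adm t x y J0" by (rule adm_exists[OF t])
 then have ne: "{J. adm t x y J} \<noteq> {}" by blast
 show "adm t x y J ==> action A g H t x y \<le> J" unfolding action_adm by (rule cInf_lower[OF _ bdd]) simp
 assume "e > 0"
 then have "Inf {J. adm t x y J} < action A g H t x y + e" by (simp add: action_adm)
 then show "\<exists>J. adm t x y J \<and> J < action A g H t x y + e" using cInf_lessD[OF ne] by blast
qed

lemma value_bdd:
 assumes t: "t > 0" shows "bdd_above (range (\<lambda>y. \<phi> y - action A g H t x y))"
proof -
 obtain C where C: "\<And>t x y J. t \<ge> 0 ==> adm t x y J ==> - C * t \<le> J" using adm_bounded_below by metis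
 obtain F where F: "\<And>x. \<bar>\<phi> x\<bar> \<le> F" using phi_bound by metis
 have "\<phi> y - action A g H t x y \<le> F + C * t + 1" for y
 proof -
  obtain J where J: "adm t x y J" "J < action A g H t x y + 1" using action_facts(2)[OF t, of 1] by auto
  have "- C * t \<le> J" using C[OF _ J(1)] t by simp
  then show ?thesis using J(2) F[of y] by simp
 qed
 then show ?thesis by (intro bdd_aboveI[of _ "F + C * t + 1"]) auto
qed

lemma u_ge:
 assumes t: "t > 0" and J: "adm t x y J" shows "\<phi> y - J \<le> u t x"
proof -
 have "\<phi> y - action A g H t x y \<le> u t x"
  using t cSUP_upper[OF UNIV_I value_bdd[OF t]] by (simp add: u_def T_plus_def)
 then show ?thesis using action_facts(1)[OF t J] by simp
qed

lemma u_approx: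
 assumes t: "t > 0" and e: "e > 0" obtains y J where "adm t x y J" "u t x - e < \<phi> y - J"
proof -
 have "u t x - e / 2 < (SUP y. \<phi> y - action A g H t x y)" using t e by (simp add: u_def T_plus_def)
 then obtain y where y: "u t x - e / 2 < \<phi> y - action A g H t x y"
  using less_cSUP_iff[OF _ value_bdd[OF t]] by auto
 obtain J where "adm t x y J" "J < action A g H t x y + e / 2" using action_facts(2)[OF t, of "e / 2"] e by auto
 then show thesis using that[of y J] y by simp
qed

lemma opt_unique:
 assumes t: "0 < t" "t \<le> \<tau>" shows "\<exists>!y. opt t x y"
proof -
 have iff: "opt t x y \<longleftrightarrow> (\<forall>z. \<phi> z - action A g H t x z \<le> \<phi> y - action A g H t x y)" for y
 proof
  assume o: "opt t x y"
  show "\<forall>z. \<phi> z - action A g H t x z \<le> \<phi> y - action A g H t x y"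
  proof
   fix z
   have "\<phi> z - action A g H t x z \<le> u t x"
    using t cSUP_upper[OF UNIV_I value_bdd[OF t(1)]] by (simp add: u_def T_plus_def)
   also have "u t x \<le> \<phi> y - action A g H t x y"
   proof (rule field_le_epsilon)
    fix e :: real assume "e > 0"
    then obtain J where "adm t x y J" "u t x - e < \<phi> y - J" using o unfolding opt_def by blast
    then show "u t x \<le> \<phi> y - action A g H t x y + e" using action_facts(1)[OF t(1), of x y J] by simp
   qed
   finally show "\<phi> z - action A g H t x z \<le> \<phi> y - action A g H t x y" .
  qed
 next
  assume m: "\<forall>z. \<phi> z - action A g H t x z \<le> \<phi> y - action A g H t x y"
  then have le: "u t x \<le> \<phi> y - action A g H t x y"
   using t unfolding u_def T_plus_def by (auto intro!: cSUP_least)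
  show "opt t x y" unfolding opt_def
  proof (intro allI impI)
   fix e :: real assume "e > 0"
   then obtain J where "adm t x y J" "J < action A g H t x y + e" using action_facts(2)[OF t(1)] by blast
   then show "\<exists>J. adm t x y J \<and> u t x - e < \<phi> y - J" using le by (intro exI[of _ J]) auto
  qed
 qed
 show ?thesis unfolding iff using tau t unfolding admissible_time_def by blast
qed

text \<open>One half of the semigroup property: a curve from \<open>z\<close> to \<open>z'\<close>
  followed by a nearly optimal one from \<open>z'\<close> is a competitor for \<open>z\<close>. All
  comparisons between different times use only this inequality.\<close>

lemma u_step:
 assumes r: "r \<ge> 0" and h: "h > 0" and J: "adm h z z' J" shows "u r z' - J \<le> u (r + h) z"
proof (cases "r = 0")
 case True
 then show ?thesis using u_ge[OF h J] by simp
next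
 case False
 show ?thesis
 proof (rule field_le_epsilon)
  fix e :: real assume "e > 0"
  then obtain y J' where y: "adm r z' y J'" "u r z' - e < \<phi> y - J'" using u_approx[of r e z'] False r by auto
  have "adm (h + r) z y (J + J')" using adm_concat[OF J y(1)] h r by simp
  then have "\<phi> y - (J + J') \<le> u (r + h) z" using u_ge[of "h + r"] h r by (simp add: add.commute)
  then show "u r z' - J \<le> u (r + h) z + e" using y(2) by simp
 qed
qed

lemma u_bounded:
 obtains F d where "F > 0" "d > 0" "\<And>t x. 0 \<le> t ==> t < d ==> \<bar>u t x\<bar> \<le> F"
proof -
 obtain F where F: "F > 0" "\<And>x. \<bar>\<phi> x\<bar> \<le> F" using phi_bound by metis
 obtain C where C: "C > 0" "\<And>t x y J. t \<ge> 0 ==> adm t x y J ==> - C * t \<le> J" using adm_bounded_below by metis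
 obtain C1 d1 where L1: "C1 > 0" "d1 > 0" "\<forall>x y h. 0 < h \<and> h < d1 \<and> (dm x y \<le> 0 * h \<or> dm y x \<le> 0 * h) --> (\<exists>J. adm h x y J \<and> J \<le> C1 * h)"
  by (rule short_lines[of 0]) simp_all
 have "\<bar>u t x\<bar> \<le> F + C1 * d1 + C * d1" if t: "0 \<le> t" "t < d1" for t x
 proof (cases "t = 0")
  case True
  then show ?thesis using F(2)[of x] C(1) L1 by (simp add: add_increasing2)
 next
  case False
  then have t0: "t > 0" using t by simp
  obtain J where J: "adm t x x J" "J \<le> C1 * t" using L1(3)[rule_format, of t x x] t0 t by auto
  have Ct: "C1 * t \<le> C1 * d1" "C * t \<le> C * d1" "0 \<le> C1 * d1" "0 \<le> C * d1"
   using t L1 C(1) by (auto intro!: mult_left_mono)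
  have lo: "- (F + C1 * d1 + C * d1) \<le> u t x" using u_ge[OF t0 J(1)] J(2) F(2)[of x] Ct by (simp add: abs_le_iff)
  have "u t x \<le> F + C * t"
  proof (rule field_le_epsilon)
   fix e :: real assume "e > 0"
   then obtain y J' where y: "adm t x y J'" "u t x - e < \<phi> y - J'" using u_approx[OF t0] by metis
   have "- C * t \<le> J'" by (rule C(2)[OF t(1) y(1)])
   then show "u t x \<le> F + C * t + e" using y(2) F(2)[of y] by simp
  qed
  then show ?thesis using lo Ct by (simp add: abs_le_iff)
 qed
 moreover have "F + C1 * d1 + C * d1 > 0" using F(1) L1 C(1) by (simp add: add_pos_pos)
 ultimately show thesis using that L1(2) by blast
qed

lemma C11_gradient:
 assumes f: "C11 A f" and c: "c \<in> A"
 obtains G where "\<forall>zt\<in>cdom c. GDERIV (f \<circ> chart_inv c) zt :> G zt" "continuous_on (cdom c) G"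
proof -
 obtain G where G: "\<forall>z\<in>cdom c. GDERIV (f \<circ> chart_inv c) z :> G z \<and> (\<exists>r>0. \<exists>C. C-lipschitz_on (ball z r \<inter> cdom c) G)"
  using f c unfolding C11_def by metis
 have "continuous_on (cdom c) G" unfolding continuous_on_eq_continuous_within
 proof
  fix z assume z: "z \<in> cdom c"
  then obtain r C where r: "r > 0" "C-lipschitz_on (ball z r \<inter> cdom c) G" using G by blast
  have "open (ball z r \<inter> cdom c)" using chart_open(2)[OF c] by blast
  moreover have "z \<in> ball z r \<inter> cdom c" using z r by simp
  ultimately have "isCont G z" using lipschitz_on_continuous_on[OF r(2)] continuous_on_eq_continuous_at by blast
  then show "continuous (at z within cdom c) G" by (rule continuous_at_imp_continuous_at_within)
 qed
 then show thesis using that G by blast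
qed

lemma C11_u: assumes "0 < t" "t \<le> \<tau>" shows "C11 A (u t)"
proof -
 have "u t = T_plus A g H t \<phi>" using assms by (auto simp: u_def fun_eq_iff)
 then show ?thesis using tau assms unfolding admissible_time_def by simp
qed

lemma gradient_lipschitz:
 fixes f :: "'e => real"
 assumes B: "convex B" and f: "\<And>z. z \<in> B ==> GDERIV f z :> G z" "\<And>z. z \<in> B ==> norm (G z - p) \<le> K"
  and z: "z \<in> B" "z' \<in> B"
 shows "\<bar>f z' - f z - p \<bullet> (z' - z)\<bar> \<le> K * norm (z' - z)"
proof -
 have "norm ((f z' - p \<bullet> z') - (f z - p \<bullet> z)) \<le> K * norm (z' - z)"
 proof (rule differentiable_bound[OF B _ _ z(2,1)])
  fix x assume x: "x \<in> B"
  have "(f has_derivative (\<lambda>v. v \<bullet> G x)) (at x within B)"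
   using f(1)[OF x] unfolding gderiv_def by (rule has_derivative_at_withinI)
  then show "((\<lambda>x. f x - p \<bullet> x) has_derivative (\<lambda>v. G x \<bullet> v - p \<bullet> v)) (at x within B)"
   unfolding inner_commute[of "G x"] by (rule has_derivative_diff) (auto intro!: derivative_eq_intros)
  have "onorm (\<lambda>v. (G x - p) \<bullet> v) \<le> norm (G x - p)"
   by (rule onorm_le) (simp add: Cauchy_Schwarz_ineq2)
  then show "onorm (\<lambda>v. G x \<bullet> v - p \<bullet> v) \<le> K" using f(2)[OF x] by (simp add: inner_diff_left)
 qed
 then show ?thesis by (simp add: inner_diff_right algebra_simps)
qed

text \<open>The short-time constructions bound increments by \<open>C * h\<close> for positive
  durations \<open>h\<close> dominating the distance. Letting \<open>h\<close> decrease to the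
  distance gives the Lipschitz bound for close points; for the others the bound \<open>F\<close> on
  the function suffices.\<close>

lemma lipschitz_from_short:
 assumes d: "d > 0" and C: "C \<ge> 0" and F: "F \<ge> 0" "\<And>x. \<bar>f x\<bar> \<le> F"
  and loc: "\<And>x y h. 0 < h ==> h < d ==> dm x y \<le> h \<or> dm y x \<le> h ==> f y - f x \<le> C * h"
 shows "\<bar>f x - f y\<bar> \<le> (C + 2 * F / d) * dm x y"
proof (cases "dm x y < d")
 case True
 have *: "f b - f a \<le> C * dm x y" if ab: "(a, b) = (x, y) \<or> (a, b) = (y, x)" for a b
 proof (rule field_le_epsilon)
  fix e :: real assume e: "e > 0"
  \<comment> \<open>A positive excess keeps the duration positive even when the distance vanishes.
    It is small enough to stay below \<open>d\<close> and to cost at most \<open>e\<close>.\<close>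
  define k where "k = min ((d - dm x y) / 2) (e / (C + 1))"
  define h where "h = dm x y + k"
  have "k > 0" unfolding k_def using True e C by simp
  moreover have "k \<le> (d - dm x y) / 2" unfolding k_def by (rule min.cobounded1)
  moreover have "k \<le> e / (C + 1)" unfolding k_def by (rule min.cobounded2)
  ultimately have k: "k > 0" "k \<le> (d - dm x y) / 2" "k \<le> e / (C + 1)" by blast+
  have "0 < h" unfolding h_def using k(1) dm_nonneg[of x y] by linarith
  moreover have "h < d" using k(2) True unfolding h_def by (simp add: field_simps)
  ultimately have h: "0 < h" "h < d" "dm x y \<le> h" "h \<le> dm x y + e / (C + 1)"
   using k(1,3) unfolding h_def by simp_all
  have "f b - f a \<le> C * h" using ab h by (intro loc) auto
  also have "\<dots> \<le> C * (dm x y + e / (C + 1))" using C h by (intro mult_left_mono) auto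
  also have "C * (e / (C + 1)) \<le> e" using C e by (simp add: field_simps)
  then have "C * (dm x y + e / (C + 1)) \<le> C * dm x y + e" by (simp add: distrib_left)
  finally show "f b - f a \<le> C * dm x y + e" .
 qed
 have "\<bar>f x - f y\<bar> \<le> C * dm x y" using *[of x y] *[of y x] by (auto simp: abs_le_iff)
 also have "\<dots> \<le> (C + 2 * F / d) * dm x y" using F d by (intro mult_right_mono) auto
 finally show ?thesis .
next
 case False
 have "\<bar>f x - f y\<bar> \<le> 2 * F" using F(2)[of x] F(2)[of y] by linarith
 also have "\<dots> = 2 * F / d * d" using d by simp
 also have "\<dots> \<le> 2 * F / d * dm x y" using False F d by (intro mult_left_mono) auto
 also have "\<dots> \<le> (C + 2 * F / d) * dm x y" using C by (intro mult_right_mono) auto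
 finally show ?thesis .
qed

lemma C11_lipschitz:
 assumes f: "C11 A f" and F: "\<And>x. \<bar>f x\<bar> \<le> F"
 obtains K where "K > 0" "\<And>x y. \<bar>f x - f y\<bar> \<le> K * dm x y"
proof -
 let ?Q = "\<lambda>x d. \<forall>y. dm x y < d --> \<bar>f x - f y\<bar> \<le> (1 / d) * dm x y"
 obtain d :: real where d: "d > 0" "\<And>x. ?Q x d"
 proof (rule compact_uniform[of ?Q])
  fix z
  let ?c = "chart_at A z"
  obtain r m M where "chart_box (chart_at A z) z r m M" by (rule chart_box_exists[OF chart_at[of z]])
  note r = chart_boxD[OF this]
  obtain G where G: "\<forall>zt\<in>cdom ?c. GDERIV (f \<circ> chart_inv ?c) zt :> G zt" "continuous_on (cdom ?c) G"
   by (rule C11_gradient[OF f chart_at(1)[of z]])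
  have "compact (G ` cball (snd ?c z) r)"
   by (rule compact_continuous_image[OF continuous_on_subset[OF G(2) r(4)] compact_cball])
  then obtain B where B: "\<And>zt. zt \<in> cball (snd ?c z) r ==> norm (G zt) \<le> B"
   using compact_imp_bounded bounded_iff by (metis imageI)
  define d where "d = min (m * r / 2) (m / (\<bar>B\<bar> + 1))"
  have "d > 0" unfolding d_def using r(1,2) by simp
  moreover have "d \<le> m * r / 2" unfolding d_def by (rule min.cobounded1)
  moreover have "d \<le> m / (\<bar>B\<bar> + 1)" unfolding d_def by (rule min.cobounded2)
  ultimately have d: "d > 0" "d \<le> m * r / 2" "d \<le> m / (\<bar>B\<bar> + 1)" by blast+
  have Bd: "\<bar>B\<bar> / m \<le> 1 / d"
  proof -
   have "1 / (m / (\<bar>B\<bar> + 1)) \<le> 1 / d" using d r by (intro divide_left_mono) auto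
   then show ?thesis using r(2) by (simp add: add_divide_distrib divide_right_mono) (smt (verit) divide_pos_pos)
  qed
  let ?U = "chart_inv ?c ` ball (snd ?c z) (r / 2)"
  have op: "open ?U"
  proof (rule chart_image_open)
   show "ball (snd ?c z) (r / 2) \<subseteq> cdom ?c" using r(1,4) by (auto simp: subset_eq)
  qed auto
  have zU: "z \<in> ?U" using r(1) by (intro image_eqI[of _ _ "snd ?c z"]) auto
  have "?Q w d" if w: "w \<in> ?U" for w
  proof (intro allI impI)
   fix y assume y: "dm w y < d"
   obtain et where et: "et \<in> ball (snd ?c z) (r / 2)" "w = chart_inv ?c et" using w by blast
   have "et \<in> cball (snd ?c z) (r/2)" "et \<in> cball (snd ?c z) r" using et(1) r(1) by auto
   moreover have "dm (chart_inv ?c et) y < m * r / 2" using y d(2) et(2) by simp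
   ultimately have *: "y \<in> fst ?c" "snd ?c y \<in> cball (snd ?c z) r" "m * norm (snd ?c y - et) \<le> dm w y" "et \<in> cball (snd ?c z) r"
    using r(7)[rule_format, of et "dm w y" y] et(2) by blast+
   have g1: "GDERIV (f \<circ> chart_inv ?c) zt :> G zt" and g2: "norm (G zt - 0) \<le> \<bar>B\<bar>" if "zt \<in> cball (snd ?c z) r" for zt
    using G(1) r(4) B[OF that] that by auto
   have "\<bar>(f \<circ> chart_inv ?c) (snd ?c y) - (f \<circ> chart_inv ?c) et - 0 \<bullet> (snd ?c y - et)\<bar> \<le> \<bar>B\<bar> * norm (snd ?c y - et)"
    by (rule gradient_lipschitz[OF convex_cball g1 g2 *(4,2)])
   then have "\<bar>f w - f y\<bar> \<le> \<bar>B\<bar> * norm (snd ?c y - et)" using *(1) et(2) by (simp add: abs_minus_commute)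
   also have "\<dots> \<le> \<bar>B\<bar> / m * dm w y"
    using mult_left_mono[OF *(3), of "\<bar>B\<bar> / m"] r(2) by simp
   also have "\<dots> \<le> (1 / d) * dm w y" using Bd by (intro mult_right_mono) auto
   finally show "\<bar>f w - f y\<bar> \<le> (1 / d) * dm w y" .
  qed
  then show "\<exists>U d. open U \<and> z \<in> U \<and> 0 < d \<and> (\<forall>w\<in>U. ?Q w d)" using op zU d(1) by blast
 next
  fix w and d d' :: real assume Q: "?Q w d" and d: "0 < d'" "d' \<le> d"
  have "1 / d \<le> 1 / d'" using d by (intro divide_left_mono) auto
  then have "(1 / d) * dm w y \<le> (1 / d') * dm w y" for y by (intro mult_right_mono) auto
  then show "?Q w d'" using Q d by (meson order_less_le_trans order_trans)
 qed blast
 have F0: "F \<ge> 0" using F[of undefined] by simp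
 have "\<bar>f x - f y\<bar> \<le> (1 / d + 2 * F / d + 1) * dm x y" for x y
 proof (cases "dm x y < d")
  case True
  then have "\<bar>f x - f y\<bar> \<le> (1 / d) * dm x y" using d(2) by blast
  also have "\<dots> \<le> (1 / d + 2 * F / d + 1) * dm x y" using F0 d(1) by (intro mult_right_mono) auto
  finally show ?thesis .
 next
  case False
  have "\<bar>f x - f y\<bar> \<le> 2 * F" using F[of x] F[of y] by linarith
  also have "\<dots> = 2 * F / d * d" using d by simp
  also have "\<dots> \<le> 2 * F / d * dm x y" using False F0 d by (intro mult_left_mono) auto
  also have "\<dots> \<le> (1 / d + 2 * F / d + 1) * dm x y" using d(1) by (intro mult_right_mono) auto
  finally show ?thesis .
 qed
 moreover have "1 / d + 2 * F / d + 1 > 0" using F0 d(1) by (simp add: add_nonneg_pos)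
 ultimately show thesis using that by blast
qed

text \<open>A curve that is optimal up to 1 has action bounded in terms of the bounds on
  \<open>u\<close> and \<phi>. The lower bound for the action at a high enough rate then forces a
  small displacement in short time.\<close>

lemma displacement:
 assumes et: "et > 0"
 obtains d where "d > 0" "d \<le> \<tau>" "\<And>s x y J. 0 < s ==> s < d ==> adm s x y J ==> u s x - 1 < \<phi> y - J ==> dm x y < et"
proof -
 obtain F d0 where F: "F > 0" "d0 > 0" "\<And>t x. 0 \<le> t ==> t < d0 ==> \<bar>u t x\<bar> \<le> F" using u_bounded by metis
 \<comment> \<open>The action is below \<open>2 * F + 1\<close> and the error \<open>C * s\<close>
   below 1, so the rate times the displacement is below \<open>2 * F + 3\<close>.\<close>
 define K where "K = (2 * F + 3) / et"
 have K: "K > 0" using F et by (simp add: K_def)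
 obtain C where C: "C > 0" "\<And>t x y J. t \<ge> 0 ==> adm t x y J ==> K * dm x y \<le> J + C * t"
  using adm_lower[OF K] by metis
 define d where "d = min (min d0 \<tau>) (1 / C)"
 have "dm x y < et" if s: "0 < s" "s < d" and J: "adm s x y J" "u s x - 1 < \<phi> y - J" for s x y J
 proof -
  have "\<bar>u s x\<bar> \<le> F" using s by (intro F(3)) (auto simp: d_def)
  moreover have "\<bar>\<phi> y\<bar> \<le> F" using F(3)[of 0 y] F(2) by simp
  ultimately have "J < 2 * F + 1" using J(2) by simp
  moreover have "C * s < 1" using s C(1) by (simp add: d_def field_simps)
  moreover have "K * dm x y \<le> J + C * s" using C(2)[OF _ J(1)] s by simp
  ultimately have "K * dm x y < 2 * F + 3" by linarith
  also have "2 * F + 3 = K * et" using et by (simp add: K_def)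
  finally show ?thesis using K by simp
 qed
 moreover have "d > 0" "d \<le> \<tau>" using F C tau_pos by (auto simp: d_def)
 ultimately show thesis using that by blast
qed

lemma opt_displacement:
 assumes "opt s x y" "\<And>J. adm s x y J ==> u s x - 1 < \<phi> y - J ==> dm x y < et"
 shows "dm x y < et" using assms unfolding opt_def by (meson zero_less_one)

text \<open>Nearly optimal curves for \<open>X n\<close> and \<open>Y n\<close> are turned by
  \<open>action_perturbation\<close> into curves from \<open>x\<close> to \<open>y\<close> of almost
  the same action. This replaces a compactness argument for curves. The perturbation length
  \<open>h\<close> is fixed first and \<open>n\<close> is chosen afterwards.\<close>

lemma opt_closed:
 assumes s: "0 < s" and o: "\<And>n::nat. opt s (X n) (Y n)"
  and X: "(\<lambda>n. dm (X n) x) \<longlonglongrightarrow> 0" and Y: "(\<lambda>n. dm (Y n) y) \<longlonglongrightarrow> 0"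
  and \<phi>: "(\<lambda>n. \<phi> (Y n)) \<longlonglongrightarrow> \<phi> y" and u: "(\<lambda>n. u s (X n)) \<longlonglongrightarrow> u s x"
 shows "opt s x y" unfolding opt_def
proof (intro allI impI)
 fix e :: real assume e: "e > 0"
 \<comment> \<open>An a priori bound for the actions of the curves to be perturbed, once
   \<open>\<phi> (Y n)\<close> and \<open>u s (X n)\<close> are within 1 of their limits.\<close>
 define B where "B = \<phi> y - u s x + 2 + e"
 obtain C N0 where C: "C > 0" "\<forall>n\<ge>N0. \<forall>x z x' z' J. adm s x z J \<and> J \<le> B \<and>
   (let h = s / (4 * real (Suc n)) in (dm x x' \<le> h \<or> dm x' x \<le> h) \<and> (dm z z' \<le> h \<or> dm z' z \<le> h)) -->
   (\<exists>J'. adm s x' z' J' \<and> J' \<le> J + C * (s / (4 * real (Suc n))))" by (rule action_perturbation[OF s])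
 obtain N1 :: nat where N1: "C * s / e < real N1" using reals_Archimedean2 by blast
 define N where "N = max N0 N1"
 define h where "h = s / (4 * real (Suc N))"
 have h: "h > 0" using s by (simp add: h_def)
 have "C * s / e < real (Suc N)" using N1 by (simp add: N_def)
 then have Ch: "C * h < e / 4" using e by (simp add: h_def field_simps)
 have m: "min 1 (e / 4) > 0" using e by simp
 have "\<forall>\<^sub>F n in sequentially. dm (X n) x < h \<and> dm (Y n) y < h \<and> dist (\<phi> (Y n)) (\<phi> y) < min 1 (e/4) \<and> dist (u s (X n)) (u s x) < min 1 (e/4)"
  using order_tendstoD(2)[OF X h] order_tendstoD(2)[OF Y h] tendstoD[OF \<phi> m] tendstoD[OF u m]
  by eventually_elim simp
 then obtain n where n: "dm (X n) x < h" "dm (Y n) y < h" "dist (\<phi> (Y n)) (\<phi> y) < min 1 (e/4)" "dist (u s (X n)) (u s x) < min 1 (e/4)"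
  using eventually_happens'[OF sequentially_bot] by blast
 have "e / 4 > 0" using e by simp
 then obtain J where J: "adm s (X n) (Y n) J" "u s (X n) - e / 4 < \<phi> (Y n) - J" using o[of n] unfolding opt_def by blast
 have n': "\<bar>\<phi> (Y n) - \<phi> y\<bar> < 1" "\<bar>u s (X n) - u s x\<bar> < 1" "\<bar>\<phi> (Y n) - \<phi> y\<bar> < e / 4" "\<bar>u s (X n) - u s x\<bar> < e / 4"
  using n(3,4) by (simp_all add: dist_real_def)
 have "J \<le> B" unfolding B_def using J(2) n'(1,2) e by linarith
 then obtain J' where J': "adm s x y J'" "J' \<le> J + C * h"
  using C(2)[rule_format, of N "X n" "Y n" J x y] J(1) n(1,2) by (auto simp: Let_def h_def N_def)
 have "u s x - e < \<phi> y - J'" using J'(2) J(2) Ch n'(3,4) by linarith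
 then show "\<exists>J. adm s x y J \<and> u s x - e < \<phi> y - J" using J'(1) by blast
qed

text \<open>For small times the map \<open>Y\<close> from starting point to optimal end point is
  continuous and moves coordinates by at most \<open>r / 8\<close>. A continuous map that close to
  the identity on a ball reaches the centre of the ball.\<close>

lemma opt_surjective_local:
 obtains U dl where "open U" "z \<in> U" "dl > 0" "dl \<le> \<tau>" "\<forall>y\<in>U. \<forall>s. 0 < s \<and> s < dl --> (\<exists>x. opt s x y)"
proof -
 let ?c = "chart_at A z"
 let ?z = "snd ?c z"
 have cA: "?c \<in> A" by simp
 obtain r m M where "chart_box (chart_at A z) z r m M" by (rule chart_box_exists[OF chart_at[of z]])
 note r = chart_boxD[OF this]
 have "m * r / 8 > 0" using r by simp
 then obtain dl where dl: "dl > 0" "dl \<le> \<tau>"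
  "\<And>s x y J. 0 < s ==> s < dl ==> adm s x y J ==> u s x - 1 < \<phi> y - J ==> dm x y < m * r / 8"
  using displacement by metis
 let ?U = "chart_inv ?c ` ball ?z (r / 8)"
 have op: "open ?U"
 proof (rule chart_image_open)
  show "ball ?z (r / 8) \<subseteq> cdom ?c" using r(1,4) by (auto simp: subset_eq)
 qed auto
 have zU: "z \<in> ?U" using r(1) by (intro image_eqI[of _ _ ?z]) auto
 have "\<exists>x. opt s x y" if y: "y \<in> ?U" and s: "0 < s" "s < dl" for y s
 proof -
  obtain et where et: "et \<in> ball ?z (r / 8)" "y = chart_inv ?c et" using y by blast
  have s\<tau>: "s \<le> \<tau>" using s dl by simp
  define P where "P x = (THE y. opt s x y)" for x
  have P: "opt s x (P x)" and Pu: "opt s x y ==> y = P x" for x y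
   using theI'[OF opt_unique[OF s(1) s\<tau>, of x]] opt_unique[OF s(1) s\<tau>, of x] unfolding P_def by blast+
  define Y where "Y zt = snd ?c (P (chart_inv ?c zt))" for zt
  have near: "P (chart_inv ?c zt) \<in> fst ?c \<and> Y zt \<in> cball ?z r \<and> norm (Y zt - zt) \<le> r / 8" if zt: "zt \<in> cball ?z (r / 2)" for zt
  proof -
   let ?e = "dm (chart_inv ?c zt) (P (chart_inv ?c zt))"
   have d: "?e < m * r / 8" by (rule opt_displacement[OF P]) (rule dl(3)[OF s])
   moreover have "m * r / 8 \<le> m * r / 2" using r by simp
   ultimately have *: "P (chart_inv ?c zt) \<in> fst ?c \<and> Y zt \<in> cball ?z r \<and> m * norm (Y zt - zt) \<le> ?e"
    using r(7)[rule_format, OF zt, of ?e] unfolding Y_def by simp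
   then have "m * norm (Y zt - zt) \<le> m * (r / 8)" using d by simp
   then show ?thesis using * r(2) by simp
  qed
  obtain G where G: "\<forall>zt\<in>cdom ?c. GDERIV (u s \<circ> chart_inv ?c) zt :> G zt"
   using C11_gradient[OF C11_u[OF s(1) s\<tau>] cA] by metis
  have sub: "cball ?z (r / 2) \<subseteq> cball ?z r" using r(1) by auto
  \<comment> \<open>If continuity failed at \<open>a\<close>, compactness would give a subsequence
    of values converging to some other \<open>l\<close>; the graph of \<open>opt\<close> is closed,
    so \<open>l\<close> would be optimal for \<open>a\<close>, contradicting uniqueness.\<close>
  have contY: "continuous_on (cball ?z (r / 2)) Y" unfolding continuous_on_sequentially
  proof (intro allI ballI impI)
   fix S :: "nat => 'e" and a assume a: "a \<in> cball ?z (r / 2)" and S': "(\<forall>n. S n \<in> cball ?z (r / 2)) \<and> S \<longlonglongrightarrow> a"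
   then have S: "\<And>n. S n \<in> cball ?z (r / 2)" "S \<longlonglongrightarrow> a" by auto
   show "(Y \<circ> S) \<longlonglongrightarrow> Y a"
   proof (rule ccontr)
    assume "\<not> (Y \<circ> S) \<longlonglongrightarrow> Y a"
    then obtain e where e: "e > 0" "\<not> (\<forall>\<^sub>F n in sequentially. dist ((Y \<circ> S) n) (Y a) < e)" unfolding tendsto_iff by blast
    then obtain q :: "nat => nat" where q: "strict_mono q" "\<And>n. \<not> dist ((Y \<circ> S) (q n)) (Y a) < e"
     using not_eventually_sequentiallyD by blast
    have "\<forall>n. (Y \<circ> S \<circ> q) n \<in> cball ?z r" using near S(1) by auto
    then obtain l p where l: "l \<in> cball ?z r" "strict_mono (p :: nat => nat)" "((Y \<circ> S \<circ> q) \<circ> p) \<longlonglongrightarrow> l"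
     using compact_cball[of ?z r] unfolding compact_def by metis
    define k where "k = q \<circ> p"
    have k: "strict_mono k" unfolding k_def by (rule strict_mono_o[OF q(1) l(2)])
    have Sk: "(\<lambda>n. S (k n)) \<longlonglongrightarrow> a" using LIMSEQ_subseq_LIMSEQ[OF S(2) k] by (simp add: o_def)
    have Yk: "(\<lambda>n. Y (S (k n))) \<longlonglongrightarrow> l" using l(3) by (simp add: o_def k_def)
    have "opt s (chart_inv ?c a) (chart_inv ?c l)"
    proof (rule opt_closed[OF s(1), of "\<lambda>n. chart_inv ?c (S (k n))" "\<lambda>n. chart_inv ?c (Y (S (k n)))"])
     fix n
     show "opt s (chart_inv ?c (S (k n))) (chart_inv ?c (Y (S (k n))))"
      using P[of "chart_inv ?c (S (k n))"] near[OF S(1)[of "k n"]] by (simp add: Y_def)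
    next
     have ar: "a \<in> cball ?z r" and Sr: "S n \<in> cball ?z r" for n using a S(1) sub by blast+
     have dom: "a \<in> cdom ?c" "l \<in> cdom ?c" using ar l(1) r(4) by blast+
     have lim: "(\<lambda>n. dm (chart_inv ?c (V n)) (chart_inv ?c v)) \<longlonglongrightarrow> 0"
      if "\<And>n. V n \<in> cball ?z r" "v \<in> cball ?z r" "V \<longlonglongrightarrow> v" for V and v
     proof (rule tendsto_sandwich[of "\<lambda>_. 0"])
      have "(\<lambda>n. M * norm (v - V n)) \<longlonglongrightarrow> M * norm (v - v)" by (intro tendsto_intros that(3))
      then show "(\<lambda>n. M * norm (v - V n)) \<longlonglongrightarrow> 0" by simp
      show "\<forall>\<^sub>F n in sequentially. dm (chart_inv ?c (V n)) (chart_inv ?c v) \<le> M * norm (v - V n)"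
       using r(6) that by (intro always_eventually) blast
     qed simp_all
     show "(\<lambda>n. dm (chart_inv ?c (S (k n))) (chart_inv ?c a)) \<longlonglongrightarrow> 0" by (rule lim[OF Sr ar Sk])
     show "(\<lambda>n. dm (chart_inv ?c (Y (S (k n)))) (chart_inv ?c l)) \<longlonglongrightarrow> 0"
      by (rule lim[OF _ l(1) Yk]) (use near S(1) in blast)
     have "isCont (\<phi> \<circ> chart_inv ?c) l"
     proof -
      have "continuous_on (cdom ?c) (\<phi> \<circ> chart_inv ?c)"
       by (rule continuous_on_compose[OF chart_continuous(2)[OF cA] continuous_on_subset[OF phi_continuous]]) simp
      then show ?thesis using continuous_on_eq_continuous_at[OF chart_open(2)[OF cA]] dom(2) by blast
     qed
     then show "(\<lambda>n. \<phi> (chart_inv ?c (Y (S (k n))))) \<longlonglongrightarrow> \<phi> (chart_inv ?c l)"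
      using isCont_tendsto_compose[OF _ Yk, of "\<phi> \<circ> chart_inv ?c"] by simp
     have "isCont (u s \<circ> chart_inv ?c) a"
      using G dom(1) unfolding gderiv_def using has_derivative_continuous by blast
     then show "(\<lambda>n. u s (chart_inv ?c (S (k n)))) \<longlonglongrightarrow> u s (chart_inv ?c a)"
      using isCont_tendsto_compose[OF _ Sk, of "u s \<circ> chart_inv ?c"] by simp
    qed
    then have "chart_inv ?c l = P (chart_inv ?c a)" by (rule Pu)
    then have "l = Y a" using chart_chart_inv(1)[OF cA, of l] l(1) r(4) unfolding Y_def by auto
    with Yk have "(\<lambda>n. Y (S (k n))) \<longlonglongrightarrow> Y a" by simp
    then have "\<forall>\<^sub>F n in sequentially. dist (Y (S (k n))) (Y a) < e" using e(1) by (rule tendstoD)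
    then obtain n where "dist (Y (S (k n))) (Y a) < e" using eventually_happens'[OF sequentially_bot] by blast
    then show False using q(2)[of "p n"] by (simp add: k_def)
   qed
  qed
  have sub2: "cball et (r / 8) \<subseteq> cball ?z (r / 2)"
  proof
   fix w assume "w \<in> cball et (r / 8)"
   then have "dist ?z w \<le> r / 8 + r / 8" using et(1) dist_triangle[of ?z w et] by simp
   then show "w \<in> cball ?z (r / 2)" using r(1) by simp
  qed
  \<comment> \<open>Fixed points of this map are exactly the solutions of \<open>Y zt = et\<close>,
    and it maps the ball about \<open>et\<close> to itself because \<open>Y\<close> is within
    \<open>r / 8\<close> of the identity.\<close>
  obtain zt where zt: "zt \<in> cball et (r / 8)" "zt - Y zt + et = zt"
  proof (rule brouwer[of "cball et (r / 8)" "\<lambda>zt. zt - Y zt + et"])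
   show "continuous_on (cball et (r / 8)) (\<lambda>zt. zt - Y zt + et)"
    by (intro continuous_intros continuous_on_subset[OF contY sub2])
   show "(\<lambda>zt. zt - Y zt + et) \<in> cball et (r / 8) \<rightarrow> cball et (r / 8)"
   proof
    fix w assume "w \<in> cball et (r / 8)"
    then have "norm (Y w - w) \<le> r / 8" using near sub2 by blast
    then show "w - Y w + et \<in> cball et (r / 8)" by (simp add: dist_norm norm_minus_commute algebra_simps)
   qed
  qed (use r(1) in auto)
  then have "Y zt = et" by (simp add: algebra_simps)
  moreover have "P (chart_inv ?c zt) \<in> fst ?c" using near zt(1) sub2 by blast
  then have "chart_inv ?c (Y zt) = P (chart_inv ?c zt)" unfolding Y_def by simp
  ultimately have "P (chart_inv ?c zt) = y" using et(2) by simp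
  then show ?thesis using P[of "chart_inv ?c zt"] by auto
 qed
 then have "\<forall>y\<in>?U. \<forall>s. 0 < s \<and> s < dl --> (\<exists>x. opt s x y)" by (intro ballI allI impI) (elim conjE)
 then show thesis by (rule that[OF op zU dl(1,2)])
qed

lemma opt_surjective:
 obtains d where "d > 0" "\<And>y s. 0 < s ==> s < d ==> \<exists>x. opt s x y"
proof -
 let ?Q = "\<lambda>y d. \<forall>s. 0 < s \<and> s < d --> (\<exists>x. opt s x y)"
 obtain d :: real where "d > 0" "\<And>y. ?Q y d"
 proof (rule compact_uniform[of ?Q])
  fix z
  show "\<exists>U d. open U \<and> z \<in> U \<and> 0 < d \<and> (\<forall>w\<in>U. ?Q w d)"
   by (rule opt_surjective_local[of z]) blast
 qed (blast intro: less_le_trans)+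
 then show thesis using that by blast
qed

end

section \<open>Uniform Lipschitz bounds and translation of nearly optimal curves\<close>

context lax_oleinik
begin

lemma unit_lines:
 obtains C d where "C > 0" "d > 0" "\<And>x y h. 0 < h ==> h < d ==> dm x y \<le> h \<or> dm y x \<le> h ==> \<exists>J. adm h x y J \<and> J \<le> C * h"
proof -
 obtain C d where L: "C > 0" "d > 0" "\<forall>x y h. 0 < h \<and> h < d \<and> (dm x y \<le> 1 * h \<or> dm y x \<le> 1 * h) --> (\<exists>J. adm h x y J \<and> J \<le> C * h)"
  by (rule short_lines[of 1]) simp_all
 then have "\<exists>J. adm h x y J \<and> J \<le> C * h" if "0 < h" "h < d" "dm x y \<le> h \<or> dm y x \<le> h" for x y h
  using that by simp
 then show thesis using that L(1,2) by metis
qed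

text \<open>Given \<open>y\<close>, take \<open>x\<close> with \<open>y\<close> optimal for
  \<open>x\<close> at a fixed time \<open>s\<close>. Dropping the first piece of duration
  \<open>h\<close> of a nearly optimal curve and appending a segment from \<open>y\<close> to
  \<open>y'\<close> gives a competitor from a later point \<open>x'\<close>. The Lipschitz
  continuity of \<open>u s\<close> pays for moving from \<open>x\<close> to \<open>x'\<close>, and
  the action of the dropped piece compensates that cost up to a multiple of
  \<open>h\<close>.\<close>

lemma phi_lipschitz: obtains K where "K > 0" "\<And>x y. \<bar>\<phi> x - \<phi> y\<bar> \<le> K * dm x y"
proof -
 obtain dls where dls: "dls > 0" "\<And>y s. 0 < s ==> s < dls ==> \<exists>x. opt s x y" using opt_surjective by metis
 obtain F dl0 where F: "F > 0" "dl0 > 0" "\<And>t x. 0 \<le> t ==> t < dl0 ==> \<bar>u t x\<bar> \<le> F" using u_bounded by metis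
 define s where "s = min (min dls dl0) \<tau> / 2"
 have s: "0 < s" "s < dls" "s < dl0" "s \<le> \<tau>" using dls(1) F(2) tau_pos by (auto simp: s_def)
 obtain K where K: "K > 0" "\<And>x y. \<bar>u s x - u s y\<bar> \<le> K * dm x y"
  using C11_lipschitz[OF C11_u[OF s(1,4)], of F] F(3) s by (metis less_imp_le)
 obtain C1 dl1 where L: "C1 > 0" "dl1 > 0" "\<And>x y h. 0 < h ==> h < dl1 ==> dm x y \<le> h \<or> dm y x \<le> h ==> \<exists>J. adm h x y J \<and> J \<le> C1 * h"
  using unit_lines by metis
 obtain C where C: "C > 0" "\<And>t x y J. t \<ge> 0 ==> adm t x y J ==> K * dm x y \<le> J + C * t"
  using adm_lower[OF K(1)] by metis
 have loc: "\<phi> y' - \<phi> y \<le> (C1 + C) * h" if h: "0 < h" "h < min s dl1" and d: "dm y y' \<le> h \<or> dm y' y \<le> h" for y y' h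
 proof (rule field_le_epsilon)
  fix e :: real assume e: "e > 0"
  obtain x where x: "opt s x y" using dls(2)[OF s(1,2)] by blast
  then obtain J where J: "adm s x y J" "u s x - e < \<phi> y - J" using e unfolding opt_def by blast
  have "adm (h + (s - h)) x y J" using J(1) by simp
  then obtain x' J1 J2 where x': "adm h x x' J1" "adm (s - h) x' y J2" "J1 + J2 = J" using h by (elim adm_cut) auto
  obtain J3 where J3: "adm h y y' J3" "J3 \<le> C1 * h" using L(3)[OF h(1) _ d] h(2) by auto
  have "adm (s - h + h) x' y' (J2 + J3)" by (rule adm_concat[OF x'(2) J3(1)]) (use h in auto)
  then have "\<phi> y' - (J2 + J3) \<le> u s x'" using u_ge[OF s(1)] by simp
  moreover have "u s x' \<le> u s x + K * dm x x'" using K(2)[of x x'] by simp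
  moreover have "K * dm x x' \<le> J1 + C * h" using C(2)[OF _ x'(1)] h by simp
  ultimately show "\<phi> y' - \<phi> y \<le> (C1 + C) * h + e" using J(2) J3(2) x'(3) by (simp add: distrib_right)
 qed
 have F': "\<bar>\<phi> x\<bar> \<le> F" for x using F(3)[of 0 x] F(2) by simp
 have "\<bar>\<phi> x - \<phi> y\<bar> \<le> (C1 + C + 2 * F / min s dl1) * dm x y" for x y
  by (rule lipschitz_from_short[OF _ _ _ F' loc]) (use s L C F in auto)
 moreover have "C1 + C + 2 * F / min s dl1 > 0" using s L C F by (simp add: add_pos_pos)
 ultimately show thesis using that by blast
qed

text \<open>To compare \<open>x\<close> with \<open>y\<close>, a segment from \<open>x\<close> to
  \<open>y\<close> of duration \<open>h\<close> is put before a nearly optimal curve from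
  \<open>y\<close>, and the last piece of duration \<open>h\<close> is dropped. The Lipschitz
  continuity of \<phi> pays for the changed end point, so the constant does not deteriorate as
  \<open>t\<close> tends to 0.\<close>

lemma u_lipschitz:
 obtains K dl where "K > 0" "dl > 0" "dl \<le> \<tau>" "\<And>t x y. 0 \<le> t ==> t < dl ==> \<bar>u t x - u t y\<bar> \<le> K * dm x y"
proof -
 obtain K where K: "K > 0" "\<And>x y. \<bar>\<phi> x - \<phi> y\<bar> \<le> K * dm x y" using phi_lipschitz by metis
 obtain F dl0 where F: "F > 0" "dl0 > 0" "\<And>t x. 0 \<le> t ==> t < dl0 ==> \<bar>u t x\<bar> \<le> F" using u_bounded by metis
 obtain C1 dl1 where L: "C1 > 0" "dl1 > 0" "\<And>x y h. 0 < h ==> h < dl1 ==> dm x y \<le> h \<or> dm y x \<le> h ==> \<exists>J. adm h x y J \<and> J \<le> C1 * h"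
  using unit_lines by metis
 obtain C where C: "C > 0" "\<And>t x y J. t \<ge> 0 ==> adm t x y J ==> K * dm x y \<le> J + C * t"
  using adm_lower[OF K(1)] by metis
 define D where "D = K + C1 + C"
 have D: "D > 0" using K C L by (simp add: D_def)
 define dl where "dl = min (min dl0 \<tau>) dl1"
 have loc: "u t y - u t x \<le> D * h" if t: "0 \<le> t" "t < dl" and h: "0 < h" "h < dl1" and d: "dm x y \<le> h \<or> dm y x \<le> h" for t x y h
 proof -
  have t1: "t < dl1" using t by (simp add: dl_def)
  have "\<bar>\<phi> y - \<phi> x\<bar> \<le> K * h"
  proof -
   obtain e where "e \<le> h" "\<bar>\<phi> y - \<phi> x\<bar> \<le> K * e" using d K(2)[of x y] K(2)[of y x] by (metis abs_minus_commute)
   moreover have "K * e \<le> K * h" using K(1) \<open>e \<le> h\<close> by simp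
   ultimately show ?thesis by linarith
  qed
  then have \<phi>: "\<phi> y - \<phi> x \<le> K * h" by linarith
  have Dh: "D * h = K * h + C1 * h + C * h" "C1 * h > 0" "C * h > 0" "K * h > 0"
   using h K C L by (simp_all add: D_def distrib_right)
  show ?thesis
  proof (cases "t = 0")
   case True
   then show ?thesis using \<phi> Dh by simp
  next
   case False
   then have t0: "t > 0" using t by simp
   show ?thesis
   proof (rule field_le_epsilon)
    fix ep :: real assume ep: "ep > 0"
    obtain w J where w: "adm t y w J" "u t y - ep < \<phi> w - J" by (rule u_approx[OF t0 ep])
    show "u t y - u t x \<le> D * h + ep"
    proof (cases "h < t")
     case True
     have "adm (t - h + h) y w J" using w(1) by simp
     then obtain m J1 J2 where m: "adm (t - h) y m J1" "adm h m w J2" "J1 + J2 = J"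
      using h True by (elim adm_cut) auto
     obtain J3 where J3: "adm h x y J3" "J3 \<le> C1 * h" using L(3)[OF h d] by blast
     have "adm (h + (t - h)) x m (J3 + J1)" by (rule adm_concat[OF J3(1) m(1)]) (use h True in auto)
     then have "\<phi> m - (J3 + J1) \<le> u t x" using u_ge[OF t0] by simp
     moreover have "\<phi> w \<le> \<phi> m + K * dm m w" using K(2)[of m w] by simp
     moreover have "K * dm m w \<le> J2 + C * h" using C(2)[OF _ m(2)] h by simp
     ultimately show ?thesis using w(2) J3(2) m(3) Dh by linarith
    next
     case False
     \<comment> \<open>The time is too short for the segment of duration \<open>h\<close>. Staying
       near \<open>x\<close> throughout suffices: \<phi> is Lipschitz and both curves cost only a
       multiple of \<open>h\<close>.\<close>
     obtain J3 where J3: "adm t x x J3" "J3 \<le> C1 * t" using L(3)[OF t0 t1, of x x] t0 by auto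
     have "C1 * t \<le> C1 * h" "C * t \<le> C * h" using False L C by auto
     moreover have "\<phi> x - J3 \<le> u t x" by (rule u_ge[OF t0 J3(1)])
     moreover have "\<phi> w \<le> \<phi> y + K * dm y w" using K(2)[of y w] by simp
     moreover have "K * dm y w \<le> J + C * t" using C(2)[OF _ w(1)] t by simp
     ultimately show ?thesis using w(2) J3(2) \<phi> Dh by linarith
    qed
   qed
  qed
 qed
 have "\<bar>u t x - u t y\<bar> \<le> (D + 2 * F / dl1) * dm x y" if t: "0 \<le> t" "t < dl" for t x y
 proof -
  have F': "\<bar>u t x\<bar> \<le> F" for x using F(3)[of t x] t by (simp add: dl_def)
  show ?thesis by (rule lipschitz_from_short[OF _ _ _ F' loc[OF t]]) (use D L F in auto)
 qed
 moreover have "D + 2 * F / dl1 > 0" using D L F by (simp add: add_pos_pos)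
 moreover have "dl > 0" "dl \<le> \<tau>" using F(2) L(2) tau_pos by (auto simp: dl_def)
 ultimately show thesis using that by blast
qed

text \<open>As in \<open>displacement\<close>, but for every intermediate time: the final piece
  inherits the upper bound on the action, because the initial piece cannot have very negative
  action.\<close>

lemma curve_near_end:
 assumes et: "et > 0"
 obtains d where "d > 0" "\<forall>t \<xi> J s. 0 < t \<and> t < d \<and> acc t \<xi> \<and> (lag \<xi> {0..t} has_integral J) {0..t} \<and>
   u t (\<xi> 0) - 1 < \<phi> (\<xi> t) - J \<and> s \<in> {0..t} --> dm (\<xi> s) (\<xi> t) < et"
proof -
 obtain F d0 where F: "F > 0" "d0 > 0" "\<And>t x. 0 \<le> t ==> t < d0 ==> \<bar>u t x\<bar> \<le> F" using u_bounded by metis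
 define K where "K = (2 * F + 3) / et"
 have K: "K > 0" using F et by (simp add: K_def)
 obtain C where C: "C > 0" "\<And>t x y J. t \<ge> 0 ==> adm t x y J ==> K * dm x y \<le> J + C * t"
  using adm_lower[OF K] by metis
 define d where "d = min d0 (1 / C)"
 have "dm (\<xi> s) (\<xi> t) < et" if t: "0 < t" "t < d" and \<xi>: "acc t \<xi>" and J: "(lag \<xi> {0..t} has_integral J) {0..t}"
  "u t (\<xi> 0) - 1 < \<phi> (\<xi> t) - J" and s: "s \<in> {0..t}" for t \<xi> J s
 proof -
  have "\<bar>u t (\<xi> 0)\<bar> \<le> F" using t by (intro F(3)) (auto simp: d_def)
  moreover have "\<bar>\<phi> (\<xi> t)\<bar> \<le> F" using F(3)[of 0 "\<xi> t"] F(2) by simp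
  ultimately have JF: "J < 2 * F + 1" using J(2) by simp
  have Ct: "C * t < 1" using t C(1) by (simp add: d_def field_simps)
  have "K * dm (\<xi> s) (\<xi> t) < 2 * F + 3"
  proof -
   consider "s = 0" | "s = t" | "0 < s" "s < t" using s by fastforce
   then show ?thesis
   proof cases
    case 1
    have "adm t (\<xi> 0) (\<xi> t) J" unfolding adm_def using \<xi> J(1) by blast
    then have "K * dm (\<xi> 0) (\<xi> t) \<le> J + C * t" using C(2) t by simp
    then show ?thesis using JF Ct 1 by simp
   next
    case 2
    then show ?thesis using F(1) by simp
   next
    case 3
    have e: "s + (t - s) = t" by simp
    obtain J1 J2 where *: "adm s (\<xi> 0) (\<xi> s) J1" "adm (t - s) (\<xi> s) (\<xi> (s + (t - s))) J2" "J1 + J2 = J"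
     by (rule adm_split[of s "t - s" \<xi> J]) (use \<xi> J(1) 3 e in auto)
    have "K * dm (\<xi> s) (\<xi> t) \<le> J2 + C * (t - s)" using C(2)[OF _ *(2)] 3 by simp
    moreover have "0 \<le> K * dm (\<xi> 0) (\<xi> s)" using K by simp
    then have "0 \<le> J1 + C * s" using C(2)[OF _ *(1)] 3 by simp
    ultimately show ?thesis using JF Ct *(3) by (simp add: right_diff_distrib)
   qed
  qed
  also have "2 * F + 3 = K * et" using et by (simp add: K_def)
  finally show ?thesis using K by simp
 qed
 then have "\<forall>t \<xi> J s. 0 < t \<and> t < d \<and> acc t \<xi> \<and> (lag \<xi> {0..t} has_integral J) {0..t} \<and>
   u t (\<xi> 0) - 1 < \<phi> (\<xi> t) - J \<and> s \<in> {0..t} --> dm (\<xi> s) (\<xi> t) < et"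
  by (intro allI impI) (elim conjE)
 moreover have "d > 0" using F C by (simp add: d_def)
 ultimately show thesis by (intro that)
qed

text \<open>One small step of the translated curve. From \<open>\<alpha> + v\<close> one moves for
  time \<open>h\<close> with the truncated velocity \<open>w\<close>, at which the Lagrangian is
  Lipschitz in the position, so shifting by \<open>v\<close> costs \<open>CL * norm v\<close> per
  unit of time. The end point then misses \<open>\<beta> + v\<close> by about
  \<open>h * norm (D - w)\<close>; the Lipschitz constant \<open>K\<close> of \<open>u q\<close>
  prices this at exactly what truncation saved.\<close>

lemma action_increment_translate:
 assumes c: "c \<in> A" and K: "K \<ge> 0" and r: "r > 0" and B: "cball \<zeta>0 (4 * r) \<subseteq> cdom c"
  and W: "norm w \<le> W" "W > 0" "Lc c \<zeta> w + K * norm (D - w) \<le> Lc c \<zeta> D"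
  and CL: "CL \<ge> 0" "\<And>\<zeta> \<zeta>' w. \<zeta> \<in> cball \<zeta>0 (4 * r) ==> \<zeta>' \<in> cball \<zeta>0 (4 * r) ==> norm w \<le> W ==> \<bar>Lc c \<zeta> w - Lc c \<zeta>' w\<bar> \<le> CL * norm (\<zeta> - \<zeta>')"
  and uK: "\<And>\<zeta> \<zeta>'. \<zeta> \<in> cball \<zeta>0 (4 * r) ==> \<zeta>' \<in> cball \<zeta>0 (4 * r) ==> \<bar>u q (chart_inv c \<zeta>) - u q (chart_inv c \<zeta>')\<bar> \<le> K * norm (\<zeta> - \<zeta>')"
  and q: "q \<ge> 0" and h: "h > 0" "h * W \<le> r"
  and pts: "\<zeta> \<in> cball \<zeta>0 (2 * r)" "\<alpha> \<in> cball \<zeta>0 (2 * r)" "\<beta> \<in> cball \<zeta>0 (2 * r)" "norm v \<le> r"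
  and d: "norm (\<beta> - \<alpha> - h *\<^sub>R D) \<le> e * h" "norm (\<alpha> - \<zeta>) \<le> e' * h"
 shows "u q (chart_inv c (\<beta> + v)) - u (q + h) (chart_inv c (\<alpha> + v)) \<le> h * (Lc c \<zeta> D + CL * norm v + K * e + CL * (e' + W) * h)"
proof -
 let ?B = "cball \<zeta>0 (4 * r)"
 have \<alpha>3: "norm (\<alpha> + v - \<zeta>0) \<le> 3 * r" and \<beta>3: "norm (\<beta> + v - \<zeta>0) \<le> 3 * r"
  using norm_triangle_ineq[of "\<alpha> - \<zeta>0" v] norm_triangle_ineq[of "\<beta> - \<zeta>0" v] pts
  by (simp_all add: dist_norm norm_minus_commute algebra_simps)
 have hw: "norm (h *\<^sub>R w) \<le> r"
 proof -
  have "h * norm w \<le> h * W" using W h by (intro mult_left_mono) auto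
  then have "h * norm w \<le> r" using h(2) by linarith
  then show ?thesis using h(1) by simp
 qed
 have inB: "\<zeta> \<in> ?B" "\<alpha> + v \<in> ?B" "\<beta> + v \<in> ?B" "\<alpha> + v + h *\<^sub>R w \<in> ?B"
  using pts(1) \<alpha>3 \<beta>3 r norm_triangle_ineq[of "\<alpha> + v - \<zeta>0" "h *\<^sub>R w"] hw
  by (simp_all add: dist_norm norm_minus_commute algebra_simps)
 have Lw: "Lc c \<theta> w \<le> Lc c \<zeta> w + CL * (norm v + (e' + W) * h)" if \<theta>: "\<theta> \<in> closed_segment (\<alpha> + v) (\<alpha> + v + h *\<^sub>R w)" for \<theta>
 proof -
  have \<theta>B: "\<theta> \<in> ?B" using closed_segment_subset[OF inB(2,4) convex_cball] \<theta> by blast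
  have "norm (\<theta> - (\<alpha> + v)) \<le> norm (h *\<^sub>R w)" using segment_bound1[OF \<theta>] by simp
  also have "\<dots> \<le> W * h" using W h by simp
  finally have 1: "norm (\<theta> - (\<alpha> + v)) \<le> W * h" .
  have "\<theta> - \<zeta> = (\<theta> - (\<alpha> + v)) + ((\<alpha> - \<zeta>) + v)" by simp
  then have "norm (\<theta> - \<zeta>) \<le> norm (\<theta> - (\<alpha> + v)) + (norm (\<alpha> - \<zeta>) + norm v)"
   by (metis norm_triangle_le add_left_mono norm_triangle_ineq)
  also have "\<dots> \<le> norm v + (e' + W) * h" using 1 d(2) by (simp add: algebra_simps)
  finally have "CL * norm (\<theta> - \<zeta>) \<le> CL * (norm v + (e' + W) * h)" using CL(1) by (rule mult_left_mono)
  then show ?thesis using CL(2)[OF \<theta>B inB(1) W(1)] by linarith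
 qed
 obtain J where J: "adm h (chart_inv c (\<alpha> + v)) (chart_inv c (\<alpha> + v + h *\<^sub>R w)) J" "J \<le> (Lc c \<zeta> w + CL * (norm v + (e' + W) * h)) * h"
  by (rule adm_line[OF c compact_cball convex_cball B inB(2,4) h(1) Lw])
 have "u q (chart_inv c (\<alpha> + v + h *\<^sub>R w)) - J \<le> u (q + h) (chart_inv c (\<alpha> + v))" by (rule u_step[OF q h(1) J(1)])
 moreover have "u q (chart_inv c (\<beta> + v)) - u q (chart_inv c (\<alpha> + v + h *\<^sub>R w)) \<le> K * (e * h + h * norm (D - w))"
 proof -
  have "(\<beta> + v) - (\<alpha> + v + h *\<^sub>R w) = (\<beta> - \<alpha> - h *\<^sub>R D) + h *\<^sub>R (D - w)" by (simp add: algebra_simps)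
  then have "norm ((\<beta> + v) - (\<alpha> + v + h *\<^sub>R w)) \<le> norm (\<beta> - \<alpha> - h *\<^sub>R D) + norm (h *\<^sub>R (D - w))"
   by (metis norm_triangle_ineq)
  also have "\<dots> \<le> e * h + h * norm (D - w)" using d(1) h by simp
  finally have "K * norm ((\<beta> + v) - (\<alpha> + v + h *\<^sub>R w)) \<le> K * (e * h + h * norm (D - w))" using K by (rule mult_left_mono)
  then show ?thesis using uK[OF inB(3,4)] by linarith
 qed
 ultimately have "u q (chart_inv c (\<beta> + v)) - u (q + h) (chart_inv c (\<alpha> + v)) \<le>
  (Lc c \<zeta> w + CL * (norm v + (e' + W) * h)) * h + K * (e * h + h * norm (D - w))" using J(2) by linarith
 also have "\<dots> = h * ((Lc c \<zeta> w + K * norm (D - w)) + CL * norm v + K * e + CL * (e' + W) * h)"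
  by (simp add: algebra_simps)
 also have "\<dots> \<le> h * (Lc c \<zeta> D + CL * norm v + K * e + CL * (e' + W) * h)"
  using W(3) h by (intro mult_left_mono) auto
 finally show ?thesis .
qed

end

lemma GDERIV_near:
 assumes "GDERIV f z :> q" "e > 0"
 obtains d where "d > 0" "\<And>v. norm v < d ==> \<bar>f (z + v) - f z - q \<bullet> v\<bar> \<le> e * norm v"
proof -
 obtain d where d: "d > 0" "\<And>y. norm (y - z) < d ==> norm (f y - f z - (y - z) \<bullet> q) \<le> e * norm (y - z)"
  using assms unfolding gderiv_def has_derivative_at_alt by blast
 have "\<bar>f (z + v) - f z - q \<bullet> v\<bar> \<le> e * norm v" if "norm v < d" for v
  using d(2)[of "z + v"] that by (simp add: inner_commute)
 then show thesis using that d(1) by blast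
qed

lemma GDERIV_norm_le:
 fixes f :: "'a::euclidean_space => real"
 assumes q: "GDERIV f z :> q" and d: "d > 0" "\<And>z'. norm (z' - z) < d ==> \<bar>f z' - f z\<bar> \<le> K * norm (z' - z)"
 shows "norm q \<le> K"
proof (rule field_le_epsilon)
 fix e :: real assume e: "e > 0"
 show "norm q \<le> K + e"
 proof (cases "q = 0")
  case True
  obtain b :: 'a where b: "norm b = d / 2" by (rule vector_choose_size[of "d / 2"]) (use d(1) in auto)
  have "0 \<le> \<bar>f (z + b) - f z\<bar>" by simp
  also have "\<dots> \<le> K * norm ((z + b) - z)" by (rule d(2)) (use b d(1) in simp)
  finally have "0 \<le> K * norm ((z + b) - z)" .
  then have "0 \<le> K" using b d(1) by (simp add: zero_le_mult_iff)
  then show ?thesis using True e by simp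
 next
  case False
  obtain d' where d': "d' > 0" "\<And>v. norm v < d' ==> \<bar>f (z + v) - f z - q \<bullet> v\<bar> \<le> e * norm v"
   using GDERIV_near[OF q e] by blast
  define l where "l = min d d' / (2 * norm q)"
  have l: "l > 0" using False d(1) d'(1) by (simp add: l_def)
  have n: "norm (l *\<^sub>R q) = min d d' / 2" using False d(1) d'(1) by (simp add: l_def)
  have "\<bar>f (z + l *\<^sub>R q) - f z - q \<bullet> (l *\<^sub>R q)\<bar> \<le> e * norm (l *\<^sub>R q)"
   using n d(1) d'(1) by (intro d'(2)) auto
  moreover have "\<bar>f (z + l *\<^sub>R q) - f z\<bar> \<le> K * norm (l *\<^sub>R q)"
   using d(2)[of "z + l *\<^sub>R q"] n d(1) d'(1) by simp
  ultimately have "q \<bullet> (l *\<^sub>R q) \<le> (K + e) * norm (l *\<^sub>R q)" by (simp add: distrib_right)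
  then have "l * norm q * norm q \<le> l * norm q * (K + e)"
   using l by (simp add: power2_norm_eq_inner[symmetric] power2_eq_square mult_ac)
  then show ?thesis using l False by simp
 qed
qed

context lax_oleinik
begin

text \<open>The value along the translated curve, with the elapsed time subtracted, starts at
  \<open>u t\<close> of the shifted \<open>x\<close> and ends at \<phi> of the shifted
  \<open>y\<close>. Its growth rate is at most the Lagrangian of the original curve plus
  \<open>CL * norm v\<close>. Translating the curve itself would not do, since the Lagrangian is not
  uniformly Lipschitz in the position at large velocities.\<close>

lemma opt_translate:
 assumes c: "c \<in> A" and z: "z \<in> fst c"
 obtains r C dl where "r > 0" "C \<ge> 0" "dl > 0" "dl \<le> \<tau>" "cball (snd c z) (4 * r) \<subseteq> cdom c"
  "\<forall>t x y v. 0 < t \<and> t < dl \<and> opt t x y \<and> y \<in> fst c \<and> snd c y \<in> cball (snd c z) r \<and> norm v \<le> r -->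
    x \<in> fst c \<and> snd c x \<in> cball (snd c z) (2 * r) \<and>
    \<phi> (chart_inv c (snd c y + v)) - \<phi> y \<le> u t (chart_inv c (snd c x + v)) - u t x + C * t * norm v"
proof -
 obtain r0 m M where "chart_box c z r0 m M" by (rule chart_box_exists[OF c z])
 note r0 = chart_boxD[OF this]
 define r where "r = r0 / 8"
 let ?z = "snd c z" and ?I = "chart_inv c" and ?B = "cball (snd c z) (4 * r)"
 have r: "r > 0" "r0 = 8 * r" "m * r < m * r0 / 2" using r0(1,2) by (auto simp: r_def)
 have sub: "?B \<subseteq> cball ?z r0" "?B \<subseteq> cball ?z (r0 / 2)" "cball ?z (2 * r) \<subseteq> ?B" "cball ?z r \<subseteq> ?B" using r by auto
 have dom: "?B \<subseteq> cdom c" using sub r0(4) by blast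
 obtain Ku dl1 where Ku: "Ku > 0" "dl1 > 0" "dl1 \<le> \<tau>" "\<And>t x y. 0 \<le> t ==> t < dl1 ==> \<bar>u t x - u t y\<bar> \<le> Ku * dm x y"
  using u_lipschitz by metis
 define K where "K = Ku * M"
 have K: "K > 0" using Ku r0 by (simp add: K_def)
 have uK: "\<bar>u t (?I \<zeta>) - u t (?I \<zeta>')\<bar> \<le> K * norm (\<zeta> - \<zeta>')" if t: "0 \<le> t" "t < dl1" and \<zeta>: "\<zeta> \<in> ?B" "\<zeta>' \<in> ?B" for t \<zeta> \<zeta>'
 proof -
  have "\<zeta> \<in> cball ?z r0" "\<zeta>' \<in> cball ?z r0" using \<zeta> sub(1) by blast+
  then have "dm (?I \<zeta>) (?I \<zeta>') \<le> M * norm (\<zeta>' - \<zeta>)" using r0(6) by blast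
  then have "Ku * dm (?I \<zeta>) (?I \<zeta>') \<le> Ku * (M * norm (\<zeta>' - \<zeta>))" using Ku(1) by simp
  then show ?thesis using Ku(4)[OF t, of "?I \<zeta>" "?I \<zeta>'"] by (simp add: K_def norm_minus_commute)
 qed
 obtain W where W: "W > 0" "\<And>\<zeta> w. \<zeta> \<in> ?B ==> \<exists>w'. norm w' \<le> W \<and> Lc c \<zeta> w' + K * norm (w - w') \<le> Lc c \<zeta> w"
  using Lc_truncate[OF c compact_cball dom less_imp_le[OF K]] by blast
 obtain CL where CL: "CL \<ge> 0" "\<And>\<zeta> \<zeta>' w. \<zeta> \<in> ?B ==> \<zeta>' \<in> ?B ==> norm w \<le> W ==> \<bar>Lc c \<zeta> w - Lc c \<zeta>' w\<bar> \<le> CL * norm (\<zeta> - \<zeta>')"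
  using Lc_lipschitz[OF c compact_cball convex_cball dom, of W] by metis
 have mr: "m * r > 0" using r r0 by simp
 obtain dl2 where dl2: "dl2 > 0" "\<forall>t \<xi> J s. 0 < t \<and> t < dl2 \<and> acc t \<xi> \<and> (lag \<xi> {0..t} has_integral J) {0..t} \<and>
   u t (\<xi> 0) - 1 < \<phi> (\<xi> t) - J \<and> s \<in> {0..t} --> dm (\<xi> s) (\<xi> t) < m * r"
  by (rule curve_near_end[OF mr])
 obtain C1 dl3 where L: "C1 > 0" "dl3 > 0" "\<And>x y h. 0 < h ==> h < dl3 ==> dm x y \<le> h \<or> dm y x \<le> h ==> \<exists>J. adm h x y J \<and> J \<le> C1 * h"
  using unit_lines by metis
 define dl where "dl = min dl1 (min dl2 dl3)"
 have dl: "dl > 0" "dl \<le> \<tau>" using Ku dl2 L by (auto simp: dl_def)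
 have near0: "w \<in> fst c \<and> m * norm (snd c w - et) \<le> e"
  if et: "et \<in> ?B" and e: "e < m * r" "e = dm (?I et) w \<or> e = dm w (?I et)" for et w e
 proof -
  have "et \<in> cball ?z (r0 / 2)" using et sub(2) by blast
  moreover have "e < m * r0 / 2" using e(1) r(3) by linarith
  ultimately show ?thesis using r0(7)[rule_format, of et e w] e(2) by blast
 qed
 have near: "dm w (?I et) < m * r ==> w \<in> fst c \<and> m * norm (snd c w - et) \<le> dm w (?I et)"
  "dm (?I et) w < m * r ==> w \<in> fst c \<and> m * norm (snd c w - et) \<le> dm (?I et) w" if "et \<in> ?B" for et w
  using near0[where e="dm w (?I et)" and w=w, OF that] near0[where e="dm (?I et) w" and w=w, OF that] by simp_all
 have main: "x \<in> fst c \<and> snd c x \<in> cball ?z (2 * r) \<and>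
    \<phi> (?I (snd c y + v)) - \<phi> y \<le> u t (?I (snd c x + v)) - u t x + CL * t * norm v + ep"
  if t: "0 < t" "t < dl" and o: "opt t x y" and y: "y \<in> fst c" "snd c y \<in> cball ?z r" and v: "norm v \<le> r" and ep: "ep > 0"
  for t x y v ep
 proof -
  have t': "t < dl1" "t < dl2" "t < dl3" using t by (auto simp: dl_def)
  have "min ep 1 > 0" using ep by simp
  then obtain J where "adm t x y J" and J: "u t x - min ep 1 < \<phi> y - J" using o unfolding opt_def by blast
  then obtain \<xi> where \<xi>: "acc t \<xi>" "\<xi> 0 = x" "\<xi> t = y" "(lag \<xi> {0..t} has_integral J) {0..t}"
   unfolding adm_def by blast
  have J': "u t (\<xi> 0) - 1 < \<phi> (\<xi> t) - J" using J \<xi> by simp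
  have inc: "\<xi> s \<in> fst c \<and> snd c (\<xi> s) \<in> cball ?z (2 * r)" if s: "s \<in> {0..t}" for s
  proof -
   have d: "dm (\<xi> s) y < m * r" using dl2(2)[rule_format, of t \<xi> J s] t(1) t'(2) \<xi>(1,3,4) J' s by simp
   then have "\<xi> s \<in> fst c \<and> m * norm (snd c (\<xi> s) - snd c y) \<le> dm (\<xi> s) y"
    using near(1)[of "snd c y" "\<xi> s"] y sub(4) c by auto
   moreover from this d have "m * norm (snd c (\<xi> s) - snd c y) \<le> m * r" by linarith
   then have "norm (snd c (\<xi> s) - snd c y) \<le> r" using r0(2) by simp
   then have "dist ?z (snd c (\<xi> s)) \<le> r + r" using y(2) dist_triangle[of ?z "snd c (\<xi> s)" "snd c y"]
    by (simp add: dist_norm norm_minus_commute)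
   ultimately show ?thesis by simp
  qed
  define X where "X s = snd c (\<xi> s)" for s
  have X2: "X s \<in> cball ?z (2 * r)" and IX: "?I (X s) = \<xi> s" and XB: "X s \<in> ?B" if "s \<in> {0..t}" for s
   using inc[OF that] c sub(3) by (auto simp: X_def)
  have XvB: "X s + v \<in> ?B" if "s \<in> {0..t}" for s using X2[OF that] v r(1) norm_triangle_ineq[of "X s - ?z" v]
   by (simp add: dist_norm norm_minus_commute algebra_simps)
  obtain N where N: "negligible N" "\<forall>s\<in>{0<..<t} - N. \<forall>c\<in>A. \<xi> s \<in> fst c -->
   ((snd c \<circ> \<xi>) has_vector_derivative tangent_in A c (\<xi> s) (velocity A {0..t} \<xi> s)) (at s)"
   by (rule acc_differentiable_ae[OF \<xi>(1)])
  \<comment> \<open>\<open>F 0\<close> is the value at the translated starting point, and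
    \<open>F t\<close> is \<phi> at the translated end point.\<close>
  define F where "F s = u (t - s) (?I (X s + v))" for s
  have I: "((\<lambda>s. lag \<xi> {0..t} s + CL * norm v) has_integral (J + CL * norm v * t)) {0..t}"
  proof -
   have "((\<lambda>s. CL * norm v) has_integral CL * norm v * t) {0..t}"
    using has_integral_const_real[of "CL * norm v" 0 t] t by (simp add: mult.commute)
   from has_integral_add[OF \<xi>(4) this] show ?thesis .
  qed
  have "F t - F 0 \<le> integral {0..t} (\<lambda>s. lag \<xi> {0..t} s + CL * norm v)"
  proof (rule integral_comparison)
   show "negligible (N \<union> {0, t})" using N(1) by (simp add: negligible_insert)
   obtain dl0 where dl0: "dl0 > 0" "\<And>a b. 0 \<le> a ==> a \<le> b ==> b \<le> t ==> b - a < dl0 ==> dm (\<xi> a) (\<xi> b) < m * r"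
    using acc_uniform[OF \<xi>(1) mr] by metis
   have "ac_family (\<lambda>a b. F b - F a) 0 t"
   proof (rule ac_family_mono[OF acc_family[OF \<xi>(1)], of "K / m + C1" dl0])
    show "K / m + C1 \<ge> 0" using K L r0 by simp
    fix a b assume ab: "0 \<le> a" "a \<le> b" "b \<le> t" "b - a < dl0"
    have "m * norm (X b - X a) \<le> dm (\<xi> a) (\<xi> b)"
     using near(2)[OF XB, of a "\<xi> b"] dl0(2)[OF ab] IX[of a] ab by (simp add: X_def)
    then have n: "K * norm (X b - X a) \<le> K / m * dm (\<xi> a) (\<xi> b)"
     using mult_left_mono[of "m * norm (X b - X a)" "dm (\<xi> a) (\<xi> b)" "K / m"] K r0 by simp
    have 1: "u (t - b) (?I (X b + v)) - u (t - b) (?I (X a + v)) \<le> K * norm (X b - X a)"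
     using uK[of "t - b" "X b + v" "X a + v"] XvB[of a] XvB[of b] ab t' by (simp del: mem_cball)
    \<comment> \<open>Only an upper bound is needed: waiting at the point for time
      \<open>b - a\<close> is a competitor for the longer time.\<close>
    have 2: "u (t - b) (?I (X a + v)) - u (t - a) (?I (X a + v)) \<le> C1 * (b - a)"
    proof (cases "a = b")
     case False
     obtain J3 where J3: "adm (b - a) (?I (X a + v)) (?I (X a + v)) J3" "J3 \<le> C1 * (b - a)"
      using L(3)[of "b - a" "?I (X a + v)" "?I (X a + v)"] False ab t' by auto
     show ?thesis using u_step[OF _ _ J3(1), of "t - b"] J3(2) ab False by simp
    qed simp
    have "0 \<le> K / m * (b - a)" "0 \<le> C1 * dm (\<xi> a) (\<xi> b)" using K L r0 ab by auto
    then show "F b - F a \<le> (K / m + C1) * dm (\<xi> a) (\<xi> b) + (K / m + C1) * (b - a)"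
     unfolding F_def using 1 2 n by (simp add: distrib_right)
   qed (use dl0 in auto)
   then show "N \<union> {0, t} = {} \<or> ac_family (\<lambda>a b. F b - F a) 0 t" ..
   fix s ep' :: real assume s: "s \<in> {0..t} - (N \<union> {0, t})" and ep': "ep' > 0"
   have s': "s \<in> {0..t}" using s by simp
   define D where "D = tangent_in A c (\<xi> s) (velocity A {0..t} \<xi> s)"
   have D: "((snd c \<circ> \<xi>) has_vector_derivative D) (at s within UNIV)"
    using N(2) s c inc[OF s'] unfolding D_def by auto
   have lg: "lag \<xi> {0..t} s = Lc c (X s) D" using inc[OF s'] c by (simp add: lagrangian_chart D_def X_def)
   obtain w where w: "norm w \<le> W" "Lc c (X s) w + K * norm (D - w) \<le> Lc c (X s) D" using W(2)[OF XB[OF s']] by blast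
   define e where "e = ep' / (2 * K)"
   have e: "e > 0" "K * e = ep' / 2" using ep' K by (auto simp: e_def)
   define e' where "e' = e + norm D"
   have e'W: "e' + W > 0" using e W by (simp add: e'_def add_pos_nonneg)
   obtain dla where dla: "dla > 0" "\<And>a b. a \<in> UNIV ==> b \<in> UNIV ==> a \<le> s ==> s \<le> b ==> b - a < dla ==>
    norm ((snd c \<circ> \<xi>) b - (snd c \<circ> \<xi>) a - (b - a) *\<^sub>R D) \<le> e * (b - a)"
    using vector_derivative_straddle[OF D e(1)] by metis
   \<comment> \<open>\<open>dla\<close> is the differentiability radius; \<open>r / W\<close> keeps
     the truncated step in the chart; the last term makes the second-order error
     \<open>CL * (e' + W) * h\<close> at most \<open>ep' / 2\<close>.\<close>
   define d where "d = min dla (min (r / W) (ep' / (2 * (CL + 1) * (e' + W))))"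
   have P0: "2 * (CL + 1) * (e' + W) > 0" using CL(1) e'W by simp
   with P0 have d: "d > 0" using dla(1) r W ep' by (simp add: d_def)
   show "\<exists>d>0. \<forall>a b. 0 \<le> a \<and> a \<le> s \<and> s \<le> b \<and> b \<le> t \<and> b - a < d -->
    F b - F a \<le> (b - a) * ((lag \<xi> {0..t} s + CL * norm v) + ep')"
   proof (intro exI[of _ d] conjI d allI impI)
    fix a b assume *: "0 \<le> a \<and> a \<le> s \<and> s \<le> b \<and> b \<le> t \<and> b - a < d"
    show "F b - F a \<le> (b - a) * ((lag \<xi> {0..t} s + CL * norm v) + ep')"
    proof (cases "a = b")
     case True
     then show ?thesis by simp
    next
     case False
     define h where "h = b - a"
     have h: "h > 0" using False * by (simp add: h_def)
     have hd: "h < dla" "h < r / W" "h < ep' / (2 * (CL + 1) * (e' + W))" using * by (auto simp: h_def d_def)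
     have d1: "norm (X b - X a - h *\<^sub>R D) \<le> e * h" using dla(2)[of a b] * hd by (simp add: X_def h_def)
     have d2: "norm (X a - X s) \<le> e' * h"
     proof -
      have "norm (X s - X a - (s - a) *\<^sub>R D) \<le> e * (s - a)" using dla(2)[of a s] * hd by (simp add: X_def h_def)
      then have "norm (X s - X a) \<le> e * (s - a) + (s - a) * norm D"
       using norm_triangle_ineq[of "X s - X a - (s - a) *\<^sub>R D" "(s - a) *\<^sub>R D"] * by simp
      also have "\<dots> = e' * (s - a)" by (simp add: e'_def algebra_simps)
      also have "\<dots> \<le> e' * h" using * e by (intro mult_left_mono) (auto simp: e'_def h_def)
      finally show ?thesis by (simp add: norm_minus_commute)
     qed
     have ab: "a \<in> {0..t}" "b \<in> {0..t}" using * by auto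
     have q: "0 \<le> t - b" "t - b < dl1" using * t' by auto
     have hW: "h * W \<le> r" using hd(2) W(1) by (simp add: field_simps)
     define G where "G = h * (Lc c (X s) D + CL * norm v + K * e + CL * (e' + W) * h)"
     have "u (t - b) (?I (X b + v)) - u (t - b + h) (?I (X a + v)) \<le> G" unfolding G_def
      by (rule action_increment_translate[where c=c and K=K and r=r and ?\<zeta>0.0="snd c z" and W=W and w=w
         and \<zeta>="X s" and D=D and CL=CL and q="t - b" and h=h and \<alpha>="X a" and \<beta>="X b" and v=v and e=e and e'=e'])
       (assumption | rule c less_imp_le[OF K] r(1) dom w W(1) CL uK q h hW X2 s' ab v d1 d2)+
     moreover have "t - b + h = t - a" by (simp add: h_def)
     ultimately have step: "F b - F a \<le> G" by (simp add: F_def)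
     have "G \<le> h * ((lag \<xi> {0..t} s + CL * norm v) + ep')" unfolding G_def
     proof (rule mult_left_mono)
      have "(CL + 1) * (e' + W) * h \<le> ep' / 2" using hd(3) unfolding pos_less_divide_eq[OF P0] by (simp add: algebra_simps)
      moreover have "CL * (e' + W) * h \<le> (CL + 1) * (e' + W) * h" using e'W h by (intro mult_right_mono) auto
      ultimately show "Lc c (X s) D + CL * norm v + K * e + CL * (e' + W) * h \<le> (lag \<xi> {0..t} s + CL * norm v) + ep'"
       unfolding e(2) lg by linarith
     qed (use h in simp)
     then show ?thesis using step unfolding h_def by linarith
    qed
   qed
  qed (use t I in auto)
  also have "\<dots> = J + CL * norm v * t" by (rule integral_unique[OF I])
  finally have "\<phi> (?I (snd c y + v)) - u t (?I (snd c x + v)) \<le> J + CL * norm v * t"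
   using \<xi>(2,3) by (simp add: F_def X_def)
  then have "\<phi> (?I (snd c y + v)) - \<phi> y \<le> u t (?I (snd c x + v)) - u t x + CL * t * norm v + ep"
   using J by (simp add: mult_ac)
  then show ?thesis using inc[of 0] \<xi>(2) t by simp
 qed
 have "\<forall>t x y v. 0 < t \<and> t < dl \<and> opt t x y \<and> y \<in> fst c \<and> snd c y \<in> cball ?z r \<and> norm v \<le> r -->
    x \<in> fst c \<and> snd c x \<in> cball ?z (2 * r) \<and>
    \<phi> (?I (snd c y + v)) - \<phi> y \<le> u t (?I (snd c x + v)) - u t x + CL * t * norm v"
 proof (intro allI impI)
  fix t x y and v :: 'e assume *: "0 < t \<and> t < dl \<and> opt t x y \<and> y \<in> fst c \<and> snd c y \<in> cball ?z r \<and> norm v \<le> r"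
  then have 1: "x \<in> fst c" "snd c x \<in> cball ?z (2 * r)" using main[of t x y v 1] zero_less_one by blast+
  have "\<phi> (?I (snd c y + v)) - \<phi> y \<le> u t (?I (snd c x + v)) - u t x + CL * t * norm v"
   by (rule field_le_epsilon) (use main[of t x y v] * in blast)
  then show "x \<in> fst c \<and> snd c x \<in> cball ?z (2 * r) \<and>
    \<phi> (?I (snd c y + v)) - \<phi> y \<le> u t (?I (snd c x + v)) - u t x + CL * t * norm v" using 1 by blast
 qed
 then show thesis by (rule that[OF r(1) CL(1) dl dom])
qed

end

section \<open>Semiconcavity of \<phi> and limits of gradients\<close>

context lax_oleinik
begin

text \<open>At a fixed small time, the increment of \<phi> at \<open>y\<close> is dominated by that
  of a C1 function at some \<open>x\<close>, whose gradient is uniformly continuous on compact sets.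
  Hence \<open>d\<close> depends on \<open>e\<close> but not on the point, which is a uniform
  semiconcavity modulus in coordinates.\<close>

lemma phi_supergradient:
 assumes c: "c \<in> A" and z: "z \<in> fst c"
 obtains rh where "rh > 0" "cball (snd c z) (2 * rh) \<subseteq> cdom c"
  "\<forall>e>0. \<exists>d>0. \<forall>zt\<in>cball (snd c z) rh. \<exists>p. \<forall>v. norm v \<le> d -->
    \<phi> (chart_inv c (zt + v)) - \<phi> (chart_inv c zt) \<le> p \<bullet> v + e * norm v"
proof -
 obtain r C dl where r: "r > 0" "C \<ge> 0" "dl > 0" "dl \<le> \<tau>" "cball (snd c z) (4 * r) \<subseteq> cdom c"
  "\<forall>t x y v. 0 < t \<and> t < dl \<and> opt t x y \<and> y \<in> fst c \<and> snd c y \<in> cball (snd c z) r \<and> norm v \<le> r -->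
    x \<in> fst c \<and> snd c x \<in> cball (snd c z) (2 * r) \<and>
    \<phi> (chart_inv c (snd c y + v)) - \<phi> y \<le> u t (chart_inv c (snd c x + v)) - u t x + C * t * norm v"
  by (rule opt_translate[OF c z])
 obtain dls where dls: "dls > 0" "\<And>y s. 0 < s ==> s < dls ==> \<exists>x. opt s x y" using opt_surjective by metis
 have "\<exists>d>0. \<forall>zt\<in>cball (snd c z) r. \<exists>p. \<forall>v. norm v \<le> d -->
    \<phi> (chart_inv c (zt + v)) - \<phi> (chart_inv c zt) \<le> p \<bullet> v + e * norm v" if e: "e > 0" for e
 proof -
  \<comment> \<open>The time depends on \<open>e\<close>: it makes the translation error
    \<open>C * s\<close> at most \<open>e / 2\<close>, leaving the other half for the oscillation of
    the gradient.\<close>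
  define s where "s = min (min dl dls) (e / (C + 1)) / 2"
  have Ce: "e / (C + 1) > 0" using e r by simp
  then have s: "0 < s" "s < dl" "s < dls" using r dls by (auto simp: s_def)
  have "2 * s \<le> e / (C + 1)" by (simp add: s_def)
  then have "(C + 1) * s \<le> e / 2" using r(2) by (simp add: field_simps)
  then have Cs: "C * s \<le> e / 2" using s(1) by (simp add: distrib_right)
  have s\<tau>: "s \<le> \<tau>" using s r by simp
  obtain G where G: "\<forall>zt\<in>cdom c. GDERIV (u s \<circ> chart_inv c) zt :> G zt" "continuous_on (cdom c) G"
   by (rule C11_gradient[OF C11_u[OF s(1) s\<tau>] c])
  have "uniformly_continuous_on (cball (snd c z) (4 * r)) G"
   by (rule compact_uniformly_continuous[OF continuous_on_subset[OF G(2) r(5)] compact_cball])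
  then obtain d where d: "d > 0" "\<And>a b. a \<in> cball (snd c z) (4 * r) ==> b \<in> cball (snd c z) (4 * r) ==> dist b a < d ==> dist (G b) (G a) < e / 2"
   using e unfolding uniformly_continuous_on_def by (metis half_gt_zero)
  define d' where "d' = min r (d / 2)"
  have d': "d' > 0" "d' \<le> r" "d' < d" using d r by (auto simp: d'_def)
  have "\<exists>p. \<forall>v. norm v \<le> d' --> \<phi> (chart_inv c (zt + v)) - \<phi> (chart_inv c zt) \<le> p \<bullet> v + e * norm v"
   if zt: "zt \<in> cball (snd c z) r" for zt
  proof -
   have "zt \<in> cdom c" using zt r(1,5) by (auto simp: subset_eq)
   then have y: "chart_inv c zt \<in> fst c" "snd c (chart_inv c zt) = zt" using c by auto
   obtain x where x: "opt s x (chart_inv c zt)" using dls(2)[OF s(1,3)] by blast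
   have *: "x \<in> fst c \<and> snd c x \<in> cball (snd c z) (2 * r) \<and>
    \<phi> (chart_inv c (zt + v)) - \<phi> (chart_inv c zt) \<le> u s (chart_inv c (snd c x + v)) - u s x + C * s * norm v" if "norm v \<le> r" for v
    using r(6)[rule_format, of s x "chart_inv c zt" v] s x y zt that by simp
   have x': "x \<in> fst c" "snd c x \<in> cball (snd c z) (2 * r)" using *[of 0] r(1) by auto
   show ?thesis
   proof (intro exI[of _ "G (snd c x)"] allI impI)
    fix v :: 'e assume v: "norm v \<le> d'"
    have sub: "cball (snd c x) d' \<subseteq> cball (snd c z) (4 * r)"
    proof
     fix a assume "a \<in> cball (snd c x) d'"
     then have "dist (snd c z) a \<le> 2 * r + r" using x'(2) d'(2) dist_triangle[of "snd c z" a "snd c x"] by simp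
     then show "a \<in> cball (snd c z) (4 * r)" using r(1) by simp
    qed
    have "\<bar>(u s \<circ> chart_inv c) (snd c x + v) - (u s \<circ> chart_inv c) (snd c x) - G (snd c x) \<bullet> ((snd c x + v) - snd c x)\<bar>
     \<le> e / 2 * norm ((snd c x + v) - snd c x)"
    proof (rule gradient_lipschitz[of "cball (snd c x) d'" _ G])
     fix a assume a: "a \<in> cball (snd c x) d'"
     then show "GDERIV (u s \<circ> chart_inv c) a :> G a" using G(1) sub r(5) by blast
     have "snd c x \<in> cball (snd c z) (4 * r)" using sub d' by (auto simp: subset_eq)
     then have "dist (G a) (G (snd c x)) < e / 2" using d(2)[of "snd c x" a] a sub d'(3) by (auto simp: dist_commute)
     then show "norm (G a - G (snd c x)) \<le> e / 2" by (simp add: dist_norm)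
    qed (use v d' in \<open>auto simp: dist_norm\<close>)
    then have "\<bar>u s (chart_inv c (snd c x + v)) - u s x - G (snd c x) \<bullet> v\<bar> \<le> e / 2 * norm v"
     using x'(1) c by simp
    then have "u s (chart_inv c (snd c x + v)) - u s x \<le> G (snd c x) \<bullet> v + e / 2 * norm v" by linarith
    moreover have "C * s * norm v \<le> e / 2 * norm v" using Cs by (intro mult_right_mono) auto
    moreover have "norm v \<le> r" using v d'(2) by simp
    note *[OF this]
    moreover have "e * norm v = e / 2 * norm v + e / 2 * norm v" by simp
    ultimately show "\<phi> (chart_inv c (zt + v)) - \<phi> (chart_inv c zt) \<le> G (snd c x) \<bullet> v + e * norm v"
     by linarith
   qed
  qed
  then show ?thesis using d'(1) by blast
 qed
 moreover have "cball (snd c z) (2 * r) \<subseteq> cdom c" using r(1,5) by (auto simp: subset_eq)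
 ultimately show thesis using that[OF r(1)] by blast
qed

text \<open>Translation and differentiability of \<open>u t\<close> at \<open>x\<close> bound the
  increment of \<phi> only for vectors whose size depends on \<open>t\<close>. The semiconcavity
  modulus of \<open>phi_supergradient\<close> along the segment towards \<open>v\<close> scales the
  bound for \<open>l *\<^sub>R v\<close> up to \<open>v\<close>. So \<open>d\<close> and
  \<open>dl\<close> are independent of \<open>t\<close>, which allows \<open>t\<close> to tend to
  0.\<close>

lemma gradient_upper_bound:
 assumes c: "c \<in> A" and z: "z \<in> fst c"
 obtains rh where "rh > 0" "cball (snd c z) (2 * rh) \<subseteq> cdom c"
  "\<forall>e>0. \<exists>d>0. \<exists>dl>0. \<forall>t x y q v. 0 < t \<and> t < dl \<and> opt t x y \<and> y \<in> fst c \<and> snd c y \<in> cball (snd c z) rh \<and>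
    GDERIV (u t \<circ> chart_inv c) (snd c x) :> q \<and> norm v \<le> d -->
    \<phi> (chart_inv c (snd c y + v)) - \<phi> y \<le> q \<bullet> v + e * norm v"
proof -
 obtain r C dl0 where r: "r > 0" "C \<ge> 0" "dl0 > 0" "dl0 \<le> \<tau>" "cball (snd c z) (4 * r) \<subseteq> cdom c"
  "\<forall>t x y v. 0 < t \<and> t < dl0 \<and> opt t x y \<and> y \<in> fst c \<and> snd c y \<in> cball (snd c z) r \<and> norm v \<le> r -->
    x \<in> fst c \<and> snd c x \<in> cball (snd c z) (2 * r) \<and>
    \<phi> (chart_inv c (snd c y + v)) - \<phi> y \<le> u t (chart_inv c (snd c x + v)) - u t x + C * t * norm v"
  by (rule opt_translate[OF c z])
 obtain rh0 where rh0: "rh0 > 0" "cball (snd c z) (2 * rh0) \<subseteq> cdom c"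
  "\<forall>e>0. \<exists>d>0. \<forall>zt\<in>cball (snd c z) rh0. \<exists>p. \<forall>v. norm v \<le> d -->
    \<phi> (chart_inv c (zt + v)) - \<phi> (chart_inv c zt) \<le> p \<bullet> v + e * norm v"
  by (rule phi_supergradient[OF c z])
 define rh where "rh = min r rh0 / 2"
 have rh: "rh > 0" "2 * rh \<le> r" "2 * rh \<le> rh0" using r rh0 by (auto simp: rh_def)
 have "\<exists>d>0. \<exists>dl>0. \<forall>t x y q v. 0 < t \<and> t < dl \<and> opt t x y \<and> y \<in> fst c \<and> snd c y \<in> cball (snd c z) rh \<and>
    GDERIV (u t \<circ> chart_inv c) (snd c x) :> q \<and> norm v \<le> d -->
    \<phi> (chart_inv c (snd c y + v)) - \<phi> y \<le> q \<bullet> v + e * norm v" if e: "e > 0" for e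
 proof -
  have "e / 4 > 0" using e by simp
  then obtain d where d: "d > 0" "\<And>zt. zt \<in> cball (snd c z) rh0 ==> \<exists>p. \<forall>v. norm v \<le> d -->
    \<phi> (chart_inv c (zt + v)) - \<phi> (chart_inv c zt) \<le> p \<bullet> v + e / 4 * norm v"
   using rh0(3) by metis
  define d' where "d' = min d rh"
  define dl where "dl = min dl0 (e / (4 * (C + 1)))"
  have d': "d' > 0" "d' \<le> d" "d' \<le> rh" using d rh by (auto simp: d'_def)
  have dl: "dl > 0" using r e by (simp add: dl_def)
  have "\<phi> (chart_inv c (snd c y + v)) - \<phi> y \<le> q \<bullet> v + e * norm v"
   if t: "0 < t" "t < dl" and o: "opt t x y" and y: "y \<in> fst c" "snd c y \<in> cball (snd c z) rh"
    and q: "GDERIV (u t \<circ> chart_inv c) (snd c x) :> q" and v: "norm v \<le> d'" for t x y q v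
  proof -
   have t0: "t < dl0" using t by (simp add: dl_def)
   have "t < e / (4 * (C + 1))" using t by (simp add: dl_def)
   then have "4 * ((C + 1) * t) \<le> e" using r(2) by (simp add: field_simps)
   then have Ct: "C * t \<le> e / 4" using t(1) by (simp add: distrib_right)
   have yr: "snd c y \<in> cball (snd c z) r" using y(2) rh by auto
   have tr: "x \<in> fst c \<and> \<phi> (chart_inv c (snd c y + w)) - \<phi> y \<le> u t (chart_inv c (snd c x + w)) - u t x + C * t * norm w" if "norm w \<le> r" for w
    using r(6)[rule_format, of t x y w] t t0 o y yr that by simp
   have x: "x \<in> fst c" using tr[of 0] r by simp
   define f where "f = \<phi> \<circ> chart_inv c"
   define Y where "Y = snd c y"
   define U where "U = u t \<circ> chart_inv c"
   define X where "X = snd c x"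
   have fY: "f Y = \<phi> y" and UX: "U X = u t x" using y(1) x c by (auto simp: f_def Y_def U_def X_def)
   \<comment> \<open>A supergradient at the intermediate point, tested towards both ends and
     weighted by \<open>1 - l\<close> and \<open>l\<close>, cancels its linear part and leaves
     approximate concavity with error \<open>e / 2\<close>; translation contributes a further
     \<open>e / 4\<close>.\<close>
   have conc: "l * (f (Y + v) - f Y) \<le> U (X + l *\<^sub>R v) - U X + (3 * e / 4) * (l * norm v)" if l: "0 < l" "l \<le> 1" for l
   proof -
    have lv: "norm (l *\<^sub>R v) \<le> norm v" using l by (simp add: mult_left_le_one_le)
    have "norm (Y + l *\<^sub>R v - snd c z) \<le> norm (Y - snd c z) + norm (l *\<^sub>R v)"
     using norm_triangle_ineq[of "Y - snd c z" "l *\<^sub>R v"] by (simp add: algebra_simps)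
    also have "\<dots> \<le> rh + rh" using y(2) lv v d' by (simp add: Y_def dist_norm norm_minus_commute)
    finally have "Y + l *\<^sub>R v \<in> cball (snd c z) rh0" using rh(3) by (simp add: dist_norm norm_minus_commute)
    then obtain p where p: "\<And>w. norm w \<le> d ==> f (Y + l *\<^sub>R v + w) - f (Y + l *\<^sub>R v) \<le> p \<bullet> w + e / 4 * norm w"
     using d(2) unfolding f_def o_def by metis
    have n1: "norm (- l *\<^sub>R v) \<le> d" and n2: "norm ((1 - l) *\<^sub>R v) \<le> d"
     using lv v d' l mult_left_le_one_le[of "norm v" "1 - l"] by auto
    have e2: "Y + l *\<^sub>R v + (1 - l) *\<^sub>R v = Y + v" and e1: "Y + l *\<^sub>R v + - l *\<^sub>R v = Y" by (simp_all add: algebra_simps)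
    have p1: "f Y - f (Y + l *\<^sub>R v) \<le> - l * (p \<bullet> v) + e / 4 * (l * norm v)"
     using p[OF n1] l unfolding e1 by simp
    have p2: "f (Y + v) - f (Y + l *\<^sub>R v) \<le> (1 - l) * (p \<bullet> v) + e / 4 * ((1 - l) * norm v)"
     using p[OF n2] l unfolding e2 by simp
    have "(1 - l) * (f Y - f (Y + l *\<^sub>R v)) + l * (f (Y + v) - f (Y + l *\<^sub>R v))
     \<le> (1 - l) * (- l * (p \<bullet> v) + e / 4 * (l * norm v)) + l * ((1 - l) * (p \<bullet> v) + e / 4 * ((1 - l) * norm v))"
     using p1 p2 l by (intro add_mono mult_left_mono) auto
    also have "\<dots> = e / 2 * (l * norm v) * (1 - l)" by (simp add: field_simps)
    also have "\<dots> \<le> e / 2 * (l * norm v)" using l e by (intro mult_left_le) auto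
    finally have "l * (f (Y + v) - f Y) \<le> f (Y + l *\<^sub>R v) - f Y + e / 2 * (l * norm v)" by (simp add: algebra_simps)
    moreover have "f (Y + l *\<^sub>R v) - f Y \<le> U (X + l *\<^sub>R v) - U X + C * t * norm (l *\<^sub>R v)"
     using tr[of "l *\<^sub>R v"] lv v d' rh fY UX by (simp add: f_def Y_def U_def X_def)
    moreover have "C * t * norm (l *\<^sub>R v) \<le> e / 4 * (l * norm v)" using mult_right_mono[OF Ct, of "l * norm v"] l by simp
    ultimately show ?thesis by (simp add: field_simps)
   qed
   obtain d0 where d0: "d0 > 0" "\<And>v. norm v < d0 ==> \<bar>U (X + v) - U X - q \<bullet> v\<bar> \<le> e / 4 * norm v"
    using GDERIV_near[OF q \<open>e / 4 > 0\<close>] unfolding U_def X_def by metis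
   \<comment> \<open>Any positive fraction bringing \<open>l *\<^sub>R v\<close> into the
     differentiability radius at \<open>X\<close> will do; it cancels in the final
     inequality.\<close>
   define l where "l = min 1 (d0 / (2 * (norm v + 1)))"
   have nv: "norm v + 1 > 0" by (simp add: add_nonneg_pos)
   have l: "0 < l" "l \<le> 1" using d0(1) nv by (auto simp: l_def)
   have "l \<le> d0 / (2 * (norm v + 1))" by (simp add: l_def)
   then have "l * (norm v + 1) \<le> d0 / 2" using nv by (simp add: field_simps)
   then have "norm (l *\<^sub>R v) < d0" using l d0(1) by (simp add: distrib_left)
   then have "\<bar>U (X + l *\<^sub>R v) - U X - q \<bullet> (l *\<^sub>R v)\<bar> \<le> e / 4 * norm (l *\<^sub>R v)" by (rule d0(2))
   then have "\<bar>U (X + l *\<^sub>R v) - U X - l * (q \<bullet> v)\<bar> \<le> e / 4 * (l * norm v)" using l by simp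
   then have "U (X + l *\<^sub>R v) - U X \<le> l * (q \<bullet> v) + e / 4 * (l * norm v)" by linarith
   then have "l * (f (Y + v) - f Y) \<le> l * (q \<bullet> v + e * norm v)" using conc[OF l] by (simp add: algebra_simps)
   then show ?thesis using l(1) fY by (simp add: f_def Y_def)
  qed
  then show ?thesis using d'(1) dl by blast
 qed
 moreover have "cball (snd c z) (2 * rh) \<subseteq> cdom c" using rh r(1,5) by (auto simp: subset_eq)
 ultimately show thesis using that[OF rh(1)] by blast
qed

text \<open>The superdifferential of \<phi> in the coordinates of an arbitrary chart, with the upper
  limit of quotients unfolded into a uniform inequality near the point. In the preferred chart its
  elements belong to \<open>superdifferential\<close>.\<close>

definition supergradients :: "('m, 'e) chart => 'm => 'e set" where
 "supergradients c z = {p. \<forall>e>0. \<exists>d>0. \<forall>v. norm v \<le> d -->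
   \<phi> (chart_inv c (snd c z + v)) - \<phi> z \<le> p \<bullet> v + e * norm v}"

lemma phi_chart_continuous:
 assumes "c \<in> A" "z \<in> cdom c" shows "isCont (\<lambda>z. \<phi> (chart_inv c z)) z"
proof -
 have "continuous_on (cdom c) (\<lambda>z. \<phi> (chart_inv c z))"
  by (rule continuous_on_compose2[OF phi_continuous chart_continuous(2)[OF assms(1)]]) simp
 then show ?thesis using continuous_on_eq_continuous_at[OF chart_open(2)[OF assms(1)]] assms(2) by blast
qed

text \<open>The gradients are bounded by the uniform Lipschitz constant of \<open>u t\<close>, so a
  failing sequence has a convergent subsequence of gradients. The optimal end points converge to
  \<open>z\<close> because displacements vanish, and \<open>gradient_upper_bound\<close>, with its
  radius independent of \<open>t\<close>, passes to the limit: the limit gradient is a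
  supergradient, a contradiction.\<close>

lemma gradients_near_supergradients:
 assumes c: "c \<in> A" and z: "z \<in> fst c"
 obtains B where "B > 0" "\<forall>ep>0. \<exists>dl>0. \<forall>zt t. norm (zt - snd c z) < dl \<and> 0 < t \<and> t < dl -->
   zt \<in> cdom c \<and> (\<exists>q. GDERIV (u t \<circ> chart_inv c) zt :> q \<and> norm q \<le> B \<and> (\<exists>p\<in>supergradients c z. norm (q - p) < ep))"
proof -
 let ?z = "snd c z" and ?I = "chart_inv c"
 obtain r m M where "chart_box c z r m M" by (rule chart_box_exists[OF c z])
 note r = chart_boxD[OF this]
 obtain rh where rh: "rh > 0" "cball (snd c z) (2 * rh) \<subseteq> cdom c"
  "\<forall>e>0. \<exists>d>0. \<exists>dl>0. \<forall>t x y q v. 0 < t \<and> t < dl \<and> opt t x y \<and> y \<in> fst c \<and> snd c y \<in> cball (snd c z) rh \<and>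
    GDERIV (u t \<circ> chart_inv c) (snd c x) :> q \<and> norm v \<le> d -->
    \<phi> (chart_inv c (snd c y + v)) - \<phi> y \<le> q \<bullet> v + e * norm v"
  by (rule gradient_upper_bound[OF c z])
 obtain K dl1 where K: "K > 0" "dl1 > 0" "dl1 \<le> \<tau>" "\<And>t x y. 0 \<le> t ==> t < dl1 ==> \<bar>u t x - u t y\<bar> \<le> K * dm x y"
  using u_lipschitz by metis
 have grad: "\<exists>q. GDERIV (u t \<circ> ?I) zt :> q \<and> norm q \<le> K * M" if zt: "zt \<in> ball ?z r" and t: "0 < t" "t < dl1" for zt t
 proof -
  have t\<tau>: "t \<le> \<tau>" using t K by simp
  obtain G where "\<forall>zt\<in>cdom c. GDERIV (u t \<circ> ?I) zt :> G zt"
   using C11_gradient[OF C11_u[OF t(1) t\<tau>] c] by metis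
  then have q: "GDERIV (u t \<circ> ?I) zt :> G zt" using zt r(4) ball_subset_cball by blast
  obtain d where d: "d > 0" "ball zt d \<subseteq> ball ?z r" using zt open_ball open_contains_ball by metis
  have "norm (G zt) \<le> K * M"
  proof (rule GDERIV_norm_le[OF q d(1)])
   fix zt' assume "norm (zt' - zt) < d"
   then have "zt' \<in> ball zt d" by (simp add: dist_norm norm_minus_commute)
   then have "zt' \<in> cball ?z r" "zt \<in> cball ?z r" using d(2) zt ball_subset_cball by blast+
   then have "dm (?I zt) (?I zt') \<le> M * norm (zt' - zt)" using r(6) by blast
   then have "K * dm (?I zt) (?I zt') \<le> K * (M * norm (zt' - zt))" using K(1) by simp
   then show "\<bar>(u t \<circ> ?I) zt' - (u t \<circ> ?I) zt\<bar> \<le> K * M * norm (zt' - zt)"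
    using K(4)[of t "?I zt" "?I zt'"] t by (simp add: abs_minus_commute)
  qed
  then show ?thesis using q by blast
 qed
 let ?P = "\<lambda>ep zt t. zt \<in> cdom c \<and> (\<exists>q. GDERIV (u t \<circ> ?I) zt :> q \<and> norm q \<le> K * M \<and> (\<exists>p\<in>supergradients c z. norm (q - p) < ep))"
 have "\<exists>dl>0. \<forall>zt t. norm (zt - ?z) < dl \<and> 0 < t \<and> t < dl --> ?P ep zt t" if ep: "ep > 0" for ep
 proof (rule ccontr)
  assume no: "\<not> ?thesis"
  define d0 where "d0 = min (min r dl1) (min (r / 4) (rh / 2))"
  have d0: "d0 > 0" "d0 \<le> r" "d0 \<le> dl1" "d0 \<le> r / 4" "d0 \<le> rh / 2" using r K rh by (auto simp: d0_def)
  have "\<forall>n::nat. \<exists>a. norm (fst a - ?z) < d0 / real (Suc n) \<and> 0 < snd a \<and> snd a < d0 / real (Suc n) \<and> \<not> ?P ep (fst a) (snd a)"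
  proof
   fix n :: nat
   have "d0 / real (Suc n) > 0" using d0 by simp
   then show "\<exists>a. norm (fst a - ?z) < d0 / real (Suc n) \<and> 0 < snd a \<and> snd a < d0 / real (Suc n) \<and> \<not> ?P ep (fst a) (snd a)"
    using no by auto
  qed
  then obtain a where a: "\<And>n::nat. norm (fst (a n) - ?z) < d0 / real (Suc n) \<and> 0 < snd (a n) \<and> snd (a n) < d0 / real (Suc n) \<and> \<not> ?P ep (fst (a n)) (snd (a n))"
   using choice[of "\<lambda>n a. norm (fst a - ?z) < d0 / real (Suc n) \<and> 0 < snd a \<and> snd a < d0 / real (Suc n) \<and> \<not> ?P ep (fst a) (snd a)"] by blast
  define Z where "Z n = fst (a n)" for n
  define t where "t n = snd (a n)" for n
  have le: "d0 / real (Suc n) \<le> d0" for n using d0(1) by (simp add: field_simps)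
  have Z: "norm (Z n - ?z) < d0" and t: "0 < t n" "t n < d0" and nP: "\<not> ?P ep (Z n) (t n)" for n
   using a[of n] le[of n] unfolding Z_def t_def by auto
  have lim0: "(\<lambda>n. d0 / real (Suc n)) \<longlonglongrightarrow> 0" using tendsto_mult_right_zero[OF LIMSEQ_inverse_real_of_nat, of d0]
   by (simp add: divide_inverse)
  have Zlim: "Z \<longlonglongrightarrow> ?z"
  proof (rule tendstoI)
   fix e :: real assume "e > 0"
   with lim0 have "\<forall>\<^sub>F n in sequentially. d0 / real (Suc n) < e" by (rule order_tendstoD(2))
   then show "\<forall>\<^sub>F n in sequentially. dist (Z n) ?z < e"
    by eventually_elim (use a in \<open>auto simp: Z_def dist_norm intro: less_trans\<close>)
  qed
  have tlim: "\<forall>\<^sub>F n in sequentially. t n < e" if "e > 0" for e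
  proof -
   have "\<forall>\<^sub>F n in sequentially. d0 / real (Suc n) < e" using lim0 that by (rule order_tendstoD(2))
   then show ?thesis by eventually_elim (use a in \<open>auto simp: t_def intro: less_trans\<close>)
  qed
  have Zr: "Z n \<in> ball ?z r" "Z n \<in> cball ?z (r / 2)" "Z n \<in> cdom c" for n
   using Z[of n] d0 r(4) by (auto simp: dist_norm norm_minus_commute subset_eq)
  have "\<forall>n. \<exists>q. GDERIV (u (t n) \<circ> ?I) (Z n) :> q \<and> norm q \<le> K * M" using grad Zr(1) t d0(3) by (meson less_le_trans)
  then obtain q where q: "\<And>n. GDERIV (u (t n) \<circ> ?I) (Z n) :> q n" "\<And>n. norm (q n) \<le> K * M" by metis
  have far: "norm (q n - p) \<ge> ep" if "p \<in> supergradients c z" for n p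
   using nP[of n] Zr(3)[of n] q[of n] that by (meson linorder_not_le)
  have "\<forall>n. q n \<in> cball 0 (K * M)" using q(2) by simp
  then obtain p k where p: "strict_mono (k :: nat => nat)" "(q \<circ> k) \<longlonglongrightarrow> p"
   using compact_cball[of 0 "K * M"] unfolding compact_def by metis
  have "\<forall>n. \<exists>y. opt (t n) (?I (Z n)) y"
  proof
   fix n
   have "t n \<le> \<tau>" using t(2)[of n] d0 K by linarith
   then show "\<exists>y. opt (t n) (?I (Z n)) y" using opt_unique[OF t(1)] by blast
  qed
  then obtain y where y: "\<And>n. opt (t n) (?I (Z n)) (y n)" by metis
  have ynear: "\<forall>\<^sub>F n in sequentially. y n \<in> fst c \<and> norm (snd c (y n) - Z n) < e" if e: "e > 0" for e
  proof -
   define e' where "e' = min (m * r / 2) (m * e)"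
   have e': "e' > 0" "e' \<le> m * r / 2" "e' \<le> m * e" using r e by (auto simp: e'_def)
   obtain dl' where dl': "dl' > 0" "\<And>s x y J. 0 < s ==> s < dl' ==> adm s x y J ==> u s x - 1 < \<phi> y - J ==> dm x y < e'"
    using displacement[OF e'(1)] by metis
   show ?thesis using tlim[OF dl'(1)]
   proof eventually_elim
    case (elim n)
    have d: "dm (?I (Z n)) (y n) < e'" by (rule opt_displacement[OF y]) (rule dl'(2)[OF t(1) elim])
    then have *: "y n \<in> fst c \<and> m * norm (snd c (y n) - Z n) \<le> dm (?I (Z n)) (y n)"
     using r(7)[rule_format, OF Zr(2)[of n], of "dm (?I (Z n)) (y n)" "y n"] e'(2) by simp
    then have "m * norm (snd c (y n) - Z n) < m * e" using d e'(3) by linarith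
    then show ?case using * r(2) by simp
   qed
  qed
  have Ylim: "(\<lambda>n. snd c (y n)) \<longlonglongrightarrow> ?z"
  proof -
   have "(\<lambda>n. snd c (y n) - Z n) \<longlonglongrightarrow> 0"
   proof (rule tendstoI)
    fix e :: real assume "e > 0"
    from ynear[OF this] show "\<forall>\<^sub>F n in sequentially. dist (snd c (y n) - Z n) 0 < e" by eventually_elim simp
   qed
   from tendsto_add[OF this Zlim] show ?thesis by simp
  qed
  have "p \<in> supergradients c z" unfolding supergradients_def
  proof (intro CollectI allI impI)
   fix e :: real assume e: "e > 0"
   obtain d dl' where d: "d > 0" "dl' > 0" "\<forall>t x y q v. 0 < t \<and> t < dl' \<and> opt t x y \<and> y \<in> fst c \<and> snd c y \<in> cball (snd c z) rh \<and>
    GDERIV (u t \<circ> chart_inv c) (snd c x) :> q \<and> norm v \<le> d -->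
    \<phi> (chart_inv c (snd c y + v)) - \<phi> y \<le> q \<bullet> v + e * norm v"
    using rh(3)[rule_format, OF e] by (elim exE conjE)
   define d' where "d' = min d rh"
   have "\<phi> (?I (?z + v)) - \<phi> z \<le> p \<bullet> v + e * norm v" if v: "norm v \<le> d'" for v
   proof -
    have ev: "\<forall>\<^sub>F n in sequentially. \<phi> (?I (snd c (y n) + v)) - \<phi> (?I (snd c (y n))) \<le> q n \<bullet> v + e * norm v"
    proof (rule eventually_mono[OF eventually_conj[OF tlim[OF d(2)] ynear[OF half_gt_zero[OF rh(1)]]]])
     fix n assume "t n < dl' \<and> y n \<in> fst c \<and> norm (snd c (y n) - Z n) < rh / 2"
     then have tn: "t n < dl'" and yn: "y n \<in> fst c \<and> norm (snd c (y n) - Z n) < rh / 2" by blast+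
     have "norm (snd c (y n) - ?z) \<le> rh / 2 + rh / 2"
      using yn Z[of n] d0(5) norm_triangle_ineq[of "snd c (y n) - Z n" "Z n - ?z"] by simp
     then have "snd c (y n) \<in> cball ?z rh" by (simp add: dist_norm norm_minus_commute)
     moreover have "GDERIV (u (t n) \<circ> ?I) (snd c (?I (Z n))) :> q n" using q(1)[of n] Zr(3)[of n] c by simp
     ultimately have "\<phi> (?I (snd c (y n) + v)) - \<phi> (y n) \<le> q n \<bullet> v + e * norm v"
      using d(3)[rule_format, of "t n" "?I (Z n)" "y n" "q n" v] t(1)[of n] tn y[of n] yn v by (simp add: d'_def)
     then show "\<phi> (?I (snd c (y n) + v)) - \<phi> (?I (snd c (y n))) \<le> q n \<bullet> v + e * norm v" using yn c by simp
    qed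
    have dv: "?z + v \<in> cdom c" "?z \<in> cdom c" using rh(1,2) v z by (auto simp: subset_eq dist_norm d'_def)
    have l1: "(\<lambda>n. \<phi> (?I (snd c (y (k n)) + v)) - \<phi> (?I (snd c (y (k n))))) \<longlonglongrightarrow> \<phi> (?I (?z + v)) - \<phi> (?I ?z)"
    proof (intro tendsto_diff)
     have Yk: "(\<lambda>n. snd c (y (k n))) \<longlonglongrightarrow> ?z" using LIMSEQ_subseq_LIMSEQ[OF Ylim p(1)] by (simp add: o_def)
     show "(\<lambda>n. \<phi> (?I (snd c (y (k n)) + v))) \<longlonglongrightarrow> \<phi> (?I (?z + v))"
      by (rule isCont_tendsto_compose[OF phi_chart_continuous[OF c dv(1)] tendsto_add[OF Yk tendsto_const]])
     show "(\<lambda>n. \<phi> (?I (snd c (y (k n))))) \<longlonglongrightarrow> \<phi> (?I ?z)"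
      by (rule isCont_tendsto_compose[OF phi_chart_continuous[OF c dv(2)] Yk])
    qed
    have l2: "(\<lambda>n. q (k n) \<bullet> v + e * norm v) \<longlonglongrightarrow> p \<bullet> v + e * norm v"
     using p(2) by (intro tendsto_intros) (simp add: o_def)
    have "\<phi> (?I (?z + v)) - \<phi> (?I ?z) \<le> p \<bullet> v + e * norm v"
     by (rule tendsto_le[OF sequentially_bot l2 l1]) (rule eventually_subseq[OF p(1) ev])
    then show ?thesis using z c by simp
   qed
   moreover have "d' > 0" using d rh by (simp add: d'_def)
   ultimately show "\<exists>d>0. \<forall>v. norm v \<le> d --> \<phi> (?I (?z + v)) - \<phi> z \<le> p \<bullet> v + e * norm v" by blast
  qed
  then have "\<And>n. norm ((q \<circ> k) n - p) \<ge> ep" using far by simp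
  moreover have "\<forall>\<^sub>F n in sequentially. dist ((q \<circ> k) n) p < ep" using p(2) ep by (rule tendstoD)
  then obtain n where "dist ((q \<circ> k) n) p < ep" using eventually_happens'[OF sequentially_bot] by blast
  ultimately show False by (simp add: dist_norm linorder_not_less[symmetric])
 qed
 moreover have "K * M > 0" using K r by simp
 ultimately show thesis using that by blast
qed

lemma supergradients_subset: "supergradients (chart_at A z) z \<subseteq> superdifferential A \<phi> z"
proof
 let ?c = "chart_at A z"
 let ?z = "snd ?c z"
 fix p assume p: "p \<in> supergradients ?c z"
 let ?q = "\<lambda>w. ((\<phi> \<circ> chart_inv ?c) w - (\<phi> \<circ> chart_inv ?c) ?z - p \<bullet> (w - ?z)) / norm (w - ?z)"
 have "Limsup (at ?z) (\<lambda>w. ereal (?q w)) \<le> 0 + ereal e" if e: "e > 0" for e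
 proof -
  obtain d where d: "d > 0" "\<And>v. norm v \<le> d ==> \<phi> (chart_inv ?c (?z + v)) - \<phi> z \<le> p \<bullet> v + e * norm v"
   using p e unfolding supergradients_def by blast
  have "?q w \<le> e" if w: "w \<noteq> ?z" "dist w ?z < d" for w
  proof -
   have "\<phi> (chart_inv ?c (?z + (w - ?z))) - \<phi> z \<le> p \<bullet> (w - ?z) + e * norm (w - ?z)"
    using w by (intro d(2)) (simp add: dist_norm)
   then show ?thesis using w by (simp add: pos_divide_le_eq)
  qed
  then have "\<forall>\<^sub>F w in at ?z. ereal (?q w) \<le> ereal e" unfolding eventually_at using d(1) by auto
  from Limsup_bounded[OF this] show ?thesis by simp
 qed
 then have "Limsup (at ?z) (\<lambda>w. ereal (?q w)) \<le> 0" using ereal_le_epsilon2 by blast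
 then show "p \<in> superdifferential A \<phi> z" unfolding superdifferential_def by (simp add: Let_def)
qed

lemma supergradients_closed: "closed (supergradients c z)" unfolding closed_sequential_limits
proof (intro allI impI)
 fix f p assume *: "(\<forall>n. f n \<in> supergradients c z) \<and> f \<longlonglongrightarrow> p"
 show "p \<in> supergradients c z" unfolding supergradients_def
 proof (intro CollectI allI impI)
  fix e :: real assume e: "e > 0"
  then have "\<forall>\<^sub>F n in sequentially. dist (f n) p < e / 2" using * by (intro tendstoD) auto
  then obtain n where n: "dist (f n) p < e / 2" using eventually_happens'[OF sequentially_bot] by blast
  have "f n \<in> supergradients c z" "e / 2 > 0" using * e by auto
  then obtain d where d: "d > 0" "\<And>v. norm v \<le> d ==> \<phi> (chart_inv c (snd c z + v)) - \<phi> z \<le> f n \<bullet> v + e / 2 * norm v"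
   unfolding supergradients_def by blast
  have "\<phi> (chart_inv c (snd c z + v)) - \<phi> z \<le> p \<bullet> v + e * norm v" if v: "norm v \<le> d" for v
  proof -
   have "f n \<bullet> v = p \<bullet> v + (f n - p) \<bullet> v" by (simp add: inner_diff_left)
   also have "(f n - p) \<bullet> v \<le> norm (f n - p) * norm v" by (rule norm_cauchy_schwarz)
   also have "\<dots> \<le> e / 2 * norm v" using n by (intro mult_right_mono) (auto simp: dist_norm)
   finally show ?thesis using d(2)[OF v] by (simp add: field_simps)
  qed
  then show "\<exists>d>0. \<forall>v. norm v \<le> d --> \<phi> (chart_inv c (snd c z + v)) - \<phi> z \<le> p \<bullet> v + e * norm v" using d(1) by blast
 qed
qed

end

section \<open>Partitions, null sets and expectations over convex hulls\<close>

lemma partition_next_time: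
 assumes \<Delta>: "is_partition \<Delta>" and t: "t \<ge> 0"
 obtains i where "\<Delta> i \<le> t" "t < \<Delta> (Suc i)" "next_time \<Delta> t = \<Delta> (Suc i)"
proof -
 have mono: "strict_mono \<Delta>" and 0: "\<Delta> 0 = 0" and top: "filterlim \<Delta> at_top sequentially"
  using \<Delta> by (auto simp: is_partition_def)
 have "\<forall>\<^sub>F n in sequentially. t < \<Delta> n" using top unfolding filterlim_at_top_dense by blast
 then obtain n where n: "t < \<Delta> n" using eventually_happens'[OF sequentially_bot] by blast
 define k where "k = (LEAST n. t < \<Delta> n)"
 have k: "t < \<Delta> k" and least: "\<And>j. t < \<Delta> j ==> k \<le> j" unfolding k_def using n by (rule LeastI) (rule Least_le)
 have "k \<noteq> 0" using k 0 t by (metis linorder_not_le)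
 then obtain i where i: "k = Suc i" using not0_implies_Suc by blast
 have "\<Delta> i \<le> t" using least[of i] i by force
 moreover have "next_time \<Delta> t = \<Delta> k" unfolding next_time_def
  by (rule cInf_eq_minimum) (use k least mono in \<open>auto simp: strict_mono_less_eq\<close>)
 ultimately show thesis using that k i by simp
qed

lemma partition_finite:
 assumes "is_partition \<Delta>" shows "finite (range \<Delta> \<inter> {0..T})"
proof -
 have "\<forall>\<^sub>F n in sequentially. T < \<Delta> n"
  using assms unfolding is_partition_def filterlim_at_top_dense by blast
 then obtain N where "\<And>n. n \<ge> N ==> T < \<Delta> n" unfolding eventually_sequentially by blast
 then have "range \<Delta> \<inter> {0..T} \<subseteq> \<Delta> ` {..<N}" by (force simp: not_less[symmetric])
 then show ?thesis by (rule finite_subset) simp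
qed

lemma AE_lebesgue_on_negligible:
 assumes N: "negligible N" and P: "\<And>t. t \<in> {a..b} - N ==> P t"
 shows "AE t in lebesgue_on {a..b::real}. P t"
proof (rule AE_I')
 have "negligible ({a..b} \<inter> N)" using N negligible_Int by blast
 then show "{a..b} \<inter> N \<in> null_sets (lebesgue_on {a..b})"
  by (subst null_sets_restrict_space) (auto simp: negligible_iff_null_sets)
 show "{t \<in> space (lebesgue_on {a..b}). \<not> P t} \<subseteq> {a..b} \<inter> N" using P by auto
qed

lemma convex_hull_expectation:
 fixes f :: "'a => 'b::euclidean_space"
 assumes "v \<in> convex hull (f ` S)"
 obtains p where "finite (set_pmf p)" "set_pmf p \<subseteq> S" "measure_pmf.expectation p f = v"
proof -
 define Q where "Q = {v. \<exists>p. finite (set_pmf p) \<and> set_pmf p \<subseteq> S \<and> measure_pmf.expectation p f = v}"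
 have "convex Q"
 proof (rule convexI)
  fix v w and a b :: real assume v: "v \<in> Q" and w: "w \<in> Q" and ab: "0 \<le> a" "0 \<le> b" "a + b = 1"
  obtain p where p: "finite (set_pmf p)" "set_pmf p \<subseteq> S" "measure_pmf.expectation p f = v" using v by (auto simp: Q_def)
  obtain q where q: "finite (set_pmf q)" "set_pmf q \<subseteq> S" "measure_pmf.expectation q f = w" using w by (auto simp: Q_def)
  \<comment> \<open>A coin with probability \<open>a\<close> decides between \<open>p\<close> and
    \<open>q\<close>, so the expectation is the convex combination.\<close>
  define r where "r = bernoulli_pmf a \<bind> (\<lambda>c. if c then p else q)"
  have "set_pmf r \<subseteq> set_pmf p \<union> set_pmf q" by (auto simp: r_def split: if_splits)
  moreover have "measure_pmf.expectation r f = (\<Sum>c\<in>UNIV. pmf (bernoulli_pmf a) c *\<^sub>R measure_pmf.expectation (if c then p else q) f)"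
   unfolding r_def by (rule pmf_expectation_bind) (use p q in auto)
  then have "measure_pmf.expectation r f = a *\<^sub>R v + b *\<^sub>R w"
   using ab p(3) q(3) by (simp add: UNIV_bool pmf_bernoulli_True pmf_bernoulli_False eq_diff_eq[symmetric] add.commute)
  ultimately show "a *\<^sub>R v + b *\<^sub>R w \<in> Q"
   using p q unfolding Q_def by (intro CollectI exI[of _ r]) (meson finite_UnI finite_subset le_sup_iff subset_trans Un_least)
 qed
 moreover have "f ` S \<subseteq> Q"
 proof
  fix v assume "v \<in> f ` S"
  then obtain s where "s \<in> S" "v = f s" by blast
  then show "v \<in> Q" unfolding Q_def by (intro CollectI exI[of _ "return_pmf s"]) auto
 qed
 ultimately have "convex hull (f ` S) \<subseteq> Q" by (rule hull_minimal[rotated])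
 then show thesis using assms that unfolding Q_def by blast
qed

text \<open>The discrete distribution is pushed forward to the Borel sets. Its finite support is
  closed, and the open complement has measure zero, so no other point lies in
  \<open>measure_support\<close>.\<close>

lemma convex_hull_measure:
 fixes f :: "'b::euclidean_space => 'b"
 assumes v: "v \<in> convex hull (f ` S)" and f: "f \<in> borel_measurable borel"
 obtains \<mu> where "prob_space \<mu>" "sets \<mu> = sets borel" "integrable \<mu> f" "measure_support \<mu> \<subseteq> S" "integral\<^sup>L \<mu> f = v"
proof -
 obtain p where p: "finite (set_pmf p)" "set_pmf p \<subseteq> S" "measure_pmf.expectation p f = v"
  by (rule convex_hull_expectation[OF v])
 define \<mu> where "\<mu> = distr (measure_pmf p) borel (\<lambda>x. x)"
 have m: "(\<lambda>x. x) \<in> measure_pmf p \<rightarrow>\<^sub>M borel" by simp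
 have "prob_space \<mu>" unfolding \<mu>_def by (rule measure_pmf.prob_space_distr[OF m])
 moreover have "sets \<mu> = sets borel" by (simp add: \<mu>_def)
 moreover have "integrable \<mu> f"
  unfolding \<mu>_def integrable_distr_eq[OF m f] by (rule integrable_measure_pmf_finite[OF p(1)])
 moreover have "measure_support \<mu> \<subseteq> S"
 proof
  fix y assume y: "y \<in> measure_support \<mu>"
  have o: "open (- set_pmf p)" using p(1) finite_imp_closed by blast
  have "y \<in> set_pmf p"
  proof (rule ccontr)
   assume "y \<notin> set_pmf p"
   then have "emeasure \<mu> (- set_pmf p) > 0" using y o by (auto simp: measure_support_def)
   moreover have "emeasure \<mu> (- set_pmf p) = emeasure (measure_pmf p) (- set_pmf p)"
    unfolding \<mu>_def using o by (subst emeasure_distr[OF m]) auto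
   moreover have "emeasure (measure_pmf p) (- set_pmf p) = 0"
    by (simp add: emeasure_pmf_single_eq_zero_iff measure_pmf.emeasure_eq_measure measure_pmf_zero_iff)
   ultimately show False by simp
  qed
  then show "y \<in> S" using p(2) by blast
 qed
 moreover have "integral\<^sup>L \<mu> f = v" unfolding \<mu>_def integral_distr[OF m f] using p(3) .
 ultimately show thesis by (rule that)
qed

section \<open>Velocities near a point of the limit curve\<close>

context lax_oleinik
begin

text \<open>In coordinates the velocity is \<open>hv c\<close> at the gradient of
  \<open>u t\<close>. This gradient is close to a supergradient at \<open>z\<close>, and
  \<open>hv\<close> is uniformly continuous on the compact set \<open>K\<close>. \<open>V\<close>
  and \<open>B\<close> are fixed before \<open>ep\<close>.\<close>

lemma local_velocity:
 assumes c: "c \<in> A" and z: "z \<in> fst c"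
 obtains V B where "compact V" "V \<subseteq> hv c (snd c z) ` supergradients c z"
  "\<forall>ep>0. \<exists>dl>0. \<forall>y t. y \<in> fst c \<and> norm (snd c y - snd c z) < dl \<and> 0 < t \<and> t < dl -->
    norm (tangent_in A c y (Hp H y (differential_at A (T_plus A g H t \<phi>) y))) \<le> B \<and>
    (\<exists>w\<in>V. norm (tangent_in A c y (Hp H y (differential_at A (T_plus A g H t \<phi>) y)) - w) < ep)"
proof -
 let ?z = "snd c z" and ?I = "chart_inv c"
 obtain B where B: "B > 0" "\<forall>ep>0. \<exists>dl>0. \<forall>zt t. norm (zt - ?z) < dl \<and> 0 < t \<and> t < dl -->
   zt \<in> cdom c \<and> (\<exists>q. GDERIV (u t \<circ> chart_inv c) zt :> q \<and> norm q \<le> B \<and> (\<exists>p\<in>supergradients c z. norm (q - p) < ep))"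
  by (rule gradients_near_supergradients[OF c z])
 obtain r where r: "r > 0" "cball ?z r \<subseteq> cdom c" using chart_ball[OF c z, of UNIV] by auto
 define K where "K = cball ?z r \<times> cball (0::'e) (B + 1)"
 have Kc: "compact K" unfolding K_def by (intro compact_Times compact_cball)
 have hc: "continuous_on K (\<lambda>(zt, q). hv c zt q)"
  by (rule continuous_on_subset[OF hv_continuous[OF c]]) (use r in \<open>auto simp: K_def\<close>)
 \<comment> \<open>Gradients are bounded by \<open>B\<close> and are approximated within 1, so
   supergradients of norm at most \<open>B + 1\<close> suffice; the cut-off makes \<open>V\<close>
   compact.\<close>
 define V where "V = hv c ?z ` (supergradients c z \<inter> cball 0 (B + 1))"
 have "compact V" unfolding V_def
 proof (rule compact_continuous_image)
  show "compact (supergradients c z \<inter> cball 0 (B + 1))" using supergradients_closed closed_Int_compact compact_cball by blast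
  have "continuous_on (supergradients c z \<inter> cball 0 (B + 1)) ((\<lambda>(zt, q). hv c zt q) \<circ> (\<lambda>q. (?z, q)))"
   by (rule continuous_on_compose[OF _ continuous_on_subset[OF hc]])
    (use r in \<open>auto simp: K_def intro!: continuous_intros\<close>)
  then show "continuous_on (supergradients c z \<inter> cball 0 (B + 1)) (hv c ?z)" by (simp add: o_def)
 qed
 moreover have "V \<subseteq> hv c ?z ` supergradients c z" by (auto simp: V_def)
 moreover have "bounded ((\<lambda>(zt, q). hv c zt q) ` K)" by (rule compact_imp_bounded[OF compact_continuous_image[OF hc Kc]])
 then obtain Bv where Bv: "\<And>x. x \<in> K ==> norm (case x of (zt, q) => hv c zt q) \<le> Bv" unfolding bounded_iff by blast
 have "\<exists>dl>0. \<forall>y t. y \<in> fst c \<and> norm (snd c y - ?z) < dl \<and> 0 < t \<and> t < dl -->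
    norm (tangent_in A c y (Hp H y (differential_at A (T_plus A g H t \<phi>) y))) \<le> Bv \<and>
    (\<exists>w\<in>V. norm (tangent_in A c y (Hp H y (differential_at A (T_plus A g H t \<phi>) y)) - w) < ep)" if ep: "ep > 0" for ep
 proof -
  obtain d where d: "d > 0" "\<And>a b. a \<in> K ==> b \<in> K ==> dist b a < d ==>
    dist (case b of (zt, q) => hv c zt q) (case a of (zt, q) => hv c zt q) < ep"
   using compact_uniformly_continuous[OF hc Kc, unfolded uniformly_continuous_on_def, rule_format, OF ep] by blast
  have d1: "min (d / 2) 1 > 0" using d by simp
  obtain dl1 where dl1: "dl1 > 0" "\<forall>zt t. norm (zt - ?z) < dl1 \<and> 0 < t \<and> t < dl1 -->
   zt \<in> cdom c \<and> (\<exists>q. GDERIV (u t \<circ> chart_inv c) zt :> q \<and> norm q \<le> B \<and> (\<exists>p\<in>supergradients c z. norm (q - p) < min (d / 2) 1))"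
   using B(2)[rule_format, OF d1] by (elim exE conjE)
  define dl where "dl = min dl1 (min r (d / 2))"
  have dl: "dl > 0" "dl \<le> dl1" "dl \<le> r" "dl \<le> d / 2" using dl1 r d by (auto simp: dl_def)
  have "norm (tangent_in A c y (Hp H y (differential_at A (T_plus A g H t \<phi>) y))) \<le> Bv \<and>
    (\<exists>w\<in>V. norm (tangent_in A c y (Hp H y (differential_at A (T_plus A g H t \<phi>) y)) - w) < ep)"
   if y: "y \<in> fst c" "norm (snd c y - ?z) < dl" and t: "0 < t" "t < dl" for y t
  proof -
   have "norm (snd c y - ?z) < dl1 \<and> 0 < t \<and> t < dl1" using y t dl(2) by linarith
   then obtain q p where q: "GDERIV (u t \<circ> ?I) (snd c y) :> q" "norm q \<le> B" and p: "p \<in> supergradients c z" "norm (q - p) < min (d / 2) 1"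
    using dl1(2) by meson
   have "u t = T_plus A g H t \<phi>" using t by (auto simp: u_def fun_eq_iff)
   then have "differential_at A (T_plus A g H t \<phi>) y = cotangent_from A c y q"
    using gradient_chart_change(2)[OF c y(1) q(1)] by simp
   then have e: "tangent_in A c y (Hp H y (differential_at A (T_plus A g H t \<phi>) y)) = hv c (snd c y) q"
    using Hp_gradient(2)[OF c y(1)] c y(1) by simp
   have pB: "norm p \<le> B + 1" using p(2) q(2) norm_triangle_ineq2[of p q] by (simp add: norm_minus_commute)
   have K: "(snd c y, q) \<in> K" "(?z, p) \<in> K"
    using y(2) dl(3) q(2) pB r by (auto simp: K_def dist_norm norm_minus_commute)
   have "dist (snd c y, q) (?z, p) \<le> dist (snd c y) ?z + dist q p"
    unfolding dist_prod_def using real_sqrt_sum_squares_triangle_ineq[of "dist (snd c y) ?z" 0 0 "dist q p"] by simp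
   also have "\<dots> < d" using y(2) dl(4) p(2) by (simp add: dist_norm)
   finally have "dist (hv c (snd c y) q) (hv c ?z p) < ep" using d(2)[OF K(2,1)] by simp
   moreover have "hv c ?z p \<in> V" using p(1) pB by (simp add: V_def)
   moreover have "norm (hv c (snd c y) q) \<le> Bv" using Bv[OF K(1)] by simp
   ultimately show ?thesis unfolding e by (auto simp: dist_norm)
  qed
  then show ?thesis using dl(1) by blast
 qed
 ultimately show thesis using that by blast
qed

lemma hv_chart_at: "hv (chart_at A z) (snd (chart_at A z) z) p = Hp H z p"
proof -
 have "Hp H z (cotangent_from A (chart_at A z) z p) = tangent_from A (chart_at A z) z (hv (chart_at A z) (snd (chart_at A z) z) p)"
  by (rule Hp_gradient(2)) simp_all
 moreover have "tangent_from A (chart_at A z) z w = w" for w using tangent_in_from(1)[of "chart_at A z" z w] by simp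
 ultimately show ?thesis by simp
qed

lemma Hp_measurable: "Hp H z \<in> borel_measurable borel"
proof -
 let ?c = "chart_at A z"
 have "continuous_on UNIV ((\<lambda>(zt, q). hv ?c zt q) \<circ> (\<lambda>q. (snd ?c z, q)))"
  by (rule continuous_on_compose[OF _ continuous_on_subset[OF hv_continuous[OF chart_at(1)[of z]]]])
   (auto intro!: continuous_intros)
 then have "continuous_on UNIV (Hp H z)" by (simp add: o_def hv_chart_at)
 then show ?thesis by (rule borel_measurable_continuous_onI)
qed

end

section \<open>Passage to the limit\<close>

locale approximation = lax_oleinik A g H \<phi> \<tau>
 for A :: "('m::t2_space, 'e::euclidean_space) chart set" and g :: "'m => 'e => 'e => real"
  and H :: "'m => 'e => real" and \<phi> :: "'m => real" and \<tau> :: real +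
 fixes x0 :: 'm and T :: real and \<Delta> :: "nat => nat => real"
  and xs :: "nat => real => 'm" and x :: "real => 'm"
 assumes T: "T > 0" and partitions: "\<And>m. is_partition (\<Delta> m)"
  and width_lim: "(\<lambda>m. width (\<Delta> m)) \<longlonglongrightarrow> 0"
  and solution: "\<And>m. is_approx_solution A g H \<phi> (\<Delta> m) x0 T (xs m)"
  and uniform: "\<And>\<epsilon>. \<epsilon> > 0 ==> \<forall>\<^sub>F m in sequentially. \<forall>t\<in>{0..T}. dm (xs m t) (x t) < \<epsilon>"
begin

definition vel :: "nat => real => 'e" where
 "vel m t = Hp H (xs m t) (momentum A g H \<phi> (\<Delta> m) (xs m) t)"

abbreviation cvel :: "('m, 'e) chart => nat => real => 'e" where
 "cvel c m t \<equiv> tangent_in A c (xs m t) (vel m t)"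

lemma remaining_time_small:
 assumes "d > 0"
 shows "\<forall>\<^sub>F m in sequentially. \<forall>t\<ge>0. 0 < next_time (\<Delta> m) t - t \<and> next_time (\<Delta> m) t - t < d"
proof -
 have "\<forall>\<^sub>F m in sequentially. width (\<Delta> m) < ereal d"
  by (rule order_tendstoD(2)[OF width_lim]) (use assms in simp)
 then show ?thesis
 proof eventually_elim
  case (elim m)
  show ?case
  proof (intro allI impI)
   fix t :: real assume t: "t \<ge> 0"
   obtain i where i: "\<Delta> m i \<le> t" "t < \<Delta> m (Suc i)" "next_time (\<Delta> m) t = \<Delta> m (Suc i)"
    by (rule partition_next_time[OF partitions t])
   have "ereal (\<Delta> m (Suc i) - \<Delta> m i) \<le> width (\<Delta> m)" unfolding width_def by (rule SUP_upper) simp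
   then have "ereal (\<Delta> m (Suc i) - \<Delta> m i) < ereal d" using elim by (rule le_less_trans)
   then show "0 < next_time (\<Delta> m) t - t \<and> next_time (\<Delta> m) t - t < d" using i by simp
  qed
 qed
qed

lemma solution_continuous: "continuous_on {0..T} (xs m)" using solution[of m] by (simp add: is_approx_solution_def)

lemma solution_derivative:
 assumes s: "s \<in> {0<..<T}" "s \<notin> range (\<Delta> m)" and c: "c \<in> A" "xs m s \<in> fst c"
 shows "((snd c \<circ> xs m) has_vector_derivative cvel c m s) (at s)"
proof -
 obtain i where i: "\<Delta> m i \<le> s" "s < \<Delta> m (Suc i)" using partition_next_time[OF partitions, of s m] s by auto
 let ?I = "{\<Delta> m i..<\<Delta> m (Suc i)} \<inter> {0..T}"
 have "\<Delta> m i \<noteq> s" using s(2) by blast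
 then have *: "s \<in> {\<Delta> m i<..<\<Delta> m (Suc i)} \<inter> {0<..<T}" using i s by simp
 have "open ({\<Delta> m i<..<\<Delta> m (Suc i)} \<inter> {0<..<T})" "{\<Delta> m i<..<\<Delta> m (Suc i)} \<inter> {0<..<T} \<subseteq> ?I" by auto
 then have at: "at s within ?I = at s" using at_within_open_subset[OF *] by blast
 have sI: "s \<in> ?I" using * by auto
 have "has_velocity A ?I (xs m) s (vel m s)"
  using solution[of m] sI unfolding is_approx_solution_def Let_def vel_def by blast
 then show ?thesis using has_velocity_iff[where \<xi>="xs m", OF c sI] at by simp
qed

lemma chart_increment:
 assumes c: "c \<in> A" and ab: "0 \<le> a" "a \<le> b" "b \<le> T" and sub: "\<And>s. s \<in> {a..b} ==> xs m s \<in> fst c"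
 shows "(cvel c m has_integral (snd c (xs m b) - snd c (xs m a))) {a..b}"
proof -
 have "((\<lambda>s. cvel c m s) has_integral ((snd c \<circ> xs m) b - (snd c \<circ> xs m) a)) {a..b}"
 proof (rule fundamental_theorem_of_calculus_interior_strong[OF partition_finite[OF partitions[of m], of T] ab(2)])
  fix s assume s: "s \<in> {a<..<b} - range (\<Delta> m) \<inter> {0..T}"
  then have "s \<in> {0<..<T}" "s \<notin> range (\<Delta> m)" using ab by auto
  then show "((snd c \<circ> xs m) has_vector_derivative cvel c m s) (at s)"
   by (rule solution_derivative[OF _ _ c]) (use s sub in auto)
 next
  have "continuous_on {a..b} (xs m)" by (rule continuous_on_subset[OF solution_continuous]) (use ab in auto)
  then show "continuous_on {a..b} (snd c \<circ> xs m)"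
   by (rule continuous_on_compose[OF _ continuous_on_subset[OF chart_continuous(1)[OF c]]]) (use sub in auto)
 qed
 then show ?thesis by simp
qed

lemma chart_increment_norm:
 assumes "c \<in> A" "0 \<le> a" "a \<le> b" "b \<le> T" "\<And>s. s \<in> {a..b} ==> xs m s \<in> fst c"
  and B: "\<And>s. s \<in> {a..b} ==> norm (cvel c m s) \<le> B"
 shows "norm (snd c (xs m b) - snd c (xs m a)) \<le> B * (b - a)"
proof -
 have "0 \<le> norm (cvel c m a)" by simp
 also have "\<dots> \<le> B" by (rule B) (use assms(3) in simp)
 finally have "norm (snd c (xs m b) - snd c (xs m a)) \<le> B * measure lborel (cbox a b)"
  using has_integral_bound[of B "cvel c m" _ a b] chart_increment[OF assms(1-5)] B by simp
 then show ?thesis using assms(3) by simp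
qed

text \<open>Continuity of the limit curve has to be derived: it is obtained by comparison with one
  sufficiently close continuous \<open>xs m\<close>. Uniform convergence then carries the same time
  window over to all late curves. Auxiliary neighbourhoods of small diameter fit the distances to
  the order of arguments provided by \<open>uniform\<close>.\<close>

lemma converge_near:
 assumes t0: "t0 \<in> {0..T}" and U: "open U" "x t0 \<in> U"
 obtains y where "y > 0" "\<forall>s\<in>{0..T}. \<bar>s - t0\<bar> < y --> x s \<in> U"
  "\<forall>\<^sub>F m in sequentially. \<forall>s\<in>{0..T}. \<bar>s - t0\<bar> < y --> xs m s \<in> U"
proof -
 have near: "\<exists>y>0. \<forall>s\<in>{0..T}. \<bar>s - t0\<bar> < y --> x s \<in> U'" if U': "open U'" "x t0 \<in> U'" for U'
 proof -
  obtain e where e: "e > 0" "\<And>w. dm (x t0) w < e \<or> dm w (x t0) < e ==> w \<in> U'"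
   using dm_small_in_open[OF U'] by metis
  have e2: "e / 2 > 0" using e by simp
  obtain U1 where U1: "open U1" "x t0 \<in> U1" "\<And>w w'. w \<in> U1 ==> w' \<in> U1 ==> dm w w' < e / 2"
   using dm_continuous_nbhd[OF e2] by metis
  obtain e1 where e1: "e1 > 0" "\<And>w. dm (x t0) w < e1 \<or> dm w (x t0) < e1 ==> w \<in> U1"
   using dm_small_in_open[OF U1(1,2)] by metis
  have "min e1 (e / 2) > 0" using e1 e by simp
  then obtain m where m: "\<And>t. t \<in> {0..T} ==> dm (xs m t) (x t) < min e1 (e / 2)"
   using eventually_happens'[OF sequentially_bot uniform] by blast
  have "xs m t0 \<in> U1" using m[OF t0] by (intro e1(2)) simp
  moreover have "continuous (at t0 within {0..T}) (xs m)"
   using solution_continuous t0 continuous_on_eq_continuous_within by blast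
  ultimately obtain y where y: "y > 0" "\<And>s. s \<in> {0..T} ==> \<bar>s - t0\<bar> < y ==> xs m s \<in> U1"
   using curve_near[of t0 "{0..T}" "xs m" U1] U1(1) by metis
  have "x s \<in> U'" if s: "s \<in> {0..T}" "\<bar>s - t0\<bar> < y" for s
  proof (rule e(2), rule disjI1)
   have "dm (x t0) (xs m s) < e / 2" using U1(3)[OF U1(2) y(2)[OF s]] .
   then show "dm (x t0) (x s) < e" using m[OF s(1)] dm_triangle[of "x t0" "x s" "xs m s"] by simp
  qed
  then show ?thesis using y(1) by blast
 qed
 obtain e where e: "e > 0" "\<And>w. dm (x t0) w < e \<or> dm w (x t0) < e ==> w \<in> U"
  using dm_small_in_open[OF U] by metis
 have e2: "e / 2 > 0" using e by simp
 obtain U1 where U1: "open U1" "x t0 \<in> U1" "\<And>w w'. w \<in> U1 ==> w' \<in> U1 ==> dm w w' < e / 2"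
  using dm_continuous_nbhd[OF e2] by metis
 obtain y where y: "y > 0" "\<forall>s\<in>{0..T}. \<bar>s - t0\<bar> < y --> x s \<in> U \<inter> U1"
  using near[of "U \<inter> U1"] U U1 by blast
 have "\<forall>\<^sub>F m in sequentially. \<forall>s\<in>{0..T}. \<bar>s - t0\<bar> < y --> xs m s \<in> U"
  using uniform[OF e2]
 proof eventually_elim
  case (elim m)
  show ?case
  proof (intro ballI impI, rule e(2), rule disjI2)
   fix s assume s: "s \<in> {0..T}" "\<bar>s - t0\<bar> < y"
   have "dm (x s) (x t0) < e / 2" using U1(3)[OF _ U1(2)] y(2) s by blast
   then show "dm (xs m s) (x t0) < e" using elim s(1) dm_triangle[of "xs m s" "x t0" "x s"] by fastforce
  qed
 qed
 then show thesis using that y by blast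
qed

lemma limit_initial: "x 0 = x0"
proof (rule ccontr)
 assume "x 0 \<noteq> x0"
 then obtain U where U: "open U" "x 0 \<in> U" "x0 \<notin> U" by (rule t1_space_class.t1_space[THEN exE]) blast
 have 0: "0 \<in> {0..T}" using T by simp
 obtain y where y: "y > 0" "\<forall>\<^sub>F m in sequentially. \<forall>s\<in>{0..T}. \<bar>s - 0\<bar> < y --> xs m s \<in> U"
  by (rule converge_near[OF 0 U(1,2)])
 then obtain m where "xs m 0 \<in> U" using eventually_happens'[OF sequentially_bot y(2)] 0 by auto
 then show False using solution[of m] U(3) by (simp add: is_approx_solution_def)
qed

lemma limit_continuous: "continuous_on {0..T} x" unfolding continuous_on_topological
proof (intro ballI allI impI)
 fix s B assume s: "s \<in> {0..T}" and B: "open B" "x s \<in> B"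
 obtain et where et: "et > 0" "\<forall>r\<in>{0..T}. \<bar>r - s\<bar> < et --> x r \<in> B" by (rule converge_near[OF s B])
 then show "\<exists>A. open A \<and> s \<in> A \<and> (\<forall>y\<in>{0..T}. y \<in> A --> x y \<in> B)"
  by (intro exI[of _ "ball s et"]) (auto simp: dist_real_def abs_minus_commute)
qed

lemma chart_pointwise:
 assumes "s \<in> {0..T}" and c: "c \<in> A" "x s \<in> fst c"
 shows "(\<lambda>m. snd c (xs m s)) \<longlonglongrightarrow> snd c (x s)"
proof -
 have "(\<lambda>m. xs m s) \<longlonglongrightarrow> x s"
 proof (rule topological_tendstoI)
  fix U assume U: "open U" "x s \<in> U"
  obtain y where y: "y > 0" "\<forall>\<^sub>F m in sequentially. \<forall>r\<in>{0..T}. \<bar>r - s\<bar> < y --> xs m r \<in> U"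
   by (rule converge_near[OF assms(1) U])
  show "\<forall>\<^sub>F m in sequentially. xs m s \<in> U" using y(2) by eventually_elim (use y(1) assms(1) in auto)
 qed
 moreover have "isCont (snd c) (x s)"
  using chart_continuous(1)[OF c(1)] chart_open(1)[OF c(1)] c(2) continuous_on_eq_continuous_at by blast
 ultimately show ?thesis using isCont_tendsto_compose by blast
qed

text \<open>For late \<open>m\<close> the remaining time to the next partition point is small, and
  nearby times put \<open>xs m s\<close> close to \<open>x t0\<close>, so
  \<open>local_velocity\<close> applies. The compact set and the bound depend on \<open>t0\<close>
  only; \<open>e\<close> affects the time window and the tail of the sequence.\<close>

lemma velocities_near:
 assumes t0: "t0 \<in> {0..T}" and c: "c \<in> A" "x t0 \<in> fst c"
 obtains V B where "compact V" "V \<subseteq> hv c (snd c (x t0)) ` supergradients c (x t0)" "B \<ge> 0"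
  "\<forall>e>0. \<exists>et>0. (\<forall>s\<in>{0..T}. \<bar>s - t0\<bar> < et --> x s \<in> fst c) \<and>
    (\<forall>\<^sub>F m in sequentially. \<forall>s\<in>{0..T}. \<bar>s - t0\<bar> < et -->
     xs m s \<in> fst c \<and> norm (cvel c m s) \<le> B \<and> (\<exists>w\<in>V. norm (cvel c m s - w) < e))"
proof -
 obtain V B where V: "compact V" "V \<subseteq> hv c (snd c (x t0)) ` supergradients c (x t0)" and
  VB: "\<forall>e>0. \<exists>d>0. \<forall>y t. y \<in> fst c \<and> norm (snd c y - snd c (x t0)) < d \<and> 0 < t \<and> t < d -->
    norm (tangent_in A c y (Hp H y (differential_at A (T_plus A g H t \<phi>) y))) \<le> B \<and>
    (\<exists>w\<in>V. norm (tangent_in A c y (Hp H y (differential_at A (T_plus A g H t \<phi>) y)) - w) < e)"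
  by (rule local_velocity[OF c])
 have "\<exists>et>0. (\<forall>s\<in>{0..T}. \<bar>s - t0\<bar> < et --> x s \<in> fst c) \<and>
    (\<forall>\<^sub>F m in sequentially. \<forall>s\<in>{0..T}. \<bar>s - t0\<bar> < et -->
     xs m s \<in> fst c \<and> norm (cvel c m s) \<le> \<bar>B\<bar> \<and> (\<exists>w\<in>V. norm (cvel c m s - w) < e))" if e: "e > 0" for e
 proof -
  obtain d where d: "d > 0" "\<forall>y t. y \<in> fst c \<and> norm (snd c y - snd c (x t0)) < d \<and> 0 < t \<and> t < d -->
    norm (tangent_in A c y (Hp H y (differential_at A (T_plus A g H t \<phi>) y))) \<le> B \<and>
    (\<exists>w\<in>V. norm (tangent_in A c y (Hp H y (differential_at A (T_plus A g H t \<phi>) y)) - w) < e)"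
   using VB[rule_format, OF e] by (elim exE conjE)
  define U where "U = fst c \<inter> snd c -` ball (snd c (x t0)) d"
  have U: "open U" "x t0 \<in> U" unfolding U_def using chart_continuous(1)[OF c(1)] chart_open(1)[OF c(1)] c(2) d(1)
   by (auto intro: continuous_open_preimage)
  obtain et where et: "et > 0" "\<forall>s\<in>{0..T}. \<bar>s - t0\<bar> < et --> x s \<in> U"
   "\<forall>\<^sub>F m in sequentially. \<forall>s\<in>{0..T}. \<bar>s - t0\<bar> < et --> xs m s \<in> U"
   by (rule converge_near[OF t0 U])
  have "\<forall>\<^sub>F m in sequentially. \<forall>s\<in>{0..T}. \<bar>s - t0\<bar> < et -->
     xs m s \<in> fst c \<and> norm (cvel c m s) \<le> \<bar>B\<bar> \<and> (\<exists>w\<in>V. norm (cvel c m s - w) < e)"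
   using et(3) remaining_time_small[OF d(1)]
  proof eventually_elim
   case (elim m)
   show ?case
   proof (intro ballI impI)
    fix s assume s: "s \<in> {0..T}" "\<bar>s - t0\<bar> < et"
    then have "xs m s \<in> U" using elim(1) by blast
    then have y: "xs m s \<in> fst c" "norm (snd c (xs m s) - snd c (x t0)) < d"
     by (auto simp: U_def dist_norm norm_minus_commute)
    have t: "0 < next_time (\<Delta> m) s - s" "next_time (\<Delta> m) s - s < d" using elim(2) s(1) by auto
    show "xs m s \<in> fst c \<and> norm (cvel c m s) \<le> \<bar>B\<bar> \<and> (\<exists>w\<in>V. norm (cvel c m s - w) < e)"
     using d(2)[rule_format, of "xs m s" "next_time (\<Delta> m) s - s"] y t unfolding vel_def momentum_def by auto
   qed
  qed
  moreover have "\<forall>s\<in>{0..T}. \<bar>s - t0\<bar> < et --> x s \<in> fst c" using et(2) by (simp add: U_def)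
  ultimately show ?thesis using et(1) by blast
 qed
 then have "\<forall>e>0. \<exists>et>0. (\<forall>s\<in>{0..T}. \<bar>s - t0\<bar> < et --> x s \<in> fst c) \<and>
    (\<forall>\<^sub>F m in sequentially. \<forall>s\<in>{0..T}. \<bar>s - t0\<bar> < et -->
     xs m s \<in> fst c \<and> norm (cvel c m s) \<le> \<bar>B\<bar> \<and> (\<exists>w\<in>V. norm (cvel c m s - w) < e))"
  by (intro allI impI)
 then show thesis by (rule that[OF V abs_ge_zero])
qed

lemma local_lipschitz:
 assumes t0: "t0 \<in> {0..T}" and c: "c \<in> A" "x t0 \<in> fst c"
 obtains y B where "y > 0" "B \<ge> 0" "\<forall>s\<in>{0..T}. \<bar>s - t0\<bar> < y --> x s \<in> fst c"
  "\<forall>\<^sub>F m in sequentially. \<forall>s\<in>{0..T}. \<bar>s - t0\<bar> < y --> xs m s \<in> fst c \<and> norm (cvel c m s) \<le> B"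
  "\<forall>s\<in>{0..T}. \<forall>t\<in>{0..T}. \<bar>s - t0\<bar> < y \<and> \<bar>t - t0\<bar> < y --> norm (snd c (x t) - snd c (x s)) \<le> B * \<bar>t - s\<bar>"
proof -
 obtain V B where VB: "compact V" "V \<subseteq> hv c (snd c (x t0)) ` supergradients c (x t0)" "B \<ge> 0"
  "\<forall>e>0. \<exists>y>0. (\<forall>s\<in>{0..T}. \<bar>s - t0\<bar> < y --> x s \<in> fst c) \<and>
    (\<forall>\<^sub>F m in sequentially. \<forall>s\<in>{0..T}. \<bar>s - t0\<bar> < y -->
     xs m s \<in> fst c \<and> norm (cvel c m s) \<le> B \<and> (\<exists>w\<in>V. norm (cvel c m s - w) < e))"
  by (rule velocities_near[OF t0 c])
 obtain y where y: "y > 0" "\<forall>s\<in>{0..T}. \<bar>s - t0\<bar> < y --> x s \<in> fst c" and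
  ev0: "\<forall>\<^sub>F m in sequentially. \<forall>s\<in>{0..T}. \<bar>s - t0\<bar> < y -->
     xs m s \<in> fst c \<and> norm (cvel c m s) \<le> B \<and> (\<exists>w\<in>V. norm (cvel c m s - w) < 1)"
  using VB(4)[rule_format, OF zero_less_one] by (elim exE conjE)
 have ev: "\<forall>\<^sub>F m in sequentially. \<forall>s\<in>{0..T}. \<bar>s - t0\<bar> < y --> xs m s \<in> fst c \<and> norm (cvel c m s) \<le> B"
  using ev0 by (rule eventually_mono) blast
 have le: "norm (snd c (x t) - snd c (x s)) \<le> B * (t - s)" if st: "s \<in> {0..T}" "t \<in> {0..T}" "s \<le> t" "\<bar>s - t0\<bar> < y" "\<bar>t - t0\<bar> < y" for s t
 proof (rule Lim_norm_ubound[OF sequentially_bot])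
  show "(\<lambda>m. snd c (xs m t) - snd c (xs m s)) \<longlonglongrightarrow> snd c (x t) - snd c (x s)"
   by (intro tendsto_diff chart_pointwise c st) (use y(2) st in auto)
  show "\<forall>\<^sub>F m in sequentially. norm (snd c (xs m t) - snd c (xs m s)) \<le> B * (t - s)" using ev
  proof eventually_elim
   case (elim m)
   have r: "r \<in> {0..T}" "\<bar>r - t0\<bar> < y" if "r \<in> {s..t}" for r using that st by auto
   show ?case by (rule chart_increment_norm[OF c(1)]) (use st elim r in auto)
  qed
 qed
 have "\<forall>s\<in>{0..T}. \<forall>t\<in>{0..T}. \<bar>s - t0\<bar> < y \<and> \<bar>t - t0\<bar> < y --> norm (snd c (x t) - snd c (x s)) \<le> B * \<bar>t - s\<bar>"
 proof (intro ballI impI)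
  fix s t assume st: "s \<in> {0..T}" "t \<in> {0..T}" "\<bar>s - t0\<bar> < y \<and> \<bar>t - t0\<bar> < y"
  show "norm (snd c (x t) - snd c (x s)) \<le> B * \<bar>t - s\<bar>"
   using le[of s t] le[of t s] st by (cases "s \<le> t") (auto simp: norm_minus_commute)
 qed
 then show thesis by (rule that[OF y(1) VB(3) y(2) ev])
qed

text \<open>Bisection: two adjacent intervals with Lipschitz bounds combine through their common
  point by the triangle inequality, with the larger of the two constants. Both orders of the times
  are treated, so \<open>d\<close> may be asymmetric.\<close>

lemma interval_lipschitz:
 fixes d :: "real => real => real"
 assumes ab: "a \<le> b"
  and loc: "\<And>t0. a \<le> t0 ==> t0 \<le> b ==> \<exists>y>0. \<exists>C. \<forall>s\<in>{a..b}. \<forall>t\<in>{a..b}. \<bar>s - t0\<bar> < y \<and> \<bar>t - t0\<bar> < y --> d s t \<le> C * \<bar>s - t\<bar>"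
  and tri: "\<And>r s t. d r t \<le> d r s + d s t"
 shows "\<exists>C. \<forall>s\<in>{a..b}. \<forall>t\<in>{a..b}. d s t \<le> C * \<bar>s - t\<bar>"
proof -
 define P where "P p q \<longleftrightarrow> (\<exists>C. \<forall>s\<in>{p..q} \<inter> {a..b}. \<forall>t\<in>{p..q} \<inter> {a..b}. d s t \<le> C * \<bar>s - t\<bar>)" for p q
 have "P a b \<or> False"
 proof (intro disjI1, rule Bolzano[OF ab])
  fix p q r assume pq: "P p q" and qr: "P q r" and le: "p \<le> q" "q \<le> r"
  obtain C where C: "\<And>s t. s \<in> {p..q} \<inter> {a..b} ==> t \<in> {p..q} \<inter> {a..b} ==> d s t \<le> C * \<bar>s - t\<bar>" using pq unfolding P_def by blast
  obtain D where D: "\<And>s t. s \<in> {q..r} \<inter> {a..b} ==> t \<in> {q..r} \<inter> {a..b} ==> d s t \<le> D * \<bar>s - t\<bar>" using qr unfolding P_def by blast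
  define E where "E = max C D"
  have C': "d s t \<le> E * \<bar>s - t\<bar>" if "s \<in> {p..q} \<inter> {a..b}" "t \<in> {p..q} \<inter> {a..b}" for s t
   by (rule order_trans[OF C[OF that]]) (simp add: E_def mult_right_mono)
  have D': "d s t \<le> E * \<bar>s - t\<bar>" if "s \<in> {q..r} \<inter> {a..b}" "t \<in> {q..r} \<inter> {a..b}" for s t
   by (rule order_trans[OF D[OF that]]) (simp add: E_def mult_right_mono)
  have "d s t \<le> E * \<bar>s - t\<bar>" if s: "s \<in> {p..r} \<inter> {a..b}" and t: "t \<in> {p..r} \<inter> {a..b}" for s t
  proof -
   consider "s \<le> q" "t \<le> q" | "q \<le> s" "q \<le> t" | "s \<le> q" "q \<le> t" | "q \<le> s" "t \<le> q" by linarith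
   then show ?thesis
   proof cases
    case 1
    then show ?thesis using s t by (intro C') auto
   next
    case 2
    then show ?thesis using s t by (intro D') auto
   next
    case 3
    have "d s q \<le> E * \<bar>s - q\<bar>" using 3 s t by (intro C') auto
    moreover have "d q t \<le> E * \<bar>q - t\<bar>" using 3 s t by (intro D') auto
    moreover have "\<bar>s - t\<bar> = \<bar>s - q\<bar> + \<bar>q - t\<bar>" using 3 by simp
    ultimately show ?thesis using tri[of s t q] by (simp only: distrib_left)
   next
    case 4
    have "d s q \<le> E * \<bar>s - q\<bar>" using 4 s t by (intro D') auto
    moreover have "d q t \<le> E * \<bar>q - t\<bar>" using 4 s t by (intro C') auto
    moreover have "\<bar>s - t\<bar> = \<bar>s - q\<bar> + \<bar>q - t\<bar>" using 4 by simp
    ultimately show ?thesis using tri[of s t q] by (simp only: distrib_left)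
   qed
  qed
  then show "P p r" unfolding P_def by blast
 next
  fix t0 assume t0: "a \<le> t0" "t0 \<le> b"
  obtain y C where y: "y > 0" "\<forall>s\<in>{a..b}. \<forall>t\<in>{a..b}. \<bar>s - t0\<bar> < y \<and> \<bar>t - t0\<bar> < y --> d s t \<le> C * \<bar>s - t\<bar>"
   using loc[OF t0] by blast
  have "P p q" if pq: "p \<le> t0" "t0 \<le> q" "q - p < y" for p q unfolding P_def
  proof (intro exI[of _ C] ballI)
   fix s t assume "s \<in> {p..q} \<inter> {a..b}" "t \<in> {p..q} \<inter> {a..b}"
   then show "d s t \<le> C * \<bar>s - t\<bar>" using pq by (intro y(2)[rule_format]) auto
  qed
  then show "\<exists>y>0. \<forall>p q. p \<le> t0 \<and> t0 \<le> q \<and> q - p < y --> P p q" using y(1) by blast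
 qed
 then show ?thesis unfolding P_def by simp
qed

lemma limit_lipschitz: "\<exists>C. \<forall>s\<in>{0..T}. \<forall>t\<in>{0..T}. dm (x s) (x t) \<le> C * \<bar>s - t\<bar>"
proof (rule interval_lipschitz)
 fix t0 assume "0 \<le> t0" "t0 \<le> T"
 then have t0: "t0 \<in> {0..T}" by simp
 let ?c = "chart_at A (x t0)" and ?z = "snd (chart_at A (x t0)) (x t0)"
 obtain r m M where "chart_box (chart_at A (x t0)) (x t0) r m M" by (rule chart_box_exists[OF chart_at[of "x t0"]])
 note r = chart_boxD[OF this]
 obtain y B where y: "y > 0" "B \<ge> 0" "\<forall>s\<in>{0..T}. \<bar>s - t0\<bar> < y --> x s \<in> fst ?c"
  "\<forall>s\<in>{0..T}. \<forall>t\<in>{0..T}. \<bar>s - t0\<bar> < y \<and> \<bar>t - t0\<bar> < y --> norm (snd ?c (x t) - snd ?c (x s)) \<le> B * \<bar>t - s\<bar>"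
  by (rule local_lipschitz[OF t0 chart_at[of "x t0"]])
 define y' where "y' = min y (r / (B + 1))"
 have y': "y' > 0" using y r by (simp add: y'_def)
 have near: "x s \<in> fst ?c" "snd ?c (x s) \<in> cball ?z r" if s: "s \<in> {0..T}" "\<bar>s - t0\<bar> < y'" for s
 proof -
  have sy: "\<bar>s - t0\<bar> < y" "\<bar>s - t0\<bar> < r / (B + 1)" using s by (auto simp: y'_def)
  show "x s \<in> fst ?c" using y(3) s sy by blast
  have "norm (snd ?c (x s) - ?z) \<le> B * \<bar>s - t0\<bar>" using y(4)[rule_format, of t0 s] s(1) sy t0 y(1) by simp
  also have "\<dots> \<le> (B + 1) * \<bar>s - t0\<bar>" by (intro mult_right_mono) auto
  also have "\<dots> \<le> r" using sy(2) y(2) by (simp add: field_simps)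
  finally show "snd ?c (x s) \<in> cball ?z r" by (simp add: dist_norm norm_minus_commute)
 qed
 have "dm (x s) (x t) \<le> M * B * \<bar>s - t\<bar>" if st: "s \<in> {0..T}" "t \<in> {0..T}" "\<bar>s - t0\<bar> < y'" "\<bar>t - t0\<bar> < y'" for s t
 proof -
  have "dm (chart_inv ?c (snd ?c (x s))) (chart_inv ?c (snd ?c (x t))) \<le> M * norm (snd ?c (x t) - snd ?c (x s))"
   using r(6) near(2)[OF st(1,3)] near(2)[OF st(2,4)] by blast
  also have "\<dots> \<le> M * (B * \<bar>t - s\<bar>)"
   using y(4) st r(3) by (intro mult_left_mono) (auto simp: y'_def)
  finally show ?thesis using near(1)[OF st(1,3)] near(1)[OF st(2,4)] by (simp add: abs_minus_commute mult.assoc)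
 qed
 then show "\<exists>y>0. \<exists>C. \<forall>s\<in>{0..T}. \<forall>t\<in>{0..T}. \<bar>s - t0\<bar> < y \<and> \<bar>t - t0\<bar> < y --> dm (x s) (x t) \<le> C * \<bar>s - t\<bar>"
  using y' by blast
qed (use T dm_triangle in auto)

text \<open>If the velocity were outside the compact convex hull of \<open>V\<close>, a hyperplane
  would separate them strictly. Near \<open>t0\<close> the approximating velocities lie almost in
  \<open>V\<close>, so their increments, and in the limit those of \<open>x\<close>, keep to the far
  side of the hyperplane, against differentiability at \<open>t0\<close>.\<close>

lemma limit_velocity:
 assumes t0: "t0 \<in> {0<..<T}" and v: "has_velocity A {0..T} x t0 v"
 shows "v \<in> convex hull (Hp H (x t0) ` superdifferential A \<phi> (x t0))"
proof -
 let ?c = "chart_at A (x t0)"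
 have t0': "t0 \<in> {0..T}" using t0 by simp
 obtain V B where VB: "compact V" "V \<subseteq> hv ?c (snd ?c (x t0)) ` supergradients ?c (x t0)" "B \<ge> 0"
  "\<forall>e>0. \<exists>y>0. (\<forall>s\<in>{0..T}. \<bar>s - t0\<bar> < y --> x s \<in> fst ?c) \<and>
    (\<forall>\<^sub>F m in sequentially. \<forall>s\<in>{0..T}. \<bar>s - t0\<bar> < y -->
     xs m s \<in> fst ?c \<and> norm (cvel ?c m s) \<le> B \<and> (\<exists>w\<in>V. norm (cvel ?c m s - w) < e))"
  by (rule velocities_near[OF t0' chart_at])
 have D: "((snd ?c \<circ> x) has_vector_derivative v) (at t0 within {0..T})" using v by (simp add: has_velocity_def)
 have "v \<in> convex hull V"
 proof (rule ccontr)
  assume "v \<notin> convex hull V"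
  moreover have "closed (convex hull V)" using compact_convex_hull[OF VB(1)] compact_imp_closed by blast
  ultimately obtain a b where ab: "a \<bullet> v < b" "\<And>w. w \<in> convex hull V ==> b < a \<bullet> w"
   using separating_hyperplane_closed_point[OF convex_convex_hull] by metis
  \<comment> \<open>Both the distance of the velocities from \<open>V\<close> and the
    differentiability error enter with factor \<open>norm a\<close>; together they stay below the
    gap \<open>b - a \<bullet> v\<close>.\<close>
  define e where "e = (b - a \<bullet> v) / (2 * (norm a + 1))"
  have na: "norm a + 1 > 0" by (simp add: add_nonneg_pos)
  have e: "e > 0" using ab(1) na by (simp add: e_def)
  have "2 * (norm a + 1) * e = b - a \<bullet> v" using na by (simp add: e_def)
  then have ea: "2 * (norm a * e) < b - a \<bullet> v" using e by (simp add: algebra_simps)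
  obtain y where y: "y > 0" "\<forall>s\<in>{0..T}. \<bar>s - t0\<bar> < y --> x s \<in> fst ?c" and
   ev: "\<forall>\<^sub>F m in sequentially. \<forall>s\<in>{0..T}. \<bar>s - t0\<bar> < y -->
     xs m s \<in> fst ?c \<and> norm (cvel ?c m s) \<le> B \<and> (\<exists>w\<in>V. norm (cvel ?c m s - w) < e)"
   using VB(4)[rule_format, OF e] by (elim exE conjE)
  obtain dl where dl: "dl > 0" "\<And>u v'. u \<in> {0..T} ==> v' \<in> {0..T} ==> u \<le> t0 ==> t0 \<le> v' ==> v' - u < dl ==>
    norm ((snd ?c \<circ> x) v' - (snd ?c \<circ> x) u - (v' - u) *\<^sub>R v) \<le> e * (v' - u)"
   using vector_derivative_straddle[OF D e] by metis
  define h where "h = min (min y dl) (T - t0) / 2"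
  have "h \<le> (T - t0) / 2" unfolding h_def by (rule divide_right_mono[OF min.cobounded2]) simp
  then have "t0 + h \<le> T" using t0 by (simp add: field_simps)
  moreover have "h > 0" "h < y" "h < dl" using y(1) dl(1) t0 by (auto simp: h_def)
  ultimately have h: "h > 0" "h < y" "h < dl" "t0 + h \<in> {0..T}" using t0 by auto
  have "(b - norm a * e) * h \<le> a \<bullet> (snd ?c (x (t0 + h)) - snd ?c (x t0))"
  proof (rule tendsto_lowerbound[OF _ _ sequentially_bot])
   show "(\<lambda>m. a \<bullet> (snd ?c (xs m (t0 + h)) - snd ?c (xs m t0))) \<longlonglongrightarrow> a \<bullet> (snd ?c (x (t0 + h)) - snd ?c (x t0))"
    by (intro tendsto_intros chart_pointwise t0' chart_at h(4)) (use y(2) h in auto)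
   show "\<forall>\<^sub>F m in sequentially. (b - norm a * e) * h \<le> a \<bullet> (snd ?c (xs m (t0 + h)) - snd ?c (xs m t0))"
    using ev
   proof eventually_elim
    case (elim m)
    have r: "r \<in> {0..T} \<and> \<bar>r - t0\<bar> < y" if "r \<in> {t0..t0 + h}" for r using that h t0 by auto
    have "(cvel ?c m has_integral (snd ?c (xs m (t0 + h)) - snd ?c (xs m t0))) {t0..t0 + h}"
     by (rule chart_increment) (use t0 h r elim in auto)
    from has_integral_linear[OF this bounded_linear_inner_right[of a]]
    have i: "((\<lambda>s. a \<bullet> cvel ?c m s) has_integral a \<bullet> (snd ?c (xs m (t0 + h)) - snd ?c (xs m t0))) {t0..t0 + h}"
     by (simp add: o_def)
    have ic: "((\<lambda>s. b - norm a * e) has_integral (b - norm a * e) * h) {t0..t0 + h}"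
     using has_integral_const_real[of "b - norm a * e" t0 "t0 + h"] h(1) by (simp add: mult.commute)
    show ?case
    proof (rule has_integral_le[OF ic i])
     fix s assume "s \<in> {t0..t0 + h}"
     then obtain w where w: "w \<in> V" "norm (cvel ?c m s - w) < e" using r elim by blast
     have "b < a \<bullet> w" using w(1) by (intro ab(2) hull_inc)
     moreover have "\<bar>a \<bullet> (cvel ?c m s - w)\<bar> \<le> norm a * norm (cvel ?c m s - w)" by (rule Cauchy_Schwarz_ineq2)
     moreover have "norm a * norm (cvel ?c m s - w) \<le> norm a * e" using w(2) by (intro mult_left_mono) auto
     ultimately show "b - norm a * e \<le> a \<bullet> cvel ?c m s" unfolding inner_diff_right by linarith
    qed
   qed
  qed
  also have "\<dots> \<le> (a \<bullet> v + norm a * e) * h"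
  proof -
   let ?d = "snd ?c (x (t0 + h)) - snd ?c (x t0)"
   have n: "norm (?d - h *\<^sub>R v) \<le> e * h" using dl(2)[OF t0' h(4)] h by simp
   have "a \<bullet> ?d = h * (a \<bullet> v) + a \<bullet> (?d - h *\<^sub>R v)" by (simp add: inner_diff_right)
   also have "a \<bullet> (?d - h *\<^sub>R v) \<le> norm a * norm (?d - h *\<^sub>R v)" by (rule norm_cauchy_schwarz)
   also have "\<dots> \<le> norm a * (e * h)" using n by (intro mult_left_mono) auto
   finally show ?thesis by (simp add: algebra_simps)
  qed
  finally have "b - norm a * e \<le> a \<bullet> v + norm a * e" using h(1) by simp
  then show False using ea by linarith
 qed
 moreover have "V \<subseteq> Hp H (x t0) ` superdifferential A \<phi> (x t0)"
  using VB(2) supergradients_subset[of "x t0"] by (auto simp: hv_chart_at)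
 ultimately show ?thesis using hull_mono by blast
qed

lemma limit_differentiable_ae:
 obtains N where "negligible N" "\<forall>t\<in>{0<..<T} - N. \<exists>v. has_velocity A {0..T} x t v"
proof -
 define N where "N = {t \<in> {0<..<T}. \<not> (\<exists>v. has_velocity A {0..T} x t v)}"
 have "negligible N"
 proof (rule iffD2[OF locally_negligible_alt], rule ballI)
  fix t0 assume t0N: "t0 \<in> N"
  then have t0: "0 < t0" "t0 < T" "t0 \<in> {0..T}" by (auto simp: N_def)
  let ?c = "chart_at A (x t0)"
  obtain y B where y: "y > 0" "B \<ge> 0" "\<forall>s\<in>{0..T}. \<bar>s - t0\<bar> < y --> x s \<in> fst ?c"
   "\<forall>s\<in>{0..T}. \<forall>t\<in>{0..T}. \<bar>s - t0\<bar> < y \<and> \<bar>t - t0\<bar> < y --> norm (snd ?c (x t) - snd ?c (x s)) \<le> B * \<bar>t - s\<bar>"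
   by (rule local_lipschitz[OF t0(3) chart_at[of "x t0"]])
  define rh where "rh = min (y / 2) (min t0 (T - t0))"
  have rh: "rh > 0" "rh < y" "rh \<le> t0" "t0 + rh \<le> T" using t0 y(1) by (auto simp: rh_def)
  have "ac_family (\<lambda>u v. norm ((snd ?c \<circ> x) v - (snd ?c \<circ> x) u)) (t0 - rh) (t0 + rh)"
  proof (rule ac_family_lipschitz)
   fix u v assume uv: "t0 - rh \<le> u" "u \<le> v" "v \<le> t0 + rh"
   then have "\<bar>u - t0\<bar> < y" "\<bar>v - t0\<bar> < y" using rh(2) by (simp_all add: abs_less_iff)
   then show "norm ((snd ?c \<circ> x) v - (snd ?c \<circ> x) u) \<le> B * (v - u)"
    using y(4)[rule_format, of u v] rh uv by simp
  qed
  then obtain N' where N': "negligible N'" "\<And>s. s \<in> {t0 - rh<..<t0 + rh} - N' ==> \<exists>D. ((snd ?c \<circ> x) has_vector_derivative D) (at s)"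
   using ac_curve_differentiable_ae by blast
  have "N \<inter> {t0 - rh<..<t0 + rh} \<subseteq> N'"
  proof
   fix s assume s: "s \<in> N \<inter> {t0 - rh<..<t0 + rh}"
   show "s \<in> N'"
   proof (rule ccontr)
    assume "s \<notin> N'"
    then obtain D where D: "((snd ?c \<circ> x) has_vector_derivative D) (at s)" using N'(2)[of s] s by blast
    have s': "s \<in> {0..T}" "\<bar>s - t0\<bar> < y" using s rh by (auto simp: N_def)
    have ic: "x s \<in> fst ?c" using y(3) s' by blast
    have "continuous (at s within {0..T}) x" using limit_continuous s'(1) continuous_on_eq_continuous_within by blast
    moreover have "((snd ?c \<circ> x) has_vector_derivative tangent_in A ?c (x s) (tangent_from A ?c (x s) D)) (at s within {0..T})"
     using has_vector_derivative_at_within[OF D] ic by simp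
    ultimately have "has_velocity A {0..T} x s (tangent_from A ?c (x s) D)"
     using has_velocity_iff[where \<xi>=x, OF chart_at(1) ic s'(1)] by blast
    then show False using s by (auto simp: N_def)
   qed
  qed
  then have "negligible (N \<inter> {t0 - rh<..<t0 + rh})" using N'(1) negligible_subset by blast
  moreover have "openin (top_of_set N) (N \<inter> {t0 - rh<..<t0 + rh})" by (rule openin_open_Int) simp
  ultimately show "\<exists>U. openin (top_of_set N) U \<and> t0 \<in> U \<and> negligible U"
   using t0N rh(1) by (intro exI[of _ "N \<inter> {t0 - rh<..<t0 + rh}"]) auto
 qed
 moreover have "\<exists>v. has_velocity A {0..T} x t v" if "t \<in> {0<..<T} - N" for t using that by (auto simp: N_def)
 ultimately show thesis using that by blast
qed

text \<open>Each time has a window with a bound valid for all late \<open>m\<close>. Bisection joins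
  finitely many windows, so a single bound and a single tail serve the whole interval.\<close>

lemma velocities_bounded:
 assumes c: "c \<in> A" and ab: "0 \<le> a" "a \<le> b" "b \<le> T" and sub: "\<And>t. t \<in> {a..b} ==> x t \<in> fst c"
 obtains B where "B \<ge> 0" "\<forall>\<^sub>F m in sequentially. \<forall>s\<in>{a..b}. norm (cvel c m s) \<le> B"
proof -
 define P where "P p q \<longleftrightarrow> (\<exists>B\<ge>0. \<forall>\<^sub>F m in sequentially. \<forall>s\<in>{p..q} \<inter> {a..b}. norm (cvel c m s) \<le> B)" for p q
 have "P a b \<or> False"
 proof (intro disjI1, rule Bolzano[OF ab(2)])
  fix p q r assume "P p q" "P q r" "p \<le> q" "q \<le> r"
  then obtain B C where B: "B \<ge> 0" "\<forall>\<^sub>F m in sequentially. \<forall>s\<in>{p..q} \<inter> {a..b}. norm (cvel c m s) \<le> B"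
   and C: "C \<ge> 0" "\<forall>\<^sub>F m in sequentially. \<forall>s\<in>{q..r} \<inter> {a..b}. norm (cvel c m s) \<le> C" unfolding P_def by blast
  have "\<forall>\<^sub>F m in sequentially. \<forall>s\<in>{p..r} \<inter> {a..b}. norm (cvel c m s) \<le> max B C"
   using B(2) C(2)
  proof eventually_elim
   case (elim m)
   show ?case
   proof
    fix s assume s: "s \<in> {p..r} \<inter> {a..b}"
    show "norm (cvel c m s) \<le> max B C"
    proof (cases "s \<le> q")
     case True
     then have "norm (cvel c m s) \<le> B" using elim(1) s by auto
     then show ?thesis by simp
    next
     case False
     then have "norm (cvel c m s) \<le> C" using elim(2) s by auto
     then show ?thesis by simp
    qed
   qed
  qed
  then show "P p r" unfolding P_def using B(1) by (intro exI[of _ "max B C"]) auto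
 next
  fix t0 assume t0: "a \<le> t0" "t0 \<le> b"
  then have t0': "t0 \<in> {0..T}" "x t0 \<in> fst c" using ab sub by auto
  obtain y B where y: "y > 0" "B \<ge> 0"
   "\<forall>\<^sub>F m in sequentially. \<forall>s\<in>{0..T}. \<bar>s - t0\<bar> < y --> xs m s \<in> fst c \<and> norm (cvel c m s) \<le> B"
   by (rule local_lipschitz[OF t0'(1) c t0'(2)])
  have "P p q" if pq: "p \<le> t0" "t0 \<le> q" "q - p < y" for p q unfolding P_def
  proof (intro exI[of _ B] conjI y(2))
   show "\<forall>\<^sub>F m in sequentially. \<forall>s\<in>{p..q} \<inter> {a..b}. norm (cvel c m s) \<le> B"
    using y(3) by (rule eventually_mono) (use pq ab in auto)
  qed
  then show "\<exists>y>0. \<forall>p q. p \<le> t0 \<and> t0 \<le> q \<and> q - p < y --> P p q" using y(1) by blast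
 qed
 then show thesis using that unfolding P_def by auto
qed

text \<open>In a common chart the late curves have a common Lipschitz constant, and so does their
  pointwise limit, whose derivative is \<open>W\<close> almost everywhere. After dropping the first
  \<open>K\<close> curves \<open>weak_star_of_derivatives\<close> applies; measurability of
  \<open>W\<close> comes from its being a derivative.\<close>

lemma weak_star_velocities:
 assumes N: "negligible N" and W: "\<And>t. t \<in> {0<..<T} - N ==> has_velocity A {0..T} x t (W t)"
 shows "weak_star_along A T xs vel x W" unfolding weak_star_along_def
proof (intro ballI allI impI)
 fix c a b
 assume c: "c \<in> A" and *: "0 \<le> a \<and> a < b \<and> b \<le> T \<and> x ` {a..b} \<subseteq> fst c \<and> (\<forall>\<^sub>F k in sequentially. xs k ` {a..b} \<subseteq> fst c)"
 then have ab: "0 \<le> a" "a \<le> b" "b \<le> T" and xin: "\<And>t. t \<in> {a..b} ==> x t \<in> fst c" by auto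
 obtain B where B: "B \<ge> 0" "\<forall>\<^sub>F m in sequentially. \<forall>s\<in>{a..b}. norm (cvel c m s) \<le> B"
  by (rule velocities_bounded[OF c ab xin])
 have "\<forall>\<^sub>F m in sequentially. (\<forall>s\<in>{a..b}. norm (cvel c m s) \<le> B) \<and> xs m ` {a..b} \<subseteq> fst c"
  using B(2) * by (auto intro: eventually_conj)
 then obtain K where K: "\<And>k. k \<ge> K ==> (\<forall>s\<in>{a..b}. norm (cvel c k s) \<le> B) \<and> xs k ` {a..b} \<subseteq> fst c"
  unfolding eventually_sequentially by blast
 have lip: "norm ((snd c \<circ> xs k) t - (snd c \<circ> xs k) s) \<le> B * \<bar>t - s\<bar>" if k: "k \<ge> K" and st: "s \<in> {a..b}" "t \<in> {a..b}" for k s t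
 proof -
  have le: "norm (snd c (xs k q) - snd c (xs k p)) \<le> B * (q - p)" if "p \<in> {a..b}" "q \<in> {a..b}" "p \<le> q" for p q
   by (rule chart_increment_norm[OF c]) (use that ab K[OF k] in auto)
  show ?thesis using le[of s t] le[of t s] st by (cases "s \<le> t") (auto simp: norm_minus_commute)
 qed
 define N' where "N' k = range (\<Delta> k) \<inter> {0..T}" for k
 have N': "negligible (N' k)" for k unfolding N'_def by (rule negligible_finite[OF partition_finite[OF partitions]])
 have der: "((snd c \<circ> xs k) has_vector_derivative cvel c k t) (at t)" if k: "k \<ge> K" and t: "t \<in> {a<..<b} - N' k" for k t
  by (rule solution_derivative[OF _ _ c]) (use t ab K[OF k] in \<open>auto simp: N'_def\<close>)
 have pt: "(\<lambda>k. (snd c \<circ> xs (k + K)) t) \<longlonglongrightarrow> (snd c \<circ> x) t" if t: "t \<in> {a..b}" for t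
  using LIMSEQ_ignore_initial_segment[OF chart_pointwise[OF _ c xin[OF t]], of K] t ab by simp
 have lip0: "norm ((snd c \<circ> x) t - (snd c \<circ> x) s) \<le> B * \<bar>t - s\<bar>" if st: "s \<in> {a..b}" "t \<in> {a..b}" for s t
  by (rule Lim_norm_ubound[OF sequentially_bot tendsto_diff[OF pt[OF st(2)] pt[OF st(1)]]]) (use lip st in auto)
 have der0: "((snd c \<circ> x) has_vector_derivative tangent_in A c (x t) (W t)) (at t)" if t: "t \<in> {a<..<b} - N" for t
 proof -
  have t': "t \<in> {0<..<T} - N" "t \<in> {0..T}" "x t \<in> fst c" using t ab xin by auto
  have "((snd c \<circ> x) has_vector_derivative tangent_in A c (x t) (W t)) (at t within {0..T})"
   using W[OF t'(1)] has_velocity_iff[where \<xi>=x, OF c t'(3,2)] by blast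
  moreover have "at t within {0..T} = at t" using t'(1) by (intro at_within_Icc_at) auto
  ultimately show ?thesis by simp
 qed
 have "cvel c k \<in> Linf (lebesgue_on {a..b})" if k: "k \<ge> K" for k
 proof -
  have "cvel c k \<in> borel_measurable (lebesgue_on {a..b})"
   by (rule lipschitz_curve_integral(1)[OF ab(2) N'[of k] lip[OF k] der[OF k]])
  moreover have "AE t in lebesgue_on {a..b}. norm (cvel c k t) \<le> B" using K[OF k] by (intro AE_I2) auto
  ultimately show ?thesis unfolding Linf_def by blast
 qed
 then have 1: "\<forall>\<^sub>F k in sequentially. (\<lambda>t. cvel c k t) \<in> Linf (lebesgue_on {a..b})"
  unfolding eventually_sequentially by blast
 have "(\<lambda>t. tangent_in A c (x t) (W t)) \<in> borel_measurable (lebesgue_on {a..b})"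
  by (rule lipschitz_curve_integral(1)[OF ab(2) N lip0 der0])
 moreover have "AE t in lebesgue_on {a..b}. norm (tangent_in A c (x t) (W t)) \<le> B"
 proof (rule AE_lebesgue_on_negligible)
  show "negligible (N \<union> {a, b})" using N by (simp add: negligible_insert)
  fix t assume "t \<in> {a..b} - (N \<union> {a, b})"
  then have t: "t \<in> {a<..<b} - N" by auto
  show "norm (tangent_in A c (x t) (W t)) \<le> B"
   by (rule lipschitz_curve_integral(2)[where a=a and b=b and N=N and F="snd c \<circ> x" and f="\<lambda>t. tangent_in A c (x t) (W t)" and t=t])
    (rule ab(2) N lip0 der0 t | assumption)+
 qed
 ultimately have 2: "(\<lambda>t. tangent_in A c (x t) (W t)) \<in> Linf (lebesgue_on {a..b})" unfolding Linf_def by blast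
 have 3: "(\<lambda>k. \<integral>t. cvel c k t \<bullet> h t \<partial>lebesgue_on {a..b}) \<longlonglongrightarrow> (\<integral>t. tangent_in A c (x t) (W t) \<bullet> h t \<partial>lebesgue_on {a..b})"
  if h: "integrable (lebesgue_on {a..b}) h" for h
 proof -
  have "(\<lambda>k. \<integral>t. cvel c (k + K) t \<bullet> h t \<partial>lebesgue_on {a..b}) \<longlonglongrightarrow> (\<integral>t. tangent_in A c (x t) (W t) \<bullet> h t \<partial>lebesgue_on {a..b})"
  proof (rule weak_star_of_derivatives[OF ab(2) N' N _ _ lip0 der0 pt h])
   fix k s t assume "s \<in> {a..b}" "t \<in> {a..b}"
   then show "norm ((snd c \<circ> xs (k + K)) t - (snd c \<circ> xs (k + K)) s) \<le> B * \<bar>t - s\<bar>" by (intro lip) auto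
  next
   fix k t assume "t \<in> {a<..<b} - N' (k + K)"
   then show "((snd c \<circ> xs (k + K)) has_vector_derivative cvel c (k + K) t) (at t)" by (intro der) auto
  qed
  then show ?thesis by (rule LIMSEQ_offset)
 qed
 show "weak_star_Linf (lebesgue_on {a..b}) (\<lambda>k t. cvel c k t) (\<lambda>t. tangent_in A c (x t) (W t))"
  unfolding weak_star_Linf_def using 1 2 3 by blast
qed

end

theorem theorem2p6:
  fixes A :: "('m::t2_space, 'e::euclidean_space) chart set"
    and g :: "'m \<Rightarrow> 'e \<Rightarrow> 'e \<Rightarrow> real"
    and H :: "'m \<Rightarrow> 'e \<Rightarrow> real"
    and \<phi> :: "'m \<Rightarrow> real"
    and x0 :: 'm and T \<tau> :: real
    and \<Delta> :: "nat \<Rightarrow> nat \<Rightarrow> real"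
    and xs :: "nat \<Rightarrow> real \<Rightarrow> 'm" and x :: "real \<Rightarrow> 'm"
  assumes manifold: "closed_connected_manifold A"
    and metric: "riemannian_metric A g"
    and tonelli: "tonelli_hamiltonian A g H"
    and phi: "\<phi> \<in> SCL A g"
    and T: "T > 0"
    and tau: "admissible_time A g H \<phi> \<tau>"
    and partitions: "\<And>m. is_partition (\<Delta> m)"
    and width_le: "\<And>m. width (\<Delta> m) \<le> ereal \<tau>"
    and width_lim: "(\<lambda>m. width (\<Delta> m)) \<longlonglongrightarrow> 0"
    and solution: "\<And>m. is_approx_solution A g H \<phi> (\<Delta> m) x0 T (xs m)"
    and uniform: "\<And>\<epsilon>. \<epsilon> > 0 \<Longrightarrow>
          \<forall>\<^sub>F m in sequentially. \<forall>t\<in>{0..T}. riem_dist A g (xs m t) (x t) < \<epsilon>"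
  shows "(\<exists>(\<nu> :: real \<Rightarrow> 'e measure) (r :: nat \<Rightarrow> nat).
            (\<forall>t\<in>{0..T}. prob_space (\<nu> t) \<and> sets (\<nu> t) = sets borel \<and>
               integrable (\<nu> t) (Hp H (x t))) \<and>
            (AE t in lebesgue_on {0..T}. measure_support (\<nu> t) \<subseteq> superdifferential A \<phi> (x t)) \<and>
            strict_mono r \<and>
            weak_star_along A T (\<lambda>k. xs (r k))
              (\<lambda>k t. Hp H (xs (r k) t) (momentum A g H \<phi> (\<Delta> (r k)) (xs (r k)) t))
              x (mean_Hp H x \<nu>) \<and>
            (AE t in lebesgue_on {0..T}. has_velocity A {0..T} x t (mean_Hp H x \<nu> t))) \<and>
         satisfies_inclusion A H \<phi> T x \<and> x 0 = x0 \<and>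
         generalized_characteristic A g H \<phi> T x"
proof -
 have "continuous_on UNIV \<phi>" using phi by (simp add: SCL_def)
 then interpret approximation A g H \<phi> \<tau> x0 T \<Delta> xs x
  by unfold_locales (rule manifold metric tonelli tau T partitions width_lim solution uniform | assumption)+
 obtain N where N: "negligible N" "\<forall>t\<in>{0<..<T} - N. \<exists>v. has_velocity A {0..T} x t v"
  by (rule limit_differentiable_ae)
 let ?good = "\<lambda>t v. has_velocity A {0..T} x t v \<and> v \<in> convex hull (Hp H (x t) ` superdifferential A \<phi> (x t))"
 have good: "\<exists>v. ?good t v" if t: "t \<in> {0<..<T} - N" for t using N(2) limit_velocity[of t] t by blast
 have ends: "negligible (N \<union> {0, T})" using N(1) by (simp add: negligible_insert)
 have inner: "t \<in> {0<..<T} - N" if "t \<in> {0..T} - (N \<union> {0, T})" for t using that by auto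
 let ?\<mu> = "\<lambda>t \<mu>. prob_space \<mu> \<and> sets \<mu> = sets borel \<and> integrable \<mu> (Hp H (x t)) \<and>
  (t \<in> {0<..<T} - N --> measure_support \<mu> \<subseteq> superdifferential A \<phi> (x t) \<and> has_velocity A {0..T} x t (integral\<^sup>L \<mu> (Hp H (x t))))"
 have "\<exists>\<mu>. ?\<mu> t \<mu>" for t
 proof (cases "t \<in> {0<..<T} - N")
  case True
  then obtain v where v: "has_velocity A {0..T} x t v" "v \<in> convex hull (Hp H (x t) ` superdifferential A \<phi> (x t))"
   using good by blast
  obtain \<mu> where "prob_space \<mu>" "sets \<mu> = sets borel" "integrable \<mu> (Hp H (x t))"
   "measure_support \<mu> \<subseteq> superdifferential A \<phi> (x t)" "integral\<^sup>L \<mu> (Hp H (x t)) = v"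
   by (rule convex_hull_measure[OF v(2) Hp_measurable])
  then show ?thesis using v(1) by (intro exI[of _ \<mu>]) auto
 next
  case False
  \<comment> \<open>At the exceptional times some probability measure has to be supplied with no
    constraint on its support; the value at momentum 0 and \<open>UNIV\<close> in place of the
    superdifferential provide one.\<close>
  have h: "Hp H (x t) 0 \<in> convex hull (Hp H (x t) ` UNIV)" by (rule hull_inc) simp
  obtain \<mu> where "prob_space \<mu>" "sets \<mu> = sets borel" "integrable \<mu> (Hp H (x t))"
   by (rule convex_hull_measure[OF h Hp_measurable])
  then show ?thesis using False by (intro exI[of _ \<mu>]) auto
 qed
 then have "\<forall>t. \<exists>\<mu>. ?\<mu> t \<mu>" by blast
 \<comment> \<open>The measures are chosen independently at each time. Their means are nevertheless
   measurable in time up to null sets, because they are the velocities of the limit curve.\<close>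
 then obtain \<nu> where \<nu>: "\<forall>t. ?\<mu> t (\<nu> t)" using choice[of ?\<mu>] by blast
 have vel\<nu>: "has_velocity A {0..T} x t (mean_Hp H x \<nu> t)" if "t \<in> {0<..<T} - N" for t
  using \<nu> that unfolding mean_Hp_def by blast
 have "AE t in lebesgue_on {0..T}. measure_support (\<nu> t) \<subseteq> superdifferential A \<phi> (x t)"
  using \<nu> inner by (intro AE_lebesgue_on_negligible[OF ends]) blast
 moreover have "AE t in lebesgue_on {0..T}. has_velocity A {0..T} x t (mean_Hp H x \<nu> t)"
  using vel\<nu> inner by (intro AE_lebesgue_on_negligible[OF ends]) blast
 moreover have "weak_star_along A T xs vel x (mean_Hp H x \<nu>)" by (rule weak_star_velocities[OF N(1) vel\<nu>])
 then have "weak_star_along A T (\<lambda>k. xs (id k))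
    (\<lambda>k t. Hp H (xs (id k) t) (momentum A g H \<phi> (\<Delta> (id k)) (xs (id k)) t)) x (mean_Hp H x \<nu>)"
  by (simp add: vel_def[abs_def])
 moreover have "strict_mono (id :: nat => nat)" by (simp add: strict_mono_def)
 moreover have "\<forall>t\<in>{0..T}. prob_space (\<nu> t) \<and> sets (\<nu> t) = sets borel \<and> integrable (\<nu> t) (Hp H (x t))" using \<nu> by blast
 moreover have incl: "satisfies_inclusion A H \<phi> T x" unfolding satisfies_inclusion_def
  using good inner by (intro AE_lebesgue_on_negligible[OF ends]) blast
 moreover have "generalized_characteristic A g H \<phi> T x"
  unfolding generalized_characteristic_def using limit_lipschitz incl by blast
 ultimately show ?thesis using limit_initial by blast
qed

end
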